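(* Let $d\in\{2,3\}$, let $\Omega\subset\mathbb{R}^d$ be a (bounded) convex polygon/polyhedron, $\mu>0$, $\tau>0$, $0<\rho_{\min}\le\rho_{\max}$, and let $\mathcal T_h$ be a partition of $\Omega$ as in the context. For any given $(\rho_h^{n-1},u_h^{n-1})\in{\rm P}^2_{\rm dG}(\mathcal T_h)\times\mathring{\rm P}^{\rm 1b}(\mathcal T_h)^d$, the scheme (S) described in the context has a unique solution $(\rho_h^n,u_h^n,p_h^n)\in{\rm P}^2_{\rm dG}(\mathcal T_h)\times\mathring{\rm P}^{\rm 1b}(\mathcal T_h)^d\times\widetilde{\rm P}^1(\mathcal T_h)$, without any condition on the time stepsize $\tau$ or the mesh size $h$, and this solution satisfies the energy inequality $$\frac12\|\rho_h^n\|_{L^2(\Omega)}^2+\int_\Omega\frac12\chi(\rho_h^n)|u_h^n|^2\,dx+\tau\mu\|\nabla u_h^n\|_{L^2(\Omega)}^2\le\frac12\|\rho_h^{n-1}\|_{L^2(\Omega)}^2+\int_\Omega\frac12\chi(\rho_h^{n-1})|u_h^{n-1}|^2\,dx .$$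
   Context: **Mesh and spaces.** $\mathcal T_h$ is a quasi-uniform conforming partition of $\Omega$ into tetrahedra (triangles if $d=2$) of mesh size $h$; $\nu_K$ is the outward unit normal on $\partial K$, $K\in\mathcal T_h$; $\nu$ is the outward unit normal on $\partial\Omega$. ${\rm P}^r_{\rm dG}(\mathcal T_h)$ is the space of (discontinuous) piecewise polynomials of degree at most $r$. ${\rm P}^1(\mathcal T_h)={\rm P}^1_{\rm dG}(\mathcal T_h)\cap H^1(\Omega)$. $\mathring{\rm P}^{\rm 1b}(\mathcal T_h)$ is ${\rm P}^1(\mathcal T_h)$ enriched by one bubble function per element (the MINI element: on each $K$, add a multiple of the product of the barycentric coordinates), with zero boundary condition on $\partial\Omega$. $\widetilde{\rm P}^1(\mathcal T_h)=\{v\in{\rm P}^1(\mathcal T_h):\int_\Omega v\,dx=0\}$. ${\rm RT}^1(\mathcal T_h)=\{w\in H({\rm div},\Omega): w|_K\in P_1(K)^d+xP_1(K)\ \forall K\in\mathcal T_h\}$ and ${\rm RT}^1_0(\mathcal T_h)=\{v_h\in{\rm RT}^1(\mathcal T_h):\nabla\cdot v_h=0\text{ in }\Omega,\ v_h\cdot\nu=0\text{ on }\partial\Omega\}$. $P_h^{\rm RT}:L^2(\Omega)^d\to{\rm RT}^1_0(\mathcal T_h)$ is the $L^2$-orthogonal projection. **Cut-off.** $\chi(s)=\tfrac12\rho_{\min}$ if $s<\tfrac12\rho_{\min}$, $\chi(s)=s$ if $\tfrac12\rho_{\min}\le s\le\tfrac32\rho_{\max}$, $\chi(s)=\tfrac32\rho_{\max}$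 if $s>\tfrac32\rho_{\max}$ (in the application $\rho_{\min},\rho_{\max}$ are the minimum and maximum of the initial density). **Notation.** $(\cdot,\cdot)$ is the $L^2(\Omega)$ inner product (computed elementwise for piecewise functions, with gradients taken elementwise); $\langle\cdot,\cdot\rangle_{S}$ is the $L^2(S)$ inner product for $S\subset\partial K$. On $\partial K$, the jump is $[\![v]\!]=(v^--v^+)\nu_K$, where $v^-$ and $v^+$ are the interior and exterior traces of $v$ with respect to $K$. $D_\tau a^n=(a^n-a^{n-1})/\tau$; $D_\tau\chi(\rho_h^n)=(\chi(\rho_h^n)-\chi(\rho_h^{n-1}))/\tau$. The numerical inflow boundary is $\partial K_-^n=\{x\in\partial K:(P_h^{\rm RT}u_h^{n-1}\cdot\nu_K)(x)<0\}$; in integrals over $\partial K^n_-$ the test function is evaluated by its trace from inside $K$. **Scheme (S).** Given $(\rho_h^{n-1},u_h^{n-1})$, find $(\rho_h^n,u_h^n,p_h^n)\in{\rm P}^2_{\rm dG}(\mathcal T_h)\times\mathring{\rm P}^{\rm 1b}(\mathcal T_h)^d\times\widetilde{\rm P}^1(\mathcal T_h)$ such that for all $(\varphi_h,v_h,q_h)$ in the same product space $$(D_\tau\rho_h^n,\varphi_h)+\big((P_h^{\rm RT}u_h^{n-1}\cdot\nabla)\rho_h^n,\varphi_h\big)-\sum_{K\in\mathcal T_h}\langle P_h^{\rm RT}u_h^{n-1}\cdot[\![\rho_h^n]\!],\varphi_h\rangle_{\partial K_-^n}=0,$$ $$(\chi(\rho_h^{n-1})D_\tau u_h^n,v_h)+\tfrac12(D_\tau\chi(\rho_h^n)\,u_h^n,v_h)-\tfrac12(\chi(\rho_h^n)u_h^{n-1},\nabla(u_h^n\cdot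 v_h))+(\chi(\rho_h^n)(u_h^{n-1}\cdot\nabla)u_h^n,v_h)+(\mu\nabla u_h^n,\nabla v_h)-(p_h^n,\nabla\cdot v_h)=0,$$ $$(\nabla\cdot u_h^n,q_h)=0.$$ *)

theory Defs
  imports "HOL-Analysis.Analysis"
begin

section \<open>Domain and mesh\<close>

definition convex_polytopal_domain :: "(real^'d) set \<Rightarrow> bool" where
  "convex_polytopal_domain \<Omega> \<longleftrightarrow> \<Omega> \<noteq> {} \<and> (\<exists>P. polytope P \<and> \<Omega> = interior P)"

text \<open>The elements of a mesh are closed full-dimensional simplices; conformity is part of
  the library notion of a triangulation. The parameter \<open>\<gamma>\<close> is the quasi-uniformity constant.\<close>

definition quasi_uniform_mesh :: "(real^'d) set \<Rightarrow> real \<Rightarrow> real \<Rightarrow> (real^'d) set set \<Rightarrow> bool" where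
  "quasi_uniform_mesh \<Omega> \<gamma> h \<T> \<longleftrightarrow>
     triangulation \<T> \<and> (\<forall>K\<in>\<T>. (int CARD('d)) simplex K) \<and> \<Union>\<T> = closure \<Omega> \<and>
     h = Max (diameter ` \<T>) \<and> \<gamma> > 0 \<and> (\<forall>K\<in>\<T>. \<exists>x. cball x (\<gamma> * h) \<subseteq> K)"

section \<open>Boundary of a polytope\<close>

text \<open>Meaningful at the boundary points of a convex body that have exactly one unit normal; for
  a full-dimensional polytope these are the points in the relative interior of a facet.\<close>

definition outward_normal :: "(real^'d) set \<Rightarrow> real^'d \<Rightarrow> real^'d" where
  "outward_normal C x = (THE n. norm n = 1 \<and> (\<forall>y\<in>C. n \<bullet> y \<le> n \<bullet> x))"

text \<open>Surface measure on the boundary of a full-dimensional polytope. The collar consists of the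
  right prisms of height 1 erected outwards on the facets, so pushing volume forward along the
  projection onto the base gives the Lebesgue measure of codimension one on every facet.
  The completion makes functions that are only determined off the lower-dimensional faces
  measurable.\<close>

definition outer_collar :: "(real^'d) set \<Rightarrow> (real^'d) set" where
  "outer_collar C = {x + t *\<^sub>R outward_normal C x | x t F.
     F facet_of C \<and> x \<in> rel_interior F \<and> 0 \<le> t \<and> t \<le> 1}"

definition surface_measure :: "(real^'d) set \<Rightarrow> (real^'d) measure" where
  "surface_measure C =
     completion (distr (restrict_space lborel (outer_collar C)) borel (closest_point C))"

text \<open>Traces on the boundary of an element \<open>K\<close>. On a face lying on the boundary of the domain, the
  exterior trace of a function that vanishes outside the domain is 0.\<close>

definition inner_trace :: "(real^'d) set \<Rightarrow> (real^'d \<Rightarrow> 'b::t2_space) \<Rightarrow> real^'d \<Rightarrow> 'b" where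
  "inner_trace K v x = Lim (at x within interior K) v"

definition outer_trace :: "(real^'d) set \<Rightarrow> (real^'d \<Rightarrow> 'b::t2_space) \<Rightarrow> real^'d \<Rightarrow> 'b" where
  "outer_trace K v x = Lim (at x within - K) v"

definition jump :: "(real^'d) set \<Rightarrow> (real^'d \<Rightarrow> real) \<Rightarrow> real^'d \<Rightarrow> real^'d" where
  "jump K v x = (inner_trace K v x - outer_trace K v x) *\<^sub>R outward_normal K x"

definition inflow_boundary :: "(real^'d) set \<Rightarrow> (real^'d \<Rightarrow> real^'d) \<Rightarrow> (real^'d) set" where
  "inflow_boundary K w = {x \<in> frontier K. inner_trace K w x \<bullet> outward_normal K x < 0}"

section \<open>Lebesgue and Sobolev spaces\<close>

definition square_integrable :: "(real^'d) set \<Rightarrow> (real^'d \<Rightarrow> 'b::euclidean_space) \<Rightarrow> bool" where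
  "square_integrable \<Omega> f \<longleftrightarrow>
     f \<in> borel_measurable (lebesgue_on \<Omega>) \<and> integrable (lebesgue_on \<Omega>) (\<lambda>x. (norm (f x))\<^sup>2)"

text \<open>On matrix-valued functions the inner product of the library is the Frobenius product.\<close>

definition L2_inner ::
  "(real^'d) set \<Rightarrow> (real^'d \<Rightarrow> 'b::euclidean_space) \<Rightarrow> (real^'d \<Rightarrow> 'b) \<Rightarrow> real" where
  "L2_inner \<Omega> f g = (LINT x|lebesgue_on \<Omega>. f x \<bullet> g x)"

definition L2_nrm :: "(real^'d) set \<Rightarrow> (real^'d \<Rightarrow> 'b::euclidean_space) \<Rightarrow> real" where
  "L2_nrm \<Omega> f = sqrt (L2_inner \<Omega> f f)"

definition grad :: "(real^'d \<Rightarrow> real) \<Rightarrow> real^'d \<Rightarrow> real^'d" where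
  "grad f x = (\<chi> i. frechet_derivative f (at x) (axis i 1))"

definition jac :: "(real^'d \<Rightarrow> real^'d) \<Rightarrow> real^'d \<Rightarrow> real^'d^'d" where
  "jac v x = jacobian v (at x)"

definition divg :: "(real^'d \<Rightarrow> real^'d) \<Rightarrow> real^'d \<Rightarrow> real" where
  "divg v x = trace (jac v x)"

primrec Ck :: "nat \<Rightarrow> (real^'d \<Rightarrow> real) \<Rightarrow> bool" where
  "Ck 0 f \<longleftrightarrow> continuous_on UNIV f"
| "Ck (Suc k) f \<longleftrightarrow>
     (\<forall>x. f differentiable (at x)) \<and> (\<forall>i. Ck k (\<lambda>x. grad f x $ i))"

definition test_function :: "(real^'d) set \<Rightarrow> (real^'d \<Rightarrow> real) \<Rightarrow> bool" where
  "test_function \<Omega> \<phi> \<longleftrightarrow> (\<forall>k. Ck k \<phi>) \<and>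
     compact (closure {x. \<phi> x \<noteq> 0}) \<and> closure {x. \<phi> x \<noteq> 0} \<subseteq> \<Omega>"

definition H1 :: "(real^'d) set \<Rightarrow> (real^'d \<Rightarrow> real) set" where
  "H1 \<Omega> = {v. square_integrable \<Omega> v \<and>
     (\<exists>g :: real^'d \<Rightarrow> real^'d. square_integrable \<Omega> g \<and>
       (\<forall>\<phi> i. test_function \<Omega> \<phi> \<longrightarrow>
          L2_inner \<Omega> v (\<lambda>x. grad \<phi> x $ i) = - L2_inner \<Omega> (\<lambda>x. g x $ i) \<phi>))}"

definition weak_div :: "(real^'d) set \<Rightarrow> (real^'d \<Rightarrow> real^'d) \<Rightarrow> (real^'d \<Rightarrow> real) \<Rightarrow> bool" where
  "weak_div \<Omega> w g \<longleftrightarrow>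
     (\<forall>\<phi>. test_function \<Omega> \<phi> \<longrightarrow> L2_inner \<Omega> w (grad \<phi>) = - L2_inner \<Omega> g \<phi>)"

definition Hdiv :: "(real^'d) set \<Rightarrow> (real^'d \<Rightarrow> real^'d) set" where
  "Hdiv \<Omega> = {w. square_integrable \<Omega> w \<and> (\<exists>g. square_integrable \<Omega> g \<and> weak_div \<Omega> w g)}"

text \<open>The boundary conditions are imposed almost everywhere with respect to the surface measure of
  the boundary of the domain.\<close>

definition zero_on_boundary :: "(real^'d) set \<Rightarrow> (real^'d \<Rightarrow> real) \<Rightarrow> bool" where
  "zero_on_boundary \<Omega> v \<longleftrightarrow>
     (AE x in surface_measure (closure \<Omega>). (v \<longlongrightarrow> 0) (at x within \<Omega>))"

definition zero_normal_on_boundary :: "(real^'d) set \<Rightarrow> (real^'d \<Rightarrow> real^'d) \<Rightarrow> bool" where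
  "zero_normal_on_boundary \<Omega> w \<longleftrightarrow>
     (AE x in surface_measure (closure \<Omega>).
        ((\<lambda>y. w y \<bullet> outward_normal (closure \<Omega>) x) \<longlongrightarrow> 0) (at x within \<Omega>))"

section \<open>Finite element spaces\<close>

definition poly_fun :: "nat \<Rightarrow> (real^'d \<Rightarrow> real) \<Rightarrow> bool" where
  "poly_fun r p \<longleftrightarrow> (\<exists>c :: ('d \<Rightarrow> nat) \<Rightarrow> real.
     p = (\<lambda>x. \<Sum>\<alpha> | sum \<alpha> UNIV \<le> r. c \<alpha> * (\<Prod>i\<in>UNIV. (x $ i) ^ \<alpha> i)))"

text \<open>Piecewise polynomial functions are classes modulo null sets. Each class is represented by
  the function that is given by the polynomials on the interiors of the elements and is 0
  elsewhere, in particular on the null set formed by the element boundaries. Equality of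
  representatives is thus equality almost everywhere, and derivatives taken at interior points of
  elements are the elementwise ones.\<close>

definition off_elements :: "(real^'d) set set \<Rightarrow> (real^'d) set" where
  "off_elements \<T> = - (\<Union>K\<in>\<T>. interior K)"

definition PdG :: "nat \<Rightarrow> (real^'d) set set \<Rightarrow> (real^'d \<Rightarrow> real) set" where
  "PdG r \<T> = {v. (\<forall>K\<in>\<T>. \<exists>p. poly_fun r p \<and> (\<forall>x\<in>interior K. v x = p x)) \<and>
     (\<forall>x\<in>off_elements \<T>. v x = 0)}"

definition P1 :: "(real^'d) set \<Rightarrow> (real^'d) set set \<Rightarrow> (real^'d \<Rightarrow> real) set" where
  "P1 \<Omega> \<T> = PdG 1 \<T> \<inter> H1 \<Omega>"

definition P1_mean0 :: "(real^'d) set \<Rightarrow> (real^'d) set set \<Rightarrow> (real^'d \<Rightarrow> real) set" where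
  "P1_mean0 \<Omega> \<T> = {v \<in> P1 \<Omega> \<T>. (LINT x|lebesgue_on \<Omega>. v x) = 0}"

definition vertices :: "(real^'d) set \<Rightarrow> (real^'d) set" where
  "vertices K = {a. a extreme_point_of K}"

definition barycentric :: "(real^'d) set \<Rightarrow> real^'d \<Rightarrow> real^'d \<Rightarrow> real" where
  "barycentric K x = (THE l. (\<forall>a. a \<notin> vertices K \<longrightarrow> l a = 0) \<and>
     (\<Sum>a\<in>vertices K. l a) = 1 \<and> (\<Sum>a\<in>vertices K. l a *\<^sub>R a) = x)"

definition bubble :: "(real^'d) set \<Rightarrow> real^'d \<Rightarrow> real" where
  "bubble K x = (if x \<in> interior K then \<Prod>a\<in>vertices K. barycentric K x a else 0)"

definition P1b :: "(real^'d) set \<Rightarrow> (real^'d) set set \<Rightarrow> (real^'d \<Rightarrow> real) set" where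
  "P1b \<Omega> \<T> = {\<lambda>x. v x + (\<Sum>K\<in>\<T>. \<beta> K * bubble K x) | v \<beta>. v \<in> P1 \<Omega> \<T>}"

definition P1b0 :: "(real^'d) set \<Rightarrow> (real^'d) set set \<Rightarrow> (real^'d \<Rightarrow> real) set" where
  "P1b0 \<Omega> \<T> = {v \<in> P1b \<Omega> \<T>. zero_on_boundary \<Omega> v}"

definition P1b0_vec :: "(real^'d) set \<Rightarrow> (real^'d) set set \<Rightarrow> (real^'d \<Rightarrow> real^'d) set" where
  "P1b0_vec \<Omega> \<T> = {v. \<forall>i. (\<lambda>x. v x $ i) \<in> P1b0 \<Omega> \<T>}"

definition RT1 :: "(real^'d) set \<Rightarrow> (real^'d) set set \<Rightarrow> (real^'d \<Rightarrow> real^'d) set" where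
  "RT1 \<Omega> \<T> = {w \<in> Hdiv \<Omega>.
     (\<forall>K\<in>\<T>. \<exists>q s. (\<forall>i. poly_fun 1 (\<lambda>x. q x $ i)) \<and> poly_fun 1 s \<and>
        (\<forall>x\<in>interior K. w x = q x + s x *\<^sub>R x)) \<and>
     (\<forall>x\<in>off_elements \<T>. w x = 0)}"

definition RT1_0 :: "(real^'d) set \<Rightarrow> (real^'d) set set \<Rightarrow> (real^'d \<Rightarrow> real^'d) set" where
  "RT1_0 \<Omega> \<T> = {w \<in> RT1 \<Omega> \<T>. weak_div \<Omega> w (\<lambda>x. 0) \<and> zero_normal_on_boundary \<Omega> w}"

definition P_RT ::
  "(real^'d) set \<Rightarrow> (real^'d) set set \<Rightarrow> (real^'d \<Rightarrow> real^'d) \<Rightarrow> real^'d \<Rightarrow> real^'d" where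
  "P_RT \<Omega> \<T> u = (THE w. w \<in> RT1_0 \<Omega> \<T> \<and>
     (\<forall>z\<in>RT1_0 \<Omega> \<T>. L2_inner \<Omega> (\<lambda>x. u x - w x) z = 0))"

section \<open>The scheme\<close>

definition cutoff :: "real \<Rightarrow> real \<Rightarrow> real \<Rightarrow> real" where
  "cutoff \<rho>min \<rho>max s =
     (if s < \<rho>min / 2 then \<rho>min / 2 else if s \<le> 3/2 * \<rho>max then s else 3/2 * \<rho>max)"

text \<open>In the following, \<open>\<rho>0\<close>, \<open>u0\<close> are the data of the previous time level.\<close>

definition density_eq ::
  "(real^'d) set \<Rightarrow> (real^'d) set set \<Rightarrow> real \<Rightarrow> (real^'d \<Rightarrow> real) \<Rightarrow> (real^'d \<Rightarrow> real^'d) \<Rightarrow>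
   (real^'d \<Rightarrow> real) \<Rightarrow> (real^'d \<Rightarrow> real) \<Rightarrow> bool" where
  "density_eq \<Omega> \<T> \<tau> \<rho>0 u0 \<rho> \<phi> \<longleftrightarrow> (let w = P_RT \<Omega> \<T> u0 in
     L2_inner \<Omega> (\<lambda>x. (\<rho> x - \<rho>0 x) / \<tau>) \<phi>
     + L2_inner \<Omega> (\<lambda>x. w x \<bullet> grad \<rho> x) \<phi>
     - (\<Sum>K\<in>\<T>. LINT x:inflow_boundary K w|surface_measure K.
          (inner_trace K w x \<bullet> jump K \<rho> x) * inner_trace K \<phi> x) = 0)"

definition momentum_eq ::
  "(real^'d) set \<Rightarrow> real \<Rightarrow> real \<Rightarrow> (real \<Rightarrow> real) \<Rightarrow>
   (real^'d \<Rightarrow> real) \<Rightarrow> (real^'d \<Rightarrow> real^'d) \<Rightarrow>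
   (real^'d \<Rightarrow> real) \<Rightarrow> (real^'d \<Rightarrow> real^'d) \<Rightarrow> (real^'d \<Rightarrow> real) \<Rightarrow> (real^'d \<Rightarrow> real^'d) \<Rightarrow> bool" where
  "momentum_eq \<Omega> \<mu> \<tau> X \<rho>0 u0 \<rho> u p v \<longleftrightarrow>
     L2_inner \<Omega> (\<lambda>x. X (\<rho>0 x) *\<^sub>R ((u x - u0 x) /\<^sub>R \<tau>)) v
     + 1/2 * L2_inner \<Omega> (\<lambda>x. ((X (\<rho> x) - X (\<rho>0 x)) / \<tau>) *\<^sub>R u x) v
     - 1/2 * L2_inner \<Omega> (\<lambda>x. X (\<rho> x) *\<^sub>R u0 x) (grad (\<lambda>x. u x \<bullet> v x))
     + L2_inner \<Omega> (\<lambda>x. X (\<rho> x) *\<^sub>R (jac u x *v u0 x)) v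
     + L2_inner \<Omega> (\<lambda>x. \<mu> *\<^sub>R jac u x) (jac v)
     - L2_inner \<Omega> p (divg v) = 0"

definition solves_scheme ::
  "(real^'d) set \<Rightarrow> (real^'d) set set \<Rightarrow> real \<Rightarrow> real \<Rightarrow> real \<Rightarrow> real \<Rightarrow>
   (real^'d \<Rightarrow> real) \<Rightarrow> (real^'d \<Rightarrow> real^'d) \<Rightarrow>
   (real^'d \<Rightarrow> real) \<times> (real^'d \<Rightarrow> real^'d) \<times> (real^'d \<Rightarrow> real) \<Rightarrow> bool" where
  "solves_scheme \<Omega> \<T> \<mu> \<tau> \<rho>min \<rho>max \<rho>0 u0 = (\<lambda>(\<rho>, u, p).
     \<rho> \<in> PdG 2 \<T> \<and> u \<in> P1b0_vec \<Omega> \<T> \<and> p \<in> P1_mean0 \<Omega> \<T> \<and>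
     (\<forall>\<phi>\<in>PdG 2 \<T>. density_eq \<Omega> \<T> \<tau> \<rho>0 u0 \<rho> \<phi>) \<and>
     (\<forall>v\<in>P1b0_vec \<Omega> \<T>. momentum_eq \<Omega> \<mu> \<tau> (cutoff \<rho>min \<rho>max) \<rho>0 u0 \<rho> u p v) \<and>
     (\<forall>q\<in>P1_mean0 \<Omega> \<T>. L2_inner \<Omega> (divg u) q = 0))"

end

(* For a given velocity the density equation is linear, and then the momentum equation is linear in
   velocity and pressure, so existence and uniqueness reduce to injectivity on finite-dimensional
   spaces. Testing the density equation with the density, integration by parts on the elements
   leaves half the squared jumps weighted by the flow through the facets: the projected velocity is
   divergence free with continuous normal components, which follows from the weak formulation by
   testing with bump functions. In the momentum equation the convective terms are skew-symmetric.
   The pressure is unique because testing with element bubbles shows that it is piecewise constant,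
   and a piecewise constant function in H1 of a convex domain is constant. *)

theory Submission
  imports Defs "HOL-Library.Function_Algebras"
begin

section \<open>Finite-dimensional spaces of functions\<close>

text \<open>The surface measure is volume pushed forward from a collar, so the divergence theorem on
  a simplex is built from volume integrals: the simplex is sliced by lines parallel to an edge, each
  of which enters through one facet and leaves through another, and the fundamental theorem of
  calculus is applied on every line. The projections onto the facets are then oblique, which the
  measures \<open>hyp\<close> are made to absorb. Traces and boundary conditions are limits, whose
  measurability is not apparent; facet integrals are therefore moved to C1 extensions of the element
  polynomials. That a piecewise constant H1 function is constant is not shown by crossing facets one
  by one, since a segment between two elements may run through lower-dimensional faces; averaging
  over translates of a bump is insensitive to this. The absence of a step size restriction has two
  sources: the transport form is nonnegative, and the cut-off keeps the coefficient of the velocity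
  positive for every \<tau>. When the coupled system is tested with its own solution, the pressure
  and divergence terms cancel.\<close>

interpretation fs: vector_space "\<lambda>(c::real) (f::'a \<Rightarrow> 'b::real_vector). (\<lambda>x. c *\<^sub>R f x)"
  by standard (auto simp: fun_eq_iff scaleR_add_right scaleR_add_left)

lemma sum_fun_pointwise: "(\<Sum>i\<in>I. f i) = (\<lambda>x. \<Sum>i\<in>I. (f i x :: 'b::comm_monoid_add))"
  by (induction I rule: infinite_finite_induct) (auto simp: fun_eq_iff)

text \<open>The spaces of the scheme are sets of functions into the reals, vectors or pairs, so the
  subspace property is phrased through pointwise linear combinations.\<close>

definition lin_closed :: "('a \<Rightarrow> 'b::real_vector) set \<Rightarrow> bool" where
  "lin_closed V \<longleftrightarrow> (\<lambda>x. 0) \<in> V \<and>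
     (\<forall>f\<in>V. \<forall>g\<in>V. \<forall>a b. (\<lambda>x. a *\<^sub>R f x + b *\<^sub>R g x) \<in> V)"

text \<open>Only containment in a finite span is asked for. Subsets then inherit the property at
  once, so boundary, mean value and divergence constraints cost nothing.\<close>

definition fin_dim :: "('a \<Rightarrow> 'b::real_vector) set \<Rightarrow> bool" where
  "fin_dim V \<longleftrightarrow> (\<exists>S. finite S \<and> V \<subseteq> fs.span S)"

lemma lin_closedD:
  assumes "lin_closed V"
  shows "(\<lambda>x. 0) \<in> V"
    and "f \<in> V \<Longrightarrow> g \<in> V \<Longrightarrow> (\<lambda>x. a *\<^sub>R f x + b *\<^sub>R g x) \<in> V"
    and "f \<in> V \<Longrightarrow> g \<in> V \<Longrightarrow> (\<lambda>x. f x + g x) \<in> V"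
    and "f \<in> V \<Longrightarrow> g \<in> V \<Longrightarrow> (\<lambda>x. f x - g x) \<in> V"
    and "f \<in> V \<Longrightarrow> (\<lambda>x. a *\<^sub>R f x) \<in> V"
proof -
  have *: "(\<lambda>x. a *\<^sub>R f x + b *\<^sub>R g x) \<in> V" if "f \<in> V" "g \<in> V" for f g a b
    using assms that by (auto simp: lin_closed_def)
  show "(\<lambda>x. 0) \<in> V" using assms by (auto simp: lin_closed_def)
  show "f \<in> V \<Longrightarrow> g \<in> V \<Longrightarrow> (\<lambda>x. a *\<^sub>R f x + b *\<^sub>R g x) \<in> V" by (rule *)
  show "f \<in> V \<Longrightarrow> g \<in> V \<Longrightarrow> (\<lambda>x. f x + g x) \<in> V" using *[of f g 1 1] by simp
  show "f \<in> V \<Longrightarrow> g \<in> V \<Longrightarrow> (\<lambda>x. f x - g x) \<in> V" using *[of f g 1 "-1"] by simp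
  show "f \<in> V \<Longrightarrow> (\<lambda>x. a *\<^sub>R f x) \<in> V" using *[of f f a 0] by simp
qed

lemma lin_closed_sum:
  assumes "lin_closed V" "\<And>i. i \<in> I \<Longrightarrow> f i \<in> V"
  shows "(\<lambda>x. \<Sum>i\<in>I. c i *\<^sub>R f i x) \<in> V"
  using assms(2)
proof (induction I rule: infinite_finite_induct)
  case (insert i I)
  then show ?case
    using lin_closedD(2)[OF assms(1), of "f i" "\<lambda>x. \<Sum>i\<in>I. c i *\<^sub>R f i x" "c i" 1] by simp
qed (use lin_closedD(1)[OF assms(1)] in auto)

lemma fin_dim_subset: "V \<subseteq> W \<Longrightarrow> fin_dim W \<Longrightarrow> fin_dim V"
  unfolding fin_dim_def by blast

lemma fin_dim_finite_sums:
  assumes "finite I"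
  shows "fin_dim {\<lambda>x. \<Sum>i\<in>I. c i *\<^sub>R f i x | c. True}"
  unfolding fin_dim_def
proof (intro exI conjI subsetI)
  show "finite (f ` I)" using assms by simp
  fix v assume "v \<in> {\<lambda>x. \<Sum>i\<in>I. c i *\<^sub>R f i x | c. True}"
  then obtain c where v: "v = (\<lambda>x. \<Sum>i\<in>I. c i *\<^sub>R f i x)" by blast
  have "(\<Sum>i\<in>I. (\<lambda>x. c i *\<^sub>R f i x)) \<in> fs.span (f ` I)"
    by (intro fs.span_sum fs.span_scale fs.span_base) auto
  then show "v \<in> fs.span (f ` I)" by (simp add: v sum_fun_pointwise)
qed

lemma fin_dim_plus:
  assumes "fin_dim V" "fin_dim W"
  shows "fin_dim {\<lambda>x. f x + g x | f g. f \<in> V \<and> g \<in> W}"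
proof -
  obtain S T where S: "finite S" "V \<subseteq> fs.span S" and T: "finite T" "W \<subseteq> fs.span T"
    using assms unfolding fin_dim_def by blast
  have "f + g \<in> fs.span (S \<union> T)" if "f \<in> V" "g \<in> W" for f g
    by (intro fs.span_add) (use that S T fs.span_mono[of S "S \<union> T"] fs.span_mono[of T "S \<union> T"] in auto)
  then show ?thesis
    unfolding fin_dim_def using S T
    by (intro exI[of _ "S \<union> T"]) (auto simp: plus_fun_def)
qed

text \<open>Maps that are linear at each point cover multiplication by indicators of elements, by
  unit vectors and by the position vector, as well as the embeddings into pairs.\<close>

lemma fin_dim_image:
  fixes V :: "('a \<Rightarrow> 'b::real_vector) set" and L :: "'a \<Rightarrow> 'b \<Rightarrow> 'c::real_vector"
  assumes "fin_dim V" "\<And>x. linear (L x)"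
  shows "fin_dim ((\<lambda>f x. L x (f x)) ` V)"
proof -
  obtain S where S: "finite S" "V \<subseteq> fs.span S"
    using assms unfolding fin_dim_def by blast
  let ?M = "\<lambda>f x. L x (f x)"
  have "?M f \<in> fs.span (?M ` S)" if "f \<in> fs.span S" for f
    using that
  proof (induction rule: fs.span_induct_alt)
    case base
    have "?M 0 = 0" by (auto simp: fun_eq_iff linear_0[OF assms(2)])
    then show ?case by (metis fs.span_zero)
  next
    case (step c f g)
    have "?M ((\<lambda>x. c *\<^sub>R f x) + g) = (\<lambda>x. c *\<^sub>R ?M f x) + ?M g"
      by (auto simp: fun_eq_iff linear_add[OF assms(2)] linear_cmul[OF assms(2)])
    then show ?case
      using fs.span_add[OF fs.span_scale[OF fs.span_base[OF imageI[OF step(1)]]] step(2)] by (simp only:)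
  qed
  then show ?thesis
    using S unfolding fin_dim_def by (intro exI[of _ "?M ` S"]) auto
qed

lemma fin_dim_sum_family:
  assumes "finite I" "\<And>i. i \<in> I \<Longrightarrow> fin_dim (V i)"
  shows "fin_dim {\<lambda>x. \<Sum>i\<in>I. f i x | f. \<forall>i\<in>I. f i \<in> V i}"
  using assms
proof (induction I rule: finite_induct)
  case empty
  have "{\<lambda>x. 0} \<subseteq> fs.span {}" by (auto simp: fs.span_empty zero_fun_def)
  then show ?case unfolding fin_dim_def by (intro exI[of _ "{}"]) auto
next
  case (insert j I)
  have "fin_dim {\<lambda>x. f x + g x | f g. f \<in> V j \<and> g \<in> {\<lambda>x. \<Sum>i\<in>I. f i x | f. \<forall>i\<in>I. f i \<in> V i}}"
    by (intro fin_dim_plus insert) (auto intro: insert)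
  then show ?case
    by (rule fin_dim_subset[rotated]) (use insert in fastforce)
qed

text \<open>Trial and test space coincide, so in a basis the problem is a square linear system and
  the trivial kernel \<open>nondeg\<close> already gives solvability. Linearity is asked for on
  \<open>V\<close> only, because the integrals in the forms are linear only on functions for which
  they exist.\<close>

lemma bilinear_form_solvable:
  fixes V :: "('a \<Rightarrow> 'b::real_vector) set" and B :: "('a \<Rightarrow> 'b) \<Rightarrow> ('a \<Rightarrow> 'b) \<Rightarrow> real"
  assumes V: "lin_closed V" "fin_dim V"
    and B1: "\<And>f g h a b. f \<in> V \<Longrightarrow> g \<in> V \<Longrightarrow> h \<in> V \<Longrightarrow>
      B (\<lambda>x. a *\<^sub>R f x + b *\<^sub>R g x) h = a * B f h + b * B g h"
    and B2: "\<And>f g h a b. f \<in> V \<Longrightarrow> g \<in> V \<Longrightarrow> h \<in> V \<Longrightarrow>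
      B h (\<lambda>x. a *\<^sub>R f x + b *\<^sub>R g x) = a * B h f + b * B h g"
    and l: "\<And>f g a b. f \<in> V \<Longrightarrow> g \<in> V \<Longrightarrow> l (\<lambda>x. a *\<^sub>R f x + b *\<^sub>R g x) = a * l f + b * l g"
    and nondeg: "\<And>f. f \<in> V \<Longrightarrow> (\<And>g. g \<in> V \<Longrightarrow> B f g = 0) \<Longrightarrow> f = (\<lambda>x. 0)"
  shows "\<exists>!f. f \<in> V \<and> (\<forall>g\<in>V. B f g = l g)"
proof -
  obtain S where S: "finite S" "V \<subseteq> fs.span S" using V unfolding fin_dim_def by blast
  obtain E where E: "E \<subseteq> V" "fs.independent E" "V \<subseteq> fs.span E"
    by (rule fs.maximal_independent_subset)
  have finE: "finite E"
    using fs.independent_span_bound[OF S(1) E(2)] E(1) S(2) by blast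
  define F where "F c = (\<lambda>x. \<Sum>e\<in>E. c e *\<^sub>R e x)" for c :: "('a \<Rightarrow> 'b) \<Rightarrow> real"
  have FV: "F c \<in> V" for c
    unfolding F_def by (rule lin_closed_sum[OF V(1)]) (use E in auto)
  have VF: "\<exists>c. f = F c" if "f \<in> V" for f
  proof -
    have "f \<in> fs.span E" using that E by blast
    then obtain c where "f = (\<Sum>e\<in>E. (\<lambda>x. c e *\<^sub>R e x))"
      unfolding fs.span_finite[OF finE] by auto
    then show ?thesis by (auto simp: F_def sum_fun_pointwise)
  qed
  have zero: "F c = (\<lambda>x. 0) \<Longrightarrow> e \<in> E \<Longrightarrow> c e = 0" for c e
    using fs.independent_explicit_finite_subsets[THEN iffD1, OF E(2), rule_format, of E c e] finE
    by (auto simp: F_def sum_fun_pointwise zero_fun_def)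
  have lin1: "g (\<lambda>x. 0) = 0 \<and> g (\<lambda>x. \<Sum>e\<in>I. c e *\<^sub>R e x) = (\<Sum>e\<in>I. c e * g e)"
    if g: "\<And>f f' a b. f \<in> V \<Longrightarrow> f' \<in> V \<Longrightarrow> g (\<lambda>x. a *\<^sub>R f x + b *\<^sub>R f' x) = a * g f + b * g f'"
      and "I \<subseteq> E" for g :: "('a \<Rightarrow> 'b) \<Rightarrow> real" and c I
  proof -
    have "finite I" using that finE finite_subset by blast
    have z: "g (\<lambda>x. 0) = 0"
      using g[of "\<lambda>x. 0" "\<lambda>x. 0" 0 0] lin_closedD(1)[OF V(1)] by simp
    show ?thesis using \<open>finite I\<close> \<open>I \<subseteq> E\<close>
    proof (induction I rule: finite_induct)
      case (insert i I)
      have "g (\<lambda>x. c i *\<^sub>R i x + 1 *\<^sub>R (\<Sum>e\<in>I. c e *\<^sub>R e x)) = c i * g i + 1 * g (\<lambda>x. \<Sum>e\<in>I. c e *\<^sub>R e x)"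
        using insert E by (intro g lin_closed_sum[OF V(1)]) auto
      then show ?case using insert by auto
    qed (use z in auto)
  qed
  have BF: "B (F c) h = (\<Sum>e\<in>E. c e * B e h)" if "h \<in> V" for c h
    using lin1[of "\<lambda>f. B f h" E c] B1 that by (auto simp: F_def)
  have BF2: "B h (F c) = (\<Sum>e\<in>E. c e * B h e)" if "h \<in> V" for c h
    using lin1[of "\<lambda>f. B h f" E c] B2 that by (auto simp: F_def)
  have lF: "l (F c) = (\<Sum>e\<in>E. c e * l e)" for c
    using lin1[of l E c] l by (auto simp: F_def)
  \<comment> \<open>\<open>T f\<close> is the coordinate vector of the functional \<open>B f\<close>
    on the basis \<open>E\<close>; the value 0 off \<open>E\<close> places it in the span of the
    unit vectors \<open>\<delta> e\<close>, a space of dimension at most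
    \<open>card E\<close>.\<close>
  define T where "T f = (\<lambda>e. if e \<in> E then B f e else 0)" for f
  define \<delta> where "\<delta> e = (\<lambda>e'. if e' = e then 1 else 0::real)" for e :: "'a \<Rightarrow> 'b"
  have in_span: "h \<in> fs.span (\<delta> ` E)" if "\<And>e. e \<notin> E \<Longrightarrow> h e = 0" for h :: "('a \<Rightarrow> 'b) \<Rightarrow> real"
  proof -
    have "h = (\<Sum>e\<in>E. (\<lambda>x. h e *\<^sub>R \<delta> e x))"
    proof
      fix e'
      have "(\<Sum>e\<in>E. h e * (if e' = e then 1 else 0)) = (\<Sum>e\<in>E. if e' = e then h e else 0)"
        by (intro sum.cong) auto
      then show "h e' = (\<Sum>e\<in>E. (\<lambda>x. h e *\<^sub>R \<delta> e x)) e'"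
        using that[of e'] finE by (auto simp: sum_fun_pointwise \<delta>_def sum.delta')
    qed
    also have "\<dots> \<in> fs.span (\<delta> ` E)"
      by (intro fs.span_sum fs.span_scale fs.span_base) auto
    finally show ?thesis .
  qed
  have Tsum: "(\<Sum>e\<in>E. (\<lambda>x. c e *\<^sub>R T e x)) = T (F c)" for c
    by (auto simp: fun_eq_iff sum_fun_pointwise T_def BF subsetD[OF E(1)])
  have T0: "F c = (\<lambda>x. 0)" if "T (F c) = 0" for c
  proof (rule nondeg[OF FV])
    fix g assume "g \<in> V"
    then obtain d where "g = F d" using VF by blast
    moreover have "B (F c) e = 0" if "e \<in> E" for e
      using \<open>T (F c) = 0\<close> that by (auto simp: T_def fun_eq_iff split: if_splits)
    ultimately show "B (F c) g = 0" using BF2[OF FV[of c], of d] by simp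
  qed
  have single: "F (\<lambda>e'. if e' = e then a else 0) = (\<lambda>x. a *\<^sub>R e x)" if "e \<in> E" for e a
  proof -
    have "(\<Sum>e'\<in>E. (if e' = e then a else 0) *\<^sub>R e' x) = (\<Sum>e'\<in>E. if e' = e then a *\<^sub>R e x else 0)" for x
      by (intro sum.cong) auto
    then show ?thesis using that finE by (auto simp: F_def)
  qed
  have injT: "inj_on T E"
  proof (rule inj_onI, rule ccontr)
    fix e1 e2 assume e: "e1 \<in> E" "e2 \<in> E" "T e1 = T e2" "e1 \<noteq> e2"
    let ?c = "\<lambda>e. if e = e1 then 1 else if e = e2 then -1 else 0 :: real"
    have "(\<Sum>e\<in>E. (\<lambda>x. ?c e *\<^sub>R T e x)) = (\<lambda>x. \<Sum>e\<in>{e1,e2}. ?c e *\<^sub>R T e x)"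
      unfolding sum_fun_pointwise using e finE
      by (intro ext sum.mono_neutral_right) auto
    also have "\<dots> = 0" using e by (auto simp: fun_eq_iff)
    finally have "F ?c = (\<lambda>x. 0)" using T0[of ?c] Tsum[of ?c] by (simp only:)
    from zero[OF this e(1)] show False by simp
  qed
  have indT: "fs.independent (T ` E)"
  proof (rule fs.independent_if_scalars_zero)
    show "finite (T ` E)" using finE by simp
    fix f x assume sum0: "(\<Sum>x\<in>T ` E. (\<lambda>y. f x *\<^sub>R x y)) = 0" and "x \<in> T ` E"
    then obtain e where e: "e \<in> E" "x = T e" by blast
    have "(\<Sum>e\<in>E. (\<lambda>y. (f \<circ> T) e *\<^sub>R T e y)) = 0"
      using sum0 by (subst (asm) sum.reindex[OF injT]) auto
    then have "F (f \<circ> T) = (\<lambda>x. 0)" using T0[of "f \<circ> T"] Tsum[of "f \<circ> T"] by (simp only:)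
    from zero[OF this e(1)] show "f x = 0" using e by simp
  qed
  define \<l> where "\<l> = (\<lambda>e. if e \<in> E then l e else 0)"
  have "\<l> \<in> fs.span (T ` E)"
  proof (rule ccontr)
    \<comment> \<open>Dimension count: otherwise the image of the basis together with
      \<open>\<l>\<close> would be \<open>card E + 1\<close> independent vectors in the span of at
      most \<open>card E\<close> unit vectors.\<close>
    assume n: "\<l> \<notin> fs.span (T ` E)"
    then have "fs.independent (insert \<l> (T ` E))" using indT by (rule fs.independent_insertI)
    moreover have "\<l> \<in> fs.span (\<delta> ` E)" by (rule in_span) (simp add: \<l>_def)
    moreover have "T e \<in> fs.span (\<delta> ` E)" for e by (rule in_span) (simp add: T_def)
    ultimately have "fs.independent (insert \<l> (T ` E))" "insert \<l> (T ` E) \<subseteq> fs.span (\<delta> ` E)"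
      by blast+
    then have "card (insert \<l> (T ` E)) \<le> card (\<delta> ` E)"
      using fs.independent_span_bound[of "\<delta> ` E"] finE by blast
    moreover have "card (insert \<l> (T ` E)) = Suc (card E)"
      using n finE fs.span_base[of \<l> "T ` E"] by (subst card_insert_disjoint) (auto simp: card_image injT)
    ultimately show False using card_image_le[OF finE, of \<delta>] by simp
  qed
  then obtain c where c: "\<l> = (\<Sum>v\<in>T ` E. (\<lambda>x. c v *\<^sub>R v x))"
    unfolding fs.span_finite[OF finite_imageI[OF finE]] by auto
  have "\<l> = (\<Sum>e\<in>E. (\<lambda>x. (c \<circ> T) e *\<^sub>R T e x))"
    unfolding c by (subst sum.reindex[OF injT]) auto
  then have lT: "\<l> = T (F (c \<circ> T))" by (simp only: Tsum)
  let ?f = "F (c \<circ> T)"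
  have sol: "B ?f g = l g" if gV: "g \<in> V" for g
  proof -
    obtain d where d: "g = F d" using VF[OF gV] by blast
    have "B ?f e = l e" if "e \<in> E" for e
      using fun_cong[OF lT, of e] that by (simp add: \<l>_def T_def)
    then show ?thesis unfolding d lF BF2[OF FV] by simp
  qed
  show ?thesis
  proof (rule ex1I[of _ ?f])
    show "?f \<in> V \<and> (\<forall>g\<in>V. B ?f g = l g)" using sol FV by blast
    fix f assume f: "f \<in> V \<and> (\<forall>g\<in>V. B f g = l g)"
    have "(\<lambda>x. 1 *\<^sub>R f x + (-1) *\<^sub>R ?f x) = (\<lambda>x. 0)"
    proof (rule nondeg)
      show "(\<lambda>x. 1 *\<^sub>R f x + (-1) *\<^sub>R ?f x) \<in> V" using f FV by (intro lin_closedD(2)[OF V(1)]) auto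
      fix g assume "g \<in> V"
      then show "B (\<lambda>x. 1 *\<^sub>R f x + (-1) *\<^sub>R ?f x) g = 0"
        using f sol[of g] B1[of f ?f g 1 "-1"] FV by simp
    qed
    then show "f = ?f" by (auto simp: fun_eq_iff)
  qed
qed

section \<open>Continuously differentiable functions and test functions\<close>

text \<open>Differentiability is required on the whole space: on each element the finite element
  functions are restrictions of polynomials, and with global extensions the values on facets are
  ordinary values. Continuity of the derivative is stated direction by direction, as it enters the
  integrals.\<close>

definition C1 :: "('a::euclidean_space \<Rightarrow> real) \<Rightarrow> bool" where
  "C1 f \<longleftrightarrow> (\<forall>x. f differentiable (at x)) \<and>
     (\<forall>v. continuous_on UNIV (\<lambda>x. frechet_derivative f (at x) v))"

lemma C1I:
  assumes "\<And>x. (f has_derivative f' x) (at x)" "\<And>v. continuous_on UNIV (\<lambda>x. f' x v)"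
  shows "C1 f"
proof -
  have "frechet_derivative f (at x) = f' x" for x
    using frechet_derivative_at[OF assms(1)] by metis
  then show ?thesis using assms by (auto simp: C1_def differentiable_def)
qed

lemma C1_has_derivative: "C1 f \<Longrightarrow> (f has_derivative frechet_derivative f (at x)) (at x)"
  by (auto simp: C1_def frechet_derivative_works)

lemma frechet_eqI: "(f has_derivative f') (at x) \<Longrightarrow> frechet_derivative f (at x) = f'"
  using frechet_derivative_at by metis

lemma C1_cont_deriv: "C1 f \<Longrightarrow> continuous_on A (\<lambda>x. frechet_derivative f (at x) v)"
  unfolding C1_def using continuous_on_subset by blast

lemma C1_continuous: "C1 f \<Longrightarrow> continuous_on A f"
  using C1_has_derivative has_derivative_continuous
  by (metis continuous_at_imp_continuous_on)

lemma C1_linear: "C1 f \<Longrightarrow> linear (frechet_derivative f (at x))"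
  using C1_has_derivative has_derivative_linear by blast

lemma C1_const [simp]: "C1 (\<lambda>x. c)"
  by (rule C1I[of _ "\<lambda>x v. 0"]) auto

lemma C1_inner [simp]: "C1 (\<lambda>x. m \<bullet> x)"
  by (rule C1I[of _ "\<lambda>x v. m \<bullet> v"]) (auto intro!: derivative_eq_intros)

lemma C1_nth [simp]: "C1 (\<lambda>x. x $ i)"
  by (rule C1I[of _ "\<lambda>x v. v $ i"])
     (auto intro!: derivative_eq_intros bounded_linear_imp_has_derivative bounded_linear_vec_nth)

lemma C1_add [intro]:
  assumes "C1 f" "C1 g" shows "C1 (\<lambda>x. f x + g x)"
  by (rule C1I[of _ "\<lambda>x v. frechet_derivative f (at x) v + frechet_derivative g (at x) v"])
     (auto intro!: derivative_eq_intros continuous_intros C1_has_derivative C1_cont_deriv assms)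

lemma frechet_add:
  assumes "C1 f" "C1 g"
  shows "frechet_derivative (\<lambda>x. f x + g x) (at x) v
    = frechet_derivative f (at x) v + frechet_derivative g (at x) v"
  by (subst frechet_eqI[where f'="\<lambda>v. frechet_derivative f (at x) v + frechet_derivative g (at x) v"])
     (auto intro!: derivative_eq_intros C1_has_derivative assms)

lemma C1_mult [intro]:
  assumes "C1 f" "C1 g" shows "C1 (\<lambda>x. f x * g x)"
  by (rule C1I[of _ "\<lambda>x v. f x * frechet_derivative g (at x) v + frechet_derivative f (at x) v * g x"])
     (auto intro!: derivative_eq_intros continuous_on_add continuous_on_mult C1_has_derivative
        C1_cont_deriv[OF assms(1)] C1_cont_deriv[OF assms(2)] C1_continuous[OF assms(1)] C1_continuous[OF assms(2)] assms)

lemma frechet_mult: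
  assumes "C1 f" "C1 g"
  shows "frechet_derivative (\<lambda>x. f x * g x) (at x) v
    = f x * frechet_derivative g (at x) v + frechet_derivative f (at x) v * g x"
  by (subst frechet_eqI[where f'="\<lambda>v. f x * frechet_derivative g (at x) v + frechet_derivative f (at x) v * g x"])
     (auto intro!: derivative_eq_intros C1_has_derivative assms)

lemma frechet_const_fun: "frechet_derivative (\<lambda>x. c) (at x) v = 0"
  by (subst frechet_eqI[where f'="\<lambda>v. 0"]) auto

lemma frechet_inner: "frechet_derivative (\<lambda>x. m \<bullet> x) (at x) v = m \<bullet> v"
  by (subst frechet_eqI[where f'="\<lambda>v. m \<bullet> v"]) (auto intro!: derivative_eq_intros)

lemma C1_sum [intro]: "(\<And>i. i \<in> I \<Longrightarrow> C1 (f i)) \<Longrightarrow> C1 (\<lambda>x. \<Sum>i\<in>I. f i x)"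
  by (induction I rule: infinite_finite_induct) auto

lemma C1_prod [intro]: "(\<And>i. i \<in> I \<Longrightarrow> C1 (f i)) \<Longrightarrow> C1 (\<lambda>x. \<Prod>i\<in>I. f i x)"
  by (induction I rule: infinite_finite_induct) auto

lemma C1_power [intro]: "C1 f \<Longrightarrow> C1 (\<lambda>x. f x ^ n)"
  by (induction n) auto

lemma C1_cmult [intro]: "C1 f \<Longrightarrow> C1 (\<lambda>x. c * f x)"
  by auto

lemma C1_diff [intro]: "C1 f \<Longrightarrow> C1 g \<Longrightarrow> C1 (\<lambda>x. f x - g x)"
  using C1_add[OF _ C1_cmult[of g "-1"], of f] by simp

lemma C1_poly_fun: "poly_fun r p \<Longrightarrow> C1 p"
  unfolding poly_fun_def by (auto intro!: C1_sum C1_mult C1_prod C1_power)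

lemma linear_sum_axis:
  fixes L :: "real^'d \<Rightarrow> real"
  assumes "linear L"
  shows "L v = (\<Sum>i\<in>UNIV. v $ i * L (axis i 1))"
proof -
  have "v = (\<Sum>i\<in>UNIV. v $ i *\<^sub>R axis i 1)" 
    by (simp add: basis_expansion flip: scalar_mult_eq_scaleR)
  then have "L v = L (\<Sum>i\<in>UNIV. v $ i *\<^sub>R axis i 1)" by simp
  also have "\<dots> = (\<Sum>i\<in>UNIV. v $ i * L (axis i 1))"
    by (simp add: linear_sum[OF assms] linear_cmul[OF assms])
  finally show ?thesis .
qed

lemma grad_nth: "grad f x $ i = frechet_derivative f (at x) (axis i 1)"
  by (simp add: grad_def)

lemma inner_grad:
  fixes f :: "real^'d \<Rightarrow> real"
  assumes "f differentiable (at x)"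
  shows "grad f x \<bullet> v = frechet_derivative f (at x) v"
proof -
  have "linear (frechet_derivative f (at x))"
    using assms linear_frechet_derivative by blast
  from linear_sum_axis[OF this, of v] show ?thesis
    by (simp add: inner_vec_def grad_nth mult.commute)
qed

lemma Ck_Suc_imp: "Ck (Suc k) f \<Longrightarrow> Ck k f"
proof (induction k arbitrary: f)
  case 0
  then show ?case
    by (auto intro!: continuous_at_imp_continuous_on differentiable_imp_continuous_within)
qed auto

lemma Ck_1_C1: "Ck (Suc 0) f \<Longrightarrow> C1 f"
proof -
  assume f: "Ck (Suc 0) f"
  have "continuous_on UNIV (\<lambda>x. grad f x $ i)" for i
    using f by simp
  then have "continuous_on UNIV (\<lambda>x. \<Sum>i\<in>UNIV. grad f x $ i * v $ i)" for v
    by (intro continuous_on_sum continuous_on_mult continuous_on_const)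
  then have "continuous_on UNIV (\<lambda>x. grad f x \<bullet> v)" for v
    by (simp add: inner_vec_def)
  moreover have "f differentiable (at x)" for x using f by auto
  ultimately show ?thesis by (simp add: C1_def inner_grad)
qed

lemma Ck_Suc_C1: "Ck (Suc k) f \<Longrightarrow> C1 f"
proof (induction k)
  case (Suc k)
  then show ?case using Ck_Suc_imp by blast
qed (use Ck_1_C1 in auto)

section \<open>Smooth functions and bump functions\<close>

definition smooth :: "(real^'d \<Rightarrow> real) \<Rightarrow> bool" where
  "smooth f \<longleftrightarrow> (\<forall>k. Ck k f)"

lemma smooth_C1: "smooth f \<Longrightarrow> C1 f"
  using Ck_1_C1 smooth_def by blast

lemma Ck_const [simp]: "Ck k (\<lambda>x. c)"
proof (induction k arbitrary: c)
  case (Suc k)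
  have "(\<lambda>x. grad (\<lambda>x::real^'a. c) x $ i) = (\<lambda>x. 0)" for i
    by (simp add: grad_nth frechet_const_fun)
  then show ?case using Suc by simp
qed auto

lemma Ck_affine [simp]: "Ck k (\<lambda>x. m \<bullet> x)"
proof (cases k)
  case (Suc k)
  have "(\<lambda>x. grad (\<lambda>x. m \<bullet> x) x $ i) = (\<lambda>x. m $ i)" for i
    by (simp add: grad_nth frechet_inner inner_axis)
  then show ?thesis using Suc by (auto intro: derivative_intros differentiableI)
qed (auto intro!: continuous_intros)

lemma Ck_add: "Ck k f \<Longrightarrow> Ck k g \<Longrightarrow> Ck k (\<lambda>x. f x + g x)"
proof (induction k arbitrary: f g)
  case (Suc k)
  have 1: "C1 f" "C1 g" using Suc.prems Ck_Suc_C1 by blast+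
  have "(\<lambda>x. grad (\<lambda>x. f x + g x) x $ i) = (\<lambda>x. grad f x $ i + grad g x $ i)" for i
    by (simp add: grad_nth frechet_add 1)
  then show ?case using Suc by auto
qed (auto intro!: continuous_intros)

lemma Ck_mult: "Ck k f \<Longrightarrow> Ck k g \<Longrightarrow> Ck k (\<lambda>x. f x * g x)"
proof (induction k arbitrary: f g)
  case (Suc k)
  have 1: "C1 f" "C1 g" using Suc.prems Ck_Suc_C1 by blast+
  have "(\<lambda>x. grad (\<lambda>x. f x * g x) x $ i) = (\<lambda>x. f x * grad g x $ i + grad f x $ i * g x)" for i
    by (simp add: grad_nth frechet_mult 1)
  then show ?case using Suc.prems Ck_Suc_imp[OF Suc.prems(1)] Ck_Suc_imp[OF Suc.prems(2)]
    by (auto intro!: Ck_add Suc.IH C1_mult[OF 1, unfolded C1_def, THEN conjunct1, rule_format])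
qed (auto intro!: continuous_intros)

lemma Ck_diff: "Ck k f \<Longrightarrow> Ck k g \<Longrightarrow> Ck k (\<lambda>x. f x - g x)"
  using Ck_add[OF _ Ck_mult[OF Ck_const, of k g "-1"], of f] by simp

lemma smooth_const [simp]: "smooth (\<lambda>x. c)"
  and smooth_inner [simp]: "smooth (\<lambda>x. m \<bullet> x)"
  and smooth_add [intro]: "smooth f \<Longrightarrow> smooth g \<Longrightarrow> smooth (\<lambda>x. f x + g x)"
  and smooth_mult [intro]: "smooth f \<Longrightarrow> smooth g \<Longrightarrow> smooth (\<lambda>x. f x * g x)"
  by (auto simp: smooth_def intro: Ck_add Ck_mult)

lemma smooth_diff [intro]: "smooth f \<Longrightarrow> smooth g \<Longrightarrow> smooth (\<lambda>x. f x - g x)"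
  by (auto simp: smooth_def intro: Ck_diff)

lemma smooth_sum [intro]: "(\<And>i. i \<in> I \<Longrightarrow> smooth (f i)) \<Longrightarrow> smooth (\<lambda>x. \<Sum>i\<in>I. f i x)"
  by (induction I rule: infinite_finite_induct) auto

lemma smooth_prod [intro]: "(\<And>i. i \<in> I \<Longrightarrow> smooth (f i)) \<Longrightarrow> smooth (\<lambda>x. \<Prod>i\<in>I. f i x)"
  by (induction I rule: infinite_finite_induct) auto

lemma smooth_power [intro]: "smooth f \<Longrightarrow> smooth (\<lambda>x. f x ^ n)"
  by (induction n) auto

text \<open>The family is closed under derivatives, up to linear combinations.\<close>

definition flat :: "nat \<Rightarrow> real \<Rightarrow> real" where
  "flat m t = (if t > 0 then exp (- (1 / t)) / t ^ m else 0)"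

text \<open>From the right the substitution of \<open>1 / t\<close> turns \<open>flat m\<close> into
  a power divided by the exponential, which tends to 0; from the left the function vanishes.\<close>

lemma flat_tendsto_0: "(flat m \<longlongrightarrow> 0) (at 0)"
proof -
  have "((\<lambda>t. (inverse t) ^ m / exp (inverse t)) \<longlongrightarrow> (0::real)) (at_right 0)"
    using filterlim_compose[OF tendsto_power_div_exp_0 filterlim_inverse_at_top_right] .
  then have "(flat m \<longlongrightarrow> 0) (at_right 0)"
    by (rule Lim_transform_eventually)
       (rule eventually_at_rightI[of 0 1], auto simp: flat_def exp_minus field_simps)
  moreover have "(flat m \<longlongrightarrow> 0) (at_left 0)"
    by (rule Lim_transform_eventually[OF tendsto_const])
       (rule eventually_at_leftI[of "-1"], auto simp: flat_def)
  ultimately show ?thesis by (simp add: filterlim_split_at)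
qed

lemma flat_deriv: "(flat m has_real_derivative (flat (m + 2) t - real m * flat (m + 1) t)) (at t)"
proof -
  consider "t > 0" | "t < 0" | "t = 0" by linarith
  then show ?thesis
  proof cases
    case 1
    have "((\<lambda>t. exp (- (1 / t)) / t ^ m) has_real_derivative (flat (m + 2) t - real m * flat (m + 1) t)) (at t)"
    proof -
      have "((\<lambda>t. exp (- (1 / t)) / t ^ m) has_real_derivative
        (exp (- (1 / t)) * (1 / t\<^sup>2) * t ^ m - exp (- (1 / t)) * (real m * t ^ (m - Suc 0))) / (t ^ m * t ^ m)) (at t)"
        using 1 by (auto intro!: derivative_eq_intros simp: power2_eq_square)
      moreover have "real m * t ^ (m - Suc 0) = real m * t ^ m / t"
        using 1 by (cases m) auto
      ultimately show ?thesis
        using 1 by (simp add: flat_def diff_divide_distrib power2_eq_square ac_simps)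
    qed
    then show ?thesis
      by (rule has_field_derivative_transform_within_open[of _ _ _ "{0<..}"]) (use 1 in \<open>auto simp: flat_def\<close>)
  next
    case 2
    have "((\<lambda>t. 0) has_real_derivative (flat (m + 2) t - real m * flat (m + 1) t)) (at t)"
      using 2 by (auto simp: flat_def)
    then show ?thesis
      by (rule has_field_derivative_transform_within_open[of _ _ _ "{..<0}"]) (use 2 in \<open>auto simp: flat_def\<close>)
  next
    case 3
    \<comment> \<open>The difference quotient of \<open>flat m\<close> at 0 is
      \<open>flat (m + 1)\<close>, whose limit is already known.\<close>
    have "((\<lambda>h. (flat m (0 + h) - flat m 0) / h) \<longlongrightarrow> 0) (at 0)"
      by (rule Lim_transform_eventually[OF flat_tendsto_0[of "m + 1"]])
         (auto simp: flat_def intro!: always_eventually)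
    then show ?thesis using 3 by (simp add: DERIV_def flat_def)
  qed
qed

text \<open>The induction on \<open>k\<close> must leave \<open>m\<close> free, since one derivative
  leads from \<open>flat m\<close> to \<open>flat (m + 1)\<close> and
  \<open>flat (m + 2)\<close>.\<close>

lemma Ck_flat: "smooth q \<Longrightarrow> Ck k (\<lambda>x. flat m (q x))"
proof (induction k arbitrary: m)
  case 0
  have "continuous_on UNIV (flat m)"
    using flat_deriv by (metis DERIV_isCont continuous_at_imp_continuous_on)
  then show ?case
    using C1_continuous[OF smooth_C1[OF 0]] by (auto intro: continuous_on_compose2)
next
  case (Suc k)
  have q: "(q has_derivative frechet_derivative q (at x)) (at x)" for x
    using C1_has_derivative smooth_C1 Suc by blast
  have d: "((\<lambda>x. flat m (q x)) has_derivative
      (\<lambda>v. (flat (m + 2) (q x) - real m * flat (m + 1) (q x)) * frechet_derivative q (at x) v)) (at x)" for x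
    using has_derivative_compose[OF q, of "flat m" "\<lambda>h. (flat (m + 2) (q x) - real m * flat (m + 1) (q x)) * h"]
      flat_deriv[of m "q x"] by (simp add: has_field_derivative_def)
  have "(\<lambda>x. grad (\<lambda>x. flat m (q x)) x $ i)
      = (\<lambda>x. (flat (m + 2) (q x) + (- real m) * flat (m + 1) (q x)) * grad q x $ i)" for i
    by (simp add: grad_nth frechet_eqI[OF d])
  moreover have "Ck k (\<lambda>x. grad q x $ i)" for i
    using Suc.prems by (auto simp: smooth_def dest!: spec[of _ "Suc k"])
  ultimately show ?case
    using d by (auto simp: differentiable_def intro!: Ck_mult Ck_add Ck_diff Suc)
qed

lemma smooth_flat: "smooth q \<Longrightarrow> smooth (\<lambda>x. flat m (q x))"
  by (simp add: smooth_def Ck_flat)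

lemma flat_0: "0 \<le> flat 0 t" "flat 0 t < 1" "flat 0 t = 0 \<longleftrightarrow> t \<le> 0"
  by (auto simp: flat_def)

text \<open>The squared distance is a polynomial, so composing it with \<open>flat 0\<close> gives
  smoothness also at the centre, where the distance itself is not differentiable.\<close>

definition bump :: "real^'d \<Rightarrow> real \<Rightarrow> real^'d \<Rightarrow> real" where
  "bump a r x = flat 0 (r\<^sup>2 - (dist x a)\<^sup>2)"

lemma bump_smooth: "smooth (bump a r)"
proof -
  have "bump a r = (\<lambda>x. flat 0 (r\<^sup>2 - (\<Sum>i\<in>UNIV. (axis i 1 \<bullet> x - a $ i)\<^sup>2)))"
    by (auto simp: bump_def fun_eq_iff dist_norm norm_vec_def L2_set_def sum_nonneg inner_axis')
  then show ?thesis by (auto intro!: smooth_flat smooth_diff smooth_sum smooth_power)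
qed

lemma bump_nonneg: "0 \<le> bump a r x"
  and bump_pos_iff: "r > 0 \<Longrightarrow> bump a r x \<noteq> 0 \<longleftrightarrow> dist x a < r"
proof -
  show "0 \<le> bump a r x" by (simp add: bump_def flat_0)
  show "r > 0 \<Longrightarrow> bump a r x \<noteq> 0 \<longleftrightarrow> dist x a < r"
    using power_mono_iff[of r "dist x a" 2] by (auto simp: bump_def flat_0)
qed

lemma bump_shift: "bump (a + v) r x = bump a r (x - v)"
  by (simp add: bump_def dist_norm algebra_simps)

lemma test_functionI:
  assumes "smooth \<phi>" "compact S" "S \<subseteq> \<Omega>" "\<And>x. x \<notin> S \<Longrightarrow> \<phi> x = 0"
  shows "test_function \<Omega> \<phi>"
proof -
  have "closure {x. \<phi> x \<noteq> 0} \<subseteq> S"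
    using assms by (intro closure_minimal compact_imp_closed) auto
  then show ?thesis
    using assms compact_Int_closed[OF assms(2), of "closure {x. \<phi> x \<noteq> 0}"]
    by (auto simp: test_function_def smooth_def Int_absorb1)
qed

lemma test_function_bump: "r > 0 \<Longrightarrow> cball a r \<subseteq> \<Omega> \<Longrightarrow> test_function \<Omega> (bump a r)"
  using bump_pos_iff[of r a]
  by (intro test_functionI[of _ "cball a r"] bump_smooth compact_cball)
     (force simp: dist_commute)+

lemma test_function_C1: "test_function \<Omega> \<phi> \<Longrightarrow> C1 \<phi>"
  by (auto simp: test_function_def smooth_def intro!: smooth_C1)

section \<open>Surface measure on a hyperplane\<close>

text \<open>For \<open>m \<bullet> e = 1\<close> this is the projection along \<open>e\<close> onto
  the hyperplane \<open>m \<bullet> x = c\<close>; with \<open>m\<close> the gradient of a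
  barycentric coordinate and \<open>e\<close> an edge it is oblique in general.\<close>

definition hproj :: "'a::euclidean_space \<Rightarrow> real \<Rightarrow> 'a \<Rightarrow> 'a \<Rightarrow> 'a" where
  "hproj m c e y = y - (m \<bullet> y - c) *\<^sub>R e"

definition slab :: "'a::euclidean_space \<Rightarrow> real \<Rightarrow> 'a set" where
  "slab m c = {y. 0 \<le> m \<bullet> y - c \<and> m \<bullet> y - c \<le> 1}"

text \<open>As in the definition of the surface measure, volume is pushed forward along a projection,
  but the direction \<open>e\<close> of the projection need not be normal to the hyperplane.\<close>

definition hyp :: "'a::euclidean_space \<Rightarrow> real \<Rightarrow> 'a \<Rightarrow> 'a measure" where
  "hyp m c e = distr (density lborel (indicator (slab m c))) borel (hproj m c e)"

lemma hproj_measurable [measurable]: "hproj m c e \<in> borel_measurable borel"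
  unfolding hproj_def by measurable

lemma slab_borel [measurable]: "slab m c \<in> sets borel"
  unfolding slab_def by measurable

lemma sets_hyp [simp, measurable_cong]: "sets (hyp m c e) = sets borel"
  and space_hyp [simp]: "space (hyp m c e) = UNIV"
  by (auto simp: hyp_def)

lemma nn_integral_lborel_translate:
  fixes f :: "'a::euclidean_space \<Rightarrow> ennreal"
  assumes [measurable]: "f \<in> borel_measurable borel"
  shows "(\<integral>\<^sup>+x. f (x + a) \<partial>lborel) = (\<integral>\<^sup>+x. f x \<partial>lborel)"
  by (subst (2) lborel_distr_plus[of a, symmetric]) (simp add: nn_integral_distr add.commute)

lemma emeasure_unit_interval: "emeasure lborel {s. s \<le> a \<and> a - s \<le> 1} = 1" for a :: real
proof -
  have "{s. s \<le> a \<and> a - s \<le> 1} = {a - 1..a}" by auto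
  then show ?thesis by simp
qed

lemma hproj_line:
  assumes "m \<bullet> e = 1"
  shows "hproj m c e (y + s *\<^sub>R e) = hproj m c e y"
    and "m \<bullet> hproj m c e y = c"
  using assms by (simp_all add: hproj_def inner_add_right inner_diff_right algebra_simps)

text \<open>Fubini's theorem for lines in an arbitrary direction: on \<open>(y, s)\<close>-space the change of
  variables is a composition of translations in \<open>s\<close> for fixed \<open>y\<close> and in \<open>y\<close> for fixed \<open>s\<close>, so
  no determinant is needed.\<close>

lemma nn_integral_fibre:
  fixes F :: "'a::euclidean_space \<Rightarrow> ennreal"
  assumes e: "m \<bullet> e = 1" and [measurable]: "F \<in> borel_measurable borel"
  shows "(\<integral>\<^sup>+z. F z \<partial>lborel)
    = (\<integral>\<^sup>+y. (\<integral>\<^sup>+s. indicator (slab m c) y * F (hproj m c e y + s *\<^sub>R e) \<partial>lborel) \<partial>lborel)"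
proof -
  have [measurable]: "F \<in> borel \<rightarrow>\<^sub>M borel" by simp
  have "(\<integral>\<^sup>+s. indicator (slab m c) y * F (hproj m c e y + s *\<^sub>R e) \<partial>lborel)
      = (\<integral>\<^sup>+r. indicator (slab m c) y * F (y + r *\<^sub>R e) \<partial>lborel)" for y
    by (subst nn_integral_lborel_translate[of _ "m \<bullet> y - c", symmetric])
       (simp_all add: hproj_def algebra_simps)
  then have "(\<integral>\<^sup>+y. (\<integral>\<^sup>+s. indicator (slab m c) y * F (hproj m c e y + s *\<^sub>R e) \<partial>lborel) \<partial>lborel)
    = (\<integral>\<^sup>+y. (\<integral>\<^sup>+r. indicator (slab m c) y * F (y + r *\<^sub>R e) \<partial>lborel) \<partial>lborel)"
    by simp
  also have "\<dots> = (\<integral>\<^sup>+r. (\<integral>\<^sup>+y. indicator (slab m c) y * F (y + r *\<^sub>R e) \<partial>lborel) \<partial>lborel)"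
    by (rule lborel_pair.Fubini'[symmetric]) measurable
  also have "\<dots> = (\<integral>\<^sup>+r. (\<integral>\<^sup>+z. indicator (slab m c) (z - r *\<^sub>R e) * F z \<partial>lborel) \<partial>lborel)"
  proof (rule nn_integral_cong)
    fix r :: real
    show "(\<integral>\<^sup>+y. indicator (slab m c) y * F (y + r *\<^sub>R e) \<partial>lborel)
      = (\<integral>\<^sup>+z. indicator (slab m c) (z - r *\<^sub>R e) * F z \<partial>lborel)"
      by (subst (2) nn_integral_lborel_translate[of _ "r *\<^sub>R e", symmetric]) auto
  qed
  also have "\<dots> = (\<integral>\<^sup>+z. (\<integral>\<^sup>+r. indicator (slab m c) (z - r *\<^sub>R e) * F z \<partial>lborel) \<partial>lborel)"
    by (rule lborel_pair.Fubini') measurable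
  \<comment> \<open>For fixed \<open>z\<close> the values of \<open>r\<close> with
    \<open>z - r *\<^sub>R e\<close> in the slab form an interval of length 1, since
    \<open>m \<bullet> e = 1\<close>; so the weight integrates to 1.\<close>
  also have "\<dots> = (\<integral>\<^sup>+z. F z \<partial>lborel)"
  proof (rule nn_integral_cong)
    fix z
    have "(\<integral>\<^sup>+r. indicator (slab m c) (z - r *\<^sub>R e) * F z \<partial>lborel)
      = (\<integral>\<^sup>+r. indicator {r. 0 \<le> (m \<bullet> z - c) - r \<and> (m \<bullet> z - c) - r \<le> 1} r * F z \<partial>lborel)"
      using e by (intro nn_integral_cong) (auto simp: slab_def indicator_def inner_diff_right algebra_simps)
    also have "\<dots> = F z"
      by (subst nn_integral_multc) (simp_all add: emeasure_unit_interval)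
    finally show "(\<integral>\<^sup>+r. indicator (slab m c) (z - r *\<^sub>R e) * F z \<partial>lborel) = F z" .
  qed
  finally show ?thesis by simp
qed

lemma nn_integral_hyp:
  assumes [measurable]: "f \<in> borel_measurable borel"
  shows "(\<integral>\<^sup>+x. f x \<partial>hyp m c e) = (\<integral>\<^sup>+y. indicator (slab m c) y * f (hproj m c e y) \<partial>lborel)"
  unfolding hyp_def by (simp add: nn_integral_distr nn_integral_density)

lemma integral_hyp:
  fixes f :: "'a::euclidean_space \<Rightarrow> real"
  assumes [measurable]: "f \<in> borel_measurable borel"
  shows "(LINT x|hyp m c e. f x) = (LINT y|lborel. indicator (slab m c) y * f (hproj m c e y))"
proof -
  have "(LINT x|hyp m c e. f x) = (LINT y|density lborel (\<lambda>y. ennreal (indicator (slab m c) y)). f (hproj m c e y))"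
    unfolding hyp_def by (simp add: integral_distr ennreal_indicator)
  also have "\<dots> = (LINT y|lborel. indicator (slab m c) y *\<^sub>R f (hproj m c e y))"
    by (rule integral_density) auto
  finally show ?thesis by simp
qed

text \<open>A change of the direction \<open>e\<close> shifts each layer of the slab parallel to the
  hyperplane and leaves the measure alone; rescaling the equation changes the thickness of the slab,
  which gives the factor. With \<open>\<kappa>\<close> of either sign this covers oblique
  projections and reversed normals.\<close>

lemma nn_integral_hyp_rescale:
  fixes H :: "'a::euclidean_space \<Rightarrow> ennreal"
  assumes e: "m \<bullet> e = 1" and k: "\<kappa> \<noteq> 0" and e': "(\<kappa> *\<^sub>R m) \<bullet> e' = 1"
    and [measurable]: "H \<in> borel_measurable borel"
  shows "(\<integral>\<^sup>+x. H x \<partial>hyp (\<kappa> *\<^sub>R m) (\<kappa> * c) e') = ennreal (1 / \<bar>\<kappa>\<bar>) * (\<integral>\<^sup>+x. H x \<partial>hyp m c e)"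
proof -
  \<comment> \<open>\<open>k\<close> is parallel to the hyperplane. At height \<open>s\<close> over
    the first foot point, the second projection is that foot point translated by
    \<open>s *\<^sub>R k\<close>, and surface integrals are invariant under such
    translations.\<close>
  define k where "k = e - \<kappa> *\<^sub>R e'"
  have mk: "m \<bullet> k = 0" using e e' by (simp add: k_def inner_diff_right)
  let ?C = "\<integral>\<^sup>+x. H x \<partial>hyp m c e"
  let ?J = "indicator {s. 0 \<le> \<kappa> * s \<and> \<kappa> * s \<le> 1} :: real \<Rightarrow> ennreal"
  have [measurable]: "H \<in> borel \<rightarrow>\<^sub>M borel" by simp
  have "(\<integral>\<^sup>+x. H x \<partial>hyp (\<kappa> *\<^sub>R m) (\<kappa> * c) e')
    = (\<integral>\<^sup>+z. indicator (slab (\<kappa> *\<^sub>R m) (\<kappa> * c)) z * H (hproj (\<kappa> *\<^sub>R m) (\<kappa> * c) e' z) \<partial>lborel)"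
    by (rule nn_integral_hyp) simp
  also have "\<dots> = (\<integral>\<^sup>+y. (\<integral>\<^sup>+s. indicator (slab m c) y *
      (indicator (slab (\<kappa> *\<^sub>R m) (\<kappa> * c)) (hproj m c e y + s *\<^sub>R e) *
        H (hproj (\<kappa> *\<^sub>R m) (\<kappa> * c) e' (hproj m c e y + s *\<^sub>R e))) \<partial>lborel) \<partial>lborel)"
    by (rule nn_integral_fibre[OF e]) measurable
  also have "\<dots> = (\<integral>\<^sup>+y. (\<integral>\<^sup>+s. ?J s * (indicator (slab m c) y * H (hproj m c e y + s *\<^sub>R k)) \<partial>lborel) \<partial>lborel)"
  proof (intro nn_integral_cong)
    fix y s
    have *: "(\<kappa> *\<^sub>R m) \<bullet> (hproj m c e y + s *\<^sub>R e) - \<kappa> * c = \<kappa> * s"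
      using e hproj_line(2)[OF e, of c y] by (simp add: inner_add_right algebra_simps)
    then have "hproj (\<kappa> *\<^sub>R m) (\<kappa> * c) e' (hproj m c e y + s *\<^sub>R e) = hproj m c e y + s *\<^sub>R k"
      unfolding hproj_def[of "\<kappa> *\<^sub>R m"] by (simp add: k_def algebra_simps)
    with * show "indicator (slab m c) y *
      (indicator (slab (\<kappa> *\<^sub>R m) (\<kappa> * c)) (hproj m c e y + s *\<^sub>R e) *
        H (hproj (\<kappa> *\<^sub>R m) (\<kappa> * c) e' (hproj m c e y + s *\<^sub>R e)))
      = ?J s * (indicator (slab m c) y * H (hproj m c e y + s *\<^sub>R k))"
      by (auto simp: slab_def indicator_def)
  qed
  also have "\<dots> = (\<integral>\<^sup>+s. (\<integral>\<^sup>+y. ?J s * (indicator (slab m c) y * H (hproj m c e y + s *\<^sub>R k)) \<partial>lborel) \<partial>lborel)"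
    by (rule lborel_pair.Fubini'[symmetric]) measurable
  also have "\<dots> = (\<integral>\<^sup>+s. ?J s * ?C \<partial>lborel)"
  proof (rule nn_integral_cong)
    fix s :: real
    have "(\<integral>\<^sup>+y. indicator (slab m c) y * H (hproj m c e y + s *\<^sub>R k) \<partial>lborel)
      = (\<integral>\<^sup>+y. indicator (slab m c) (y + s *\<^sub>R k) * H (hproj m c e (y + s *\<^sub>R k)) \<partial>lborel)"
      using mk by (intro nn_integral_cong) (simp add: slab_def hproj_def inner_add_right algebra_simps indicator_def)
    also have "\<dots> = (\<integral>\<^sup>+y. indicator (slab m c) y * H (hproj m c e y) \<partial>lborel)"
      by (rule nn_integral_lborel_translate) measurable
    also have "\<dots> = ?C" by (simp add: nn_integral_hyp)
    finally show "(\<integral>\<^sup>+y. ?J s * (indicator (slab m c) y * H (hproj m c e y + s *\<^sub>R k)) \<partial>lborel) = ?J s * ?C"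
      by (subst nn_integral_cmult) simp_all
  qed
  also have "\<dots> = emeasure lborel {s. 0 \<le> \<kappa> * s \<and> \<kappa> * s \<le> 1} * ?C"
    by (subst nn_integral_multc) simp_all
  also have "emeasure lborel {s. 0 \<le> \<kappa> * s \<and> \<kappa> * s \<le> 1} = ennreal (1 / \<bar>\<kappa>\<bar>)"
  proof (cases "\<kappa> > 0")
    case True
    then have "{s. 0 \<le> \<kappa> * s \<and> \<kappa> * s \<le> 1} = {0..1 / \<kappa>}"
      by (auto simp: field_simps zero_le_mult_iff)
    then show ?thesis using True by simp
  next
    case False
    then have "{s. 0 \<le> \<kappa> * s \<and> \<kappa> * s \<le> 1} = {1 / \<kappa>..0}"
      using \<open>\<kappa> \<noteq> 0\<close> by (auto simp: field_simps zero_le_mult_iff)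
    then show ?thesis using False \<open>\<kappa> \<noteq> 0\<close> by simp
  qed
  finally show ?thesis .
qed

lemma hyp_rescale:
  fixes m :: "'a::euclidean_space"
  assumes "m \<bullet> e = 1" "\<kappa> \<noteq> 0" "(\<kappa> *\<^sub>R m) \<bullet> e' = 1"
  shows "hyp (\<kappa> *\<^sub>R m) (\<kappa> * c) e' = density (hyp m c e) (\<lambda>_. ennreal (1 / \<bar>\<kappa>\<bar>))"
proof (rule measure_eqI)
  fix A assume "A \<in> sets (hyp (\<kappa> *\<^sub>R m) (\<kappa> * c) e')"
  then have A [measurable]: "A \<in> sets borel" by simp
  have "emeasure (hyp (\<kappa> *\<^sub>R m) (\<kappa> * c) e') A = (\<integral>\<^sup>+x. indicator A x \<partial>hyp (\<kappa> *\<^sub>R m) (\<kappa> * c) e')"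
    by simp
  also have "\<dots> = ennreal (1 / \<bar>\<kappa>\<bar>) * (\<integral>\<^sup>+x. indicator A x \<partial>hyp m c e)"
    by (rule nn_integral_hyp_rescale[OF assms]) simp
  also have "\<dots> = emeasure (density (hyp m c e) (\<lambda>_. ennreal (1 / \<bar>\<kappa>\<bar>))) A"
    by (subst emeasure_density) (simp_all add: nn_integral_cmult)
  finally show "emeasure (hyp (\<kappa> *\<^sub>R m) (\<kappa> * c) e') A = emeasure (density (hyp m c e) (\<lambda>_. ennreal (1 / \<bar>\<kappa>\<bar>))) A" .
qed simp

text \<open>Two elements that share a facet describe it with opposite normals; this makes them
  induce the same measure on it.\<close>

lemma hyp_uminus:
  assumes "norm n = 1" shows "hyp (- n) (- b) (- n) = hyp n b n"
proof -
  have "n \<bullet> n = 1" using assms by (simp add: dot_square_norm)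
  then show ?thesis
    using hyp_rescale[of n n "-1" "-n" b] by (simp add: density_1)
qed

text \<open>Every line in direction \<open>e\<close> meets either slab in a segment of parameter
  length 1, so mass may be pushed forward from the slab of \<open>m\<close> instead of that of
  \<open>m'\<close>. In this way one slab parametrises both the entry and the exit points of the
  lines.\<close>

lemma nn_integral_hyp_other_slab:
  fixes H :: "'a::euclidean_space \<Rightarrow> ennreal"
  assumes e: "m \<bullet> e = 1" and e': "m' \<bullet> (- e) = 1"
    and [measurable]: "H \<in> borel_measurable borel"
  shows "(\<integral>\<^sup>+y. indicator (slab m c) y * H (hproj m' c' (- e) y) \<partial>lborel) = (\<integral>\<^sup>+x. H x \<partial>hyp m' c' (- e))"
proof -
  have [measurable]: "H \<in> borel \<rightarrow>\<^sub>M borel" by simp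
  let ?a = "\<lambda>y. m' \<bullet> hproj m c e y - c'"
  have "(\<integral>\<^sup>+x. H x \<partial>hyp m' c' (- e)) = (\<integral>\<^sup>+z. indicator (slab m' c') z * H (hproj m' c' (- e) z) \<partial>lborel)"
    by (rule nn_integral_hyp) simp
  also have "\<dots> = (\<integral>\<^sup>+y. (\<integral>\<^sup>+s. indicator (slab m c) y *
      (indicator (slab m' c') (hproj m c e y + s *\<^sub>R e) *
        H (hproj m' c' (- e) (hproj m c e y + s *\<^sub>R e))) \<partial>lborel) \<partial>lborel)"
    by (rule nn_integral_fibre[OF e]) measurable
  also have "\<dots> = (\<integral>\<^sup>+y. (\<integral>\<^sup>+s. indicator {s. 0 \<le> ?a y - s \<and> ?a y - s \<le> 1} s *
      (indicator (slab m c) y * H (hproj m' c' (- e) y)) \<partial>lborel) \<partial>lborel)"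
  proof (intro nn_integral_cong)
    fix y s
    have *: "m' \<bullet> (hproj m c e y + s *\<^sub>R e) - c' = ?a y - s"
      using e' by (simp add: inner_add_right)
    have "hproj m' c' (- e) (hproj m c e y + s *\<^sub>R e) = hproj m' c' (- e) (y + (m \<bullet> y - c - s) *\<^sub>R (- e))"
      by (simp add: hproj_def[of m] algebra_simps)
    also have "\<dots> = hproj m' c' (- e) y" by (rule hproj_line[OF e'])
    finally show "indicator (slab m c) y * (indicator (slab m' c') (hproj m c e y + s *\<^sub>R e) *
        H (hproj m' c' (- e) (hproj m c e y + s *\<^sub>R e)))
      = indicator {s. 0 \<le> ?a y - s \<and> ?a y - s \<le> 1} s * (indicator (slab m c) y * H (hproj m' c' (- e) y))"
      using * by (auto simp: slab_def indicator_def)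
  qed
  also have "\<dots> = (\<integral>\<^sup>+y. indicator (slab m c) y * H (hproj m' c' (- e) y) \<partial>lborel)"
    by (subst nn_integral_multc) (simp_all add: emeasure_unit_interval)
  finally show ?thesis by simp
qed

lemma hyp_other_slab:
  fixes m :: "'a::euclidean_space"
  assumes "m \<bullet> e = 1" "m' \<bullet> (- e) = 1"
  shows "distr (density lborel (indicator (slab m c))) borel (hproj m' c' (- e)) = hyp m' c' (- e)"
proof (rule measure_eqI)
  fix A assume "A \<in> sets (distr (density lborel (indicator (slab m c))) borel (hproj m' c' (- e)))"
  then have A [measurable]: "A \<in> sets borel" by simp
  have "emeasure (distr (density lborel (indicator (slab m c))) borel (hproj m' c' (- e))) A
     = (\<integral>\<^sup>+x. indicator A x \<partial>distr (density lborel (indicator (slab m c))) borel (hproj m' c' (- e)))"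
    by simp
  also have "\<dots> = (\<integral>\<^sup>+y. indicator (slab m c) y * indicator A (hproj m' c' (- e) y) \<partial>lborel)"
    by (simp add: nn_integral_distr nn_integral_density del: nn_integral_indicator)
  also have "\<dots> = emeasure (hyp m' c' (- e)) A"
    by (subst nn_integral_hyp_other_slab[OF assms]) simp_all
  finally show "emeasure (distr (density lborel (indicator (slab m c))) borel (hproj m' c' (- e))) A
    = emeasure (hyp m' c' (- e)) A" .
qed simp

text \<open>The signed version of \<open>nn_integral_fibre\<close>: the nonnegative identity shows
  that \<open>lborel\<close> is a push-forward of the product measure restricted to the slab, and
  Fubini is applied to the integrable \<open>F\<close> there.\<close>

lemma fibre_integral:
  fixes F :: "'a::euclidean_space \<Rightarrow> real"
  assumes e: "m \<bullet> e = 1" and F: "integrable lborel F"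
  shows "(LINT z|lborel. F z)
    = (LINT y|lborel. (LINT s|lborel. indicator (slab m c) y * F (hproj m c e y + s *\<^sub>R e)))"
    and "integrable lborel (\<lambda>y. LINT s|lborel. indicator (slab m c) y * F (hproj m c e y + s *\<^sub>R e))"
proof -
  have [measurable]: "F \<in> borel_measurable borel" using F by auto
  define G where "G = (\<lambda>(y, s). indicator (slab m c) y * F (hproj m c e y + s *\<^sub>R e))"
  define g where "g = (\<lambda>(y, s::real). hproj m c e y + s *\<^sub>R e)"
  define M :: "('a \<times> real) measure" where "M = density (lborel \<Otimes>\<^sub>M lborel) (\<lambda>z. ennreal (indicator (slab m c) (fst z)))"
  have [measurable]: "g \<in> borel \<Otimes>\<^sub>M borel \<rightarrow>\<^sub>M borel" unfolding g_def by measurable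
  have gM [measurable]: "g \<in> M \<rightarrow>\<^sub>M borel" unfolding M_def by (simp add: g_def) measurable
  have d: "(\<lambda>z. ennreal (indicator (slab m c) (fst z))) \<in> borel_measurable (lborel \<Otimes>\<^sub>M (lborel :: real measure))"
    by measurable
  have nn: "(\<integral>\<^sup>+z. f z \<partial>lborel) = (\<integral>\<^sup>+z. f (g z) \<partial>M)" if [measurable]: "f \<in> borel_measurable borel" for f :: "'a \<Rightarrow> ennreal"
  proof -
    have "(\<integral>\<^sup>+z. f (g z) \<partial>M) = (\<integral>\<^sup>+z. indicator (slab m c) (fst z) * f (g z) \<partial>(lborel \<Otimes>\<^sub>M lborel))"
      unfolding M_def by (subst nn_integral_density[OF d]) (auto simp: ennreal_indicator split: prod.splits intro!: nn_integral_cong)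
    also have "\<dots> = (\<integral>\<^sup>+y. (\<integral>\<^sup>+s. indicator (slab m c) y * f (hproj m c e y + s *\<^sub>R e) \<partial>lborel) \<partial>lborel)"
      by (subst lborel.nn_integral_fst[symmetric]) (auto simp: g_def)
    also have "\<dots> = (\<integral>\<^sup>+z. f z \<partial>lborel)" by (rule nn_integral_fibre[OF e, symmetric]) simp
    finally show ?thesis by simp
  qed
  have lb: "lborel = distr M borel g"
  proof (rule measure_eqI)
    fix A :: "'a set" assume "A \<in> sets lborel"
    then have [measurable]: "A \<in> sets borel" by simp
    have "emeasure lborel A = (\<integral>\<^sup>+z. indicator A z \<partial>lborel)" by simp
    also have "\<dots> = (\<integral>\<^sup>+z. indicator A (g z) \<partial>M)" by (rule nn) simp
    also have "\<dots> = (\<integral>\<^sup>+z. indicator A z \<partial>distr M borel g)" by (rule nn_integral_distr[symmetric]) simp_all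
    finally show "emeasure lborel A = emeasure (distr M borel g) A" by simp
  qed simp
  have F': "integrable (distr M borel g) F" using F lb by simp
  have iM: "integrable M (\<lambda>z. F (g z))"
    using F' by (subst (asm) integrable_distr_eq) auto
  have iG: "integrable (lborel \<Otimes>\<^sub>M lborel) G"
    using iM d unfolding M_def
    by (subst (asm) integrable_real_density) (auto simp: G_def g_def case_prod_unfold)
  have "(LINT z|lborel. F z) = (LINT z|M. F (g z))"
    by (subst lb) (simp add: integral_distr)
  also have "\<dots> = (LINT z|(lborel \<Otimes>\<^sub>M lborel). indicator (slab m c) (fst z) * F (g z))"
    unfolding M_def by (subst integral_real_density) (auto simp: case_prod_beta g_def)
  also have "\<dots> = (LINT z|(lborel \<Otimes>\<^sub>M lborel). G z)"
    by (intro Bochner_Integration.integral_cong) (auto simp: G_def g_def)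
  also have "\<dots> = (LINT y|lborel. (LINT s|lborel. G (y, s)))"
    by (rule lborel_pair.integral_fst'[OF iG, symmetric])
  finally show "(LINT z|lborel. F z)
    = (LINT y|lborel. (LINT s|lborel. indicator (slab m c) y * F (hproj m c e y + s *\<^sub>R e)))"
    by (simp add: G_def)
  show "integrable lborel (\<lambda>y. LINT s|lborel. indicator (slab m c) y * F (hproj m c e y + s *\<^sub>R e))"
    using lborel_pair.integrable_fst'[OF iG] by (simp add: G_def)
qed

text \<open>A point of the slab is moved by at most \<open>norm e\<close> under the projection, so
  the preimage of a bounded set is bounded.\<close>

lemma emeasure_hyp_bounded:
  assumes [measurable]: "B \<in> sets borel" and "bounded B"
  shows "emeasure (hyp m c e) B < \<infinity>"
proof -
  obtain R where R: "\<And>x. x \<in> B \<Longrightarrow> norm x \<le> R" using assms(2) bounded_iff by blast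
  let ?S = "slab m c \<inter> hproj m c e -` B"
  have "emeasure (hyp m c e) B = (\<integral>\<^sup>+y. indicator (slab m c) y * indicator B (hproj m c e y) \<partial>lborel)"
    using nn_integral_hyp[of "indicator B"] by simp
  also have "\<dots> = (\<integral>\<^sup>+y. indicator ?S y \<partial>lborel)"
    by (intro nn_integral_cong) (auto simp: indicator_def)
  also have "\<dots> = emeasure lborel ?S"
    by (rule nn_integral_indicator) (auto intro!: measurable_sets_borel[OF hproj_measurable])
  also have "\<dots> < \<infinity>"
  proof (rule emeasure_bounded_finite, rule boundedI)
    fix y assume y: "y \<in> ?S"
    have "norm y \<le> norm (hproj m c e y) + norm ((m \<bullet> y - c) *\<^sub>R e)"
      using norm_triangle_ineq[of "hproj m c e y" "(m \<bullet> y - c) *\<^sub>R e"] by (simp add: hproj_def)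
    moreover have "\<bar>m \<bullet> y - c\<bar> * norm e \<le> 1 * norm e"
      using y by (intro mult_right_mono) (auto simp: slab_def)
    ultimately show "norm y \<le> R + norm e" using R[of "hproj m c e y"] y by auto
  qed
  finally show ?thesis .
qed

section \<open>The boundary of a full-dimensional polytope\<close>

text \<open>The point is arbitrary; \<open>facet_props\<close> shows that the outward normal is the
  same at all relative interior points of the facet.\<close>

definition facet_normal :: "(real^'d) set \<Rightarrow> (real^'d) set \<Rightarrow> real^'d" where
  "facet_normal C F = outward_normal C (SOME x. x \<in> rel_interior F)"

definition facet_offset :: "(real^'d) set \<Rightarrow> (real^'d) set \<Rightarrow> real" where
  "facet_offset C F = facet_normal C F \<bullet> (SOME x. x \<in> rel_interior F)"

definition facet_measure :: "(real^'d) set \<Rightarrow> (real^'d) set \<Rightarrow> (real^'d) measure" where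
  "facet_measure C F = density (hyp (facet_normal C F) (facet_offset C F) (facet_normal C F))
     (indicator (rel_interior F))"

text \<open>The part of the outer collar over one facet, written with the linear projection onto the
  facet in place of \<open>closest_point\<close>.\<close>

definition prism :: "(real^'d) set \<Rightarrow> (real^'d) set \<Rightarrow> (real^'d) set" where
  "prism C F = {y \<in> slab (facet_normal C F) (facet_offset C F).
     hproj (facet_normal C F) (facet_offset C F) (facet_normal C F) y \<in> rel_interior F}"

lemma rel_interior_borel [measurable]:
  fixes F :: "'a::euclidean_space set"
  assumes "closed F" shows "rel_interior F \<in> sets borel"
proof -
  have "rel_interior F = F - rel_frontier F"
    using assms rel_interior_subset by (auto simp: rel_frontier_def)
  then show ?thesis using assms by simp
qed

text \<open>The facet contains a ball of the hyperplane around \<open>x\<close>. A second supporting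
  normal is therefore orthogonal to every direction of the hyperplane and equals plus or minus
  \<open>n\<close>; minus is excluded, as it would squeeze \<open>C\<close> into the hyperplane
  although the interior is nonempty.\<close>

lemma outward_normal_eqI:
  fixes C :: "(real^'d) set"
  assumes C: "interior C \<noteq> {}" and F: "F facet_of C"
    and n: "norm n = 1" "C \<subseteq> {y. n \<bullet> y \<le> b}" "F \<subseteq> {y. n \<bullet> y = b}" and x: "x \<in> rel_interior F"
  shows "outward_normal C x = n"
  unfolding outward_normal_def
proof (rule the_equality)
  have xF: "x \<in> F" using x rel_interior_subset by blast
  have FC: "F \<subseteq> C" using F facet_of_imp_subset by blast
  show "norm n = 1 \<and> (\<forall>y\<in>C. n \<bullet> y \<le> n \<bullet> x)" using n xF by auto
  fix n' assume n': "norm n' = 1 \<and> (\<forall>y\<in>C. n' \<bullet> y \<le> n' \<bullet> x)"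
  let ?H = "{y. n \<bullet> y = b}"
  have n0: "n \<noteq> 0" using n(1) by auto
  have "affine hull F = ?H"
  proof (rule affine_dim_equal)
    show "affine hull F \<subseteq> ?H" using n(3) by (simp add: affine_hyperplane hull_minimal)
    have "aff_dim F = aff_dim C - 1" using F by (simp add: facet_of_def)
    also have "aff_dim C = DIM(real^'d)" using C by (rule aff_dim_nonempty_interior)
    finally show "aff_dim (affine hull F) = aff_dim ?H"
      using n0 by (simp add: aff_dim_affine_hull aff_dim_hyperplane)
  qed (use xF in \<open>auto simp: affine_hyperplane affine_affine_hull\<close>)
  then obtain e where e: "e > 0" "ball x e \<inter> ?H \<subseteq> F"
    using x mem_rel_interior_ball[of x F] by auto
  have orth: "n' \<bullet> v = 0" if v: "n \<bullet> v = 0" for v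
  proof (cases "v = 0")
    case False
    define t where "t = e / (2 * norm v)"
    have t: "t > 0" "norm (t *\<^sub>R v) < e" using False e by (auto simp: t_def)
    have "n \<bullet> x = b" using xF n(3) by auto
    then have "x + t *\<^sub>R v \<in> C" "x - t *\<^sub>R v \<in> C"
      using t v e FC by (auto simp: inner_add_right inner_diff_right dist_norm intro!: subsetD[OF FC] subsetD[OF e(2)])
    then have "n' \<bullet> (x + t *\<^sub>R v) \<le> n' \<bullet> x" "n' \<bullet> (x - t *\<^sub>R v) \<le> n' \<bullet> x" using n' by blast+
    then have "t * (n' \<bullet> v) \<le> 0" "t * (n' \<bullet> v) \<ge> 0" by (auto simp: inner_add_right inner_diff_right)
    then show ?thesis using t(1) by (metis antisym mult_eq_0_iff less_numeral_extra(3))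
  qed simp
  \<comment> \<open>The part of \<open>n'\<close> orthogonal to \<open>n\<close>. It is a direction
    of the hyperplane, so \<open>n'\<close> is orthogonal to it as well, which forces it to
    vanish.\<close>
  define z where "z = n' - (n' \<bullet> n) *\<^sub>R n"
  have nn: "n \<bullet> n = 1" using n(1) by (simp add: dot_square_norm)
  have "n \<bullet> z = 0" using nn by (simp add: z_def inner_diff_right inner_commute)
  moreover have "z \<bullet> z = n' \<bullet> z - (n' \<bullet> n) * (n \<bullet> z)" by (simp add: z_def inner_diff_left)
  ultimately have "z = 0" using orth[of z] by simp
  then have eq: "n' = (n' \<bullet> n) *\<^sub>R n" by (simp add: z_def)
  then have "norm n' = \<bar>n' \<bullet> n\<bar> * norm n" by (metis norm_scaleR)
  then have "\<bar>n' \<bullet> n\<bar> = 1" using n' n(1) by simp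
  moreover have "n' \<bullet> n \<noteq> -1"
  proof
    assume "n' \<bullet> n = -1"
    then have "n' = - n" using eq by simp
    then have "\<forall>y\<in>C. n \<bullet> y \<ge> n \<bullet> x" using n' by simp
    then have "C \<subseteq> ?H" using n(2,3) xF by force
    then have "interior C \<subseteq> interior ?H" by (rule interior_mono)
    then show False using C interior_hyperplane[OF n0] by auto
  qed
  ultimately have "n' \<bullet> n = 1" by linarith
  then show "n' = n" using eq by simp
qed

locale full_polytope =
  fixes C :: "(real^'d) set"
  assumes poly: "polytope C" and int: "interior C \<noteq> {}"
begin

lemma compact: "compact C" and convex: "convex C" and closed: "closed C" and nonempty: "C \<noteq> {}"
  using poly polytope_imp_compact polytope_imp_convex polytope_imp_closed int interior_subset by blast+

lemma finite_facets: "finite {F. F facet_of C}"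
  using finite_polytope_facets[OF poly] .

lemma facet_halfspace:
  assumes "F facet_of C"
  obtains n b where "norm n = 1" "C \<subseteq> {y. n \<bullet> y \<le> b}" "F = C \<inter> {y. n \<bullet> y = b}"
proof -
  have "F exposed_face_of C"
    using assms exposed_face_of_polyhedron[OF polytope_imp_polyhedron[OF poly]] facet_of_imp_face_of by blast
  then obtain a b where ab: "C \<subseteq> {y. a \<bullet> y \<le> b}" "F = C \<inter> {y. a \<bullet> y = b}"
    unfolding exposed_face_of_def by blast
  have "a \<noteq> 0"
  proof
    assume "a = 0"
    then have "F = C" using ab assms unfolding facet_of_def by auto
    then show False using assms by (simp add: facet_of_def)
  qed
  then have "C \<subseteq> {y. (a /\<^sub>R norm a) \<bullet> y \<le> b / norm a}" "F = C \<inter> {y. (a /\<^sub>R norm a) \<bullet> y = b / norm a}"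
    using ab by (auto simp: field_simps)
  then show thesis using \<open>a \<noteq> 0\<close> that[of "a /\<^sub>R norm a" "b / norm a"] by simp
qed

lemma facet_nonempty: assumes "F facet_of C" shows "rel_interior F \<noteq> {}"
  using assms facet_of_imp_face_of[OF assms] face_of_imp_convex rel_interior_eq_empty
  by (metis facet_of_def)

lemma facet_closed: assumes "F facet_of C" shows "closed F"
  using assms facet_of_imp_face_of face_of_imp_closed convex closed by blast

lemma facet_bounded: assumes "F facet_of C" shows "bounded F"
  using assms facet_of_imp_subset compact compact_imp_bounded bounded_subset by metis

lemma facet_props:
  assumes F: "F facet_of C"
  shows "norm (facet_normal C F) = 1"
    and "y \<in> C \<Longrightarrow> facet_normal C F \<bullet> y \<le> facet_offset C F"
    and "y \<in> F \<Longrightarrow> facet_normal C F \<bullet> y = facet_offset C F"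
    and "F = C \<inter> {y. facet_normal C F \<bullet> y = facet_offset C F}"
    and "x \<in> rel_interior F \<Longrightarrow> outward_normal C x = facet_normal C F"
proof -
  obtain n b where n: "norm n = 1" "C \<subseteq> {y. n \<bullet> y \<le> b}" "F = C \<inter> {y. n \<bullet> y = b}"
    using facet_halfspace[OF F] by blast
  have sub: "F \<subseteq> {y. n \<bullet> y = b}" using n by auto
  have on: "outward_normal C x = n" if "x \<in> rel_interior F" for x
    by (rule outward_normal_eqI[OF int F n(1,2) sub that])
  have some: "(SOME x. x \<in> rel_interior F) \<in> rel_interior F"
    using facet_nonempty[OF F] some_in_eq by blast
  then have fn: "facet_normal C F = n" by (simp add: facet_normal_def on)
  moreover have "(SOME x. x \<in> rel_interior F) \<in> F" using some rel_interior_subset by blast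
  ultimately have fo: "facet_offset C F = b" using sub by (auto simp: facet_offset_def)
  show "norm (facet_normal C F) = 1"
    and "y \<in> C \<Longrightarrow> facet_normal C F \<bullet> y \<le> facet_offset C F"
    and "y \<in> F \<Longrightarrow> facet_normal C F \<bullet> y = facet_offset C F"
    and "x \<in> rel_interior F \<Longrightarrow> outward_normal C x = facet_normal C F"
    and "F = C \<inter> {y. facet_normal C F \<bullet> y = facet_offset C F}"
    unfolding fn fo using n on by auto
qed

lemma facet_normal_eqI:
  assumes F: "F facet_of C" and n: "norm n = 1" "C \<subseteq> {y. n \<bullet> y \<le> b}" "F \<subseteq> {y. n \<bullet> y = b}"
  shows "facet_normal C F = n" "facet_offset C F = b"
proof -
  obtain x where x: "x \<in> rel_interior F" using facet_nonempty[OF F] by blast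
  show fn: "facet_normal C F = n"
    using outward_normal_eqI[OF int F n x] facet_props(5)[OF F x] by simp
  have "x \<in> F" using x rel_interior_subset by blast
  then show "facet_offset C F = b"
    using facet_props(3)[OF F, of x] n(3) fn by auto
qed

lemma rel_interior_facet_borel [measurable]: "F facet_of C \<Longrightarrow> rel_interior F \<in> sets borel"
  using facet_closed rel_interior_borel by blast

lemma prism_borel [measurable]: assumes "F facet_of C" shows "prism C F \<in> sets borel"
proof -
  have "prism C F = slab (facet_normal C F) (facet_offset C F) \<inter>
      hproj (facet_normal C F) (facet_offset C F) (facet_normal C F) -` rel_interior F"
    by (auto simp: prism_def)
  then show ?thesis
    using measurable_sets_borel[OF hproj_measurable rel_interior_facet_borel[OF assms]] by auto
qed

text \<open>The foot point lies in \<open>C\<close>, and its distance to \<open>y\<close> is the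
  height of \<open>y\<close> over the supporting hyperplane, which by Cauchy-Schwarz no point of the
  half-space can undercut. On each prism the map in \<open>surface_measure\<close> thus becomes
  affine.\<close>

lemma closest_point_prism:
  assumes F: "F facet_of C" and y: "y \<in> prism C F"
  shows "closest_point C y = hproj (facet_normal C F) (facet_offset C F) (facet_normal C F) y"
proof -
  let ?n = "facet_normal C F" and ?b = "facet_offset C F"
  let ?x = "hproj ?n ?b ?n y"
  have x: "?x \<in> F" "?x \<in> C" and t: "0 \<le> ?n \<bullet> y - ?b"
    using y rel_interior_subset facet_of_imp_subset[OF F] by (auto simp: prism_def slab_def)
  have "dist y ?x \<le> dist y z" if "z \<in> C" for z
  proof -
    have "dist y ?x = ?n \<bullet> y - ?b" using t facet_props(1)[OF F] by (simp add: dist_norm hproj_def)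
    also have "\<dots> \<le> ?n \<bullet> (y - z)" using facet_props(2)[OF F that] by (simp add: inner_diff_right)
    also have "\<dots> \<le> norm ?n * norm (y - z)" by (rule norm_cauchy_schwarz)
    finally show ?thesis using facet_props(1)[OF F] by (simp add: dist_norm)
  qed
  then show ?thesis using closest_point_unique[OF convex closed x(2)] by metis
qed

lemma closest_point_prism_in:
  "F facet_of C \<Longrightarrow> y \<in> prism C F \<Longrightarrow> closest_point C y \<in> rel_interior F"
  using closest_point_prism[of F y] by (simp add: prism_def)

lemma outer_collar_eq: "outer_collar C = (\<Union>F\<in>{F. F facet_of C}. prism C F)"
proof (intro equalityI subsetI)
  fix y assume "y \<in> outer_collar C"
  then obtain x t F where F: "F facet_of C" "x \<in> rel_interior F" "0 \<le> t" "t \<le> 1"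
    and y: "y = x + t *\<^sub>R outward_normal C x" unfolding outer_collar_def by blast
  have xF: "x \<in> F" using F rel_interior_subset by blast
  have "y = x + t *\<^sub>R facet_normal C F" using y facet_props(5)[OF F(1,2)] by simp
  moreover have nn: "facet_normal C F \<bullet> facet_normal C F = 1"
    using facet_props(1)[OF F(1)] by (simp add: dot_square_norm)
  ultimately have "facet_normal C F \<bullet> y - facet_offset C F = t"
    using facet_props(3)[OF F(1) xF] by (simp add: inner_add_right)
  then have "y \<in> prism C F"
    using F y facet_props(5)[OF F(1,2)] by (auto simp: prism_def slab_def hproj_def)
  then show "y \<in> (\<Union>F\<in>{F. F facet_of C}. prism C F)" using F by blast
next
  fix y assume "y \<in> (\<Union>F\<in>{F. F facet_of C}. prism C F)"
  then obtain F where F: "F facet_of C" and y: "y \<in> prism C F" by blast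
  let ?n = "facet_normal C F" and ?b = "facet_offset C F"
  let ?x = "hproj ?n ?b ?n y"
  have x: "?x \<in> rel_interior F" using y by (simp add: prism_def)
  have "y = ?x + (?n \<bullet> y - ?b) *\<^sub>R outward_normal C ?x"
    using facet_props(5)[OF F x] by (simp add: hproj_def)
  moreover have "0 \<le> ?n \<bullet> y - ?b" "?n \<bullet> y - ?b \<le> 1" using y by (auto simp: prism_def slab_def)
  ultimately show "y \<in> outer_collar C" unfolding outer_collar_def using F x by blast
qed

lemma disjoint_facets:
  assumes "F facet_of C" "G facet_of C" "x \<in> rel_interior F" "x \<in> rel_interior G"
  shows "F = G"
  using face_of_eq[of F C G] assms facet_of_imp_face_of by blast

text \<open>The closest point of a collar point lies in the relative interior of its facet, and
  distinct facets have disjoint relative interiors.\<close>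

lemma disjoint_prisms: "disjoint_family_on (prism C) {F. F facet_of C}"
proof (unfold disjoint_family_on_def, intro ballI impI)
  fix F G assume FG: "F \<in> {F. F facet_of C}" "G \<in> {F. F facet_of C}" "F \<noteq> G"
  have False if "y \<in> prism C F" "y \<in> prism C G" for y
  proof -
    have "closest_point C y \<in> rel_interior F" "closest_point C y \<in> rel_interior G"
      using that FG closest_point_prism_in by auto
    then show False using disjoint_facets FG by auto
  qed
  then show "prism C F \<inter> prism C G = {}" by blast
qed

lemma sets_facet_measure [simp, measurable_cong]: "sets (facet_measure C F) = sets borel"
  and space_facet_measure [simp]: "space (facet_measure C F) = UNIV"
  by (auto simp: facet_measure_def)

lemma emeasure_facet_measure:
  assumes F [measurable]: "F facet_of C" and A [measurable]: "A \<in> sets borel"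
  shows "emeasure (facet_measure C F) A = emeasure lborel {y \<in> prism C F. closest_point C y \<in> A}"
proof -
  let ?n = "facet_normal C F" and ?b = "facet_offset C F"
  have "emeasure (facet_measure C F) A = (\<integral>\<^sup>+x. indicator (rel_interior F) x * indicator A x \<partial>hyp ?n ?b ?n)"
    unfolding facet_measure_def by (subst emeasure_density) (auto simp: F rel_interior_facet_borel)
  also have "\<dots> = (\<integral>\<^sup>+y. indicator (slab ?n ?b) y * (indicator (rel_interior F) (hproj ?n ?b ?n y)
      * indicator A (hproj ?n ?b ?n y)) \<partial>lborel)"
    by (rule nn_integral_hyp) (use rel_interior_facet_borel[OF F] in measurable)
  also have "\<dots> = (\<integral>\<^sup>+y. indicator {y \<in> prism C F. hproj ?n ?b ?n y \<in> A} y \<partial>lborel)"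
    by (intro nn_integral_cong) (auto simp: indicator_def prism_def)
  also have "\<dots> = emeasure lborel {y \<in> prism C F. hproj ?n ?b ?n y \<in> A}"
  proof (rule nn_integral_indicator)
    have "{y \<in> prism C F. hproj ?n ?b ?n y \<in> A} = prism C F \<inter> hproj ?n ?b ?n -` A" by auto
    then show "{y \<in> prism C F. hproj ?n ?b ?n y \<in> A} \<in> sets lborel"
      using prism_borel[OF F] measurable_sets_borel[OF hproj_measurable A] by auto
  qed
  also have "{y \<in> prism C F. hproj ?n ?b ?n y \<in> A} = {y \<in> prism C F. closest_point C y \<in> A}"
    using closest_point_prism[OF F] by auto
  finally show ?thesis .
qed

lemma closest_point_borel [measurable]: "closest_point C \<in> borel_measurable borel"
  using continuous_on_closest_point[OF convex closed nonempty] by (rule borel_measurable_continuous_onI)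

abbreviation "bsurface \<equiv> distr (restrict_space lborel (outer_collar C)) borel (closest_point C)"

lemma collar_borel [measurable]: "outer_collar C \<in> sets borel"
  unfolding outer_collar_eq using finite_facets prism_borel by auto

lemma closest_point_restrict [measurable]:
  "closest_point C \<in> restrict_space lborel (outer_collar C) \<rightarrow>\<^sub>M borel"
  by (rule measurable_restrict_space1) simp

lemma emeasure_bsurface:
  assumes A [measurable]: "A \<in> sets borel"
  shows "emeasure bsurface A = (\<Sum>F | F facet_of C. emeasure (facet_measure C F) A)"
proof -
  let ?P = "\<lambda>F. {y \<in> prism C F. closest_point C y \<in> A}"
  have P: "?P F \<in> sets lborel" if "F facet_of C" for F
  proof -
    have "?P F = prism C F \<inter> closest_point C -` A" by auto
    then show ?thesis
      using prism_borel[OF that] measurable_sets_borel[OF closest_point_borel A] by auto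
  qed
  have "emeasure bsurface A
      = emeasure (restrict_space lborel (outer_collar C)) (closest_point C -` A \<inter> outer_collar C)"
    by (subst emeasure_distr) (auto simp: space_restrict_space)
  also have "\<dots> = emeasure lborel (closest_point C -` A \<inter> outer_collar C)"
    by (rule emeasure_restrict_space) auto
  also have "closest_point C -` A \<inter> outer_collar C = (\<Union>F\<in>{F. F facet_of C}. ?P F)"
    by (auto simp: outer_collar_eq)
  also have "emeasure lborel \<dots> = (\<Sum>F | F facet_of C. emeasure lborel (?P F))"
    by (rule sum_emeasure[symmetric])
       (use P finite_facets disjoint_prisms in \<open>auto simp: disjoint_family_on_def\<close>)
  also have "\<dots> = (\<Sum>F | F facet_of C. emeasure (facet_measure C F) A)"
    by (intro sum.cong) (simp_all add: emeasure_facet_measure)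
  finally show ?thesis .
qed

lemma AE_facet_measure: "F facet_of C \<Longrightarrow> (AE x in facet_measure C F. x \<in> rel_interior F)"
  unfolding facet_measure_def by (subst AE_density) (auto simp: rel_interior_facet_borel indicator_def)

text \<open>The exceptional set is covered by a Borel null set, and the surface measure of a Borel
  set is the sum of its nonnegative facet measures.\<close>

lemma AE_surface_measureD:
  assumes "AE x in surface_measure C. P x" and F: "F facet_of C"
  shows "AE x in facet_measure C F. P x"
proof -
  obtain N' where "N' \<in> null_sets (completion bsurface)" "{x. \<not> P x} \<subseteq> N'"
    using assms(1) by (auto simp: surface_measure_def eventually_ae_filter)
  then obtain N where N: "N \<in> null_sets bsurface" "{x. \<not> P x} \<subseteq> N"
    unfolding null_sets_completion_iff2 by blast
  have [measurable]: "N \<in> sets borel" using N(1) by (auto simp: null_sets_def)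
  have "(\<Sum>F | F facet_of C. emeasure (facet_measure C F) N) = 0"
    using N(1) emeasure_bsurface[of N] by (auto simp: null_sets_def)
  then have "emeasure (facet_measure C F) N = 0"
    using finite_facets F by (simp add: sum_eq_0_iff)
  then show ?thesis using N(2)
    by (intro AE_I'[of N]) (auto simp: null_sets_def)
qed

text \<open>The complement, which contains the lower-dimensional faces, is a null set of the surface
  measure.\<close>

definition facet_points :: "(real^'d) set" where
  "facet_points = (\<Union>F\<in>{F. F facet_of C}. rel_interior F)"

lemma facet_points_borel [measurable]: "facet_points \<in> sets borel"
  unfolding facet_points_def using finite_facets rel_interior_facet_borel by auto

lemma null_off_facet_points: "- facet_points \<in> null_sets bsurface"
proof -
  have "emeasure (facet_measure C F) (- facet_points) = 0" if "F facet_of C" for F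
    using AE_facet_measure[OF that] that
    by (subst (asm) AE_iff_measurable[of "- rel_interior F"])
       (auto simp: facet_points_def intro!: emeasure_eq_0[of "- rel_interior F"] rel_interior_facet_borel)
  then show ?thesis
    by (auto simp: null_sets_def emeasure_bsurface)
qed

lemma AE_surface_measureI:
  assumes "\<And>F x. F facet_of C \<Longrightarrow> x \<in> rel_interior F \<Longrightarrow> P x"
  shows "AE x in surface_measure C. P x"
  unfolding surface_measure_def
  by (rule AE_completion, rule AE_I'[OF null_off_facet_points])
     (use assms in \<open>auto simp: facet_points_def\<close>)

lemma finite_facet_measure:
  assumes F: "F facet_of C" shows "finite_measure (facet_measure C F)"
proof
  have "emeasure (facet_measure C F) UNIV
      = emeasure (hyp (facet_normal C F) (facet_offset C F) (facet_normal C F)) (rel_interior F)"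
    unfolding facet_measure_def by (subst emeasure_density) (auto simp: rel_interior_facet_borel F)
  also have "\<dots> < \<infinity>"
    by (rule emeasure_hyp_bounded)
       (use facet_bounded[OF F] rel_interior_subset bounded_subset rel_interior_facet_borel[OF F] in blast)+
  finally show "emeasure (facet_measure C F) (space (facet_measure C F)) \<noteq> \<infinity>" by simp
qed

lemma facet_integrable:
  fixes g :: "real^'d \<Rightarrow> real"
  assumes F: "F facet_of C" and g: "g \<in> borel_measurable borel" "\<And>x. x \<in> F \<Longrightarrow> \<bar>g x\<bar> \<le> B"
  shows "integrable (facet_measure C F) g"
proof -
  interpret finite_measure "facet_measure C F" by (rule finite_facet_measure[OF F])
  show ?thesis
    using AE_facet_measure[OF F] rel_interior_subset[of F] g
    by (intro integrable_const_bound[of _ B]) (auto elim!: eventually_mono)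
qed

lemma facet_integrable_continuous:
  fixes g :: "real^'d \<Rightarrow> real"
  assumes F: "F facet_of C" and g: "continuous_on UNIV g"
  shows "integrable (facet_measure C F) g"
proof -
  have "compact F" using facet_closed[OF F] facet_bounded[OF F] by (simp add: compact_eq_bounded_closed)
  then have "bounded (g ` F)"
    using g by (meson compact_continuous_image compact_imp_bounded continuous_on_subset subset_UNIV)
  then obtain B where "\<And>x. x \<in> F \<Longrightarrow> \<bar>g x\<bar> \<le> B" by (auto simp: bounded_iff)
  then show ?thesis using facet_integrable[OF F] borel_measurable_continuous_onI[OF g] by blast
qed

lemma integral_facet_measure:
  fixes g :: "real^'d \<Rightarrow> real"
  assumes F: "F facet_of C" and [measurable]: "g \<in> borel_measurable borel"
  shows "(LINT x|facet_measure C F. g x) = (LINT y|lborel. indicator (prism C F) y * g (closest_point C y))"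
    and "integrable (facet_measure C F) g \<longleftrightarrow> integrable lborel (\<lambda>y. indicator (prism C F) y * g (closest_point C y))"
proof -
  let ?n = "facet_normal C F" and ?b = "facet_offset C F"
  have [measurable]: "rel_interior F \<in> sets borel" using rel_interior_facet_borel[OF F] .
  have eq: "indicator (slab ?n ?b) y * (indicator (rel_interior F) (hproj ?n ?b ?n y) * g (hproj ?n ?b ?n y))
     = indicator (prism C F) y * g (closest_point C y)" for y
    using closest_point_prism[OF F] by (auto simp: indicator_def prism_def)
  have fm: "facet_measure C F = density (hyp ?n ?b ?n) (\<lambda>x. ennreal (indicator (rel_interior F) x))"
    by (simp add: facet_measure_def ennreal_indicator)
  have "(LINT x|facet_measure C F. g x) = (LINT x|hyp ?n ?b ?n. indicator (rel_interior F) x * g x)"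
    unfolding fm by (rule integral_real_density) auto
  also have "\<dots> = (LINT y|lborel. indicator (slab ?n ?b) y * (indicator (rel_interior F) (hproj ?n ?b ?n y) * g (hproj ?n ?b ?n y)))"
    by (rule integral_hyp) measurable
  finally show "(LINT x|facet_measure C F. g x) = (LINT y|lborel. indicator (prism C F) y * g (closest_point C y))"
    by (simp add: eq)
  have hyp_eq: "hyp ?n ?b ?n = distr (density lborel (\<lambda>y. ennreal (indicator (slab ?n ?b) y))) borel (hproj ?n ?b ?n)"
    by (simp add: hyp_def ennreal_indicator)
  have "integrable (facet_measure C F) g \<longleftrightarrow> integrable (hyp ?n ?b ?n) (\<lambda>x. indicator (rel_interior F) x * g x)"
    unfolding fm by (rule integrable_real_density) auto
  also have "\<dots> \<longleftrightarrow> integrable (density lborel (\<lambda>y. ennreal (indicator (slab ?n ?b) y)))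
       (\<lambda>y. indicator (rel_interior F) (hproj ?n ?b ?n y) * g (hproj ?n ?b ?n y))"
    unfolding hyp_eq by (rule integrable_distr_eq) measurable
  also have "\<dots> \<longleftrightarrow> integrable lborel (\<lambda>y. indicator (slab ?n ?b) y *
       (indicator (rel_interior F) (hproj ?n ?b ?n y) * g (hproj ?n ?b ?n y)))"
    by (rule integrable_real_density) auto
  finally show "integrable (facet_measure C F) g \<longleftrightarrow> integrable lborel (\<lambda>y. indicator (prism C F) y * g (closest_point C y))"
    by (simp add: eq)
qed

text \<open>The integrands of the scheme contain limits and a definite description for the normal,
  so their measurability is not apparent. Agreement with a Borel function on each relative interior
  suffices: the other points form a null set, and the completion makes \<open>f\<close>
  measurable.\<close>

lemma integral_surface_measure:
  fixes f :: "real^'d \<Rightarrow> real"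
  assumes g: "\<And>F. F facet_of C \<Longrightarrow> g F \<in> borel_measurable borel"
    "\<And>F. F facet_of C \<Longrightarrow> integrable (facet_measure C F) (g F)"
    and fg: "\<And>F x. F facet_of C \<Longrightarrow> x \<in> rel_interior F \<Longrightarrow> f x = g F x"
  shows "(LINT x|surface_measure C. f x) = (\<Sum>F | F facet_of C. LINT x|facet_measure C F. g F x)"
proof -
  let ?FF = "{F. F facet_of C}"
  define h where "h x = (\<Sum>F\<in>?FF. indicator (rel_interior F) x * g F x)" for x
  have h [measurable]: "h \<in> borel_measurable borel"
    unfolding h_def using g rel_interior_facet_borel by (intro borel_measurable_sum) auto
  have h_eq: "h x = g F x" if F: "F facet_of C" and x: "x \<in> rel_interior F" for F x
  proof -
    have "h x = (\<Sum>G\<in>?FF. if G = F then g F x else 0)"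
      unfolding h_def using disjoint_facets F x by (intro sum.cong) (auto simp: indicator_def)
    then show ?thesis using F finite_facets by simp
  qed
  have fh: "f x = h x" if "x \<in> facet_points" for x
    using that h_eq fg by (auto simp: facet_points_def)
  have null: "- facet_points \<in> null_sets (completion bsurface)"
    using null_off_facet_points by (rule null_sets_completionI)
  have f: "f \<in> borel_measurable (completion bsurface)"
  proof (rule measurableI)
    fix A :: "real set" assume A: "A \<in> sets borel"
    have e: "f -` A \<inter> space (completion bsurface) = (h -` A \<inter> facet_points) \<union> (f -` A - facet_points)"
      using fh by auto
    have 1: "h -` A \<inter> facet_points \<in> sets (completion bsurface)"
      using measurable_sets_borel[OF h A] by (intro sets_completionI_sets) auto
    have 2: "f -` A - facet_points \<in> null_sets (completion bsurface)"
      by (rule null_sets_completion_subset[OF _ null]) auto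
    show "f -` A \<inter> space (completion bsurface) \<in> sets (completion bsurface)"
      unfolding e by (intro sets.Un 1 null_setsD2[OF 2])
  qed simp
  have "(LINT x|surface_measure C. f x) = (LINT x|completion bsurface. h x)"
    unfolding surface_measure_def
  proof (rule integral_cong_AE[OF f])
    show "h \<in> borel_measurable (completion bsurface)" by (rule measurable_completion) simp
    show "AE x in completion bsurface. f x = h x"
      by (rule AE_I'[OF null]) (use fh in auto)
  qed
  also have "\<dots> = (LINT x|bsurface. h x)" by (rule integral_completion) simp
  also have "\<dots> = (LINT y|restrict_space lborel (outer_collar C). h (closest_point C y))"
    by (rule integral_distr) simp_all
  also have "\<dots> = (LINT y|lborel. indicator (outer_collar C) y *\<^sub>R h (closest_point C y))"
    by (rule integral_restrict_space) simp
  also have "\<dots> = (LINT y|lborel. (\<Sum>F\<in>?FF. indicator (prism C F) y * g F (closest_point C y)))"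
  proof (intro Bochner_Integration.integral_cong refl)
    fix y
    show "indicator (outer_collar C) y *\<^sub>R h (closest_point C y)
        = (\<Sum>F\<in>?FF. indicator (prism C F) y * g F (closest_point C y))"
    proof (cases "y \<in> outer_collar C")
      case True
      then obtain F where F: "F facet_of C" "y \<in> prism C F" by (auto simp: outer_collar_eq)
      then have "closest_point C y \<in> rel_interior F"
        using closest_point_prism by (auto simp: prism_def)
      then have "h (closest_point C y) = g F (closest_point C y)" using h_eq F by blast
      moreover have "(\<Sum>G\<in>?FF. indicator (prism C G) y * g G (closest_point C y))
          = (\<Sum>G\<in>?FF. if G = F then g F (closest_point C y) else 0)"
        using disjoint_prisms F by (intro sum.cong) (auto simp: indicator_def disjoint_family_on_def)
      ultimately show ?thesis using True F finite_facets by simp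
    next
      case False
      then show ?thesis by (auto simp: outer_collar_eq)
    qed
  qed
  also have "\<dots> = (\<Sum>F\<in>?FF. LINT y|lborel. indicator (prism C F) y * g F (closest_point C y))"
    by (rule Bochner_Integration.integral_sum)
       (use iffD1[OF integral_facet_measure(2)[OF _ g(1)] g(2)] in auto)
  also have "\<dots> = (\<Sum>F\<in>?FF. LINT x|facet_measure C F. g F x)"
    by (intro sum.cong) (use integral_facet_measure(1) g in auto)
  finally show ?thesis .
qed

end

section \<open>Integration by parts on a simplex\<close>

text \<open>\<open>p\<close> is left open so that the rule covers the projection belonging to the
  slab as well as a projection onto another hyperplane.\<close>

lemma slab_push_forward:
  fixes g :: "'a::euclidean_space \<Rightarrow> real"
  assumes M: "distr (density lborel (indicator (slab m c))) borel p = M"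
    and [measurable]: "p \<in> borel_measurable borel" "g \<in> borel_measurable borel"
  shows "(LINT x|M. g x) = (LINT y|lborel. indicator (slab m c) y * g (p y))"
    and "integrable M g \<longleftrightarrow> integrable lborel (\<lambda>y. indicator (slab m c) y * g (p y))"
proof -
  have d: "density lborel (indicator (slab m c)) = density lborel (\<lambda>y. ennreal (indicator (slab m c) y))"
    by (simp add: ennreal_indicator)
  show "(LINT x|M. g x) = (LINT y|lborel. indicator (slab m c) y * g (p y))"
    unfolding M[symmetric] d by (subst integral_distr, simp, simp, subst integral_real_density) auto
  show "integrable M g \<longleftrightarrow> integrable lborel (\<lambda>y. indicator (slab m c) y * g (p y))"
    unfolding M[symmetric] d by (subst integrable_distr_eq, simp, simp, subst integrable_real_density) auto
qed

definition int_on :: "(real^'d) set \<Rightarrow> (real^'d \<Rightarrow> real) \<Rightarrow> real" where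
  "int_on K g = (LINT z|lborel. indicator (interior K) z * g z)"

section \<open>Barycentric coordinates and facets of a simplex\<close>

locale simplex_element =
  fixes K C :: "(real^'d) set"
  assumes indep: "\<not> affine_dependent C" and card_C: "card C = CARD('d) + 1" and K_def: "K = convex hull C"
begin

lemma finite_C [simp]: "finite C"
  using indep aff_independent_finite by blast

lemma vertices_K: "vertices K = C"
  unfolding vertices_def K_def using extreme_point_of_convex_hull_affine_independent[OF indep] by auto

lemma affine_hull_C: "affine hull C = UNIV"
  using aff_dim_affine_independent[OF indep] card_C aff_dim_eq_full[of C] by simp

lemma bary_unique_aux:
  assumes "sum u C = 1" "(\<Sum>a\<in>C. u a *\<^sub>R a) = x" "sum v C = 1" "(\<Sum>a\<in>C. v a *\<^sub>R a) = x" "a \<in> C"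
  shows "u a = (v a :: real)"
proof (rule ccontr)
  assume "u a \<noteq> v a"
  moreover have "sum (\<lambda>a. u a - v a) C = 0" "(\<Sum>a\<in>C. (u a - v a) *\<^sub>R a) = 0"
    using assms by (simp_all add: sum_subtractf scaleR_diff_left)
  ultimately have "affine_dependent C"
    unfolding affine_dependent_explicit_finite[OF finite_C] using assms(5)
    by (intro exI[of _ "\<lambda>a. u a - v a"]) auto
  then show False using indep by blast
qed

lemma bary:
  shows "a \<notin> C \<Longrightarrow> barycentric K x a = 0" "(\<Sum>a\<in>C. barycentric K x a) = 1"
    "(\<Sum>a\<in>C. barycentric K x a *\<^sub>R a) = x"
proof -
  have "x \<in> affine hull C" using affine_hull_C by simp
  then obtain u where u: "sum u C = 1" "(\<Sum>a\<in>C. u a *\<^sub>R a) = x"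
    unfolding affine_hull_finite[OF finite_C] by blast
  let ?P = "\<lambda>l. (\<forall>a. a \<notin> C \<longrightarrow> l a = 0) \<and> sum l C = 1 \<and> (\<Sum>a\<in>C. l a *\<^sub>R a) = x"
  have "\<exists>!l. ?P l"
  proof (rule ex1I[of _ "\<lambda>a. if a \<in> C then u a else 0"])
    show "?P (\<lambda>a. if a \<in> C then u a else 0)" using u by (auto cong: sum.cong)
    fix l assume l: "?P l"
    show "l = (\<lambda>a. if a \<in> C then u a else 0)"
    proof
      fix a show "l a = (if a \<in> C then u a else 0)"
        using bary_unique_aux[of l x u a] l u by auto
    qed
  qed
  from theI'[OF this] have "?P (barycentric K x)" unfolding barycentric_def vertices_K by simp
  then show "a \<notin> C \<Longrightarrow> barycentric K x a = 0" "(\<Sum>a\<in>C. barycentric K x a) = 1"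
    "(\<Sum>a\<in>C. barycentric K x a *\<^sub>R a) = x" by auto
qed

lemma bary_eqI: "sum u C = 1 \<Longrightarrow> (\<Sum>a\<in>C. u a *\<^sub>R a) = x \<Longrightarrow> a \<in> C \<Longrightarrow> barycentric K x a = u a"
  using bary_unique_aux[of "barycentric K x" x u a] bary(2,3)[of x] by simp

text \<open>The gradient of the barycentric coordinate of \<open>a\<close>, read off from its values
  at the origin and the unit vectors.\<close>

definition bgrad :: "real^'d \<Rightarrow> real^'d" where
  "bgrad a = (\<chi> i. barycentric K (axis i 1) a - barycentric K 0 a)"

text \<open>The sign is chosen so that the coordinate becomes
  \<open>bgrad a \<bullet> x - boff a\<close>, the form of the height in \<open>slab\<close> and
  \<open>hproj\<close>.\<close>

definition boff :: "real^'d \<Rightarrow> real" where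
  "boff a = - barycentric K 0 a"

lemma bary_affine:
  assumes a: "a \<in> C" shows "barycentric K x a = bgrad a \<bullet> x - boff a"
proof -
  define g where "g x = barycentric K x a - barycentric K 0 a" for x
  have "linear g"
  proof
    fix x y
    have "barycentric K (x + y) a = barycentric K x a + barycentric K y a - barycentric K 0 a"
      by (rule bary_eqI[OF _ _ a])
         (simp_all add: sum.distrib sum_subtractf scaleR_add_left scaleR_diff_left bary)
    then show "g (x + y) = g x + g y" by (simp add: g_def)
  next
    fix r x
    have "barycentric K (r *\<^sub>R x) a = r * barycentric K x a + (1 - r) * barycentric K 0 a"
      by (rule bary_eqI[OF _ _ a])
         (simp_all add: sum.distrib scaleR_add_left bary flip: sum_distrib_left scaleR_scaleR scaleR_sum_right)
    then show "g (r *\<^sub>R x) = r *\<^sub>R g x" by (simp add: g_def algebra_simps)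
  qed
  from linear_sum_axis[OF this, of x] show ?thesis
    by (simp add: g_def bgrad_def boff_def inner_vec_def mult.commute)
qed

lemma bary_vertex:
  assumes "a \<in> C" "b \<in> C" shows "barycentric K b a = (if a = b then 1 else 0)"
proof (rule bary_eqI[OF _ _ assms(1), of "\<lambda>a. if a = b then 1 else 0"])
  have "(\<Sum>a\<in>C. (if a = b then 1 else 0) *\<^sub>R a) = (\<Sum>a\<in>C. if a = b then b else 0)"
    by (intro sum.cong) auto
  then show "(\<Sum>a\<in>C. (if a = b then 1 else 0) *\<^sub>R a) = b" using assms by simp
qed (use assms in simp)

lemma bgrad_edge:
  assumes "a \<in> C" "b \<in> C" "c \<in> C"
  shows "bgrad c \<bullet> (b - a) = (if c = b then 1 else 0) - (if c = a then 1 else 0)"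
proof -
  have "bgrad c \<bullet> (b - a) = barycentric K b c - barycentric K a c"
    using assms by (simp add: bary_affine inner_diff_right)
  then show ?thesis using assms by (simp add: bary_vertex)
qed

text \<open>Directional derivatives of the two identities that the coordinates sum to 1 and
  reproduce \<open>x\<close>.\<close>

lemma sum_bgrad: "(\<Sum>a\<in>C. bgrad a \<bullet> v) = 0" "(\<Sum>a\<in>C. (bgrad a \<bullet> v) *\<^sub>R a) = v"
proof -
  have *: "bgrad a \<bullet> v = barycentric K v a - barycentric K 0 a" if "a \<in> C" for a
    using that by (simp add: bary_affine)
  show "(\<Sum>a\<in>C. bgrad a \<bullet> v) = 0" "(\<Sum>a\<in>C. (bgrad a \<bullet> v) *\<^sub>R a) = v"
    by (simp_all add: * sum_subtractf scaleR_diff_left bary cong: sum.cong)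
qed

lemma other_vertex: assumes "a \<in> C" obtains b where "b \<in> C" "b \<noteq> a"
proof -
  have "card C \<ge> 2" using card_C by simp
  then have "C \<noteq> {a}" by auto
  then show thesis using assms that by blast
qed

lemma bgrad_nonzero: assumes "a \<in> C" shows "bgrad a \<noteq> 0"
proof -
  obtain b where "b \<in> C" "b \<noteq> a" using other_vertex[OF assms] by blast
  then have "bgrad a \<bullet> (b - a) = -1" using assms by (simp add: bgrad_edge)
  then show ?thesis by auto
qed

lemma bary_ex:
  "(\<exists>u. (\<forall>b\<in>C. P (u b)) \<and> sum u C = 1 \<and> (\<Sum>b\<in>C. u b *\<^sub>R b) = x)
    \<longleftrightarrow> (\<forall>b\<in>C. P (barycentric K x b))" (is "?L \<longleftrightarrow> ?R")
proof
  assume ?L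
  then obtain u where u: "\<forall>b\<in>C. P (u b)" "sum u C = 1" "(\<Sum>b\<in>C. u b *\<^sub>R b) = x" by blast
  then show ?R using bary_eqI[OF u(2,3)] by simp
next
  assume ?R
  then show ?L using bary(2,3)[of x] by (intro exI[of _ "barycentric K x"]) simp
qed

lemma mem_interior: "x \<in> interior K \<longleftrightarrow> (\<forall>a\<in>C. 0 < barycentric K x a)"
proof -
  have "affine hull (convex hull C) = UNIV" using affine_hull_C by simp
  then have "interior K = {y. \<exists>u. (\<forall>x\<in>C. 0 < u x) \<and> sum u C = 1 \<and> (\<Sum>x\<in>C. u x *\<^sub>R x) = y}"
    unfolding K_def using rel_interior_convex_hull_explicit[OF indep] rel_interior_interior by metis
  then show ?thesis using bary_ex[of "\<lambda>t. 0 < t" x] by simp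
qed

lemma mem_K: "x \<in> K \<longleftrightarrow> (\<forall>a\<in>C. 0 \<le> barycentric K x a)"
proof -
  have "K = {y. \<exists>u. (\<forall>x\<in>C. 0 \<le> u x) \<and> sum u C = 1 \<and> (\<Sum>x\<in>C. u x *\<^sub>R x) = y}"
    unfolding K_def by (rule convex_hull_finite) simp
  then show ?thesis using bary_ex[of "\<lambda>t. 0 \<le> t" x] by simp
qed

definition facet :: "real^'d \<Rightarrow> (real^'d) set" where
  "facet a = convex hull (C - {a})"

lemma bary_ex_minus:
  assumes a: "a \<in> C"
  shows "(\<exists>u. (\<forall>b\<in>C-{a}. P (u b)) \<and> sum u (C-{a}) = 1 \<and> (\<Sum>b\<in>C-{a}. u b *\<^sub>R b) = x)
    \<longleftrightarrow> barycentric K x a = 0 \<and> (\<forall>b\<in>C-{a}. P (barycentric K x b))" (is "?L \<longleftrightarrow> ?R")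
proof
  assume ?L
  then obtain u where u: "\<forall>b\<in>C-{a}. P (u b)" "sum u (C-{a}) = 1" "(\<Sum>b\<in>C-{a}. u b *\<^sub>R b) = x" by blast
  let ?u = "u(a := 0)"
  have "sum ?u C = 1" "(\<Sum>b\<in>C. ?u b *\<^sub>R b) = x"
    using u(2,3) by (simp_all add: sum.remove[OF finite_C a] cong: sum.cong_simp)
  then have "barycentric K x b = ?u b" if "b \<in> C" for b using bary_eqI that by blast
  then show ?R using u(1) a by auto
next
  assume R: ?R
  then have "sum (barycentric K x) (C-{a}) = 1" "(\<Sum>b\<in>C-{a}. barycentric K x b *\<^sub>R b) = x"
    using bary(2)[of x] bary(3)[of x] by (simp_all add: sum.remove[OF finite_C a])
  then show ?L using R by blast
qed

lemma mem_rel_interior_facet: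
  assumes a: "a \<in> C"
  shows "x \<in> rel_interior (facet a) \<longleftrightarrow> barycentric K x a = 0 \<and> (\<forall>b\<in>C-{a}. 0 < barycentric K x b)"
proof -
  have "\<not> affine_dependent (C - {a})" using indep affine_independent_Diff by blast
  then show ?thesis
    unfolding facet_def rel_interior_convex_hull_explicit[OF \<open>\<not> affine_dependent (C - {a})\<close>]
    using bary_ex_minus[OF a, of "\<lambda>t. 0 < t" x] by simp
qed

lemma polytope_K: "polytope K"
  unfolding K_def using finite_C by (rule polytope_convex_hull)

lemma interior_K_nonempty: "interior K \<noteq> {}"
proof -
  let ?x = "\<Sum>a\<in>C. (1 / real (card C)) *\<^sub>R a"
  have "barycentric K ?x a = 1 / real (card C)" if "a \<in> C" for a
    by (rule bary_eqI[OF _ refl that]) (use card_C in simp)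
  then have "?x \<in> interior K" using card_C by (simp add: mem_interior)
  then show ?thesis by blast
qed

end

sublocale simplex_element \<subseteq> full_polytope K
  by standard (fact polytope_K, fact interior_K_nonempty)

context simplex_element
begin

lemma facets: "{F. F facet_of K} = facet ` C"
proof -
  have "convex hull (C - {u}) \<noteq> {}" if "u \<in> C" for u
    using other_vertex[OF that] by auto
  then show ?thesis
    using facet_of_convex_hull_affine_independent[OF indep] unfolding K_def facet_def by auto
qed

lemma facet_facet: "a \<in> C \<Longrightarrow> facet a facet_of K"
  using facets by auto

lemma inj_facet: "inj_on facet C"
proof (rule inj_onI, rule ccontr)
  fix a b assume ab: "a \<in> C" "b \<in> C" "facet a = facet b" "a \<noteq> b"
  obtain x where x: "x \<in> rel_interior (facet a)" using facet_nonempty[OF facet_facet[OF ab(1)]] by blast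
  have "barycentric K x a = 0" using mem_rel_interior_facet[OF ab(1)] x by blast
  moreover have "0 < barycentric K x a"
    using mem_rel_interior_facet[OF ab(2), of x] x ab by simp
  ultimately show False by simp
qed

text \<open>The coordinate of \<open>a\<close> is nonnegative on the simplex and 0 on the opposite
  facet, so its gradient points inwards there.\<close>

lemma facet_normal_simplex:
  assumes a: "a \<in> C"
  shows "facet_normal K (facet a) = - (bgrad a /\<^sub>R norm (bgrad a))"
    and "facet_offset K (facet a) = - (boff a / norm (bgrad a))"
proof -
  let ?n = "- (bgrad a /\<^sub>R norm (bgrad a))" and ?b = "- (boff a / norm (bgrad a))"
  have pos: "norm (bgrad a) > 0" using bgrad_nonzero[OF a] by simp
  have eq: "?n \<bullet> y - ?b = - barycentric K y a / norm (bgrad a)" for y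
    using pos by (simp add: bary_affine[OF a] field_simps)
  have 1: "norm ?n = 1" using pos by simp
  have 2: "K \<subseteq> {y. ?n \<bullet> y \<le> ?b}"
  proof
    fix y assume "y \<in> K"
    then have "- barycentric K y a / norm (bgrad a) \<le> 0" using a pos by (simp add: mem_K)
    then show "y \<in> {y. ?n \<bullet> y \<le> ?b}" using eq[of y] by simp
  qed
  have 3: "facet a \<subseteq> {y. ?n \<bullet> y = ?b}"
  proof
    fix y assume "y \<in> facet a"
    then have "barycentric K y a = 0"
      using bary_ex_minus[OF a, of "\<lambda>t. 0 \<le> t" y] unfolding facet_def
      by (subst (asm) convex_hull_finite) auto
    then show "y \<in> {y. ?n \<bullet> y = ?b}" using eq[of y] by simp
  qed
  show "facet_normal K (facet a) = ?n" "facet_offset K (facet a) = ?b"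
    using facet_normal_eqI[OF facet_facet[OF a] 1 2 3] by auto
qed

section \<open>Divergence theorem by slicing along the edges\<close>

lemma integrable_indicator_interior:
  fixes g :: "real^'d \<Rightarrow> real"
  assumes "continuous_on UNIV g"
  shows "integrable lborel (\<lambda>z. indicator (interior K) z * g z)"
proof -
  have "integrable lborel (\<lambda>z. indicator K z *\<^sub>R g z)"
    by (rule borel_integrable_compact[OF compact]) (use assms continuous_on_subset in blast)
  then have "integrable lborel (\<lambda>z. indicator (interior K) z *\<^sub>R (indicator K z *\<^sub>R g z))"
    by (rule integrable_mult_indicator[rotated]) simp
  then show ?thesis
    by (rule Bochner_Integration.integrable_cong[THEN iffD1, rotated -1])
       (use interior_subset in \<open>auto simp: indicator_def\<close>)
qed

text \<open>Passing from the unit normal to the normal \<open>bgrad a\<close>, and from the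
  orthogonal direction to the oblique \<open>e\<close>, costs the factor
  \<open>1 / norm (bgrad a)\<close> by \<open>hyp_rescale\<close>.\<close>

lemma facet_as_hyp:
  fixes g :: "real^'d \<Rightarrow> real"
  assumes a: "a \<in> C" and e: "bgrad a \<bullet> e = 1" and g: "continuous_on UNIV g"
  shows "(LINT x|hyp (bgrad a) (boff a) e. indicator (rel_interior (facet a)) x * g x)
      = (LINT x|facet_measure K (facet a). g x) / norm (bgrad a)"
    and "integrable (hyp (bgrad a) (boff a) e) (\<lambda>x. indicator (rel_interior (facet a)) x * g x)"
proof -
  let ?F = "facet a" let ?n = "facet_normal K ?F" and ?b = "facet_offset K ?F"
  have F: "?F facet_of K" by (rule facet_facet[OF a])
  have [measurable]: "rel_interior ?F \<in> sets borel" using rel_interior_facet_borel[OF F] .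
  have [measurable]: "g \<in> borel_measurable borel" by (rule borel_measurable_continuous_onI[OF g])
  have pos: "norm (bgrad a) > 0" using bgrad_nonzero[OF a] by simp
  have nn: "?n \<bullet> ?n = 1" using facet_props(1)[OF F] by (simp add: dot_square_norm)
  have m: "- norm (bgrad a) *\<^sub>R ?n = bgrad a" "- norm (bgrad a) * ?b = boff a"
    unfolding facet_normal_simplex[OF a] using pos by auto
  have "hyp (- norm (bgrad a) *\<^sub>R ?n) (- norm (bgrad a) * ?b) e
      = density (hyp ?n ?b ?n) (\<lambda>_. ennreal (1 / \<bar>- norm (bgrad a)\<bar>))"
    by (rule hyp_rescale[OF nn]) (use pos e m in auto)
  then have h: "hyp (bgrad a) (boff a) e = density (hyp ?n ?b ?n) (\<lambda>_. ennreal (1 / norm (bgrad a)))"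
    unfolding m by simp
  have fm: "facet_measure K ?F = density (hyp ?n ?b ?n) (\<lambda>x. ennreal (indicator (rel_interior ?F) x))"
    by (simp add: facet_measure_def ennreal_indicator)
  have i: "integrable (hyp ?n ?b ?n) (\<lambda>x. indicator (rel_interior ?F) x * g x)"
    using facet_integrable_continuous[OF F g] unfolding fm
    by (subst (asm) integrable_real_density) auto
  show "(LINT x|hyp (bgrad a) (boff a) e. indicator (rel_interior ?F) x * g x)
      = (LINT x|facet_measure K ?F. g x) / norm (bgrad a)"
    unfolding h fm by (subst integral_real_density, simp, simp, simp, subst integral_real_density) auto
  show "integrable (hyp (bgrad a) (boff a) e) (\<lambda>x. indicator (rel_interior ?F) x * g x)"
    unfolding h using i by (subst integrable_real_density) auto
qed

text \<open>Along a line in direction \<open>b - a\<close> only the coordinates of \<open>a\<close>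
  and \<open>b\<close> change, at rates -1 and 1. The line enters the simplex through the facet
  opposite to \<open>b\<close> and leaves it through the one opposite to \<open>a\<close>; the
  fundamental theorem of calculus gives the difference of the two values of \<open>f\<close>, and
  Fubini collects these into facet integrals.\<close>

lemma edge_integral:
  assumes f: "C1 f" and a: "a \<in> C" and b: "b \<in> C" and ab: "a \<noteq> b"
  shows "int_on K (\<lambda>z. frechet_derivative f (at z) (b - a))
    = (LINT x|facet_measure K (facet a). f x) / norm (bgrad a)
      - (LINT x|facet_measure K (facet b). f x) / norm (bgrad b)"
proof -
  define e where "e = b - a"
  define D where "D z = frechet_derivative f (at z) e" for z
  have eb: "bgrad b \<bullet> e = 1" and ea: "bgrad a \<bullet> (- e) = 1"
    using a b ab by (simp_all add: e_def bgrad_edge inner_minus_right)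
  have ec: "bgrad c \<bullet> e = 0" if "c \<in> C" "c \<noteq> a" "c \<noteq> b" for c
    using a b that by (simp add: e_def bgrad_edge)
  let ?pb = "hproj (bgrad b) (boff b) e" and ?pa = "hproj (bgrad a) (boff a) (- e)"
  let ?S = "slab (bgrad b) (boff b)"
  let ?Fa = "rel_interior (facet a)" and ?Fb = "rel_interior (facet b)"
  let ?T1 = "\<lambda>y. indicator ?S y * (indicator ?Fa (?pa y) * f (?pa y))"
  let ?T2 = "\<lambda>y. indicator ?S y * (indicator ?Fb (?pb y) * f (?pb y))"
  let ?G = "\<lambda>z. indicator (interior K) z * D z"
  have contf: "continuous_on UNIV f" by (rule C1_continuous[OF f])
  have intG: "integrable lborel ?G"
    unfolding D_def by (rule integrable_indicator_interior) (rule C1_cont_deriv[OF f])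
  have line: "(LINT s|lborel. indicator ?S y * ?G (?pb y + s *\<^sub>R e)) = ?T1 y - ?T2 y" for y
  proof -
    \<comment> \<open>\<open>x\<close> is where the line through \<open>y\<close> crosses the
      hyperplane opposite to \<open>b\<close>, and \<open>\<theta>\<close> is the parameter at which
      it crosses the one opposite to \<open>a\<close>.\<close>
    define x where "x = ?pb y"
    define \<theta> where "\<theta> = barycentric K x a"
    have xb: "barycentric K x b = 0"
      using hproj_line(2)[OF eb, of "boff b" y] by (simp add: x_def bary_affine[OF b])
    have sb: "barycentric K (x + s *\<^sub>R e) b = s" for s
      using xb eb by (simp add: bary_affine[OF b] inner_add_right)
    have sa: "barycentric K (x + s *\<^sub>R e) a = \<theta> - s" for s
      using ea by (simp add: \<theta>_def bary_affine[OF a] inner_add_right)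
    have sc: "barycentric K (x + s *\<^sub>R e) c = barycentric K x c" if "c \<in> C" "c \<noteq> a" "c \<noteq> b" for c s
      using ec[OF that] by (simp add: bary_affine[OF that(1)] inner_add_right)
    have "?pa y = ?pa x"
      using hproj_line(1)[OF ea, of "boff a" y "bgrad b \<bullet> y - boff b"] by (simp add: x_def hproj_def)
    then have pay: "?pa y = x + \<theta> *\<^sub>R e"
      by (simp add: hproj_def \<theta>_def bary_affine[OF a])
    have Ca: "C - {a} = insert b (C - {a, b})" using b ab by auto
    have CC: "(\<forall>c\<in>C. P c) \<longleftrightarrow> P a \<and> P b \<and> (\<forall>c\<in>C - {a, b}. P c)" for P using a b by auto
    have rest: "(\<forall>c\<in>C - {a, b}. 0 < barycentric K (x + s *\<^sub>R e) c) \<longleftrightarrow> (\<forall>c\<in>C - {a, b}. 0 < barycentric K x c)" for s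
      using sc by auto
    have in_b: "x \<in> ?Fb \<longleftrightarrow> 0 < \<theta> \<and> (\<forall>c\<in>C - {a, b}. 0 < barycentric K x c)"
      using mem_rel_interior_facet[OF b, of x] xb a ab by (auto simp: \<theta>_def)
    have in_a: "x + \<theta> *\<^sub>R e \<in> ?Fa \<longleftrightarrow> 0 < \<theta> \<and> (\<forall>c\<in>C - {a, b}. 0 < barycentric K x c)"
      unfolding mem_rel_interior_facet[OF a] Ca by (simp add: sa sb rest)
    have in_K: "x + s *\<^sub>R e \<in> interior K \<longleftrightarrow> 0 < s \<and> s < \<theta> \<and> (\<forall>c\<in>C - {a, b}. 0 < barycentric K x c)" for s
      unfolding mem_interior CC by (auto simp add: sa sb rest)
    have "(LINT s|lborel. ?G (x + s *\<^sub>R e)) = indicator ?Fa (x + \<theta> *\<^sub>R e) * f (x + \<theta> *\<^sub>R e) - indicator ?Fb x * f x"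
    proof (cases "0 < \<theta> \<and> (\<forall>c\<in>C - {a, b}. 0 < barycentric K x c)")
      case True
      have "(LINT s|lborel. ?G (x + s *\<^sub>R e)) = (LINT s|lborel. D (x + s *\<^sub>R e) * indicator {0..\<theta>} s)"
      proof (rule integral_cong_AE)
        have [measurable]: "D \<in> borel_measurable borel"
          unfolding D_def by (rule borel_measurable_continuous_onI) (rule C1_cont_deriv[OF f])
        have line: "(\<lambda>s. x + s *\<^sub>R e) \<in> lborel \<rightarrow>\<^sub>M borel" by simp
        have G: "?G \<in> borel_measurable borel" using borel_measurable_integrable[OF intG] by simp
        show "(\<lambda>s. ?G (x + s *\<^sub>R e)) \<in> borel_measurable lborel"
          by (rule measurable_compose[OF line G])
        have [measurable]: "(\<lambda>s. D (x + s *\<^sub>R e)) \<in> borel_measurable lborel"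
          by (rule measurable_compose[OF line]) simp
        show "(\<lambda>s. D (x + s *\<^sub>R e) * indicator {0..\<theta>} s) \<in> borel_measurable lborel" by measurable
        \<comment> \<open>The interior of the simplex gives an open interval, the fundamental
          theorem uses the closed one; the two end points are null.\<close>
        show "AE s in lborel. ?G (x + s *\<^sub>R e) = D (x + s *\<^sub>R e) * indicator {0..\<theta>} s"
          using AE_lborel_singleton[of 0] AE_lborel_singleton[of \<theta>]
          by eventually_elim (use True in_K in \<open>auto simp: indicator_def\<close>)
      qed
      also have "\<dots> = f (x + \<theta> *\<^sub>R e) - f (x + 0 *\<^sub>R e)"
      proof (rule integral_FTC_Icc_real)
        fix s
        have "((\<lambda>s. f (x + s *\<^sub>R e)) has_derivative (\<lambda>h. frechet_derivative f (at (x + s *\<^sub>R e)) (h *\<^sub>R e))) (at s)"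
          by (rule has_derivative_compose[OF _ C1_has_derivative[OF f]]) (auto intro!: derivative_eq_intros)
        then show "DERIV (\<lambda>s. f (x + s *\<^sub>R e)) s :> D (x + s *\<^sub>R e)"
          by (simp add: has_field_derivative_def D_def linear_cmul[OF C1_linear[OF f]] mult.commute[of _ "frechet_derivative _ _ _"])
        have "continuous_on UNIV (\<lambda>s. D (x + s *\<^sub>R e))"
          unfolding D_def by (intro continuous_on_compose2[OF C1_cont_deriv[OF f, of UNIV e]] continuous_intros) auto
        then show "isCont (\<lambda>s. D (x + s *\<^sub>R e)) s" by (simp add: continuous_on_eq_continuous_at)
      qed (use True in simp)
      finally show ?thesis using True in_a in_b by simp
    next
      case False
      then have z: "(\<lambda>s. ?G (x + s *\<^sub>R e)) = (\<lambda>s. 0)" using in_K by (intro ext) auto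
      show ?thesis unfolding z using False in_a in_b by simp
    qed
    then show ?thesis unfolding pay by (cases "y \<in> ?S") (simp_all add: x_def[symmetric])
  qed
  have meas [measurable]: "?Fa \<in> sets borel" "?Fb \<in> sets borel"
    using rel_interior_facet_borel facet_facet a b by auto
  have [measurable]: "f \<in> borel_measurable borel" by (rule borel_measurable_continuous_onI[OF contf])
  \<comment> \<open>The end points on both facets are indexed by the slab of \<open>b\<close>; for
    the facet opposite to \<open>a\<close> this is the content of
    \<open>hyp_other_slab\<close>.\<close>
  note A = slab_push_forward[OF hyp_other_slab[OF eb ea, of "boff b" "boff a"], of "\<lambda>x. indicator ?Fa x * f x"]
  note B = slab_push_forward[OF hyp_def[of "bgrad b" "boff b" e, symmetric], of "\<lambda>x. indicator ?Fb x * f x"]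
  have "int_on K D = (LINT y|lborel. ?T1 y - ?T2 y)"
    unfolding int_on_def by (subst fibre_integral(1)[OF eb intG, of "boff b"]) (simp only: line)
  also have "\<dots> = (LINT y|lborel. ?T1 y) - (LINT y|lborel. ?T2 y)"
  proof (rule Bochner_Integration.integral_diff)
    show "integrable lborel ?T1"
      using A(2) facet_as_hyp(2)[OF a ea contf] by simp
    show "integrable lborel ?T2"
      using B(2) facet_as_hyp(2)[OF b eb contf] by simp
  qed
  also have "\<dots> = (LINT x|facet_measure K (facet a). f x) / norm (bgrad a)
      - (LINT x|facet_measure K (facet b). f x) / norm (bgrad b)"
    using A(1) B(1) facet_as_hyp(1)[OF a ea contf] facet_as_hyp(1)[OF b eb contf] by simp
  finally show ?thesis unfolding D_def[abs_def] e_def .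
qed

text \<open>Every direction is a combination of the edges at a fixed vertex.\<close>

theorem divergence_theorem_dir:
  assumes f: "C1 f"
  shows "int_on K (\<lambda>z. frechet_derivative f (at z) e)
    = (\<Sum>F | F facet_of K. (facet_normal K F \<bullet> e) * (LINT x|facet_measure K F. f x))"
proof -
  obtain a where a: "a \<in> C" using card_C by fastforce
  define I where "I c = (LINT x|facet_measure K (facet c). f x) / norm (bgrad c)" for c
  let ?D = "\<lambda>v z. frechet_derivative f (at z) v"
  have s0: "(\<Sum>b\<in>C-{a}. bgrad b \<bullet> e) = - (bgrad a \<bullet> e)"
    using sum_bgrad(1)[of e] by (simp add: sum.remove[OF finite_C a])
  have "e = (\<Sum>b\<in>C. (bgrad b \<bullet> e) *\<^sub>R b) - (\<Sum>b\<in>C. bgrad b \<bullet> e) *\<^sub>R a"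
    using sum_bgrad[of e] by simp
  also have "\<dots> = (\<Sum>b\<in>C. (bgrad b \<bullet> e) *\<^sub>R (b - a))"
    by (simp add: scaleR_diff_right sum_subtractf scaleR_left.sum)
  also have "\<dots> = (\<Sum>b\<in>C-{a}. (bgrad b \<bullet> e) *\<^sub>R (b - a))"
    by (simp add: sum.remove[OF finite_C a])
  finally have e: "e = (\<Sum>b\<in>C-{a}. (bgrad b \<bullet> e) *\<^sub>R (b - a))" .
  have "?D e z = (\<Sum>b\<in>C-{a}. (bgrad b \<bullet> e) * ?D (b - a) z)" for z
    by (subst e) (simp add: linear_sum[OF C1_linear[OF f]] linear_cmul[OF C1_linear[OF f]])
  then have "int_on K (?D e)
      = (LINT z|lborel. (\<Sum>b\<in>C-{a}. (bgrad b \<bullet> e) * (indicator (interior K) z * ?D (b - a) z)))"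
    by (simp add: int_on_def sum_distrib_left mult.left_commute)
  also have "\<dots> = (\<Sum>b\<in>C-{a}. (bgrad b \<bullet> e) * int_on K (?D (b - a)))"
    unfolding int_on_def
    by (subst Bochner_Integration.integral_sum)
       (auto intro!: integrable_indicator_interior C1_cont_deriv[OF f])
  also have "\<dots> = (\<Sum>b\<in>C-{a}. (bgrad b \<bullet> e) * (I a - I b))"
    by (intro sum.cong refl) (use edge_integral[OF f a] in \<open>auto simp: I_def\<close>)
  also have "\<dots> = (\<Sum>b\<in>C-{a}. bgrad b \<bullet> e) * I a - (\<Sum>b\<in>C-{a}. (bgrad b \<bullet> e) * I b)"
    by (simp add: right_diff_distrib sum_subtractf sum_distrib_right)
  also have "\<dots> = (\<Sum>b\<in>C. - (bgrad b \<bullet> e) * I b)"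
    unfolding s0 by (simp add: sum.remove[OF finite_C a] sum_negf)
  also have "\<dots> = (\<Sum>b\<in>C. (facet_normal K (facet b) \<bullet> e) * (LINT x|facet_measure K (facet b). f x))"
    by (intro sum.cong refl) (simp add: facet_normal_simplex I_def inner_minus_left divide_inverse)
  also have "\<dots> = (\<Sum>F | F facet_of K. (facet_normal K F \<bullet> e) * (LINT x|facet_measure K F. f x))"
    unfolding facets by (simp add: sum.reindex[OF inj_facet])
  finally show ?thesis .
qed

end

section \<open>Triangulations of a convex domain\<close>

lemma AE_open_ex:
  fixes U :: "'a::euclidean_space set"
  assumes "AE x in lborel. P x" "open U" "U \<noteq> {}"
  shows "\<exists>x\<in>U. P x"
proof (rule ccontr)
  assume "\<not> (\<exists>x\<in>U. P x)"
  obtain N where N: "N \<in> null_sets lborel" "{x. \<not> P x} \<subseteq> N"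
    using assms(1) by (auto simp: eventually_ae_filter)
  then have "negligible N" using null_sets_completionI negligible_iff_null_sets by blast
  moreover have "U \<subseteq> N" using N \<open>\<not> (\<exists>x\<in>U. P x)\<close> by blast
  ultimately show False using open_not_negligible[OF assms(2,3)] negligible_subset by blast
qed

lemma continuous_integral_zero:
  fixes g :: "real^'d \<Rightarrow> real"
  assumes g: "continuous_on UNIV g" and i: "integrable lborel (\<lambda>z. indicator (interior K) z * g z)"
    and nn: "\<And>x. x \<in> interior K \<Longrightarrow> 0 \<le> g x" and z: "int_on K g = 0" and x: "x \<in> interior K"
  shows "g x = 0"
proof (rule ccontr)
  assume "g x \<noteq> 0"
  have "AE z in lborel. indicator (interior K) z * g z = 0"
    using z i unfolding int_on_def
    by (subst (asm) integral_nonneg_eq_0_iff_AE) (use nn in \<open>auto simp: indicator_def\<close>)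
  moreover have "open (interior K \<inter> {z. g z \<noteq> 0})"
    using open_Collect_neq[OF g continuous_on_const] by auto
  ultimately have "\<exists>z\<in>interior K \<inter> {z. g z \<noteq> 0}. indicator (interior K) z * g z = 0"
    by (rule AE_open_ex) (use x \<open>g x \<noteq> 0\<close> in auto)
  then show False by auto
qed

lemma (in complete_measure) measurable_AE_eq:
  fixes f g :: "'a \<Rightarrow> 'b::topological_space"
  assumes f: "f \<in> borel_measurable M" and fg: "AE x in M. f x = g x"
  shows "g \<in> borel_measurable M"
proof (rule measurableI)
  fix A :: "'b set" assume A: "A \<in> sets borel"
  show "g -` A \<inter> space M \<in> sets M"
  proof (rule in_sets_AE[OF _ measurable_sets[OF f A]])
    show "AE x in M. x \<in> f -` A \<inter> space M \<longleftrightarrow> x \<in> g -` A \<inter> space M"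
      using fg by eventually_elim auto
  qed auto
qed auto

text \<open>Near a relative interior point of the facet opposite to \<open>a\<close> all other
  coordinates stay positive, so every membership is decided by the sign of the coordinate of
  \<open>a\<close> alone.\<close>

lemma (in simplex_element) local_halfspace:
  assumes F: "F facet_of K" and x: "x \<in> rel_interior F"
  obtains e where "e > 0"
    "\<And>y. y \<in> ball x e \<Longrightarrow> y \<in> K \<longleftrightarrow> facet_normal K F \<bullet> y \<le> facet_offset K F"
    "\<And>y. y \<in> ball x e \<Longrightarrow> y \<in> interior K \<longleftrightarrow> facet_normal K F \<bullet> y < facet_offset K F"
    "\<And>y. y \<in> ball x e \<Longrightarrow> y \<in> rel_interior F \<longleftrightarrow> facet_normal K F \<bullet> y = facet_offset K F"
    "\<And>y G. y \<in> ball x e \<Longrightarrow> G facet_of K \<Longrightarrow> y \<in> rel_interior G \<Longrightarrow> G = F"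
proof -
  obtain a where a: "a \<in> C" "F = facet a" using F facets by auto
  have pos: "norm (bgrad a) > 0" using bgrad_nonzero[OF a(1)] by simp
  have ba: "facet_normal K F \<bullet> y - facet_offset K F = - barycentric K y a / norm (bgrad a)" for y
    using pos by (simp add: a facet_normal_simplex bary_affine[OF a(1)] field_simps)
  have cont: "continuous_on UNIV (\<lambda>y. barycentric K y c)" if "c \<in> C" for c
    by (simp add: bary_affine[OF that] continuous_intros)
  let ?U = "\<Inter>c\<in>C-{a}. {y. 0 < barycentric K y c}"
  have "open ?U"
    by (intro open_INT ballI open_Collect_less continuous_on_const cont) auto
  moreover have "x \<in> ?U" using x mem_rel_interior_facet[OF a(1)] a(2) by auto
  ultimately obtain e where e: "e > 0" "ball x e \<subseteq> ?U" using open_contains_ball by blast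
  have CC: "(\<forall>c\<in>C. P c) \<longleftrightarrow> P a \<and> (\<forall>c\<in>C - {a}. P c)" for P using a by auto
  show thesis
  proof (rule that[OF e(1)])
    fix y assume "y \<in> ball x e"
    then have y: "0 < barycentric K y c" if "c \<in> C - {a}" for c using e that by auto
    have "y \<in> K \<longleftrightarrow> 0 \<le> barycentric K y a" unfolding mem_K CC using y less_imp_le by blast
    also have "\<dots> \<longleftrightarrow> facet_normal K F \<bullet> y - facet_offset K F \<le> 0"
      unfolding ba using pos by (simp add: field_simps)
    finally show "y \<in> K \<longleftrightarrow> facet_normal K F \<bullet> y \<le> facet_offset K F" by simp
    have "y \<in> interior K \<longleftrightarrow> 0 < barycentric K y a" unfolding mem_interior CC using y by blast
    also have "\<dots> \<longleftrightarrow> facet_normal K F \<bullet> y - facet_offset K F < 0"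
      unfolding ba using pos by (simp add: field_simps)
    finally show "y \<in> interior K \<longleftrightarrow> facet_normal K F \<bullet> y < facet_offset K F" by simp
    have "y \<in> rel_interior F \<longleftrightarrow> barycentric K y a = 0"
      unfolding a(2) mem_rel_interior_facet[OF a(1)] using y by blast
    also have "\<dots> \<longleftrightarrow> facet_normal K F \<bullet> y - facet_offset K F = 0"
      unfolding ba using pos by (simp add: field_simps)
    finally show "y \<in> rel_interior F \<longleftrightarrow> facet_normal K F \<bullet> y = facet_offset K F" by simp
    fix G assume G: "G facet_of K" "y \<in> rel_interior G"
    then obtain c where c: "c \<in> C" "G = facet c" using facets by auto
    then have "barycentric K y c = 0" using G mem_rel_interior_facet[OF c(1)] by simp
    then have "c = a" using y[of c] c(1) by (cases "c = a") auto
    then show "G = F" using c a by simp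
  qed
qed

text \<open>Serves to turn knowledge near \<open>x\<close> into a half-space bound: a point of a
  convex set that violates the bound is pulled towards \<open>x\<close> into the ball, where it
  still violates it.\<close>

lemma segment_in_ball:
  fixes x y :: "'a::real_normed_vector"
  assumes "e > 0"
  obtains t where "0 < t" "t \<le> 1" "x + t *\<^sub>R (y - x) \<in> ball x e"
proof
  define N where "N = norm (y - x) + 1"
  let ?t = "min 1 (e / (2 * N))"
  have n: "N > 0" by (simp add: N_def add_nonneg_pos)
  show "0 < ?t" using assms n by simp
  show "?t \<le> 1" by simp
  have "?t * norm (y - x) \<le> e / (2 * N) * N"
    using assms n by (intro mult_mono) (auto simp: N_def)
  also have "\<dots> = e / 2" using n by simp
  also have "\<dots> < e" using assms by simp
  finally show "x + ?t *\<^sub>R (y - x) \<in> ball x e"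
    using \<open>0 < ?t\<close> by (simp add: dist_norm)
qed

section \<open>Elements, neighbours and boundary facets of the mesh\<close>

locale mesh =
  fixes \<Omega> :: "(real^'d) set" and \<T> :: "(real^'d) set set"
  assumes dom: "convex_polytopal_domain \<Omega>" and tri: "triangulation \<T>"
    and simp_T: "\<And>K. K \<in> \<T> \<Longrightarrow> (int CARD('d)) simplex K" and cover: "\<Union>\<T> = closure \<Omega>"
begin

lemma finite_T [simp]: "finite \<T>" using tri by (simp add: triangulation_def)

lemma element: assumes "K \<in> \<T>" obtains C where "simplex_element K C"
  using simp_T[OF assms] that unfolding simplex_def simplex_element_def by force

lemma domain_facts: "full_polytope (closure \<Omega>)" "interior (closure \<Omega>) = \<Omega>" "open \<Omega>" "bounded \<Omega>" "convex \<Omega>"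
proof -
  obtain P where P: "polytope P" "\<Omega> = interior P" "\<Omega> \<noteq> {}"
    using dom unfolding convex_polytopal_domain_def by blast
  have cP: "closure \<Omega> = P"
    using P convex_closure_interior[OF polytope_imp_convex[OF P(1)]] closure_closed[OF polytope_imp_closed[OF P(1)]] by simp
  show "full_polytope (closure \<Omega>)" using P cP by unfold_locales auto
  show "interior (closure \<Omega>) = \<Omega>" using P cP by simp
  show "open \<Omega>" "convex \<Omega>" using P polytope_imp_convex by (auto intro: convex_interior)
  show "bounded \<Omega>" using P polytope_imp_bounded interior_subset bounded_subset by metis
qed

lemma interior_in_domain: assumes "K \<in> \<T>" shows "interior K \<subseteq> \<Omega>"
proof -
  have "interior K \<subseteq> interior (closure \<Omega>)" using assms cover by (intro interior_mono) blast
  then show ?thesis using domain_facts by simp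
qed

lemma aff_dim_element: "K \<in> \<T> \<Longrightarrow> aff_dim K = CARD('d)"
  using simp_T aff_dim_simplex by blast

text \<open>The intersection is a face of both elements. A face that meets the interior of
  \<open>K\<close> is all of \<open>K\<close>, and a face of \<open>K'\<close> of full dimension is
  \<open>K'\<close>.\<close>

lemma interior_disjoint:
  assumes K: "K \<in> \<T>" "K' \<in> \<T>" "x \<in> interior K" "x \<in> K'" shows "K = K'"
proof -
  have f: "K \<inter> K' face_of K" "K' \<inter> K face_of K'" using tri K by (auto simp: triangulation_def)
  have "x \<in> K \<inter> K'" using K interior_subset by blast
  then have "K \<inter> K' = K" using face_of_disjoint_interior[OF f(1)] K(3) by blast
  then have "K face_of K'" using f(2) by (simp add: Int_commute)
  obtain C where "simplex_element K' C" using element K by blast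
  then interpret simplex_element K' C .
  show "K = K'"
    using face_of_aff_dim_lt[OF convex \<open>K face_of K'\<close>] aff_dim_element K by force
qed

lemma element_facts: assumes "K \<in> \<T>" shows "full_polytope K" "closed K" "convex K" "K = closure (interior K)"
proof -
  obtain C where "simplex_element K C" using element assms by blast
  then interpret simplex_element K C .
  show "full_polytope K" by unfold_locales
  show "closed K" "convex K" by (fact closed, fact convex)
  show "K = closure (interior K)" using convex_closure_interior[OF convex int] closed by simp
qed

lemma facet_halfball:
  assumes "K \<in> \<T>" "F facet_of K" "x \<in> rel_interior F"
  obtains e where "e > 0"
    "\<And>y. y \<in> ball x e \<Longrightarrow> y \<in> K \<longleftrightarrow> facet_normal K F \<bullet> y \<le> facet_offset K F"
    "\<And>y. y \<in> ball x e \<Longrightarrow> y \<in> interior K \<longleftrightarrow> facet_normal K F \<bullet> y < facet_offset K F"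
proof -
  obtain C where "simplex_element K C" using element assms by blast
  then interpret simplex_element K C .
  show ?thesis using local_halfspace[OF assms(2,3)] that by metis
qed

lemma facet_local:
  assumes "K \<in> \<T>" "F facet_of K" "x \<in> rel_interior F"
  obtains e where "e > 0"
    "\<And>y. y \<in> ball x e \<Longrightarrow> y \<in> rel_interior F \<longleftrightarrow> facet_normal K F \<bullet> y = facet_offset K F"
    "\<And>y G. y \<in> ball x e \<Longrightarrow> G facet_of K \<Longrightarrow> y \<in> rel_interior G \<Longrightarrow> G = F"
proof -
  obtain C where "simplex_element K C" using element assms by blast
  then interpret simplex_element K C .
  show ?thesis using local_halfspace[OF assms(2,3)] that by metis
qed

text \<open>The common face of the two elements is proper, hence of codimension at least one, and
  contains \<open>F\<close>; so it equals \<open>F\<close>. The neighbour lies on the other side,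
  since a point of it on the side of \<open>K\<close> could be pulled towards \<open>x\<close> into
  the interior of \<open>K\<close>.\<close>

lemma neighbour_facet:
  assumes K: "K \<in> \<T>" "K' \<in> \<T>" "K' \<noteq> K" and F: "F facet_of K" and x: "x \<in> rel_interior F" "x \<in> K'"
  shows "F facet_of K'" "facet_normal K' F = - facet_normal K F" "facet_offset K' F = - facet_offset K F"
proof -
  interpret A: full_polytope K using element_facts K by blast
  interpret B: full_polytope K' using element_facts K by blast
  let ?G = "K \<inter> K'"
  have "K \<inter> K' face_of K" "K' \<inter> K face_of K'" using tri K unfolding triangulation_def by blast+
  then have G: "?G face_of K" "?G face_of K'" by (simp_all only: Int_commute)
  have FK: "F \<subseteq> K" "F face_of K" using F facet_of_imp_subset facet_of_imp_face_of by blast+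
  have "x \<in> ?G" using x FK rel_interior_subset by blast
  then have FG: "F \<subseteq> ?G" using subset_of_face_of[OF G(1) FK(1)] x by blast
  have ndis: "interior K \<inter> K' = {}" using interior_disjoint K by blast
  have "?G \<noteq> K" using ndis A.int interior_subset by blast
  then have "aff_dim ?G < CARD('d)" using face_of_aff_dim_lt[OF A.convex G(1)] aff_dim_element K by simp
  moreover have dF: "aff_dim F = int CARD('d) - 1" using F aff_dim_element K by (simp add: facet_of_def)
  moreover have "F face_of ?G" using face_of_subset[OF FK(2) FG] by blast
  moreover have "convex ?G" using A.convex B.convex by (rule convex_Int)
  ultimately have FG_eq: "F = ?G" using face_of_aff_dim_lt[of ?G F] by force
  show FK': "F facet_of K'"
    using G(2) FG_eq dF F aff_dim_element[OF K(2)] by (auto simp: facet_of_def)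
  obtain e where e: "e > 0"
    "\<And>y. y \<in> ball x e \<Longrightarrow> y \<in> interior K \<longleftrightarrow> facet_normal K F \<bullet> y < facet_offset K F"
    using facet_halfball[OF K(1) F x(1)] by metis
  have xb: "facet_normal K F \<bullet> x = facet_offset K F" using A.facet_props(3)[OF F] x(1) rel_interior_subset by blast
  have "K' \<subseteq> {y. (- facet_normal K F) \<bullet> y \<le> - facet_offset K F}"
  proof (rule ccontr)
    assume "\<not> ?thesis"
    then obtain y where "y \<in> K'" "\<not> (- facet_normal K F) \<bullet> y \<le> - facet_offset K F" by blast
    then have y: "y \<in> K'" "facet_normal K F \<bullet> y < facet_offset K F" by simp_all
    obtain t where t: "0 < t" "t \<le> 1" "x + t *\<^sub>R (y - x) \<in> ball x e" using segment_in_ball[OF e(1)] by blast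
    have "x + t *\<^sub>R (y - x) = (1 - t) *\<^sub>R x + t *\<^sub>R y" by (simp add: algebra_simps)
    then have "x + t *\<^sub>R (y - x) \<in> K'" using B.convex x(2) y(1) t by (simp add: convexD)
    moreover have "t * (facet_normal K F \<bullet> (y - x)) < 0"
      using y xb t by (intro mult_pos_neg) (simp_all add: inner_diff_right)
    then have "x + t *\<^sub>R (y - x) \<in> interior K" using e(2)[OF t(3)] xb by (simp add: inner_add_right)
    ultimately show False using ndis by blast
  qed
  then show "facet_normal K' F = - facet_normal K F" "facet_offset K' F = - facet_offset K F"
    using B.facet_normal_eqI[OF FK', of "- facet_normal K F" "- facet_offset K F"]
      A.facet_props(1,3)[OF F] by auto
qed

lemma neighbour_facet_measure:
  assumes "K \<in> \<T>" "K' \<in> \<T>" "K' \<noteq> K" "F facet_of K" "F facet_of K'"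
  shows "facet_measure K' F = facet_measure K F" "facet_normal K' F = - facet_normal K F"
proof -
  interpret A: full_polytope K using element_facts assms by blast
  obtain x where x: "x \<in> rel_interior F" using A.facet_nonempty assms by blast
  then have "x \<in> K'" using rel_interior_subset facet_of_imp_subset assms by blast
  note n = neighbour_facet[OF assms(1-4) x this]
  show "facet_normal K' F = - facet_normal K F" by (rule n)
  show "facet_measure K' F = facet_measure K F"
    unfolding facet_measure_def n hyp_uminus[OF A.facet_props(1)[OF assms(4)]] ..
qed

text \<open>Three elements at one facet would need three pairwise opposite unit normals.\<close>

lemma neighbour_unique:
  assumes K: "K \<in> \<T>" "F facet_of K"
    and K': "K' \<in> \<T>" "K' \<noteq> K" "F facet_of K'" and K'': "K'' \<in> \<T>" "K'' \<noteq> K" "F facet_of K''"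
  shows "K' = K''"
proof (rule ccontr)
  assume "K' \<noteq> K''"
  interpret A: full_polytope K' using element_facts K' by blast
  have "facet_normal K' F = - facet_normal K F" "facet_normal K'' F = - facet_normal K F"
    "facet_normal K'' F = - facet_normal K' F"
    using neighbour_facet_measure(2) K K' K'' \<open>K' \<noteq> K''\<close> by metis+
  then have "facet_normal K' F + facet_normal K' F = 0" by (metis add.left_inverse)
  then have "facet_normal K' F = 0" by (simp flip: scaleR_2)
  then show False using A.facet_props(1)[OF K'(3)] by simp
qed

definition has_neighbour :: "(real^'d) set \<Rightarrow> (real^'d) set \<Rightarrow> bool" where
  "has_neighbour K F \<longleftrightarrow> (\<exists>K'\<in>\<T>. K' \<noteq> K \<and> F facet_of K')"

section \<open>Traces on interior and boundary facets\<close>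

lemma at_interior_nontrivial:
  assumes "K \<in> \<T>" "x \<in> K" shows "at x within interior K \<noteq> bot"
proof (cases "x \<in> interior K")
  case True
  show ?thesis unfolding at_within_open[OF True open_interior] by (rule at_neq_bot)
next
  case False
  moreover have "x \<in> closure (interior K)" using assms(2) by (simp only: element_facts(4)[OF assms(1), symmetric])
  ultimately have "x islimpt interior K" by (simp add: closure_def)
  then show ?thesis by (simp add: trivial_limit_within)
qed

lemma inner_trace_eq:
  fixes v p :: "real^'d \<Rightarrow> 'b::t2_space"
  assumes "K \<in> \<T>" "x \<in> K" "continuous_on UNIV p" "\<And>y. y \<in> interior K \<Longrightarrow> v y = p y"
  shows "inner_trace K v x = p x"
  unfolding inner_trace_def
proof (rule tendsto_Lim[OF at_interior_nontrivial[OF assms(1,2)]])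
  have "(p \<longlongrightarrow> p x) (at x within interior K)"
    using assms(3) by (meson UNIV_I continuous_on_def subset_UNIV tendsto_within_subset)
  then show "(v \<longlongrightarrow> p x) (at x within interior K)"
    by (rule Lim_transform_eventually) (use assms(4) in \<open>auto simp: eventually_at_filter\<close>)
qed

text \<open>Near \<open>x\<close> the complement of \<open>K\<close> is the interior of the
  neighbour, so both limits are taken along the same filter.\<close>

lemma outer_trace_neighbour:
  assumes K: "K \<in> \<T>" "F facet_of K" "x \<in> rel_interior F" and K': "K' \<in> \<T>" "K' \<noteq> K" "F facet_of K'"
  shows "outer_trace K v x = inner_trace K' v x"
proof -
  have xK': "x \<in> K'" using K K' rel_interior_subset facet_of_imp_subset by blast
  note n = neighbour_facet[OF K(1) K'(1,2) K(2,3) xK']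
  obtain e where e: "e > 0" "\<And>y. y \<in> ball x e \<Longrightarrow> y \<in> K \<longleftrightarrow> facet_normal K F \<bullet> y \<le> facet_offset K F"
    using facet_halfball[OF K] by metis
  obtain e' where e': "e' > 0" "\<And>y. y \<in> ball x e' \<Longrightarrow> y \<in> interior K' \<longleftrightarrow> facet_normal K F \<bullet> y > facet_offset K F"
    using facet_halfball[OF K'(1) K'(3) K(3)] n(2,3) by (metis inner_minus_left neg_less_iff_less)
  have "at x within - K = at x within interior K'"
    by (rule at_within_nhd[of x "ball x (min e e')"]) (use e e' in \<open>auto simp: not_le\<close>)
  then show ?thesis by (simp add: outer_trace_def inner_trace_def)
qed

lemma boundary_facet_local:
  assumes K: "K \<in> \<T>" "F facet_of K" "x \<in> rel_interior F" and nb: "\<not> has_neighbour K F"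
  obtains e where "e > 0" "\<And>K'. K' \<in> \<T> \<Longrightarrow> K' \<noteq> K \<Longrightarrow> ball x e \<inter> K' = {}"
    "\<And>y. y \<in> ball x e \<Longrightarrow> y \<in> K \<longleftrightarrow> facet_normal K F \<bullet> y \<le> facet_offset K F"
proof -
  have "x \<notin> K'" if "K' \<in> \<T>" "K' \<noteq> K" for K'
    using neighbour_facet(1)[OF K(1) that K(2,3)] nb that by (auto simp: has_neighbour_def)
  moreover have "open (- \<Union>(\<T> - {K}))"
    using element_facts by (intro open_Compl closed_Union) auto
  moreover from calculation(1) have "x \<in> - \<Union>(\<T> - {K})" by blast
  ultimately obtain e where e: "e > 0" "ball x e \<subseteq> - \<Union>(\<T> - {K})"
    using open_contains_ball[of "- \<Union>(\<T> - {K})"] by blast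
  obtain e' where e': "e' > 0" "\<And>y. y \<in> ball x e' \<Longrightarrow> y \<in> K \<longleftrightarrow> facet_normal K F \<bullet> y \<le> facet_offset K F"
    using facet_halfball[OF K] by metis
  show thesis by (rule that[of "min e e'"]) (use e e' in auto)
qed

lemma outer_trace_boundary:
  fixes v :: "real^'d \<Rightarrow> real"
  assumes K: "K \<in> \<T>" "F facet_of K" "x \<in> rel_interior F" and nb: "\<not> has_neighbour K F"
    and v: "\<And>y. y \<in> off_elements \<T> \<Longrightarrow> v y = 0"
  shows "outer_trace K v x = 0"
proof -
  interpret A: full_polytope K using element_facts K by blast
  obtain e where e: "e > 0" "\<And>K'. K' \<in> \<T> \<Longrightarrow> K' \<noteq> K \<Longrightarrow> ball x e \<inter> K' = {}"
    "\<And>y. y \<in> ball x e \<Longrightarrow> y \<in> K \<longleftrightarrow> facet_normal K F \<bullet> y \<le> facet_offset K F"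
    using boundary_facet_local[OF K nb] by metis
  have v0: "v y = 0" if "y \<in> ball x e" "y \<notin> K" for y
  proof (rule v)
    have "y \<notin> interior K'" if "K' \<in> \<T>" for K'
      using e(2)[OF that] \<open>y \<in> ball x e\<close> \<open>y \<notin> K\<close> interior_subset[of K'] by (cases "K' = K") auto
    then show "y \<in> off_elements \<T>" by (auto simp: off_elements_def)
  qed
  let ?n = "facet_normal K F"
  have nn: "?n \<bullet> ?n = 1" using A.facet_props(1)[OF K(2)] by (simp add: dot_square_norm)
  have xb: "?n \<bullet> x = facet_offset K F" using A.facet_props(3)[OF K(2)] K(3) rel_interior_subset by blast
  have xK: "x \<in> K" using K rel_interior_subset facet_of_imp_subset by blast
  \<comment> \<open>Stepping from \<open>x\<close> along the outward normal leaves \<open>K\<close>.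
    This makes the filter of the outer trace nontrivial, so that the limit is determined.\<close>
  have "x islimpt - K"
    unfolding islimpt_approachable
  proof (intro allI impI)
    fix d :: real assume d: "d > 0"
    define t where "t = min d e / 2"
    have t: "t > 0" "t < d" "t < e" using d e by (auto simp: t_def)
    let ?y = "x + t *\<^sub>R ?n"
    have dy: "dist ?y x = t" using t A.facet_props(1)[OF K(2)] by (simp add: dist_norm)
    moreover have "?y \<notin> K"
      using e(3)[of ?y] xb nn t dy by (simp add: dist_commute inner_add_right)
    ultimately show "\<exists>y\<in>- K. y \<noteq> x \<and> dist y x < d"
      using t xK by (intro bexI[of _ ?y]) auto
  qed
  then have nt: "at x within - K \<noteq> bot" by (simp add: trivial_limit_within)
  have "(v \<longlongrightarrow> 0) (at x within - K)"
    by (rule Lim_transform_eventually[OF tendsto_const])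
       (use v0 e(1) in \<open>auto simp: eventually_at dist_commute intro!: exI[of _ e]\<close>)
  then show ?thesis unfolding outer_trace_def by (rule tendsto_Lim[OF nt])
qed

text \<open>Near a facet without neighbour the closed domain coincides with \<open>K\<close>, so by
  convexity the supporting half-space of \<open>K\<close> contains the whole domain. The hyperplane
  cuts out a facet \<open>G\<close> of the domain whose relative interior contains that of
  \<open>F\<close>, and almost everywhere statements pass from \<open>G\<close> to
  \<open>F\<close>.\<close>

lemma AE_boundary_facet:
  assumes K: "K \<in> \<T>" "F facet_of K" and nb: "\<not> has_neighbour K F"
    and P: "AE x in surface_measure (closure \<Omega>). P x"
  shows "AE x in facet_measure K F. P x"
    and "x \<in> rel_interior F \<Longrightarrow> outward_normal (closure \<Omega>) x = facet_normal K F"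
proof -
  interpret A: full_polytope K using element_facts K by blast
  interpret D: full_polytope "closure \<Omega>" by (rule domain_facts)
  let ?n = "facet_normal K F" and ?b = "facet_offset K F"
  obtain x where x: "x \<in> rel_interior F" using A.facet_nonempty[OF K(2)] by blast
  obtain e where e: "e > 0" "\<And>K'. K' \<in> \<T> \<Longrightarrow> K' \<noteq> K \<Longrightarrow> ball x e \<inter> K' = {}"
    "\<And>y. y \<in> ball x e \<Longrightarrow> y \<in> K \<longleftrightarrow> ?n \<bullet> y \<le> ?b"
    using boundary_facet_local[OF K x nb] by metis
  have K\<Omega>: "K \<subseteq> closure \<Omega>" using K cover by blast
  have FK: "F \<subseteq> K" using K facet_of_imp_subset by blast
  have xF: "x \<in> F" using x rel_interior_subset by blast
  have xb: "?n \<bullet> x = ?b" using A.facet_props(3)[OF K(2) xF] .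
  have half: "?n \<bullet> y \<le> ?b" if "y \<in> closure \<Omega>" for y
  proof (rule ccontr)
    assume "\<not> ?n \<bullet> y \<le> ?b"
    obtain t where t: "0 < t" "t \<le> 1" "x + t *\<^sub>R (y - x) \<in> ball x e" using segment_in_ball[OF e(1)] by blast
    have "x + t *\<^sub>R (y - x) = (1 - t) *\<^sub>R x + t *\<^sub>R y" by (simp add: algebra_simps)
    then have "x + t *\<^sub>R (y - x) \<in> closure \<Omega>"
      using D.convex K\<Omega> FK xF that t by (simp add: convexD subsetD)
    then have "x + t *\<^sub>R (y - x) \<in> K" using e(2) t(3) cover by blast
    then have "?n \<bullet> (x + t *\<^sub>R (y - x)) \<le> ?b" using e(3)[OF t(3)] by simp
    then have "t * (?n \<bullet> (y - x)) \<le> 0" using xb by (simp add: inner_add_right)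
    then show False using t(1) xb \<open>\<not> ?n \<bullet> y \<le> ?b\<close> by (simp add: mult_le_0_iff inner_diff_right)
  qed
  define G where "G = closure \<Omega> \<inter> {y. ?n \<bullet> y = ?b}"
  have n0: "?n \<noteq> 0" using A.facet_props(1)[OF K(2)] by auto
  have FG: "F \<subseteq> G" using FK K\<Omega> A.facet_props(3)[OF K(2)] by (auto simp: G_def)
  have Gf: "G face_of closure \<Omega>"
    unfolding G_def by (rule face_of_Int_supporting_hyperplane_le[OF D.convex half])
  have dF: "aff_dim F = int CARD('d) - 1" using K aff_dim_element by (simp add: facet_of_def)
  have d\<Omega>: "aff_dim (closure \<Omega>) = CARD('d)" using aff_dim_nonempty_interior[OF D.int] by simp
  have "aff_dim G \<le> aff_dim {y. ?n \<bullet> y = ?b}" unfolding G_def by (intro aff_dim_subset) auto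
  then have dG: "aff_dim G = aff_dim F"
    using aff_dim_subset[OF FG] dF n0 by (simp add: aff_dim_hyperplane)
  have Gfacet: "G facet_of closure \<Omega>" using Gf dG dF d\<Omega> xF FG by (auto simp: facet_of_def)
  \<comment> \<open>Inclusion passes to relative interiors when the affine hulls agree; equal
    dimension provides this.\<close>
  have "affine hull F = affine hull G"
    by (rule affine_dim_equal) (use xF dG FG in \<open>auto simp: aff_dim_affine_hull intro: hull_mono[THEN subsetD] hull_inc\<close>)
  then have relint: "rel_interior F \<subseteq> rel_interior G" using FG subset_rel_interior by blast
  have nG: "facet_normal (closure \<Omega>) G = ?n" "facet_offset (closure \<Omega>) G = ?b"
    using D.facet_normal_eqI[OF Gfacet A.facet_props(1)[OF K(2)], of ?b] half by (auto simp: G_def)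
  show "x \<in> rel_interior F \<Longrightarrow> outward_normal (closure \<Omega>) x = facet_normal K F" for x
    using D.facet_props(5)[OF Gfacet, of x] relint nG by auto
  have "AE x in facet_measure (closure \<Omega>) G. P x" by (rule D.AE_surface_measureD[OF P Gfacet])
  then show "AE x in facet_measure K F. P x"
    unfolding facet_measure_def nG using relint
    by (subst (asm) AE_density, use D.rel_interior_facet_borel[OF Gfacet] in simp,
        subst AE_density, use A.rel_interior_facet_borel[OF K(2)] in simp)
       (auto elim!: eventually_mono simp: indicator_def split: if_splits)
qed

end

section \<open>Piecewise smooth functions\<close>

lemma square_integrable_lincomb:
  assumes "square_integrable \<Omega> f" "square_integrable \<Omega> g"
  shows "square_integrable \<Omega> (\<lambda>x. a *\<^sub>R f x + b *\<^sub>R g x)"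
proof -
  have m [measurable]: "f \<in> borel_measurable (lebesgue_on \<Omega>)" "g \<in> borel_measurable (lebesgue_on \<Omega>)"
    and i: "integrable (lebesgue_on \<Omega>) (\<lambda>x. (norm (f x))\<^sup>2)" "integrable (lebesgue_on \<Omega>) (\<lambda>x. (norm (g x))\<^sup>2)"
    using assms by (auto simp: square_integrable_def)
  have "(norm (a *\<^sub>R f x + b *\<^sub>R g x))\<^sup>2 \<le> 2 * a\<^sup>2 * (norm (f x))\<^sup>2 + 2 * b\<^sup>2 * (norm (g x))\<^sup>2" for x
  proof -
    have "(norm (a *\<^sub>R f x + b *\<^sub>R g x))\<^sup>2 \<le> (\<bar>a\<bar> * norm (f x) + \<bar>b\<bar> * norm (g x))\<^sup>2"
      by (intro power_mono norm_triangle_le) auto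
    also have "\<dots> \<le> 2 * (\<bar>a\<bar> * norm (f x))\<^sup>2 + 2 * (\<bar>b\<bar> * norm (g x))\<^sup>2"
      using sum_squares_bound[of "\<bar>a\<bar> * norm (f x)" "\<bar>b\<bar> * norm (g x)"] by (simp add: power2_sum)
    finally show ?thesis by (simp add: power_mult_distrib)
  qed
  then have "integrable (lebesgue_on \<Omega>) (\<lambda>x. (norm (a *\<^sub>R f x + b *\<^sub>R g x))\<^sup>2)"
    using i by (intro Bochner_Integration.integrable_bound[OF Bochner_Integration.integrable_add[OF
        integrable_mult_right[OF i(1), of "2 * a\<^sup>2"] integrable_mult_right[OF i(2), of "2 * b\<^sup>2"]]]) auto
  then show ?thesis by (simp add: square_integrable_def)
qed

lemma square_integrable_inner:
  assumes "square_integrable \<Omega> f" "square_integrable \<Omega> g"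
  shows "integrable (lebesgue_on \<Omega>) (\<lambda>x. f x \<bullet> g x)"
proof -
  have m [measurable]: "f \<in> borel_measurable (lebesgue_on \<Omega>)" "g \<in> borel_measurable (lebesgue_on \<Omega>)"
    and i: "integrable (lebesgue_on \<Omega>) (\<lambda>x. (norm (f x))\<^sup>2)" "integrable (lebesgue_on \<Omega>) (\<lambda>x. (norm (g x))\<^sup>2)"
    using assms by (auto simp: square_integrable_def)
  have "\<bar>f x \<bullet> g x\<bar> \<le> (norm (f x))\<^sup>2 + (norm (g x))\<^sup>2" for x
    using Cauchy_Schwarz_ineq2[of "f x" "g x"] sum_squares_bound[of "norm (f x)" "norm (g x)"]
      zero_le_power2[of "norm (f x)"] zero_le_power2[of "norm (g x)"] by linarith
  then show ?thesis
    by (intro Bochner_Integration.integrable_bound[OF Bochner_Integration.integrable_add[OF i]]) auto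
qed

lemma L2_inner_lincomb_left:
  assumes "square_integrable \<Omega> f" "square_integrable \<Omega> g" "square_integrable \<Omega> h"
  shows "L2_inner \<Omega> (\<lambda>x. a *\<^sub>R f x + b *\<^sub>R g x) h = a * L2_inner \<Omega> f h + b * L2_inner \<Omega> g h"
  using square_integrable_inner[OF assms(1,3)] square_integrable_inner[OF assms(2,3)]
  by (simp add: L2_inner_def inner_add_left)

lemma L2_inner_commute: "L2_inner \<Omega> f g = L2_inner \<Omega> g f"
  by (simp add: L2_inner_def inner_commute)

lemma L2_inner_lincomb_right:
  assumes "square_integrable \<Omega> f" "square_integrable \<Omega> g" "square_integrable \<Omega> h"
  shows "L2_inner \<Omega> h (\<lambda>x. a *\<^sub>R f x + b *\<^sub>R g x) = a * L2_inner \<Omega> h f + b * L2_inner \<Omega> h g"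
  using L2_inner_lincomb_left[OF assms] by (simp add: L2_inner_commute[of \<Omega> h])

lemma frechet_interior:
  assumes "C1 g" "\<And>y. y \<in> interior K \<Longrightarrow> f y = g y" "x \<in> interior K"
  shows "(f has_derivative frechet_derivative g (at x)) (at x)"
    and "frechet_derivative f (at x) = frechet_derivative g (at x)"
proof -
  show 1: "(f has_derivative frechet_derivative g (at x)) (at x)"
    by (rule has_derivative_transform_within_open[OF C1_has_derivative[OF assms(1)] open_interior assms(3)])
       (use assms(2) in simp)
  show "frechet_derivative f (at x) = frechet_derivative g (at x)" by (rule frechet_eqI[OF 1])
qed

context mesh
begin

text \<open>The witnesses are continuous on the whole space, hence bounded on the compact elements,
  which yields integrability over the interiors.\<close>

definition pw_cont :: "(real^'d \<Rightarrow> real) \<Rightarrow> bool" where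
  "pw_cont f \<longleftrightarrow> (\<forall>K\<in>\<T>. \<exists>g. continuous_on UNIV g \<and> (\<forall>x\<in>interior K. f x = g x))"

definition pw_C1 :: "(real^'d \<Rightarrow> real) \<Rightarrow> bool" where
  "pw_C1 f \<longleftrightarrow> (\<forall>K\<in>\<T>. \<exists>g. C1 g \<and> (\<forall>x\<in>interior K. f x = g x))"

lemma pw_contI: "(\<And>K. K \<in> \<T> \<Longrightarrow> \<exists>g. continuous_on UNIV g \<and> (\<forall>x\<in>interior K. f x = g x)) \<Longrightarrow> pw_cont f"
  and pw_contE: "pw_cont f \<Longrightarrow> K \<in> \<T> \<Longrightarrow> (\<And>g. continuous_on UNIV g \<Longrightarrow> (\<And>x. x \<in> interior K \<Longrightarrow> f x = g x) \<Longrightarrow> P) \<Longrightarrow> P"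
  and pw_C1I: "(\<And>K. K \<in> \<T> \<Longrightarrow> \<exists>g. C1 g \<and> (\<forall>x\<in>interior K. f x = g x)) \<Longrightarrow> pw_C1 f"
  and pw_C1E: "pw_C1 f \<Longrightarrow> K \<in> \<T> \<Longrightarrow> (\<And>g. C1 g \<Longrightarrow> (\<And>x. x \<in> interior K \<Longrightarrow> f x = g x) \<Longrightarrow> P) \<Longrightarrow> P"
  by (auto simp: pw_cont_def pw_C1_def)

lemma pw_cont_compose:
  assumes "pw_cont f" "continuous_on UNIV h" shows "pw_cont (\<lambda>x. h (f x))"
proof (rule pw_contI)
  fix K assume K: "K \<in> \<T>"
  obtain g where g: "continuous_on UNIV g" "\<And>x. x \<in> interior K \<Longrightarrow> f x = g x"
    using pw_contE[OF assms(1) K] by blast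
  show "\<exists>g. continuous_on UNIV g \<and> (\<forall>x\<in>interior K. h (f x) = g x)"
    by (rule exI[of _ "\<lambda>x. h (g x)"]) (use g assms(2) in \<open>auto intro: continuous_on_compose2\<close>)
qed

lemma pw_cont_add [intro]:
  assumes "pw_cont f" "pw_cont f'" shows "pw_cont (\<lambda>x. f x + f' x)"
proof (rule pw_contI)
  fix K assume K: "K \<in> \<T>"
  obtain g where g: "continuous_on UNIV g" "\<And>x. x \<in> interior K \<Longrightarrow> f x = g x"
    using pw_contE[OF assms(1) K] by blast
  obtain g' where g': "continuous_on UNIV g'" "\<And>x. x \<in> interior K \<Longrightarrow> f' x = g' x"
    using pw_contE[OF assms(2) K] by blast
  show "\<exists>g. continuous_on UNIV g \<and> (\<forall>x\<in>interior K. f x + f' x = g x)"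
    by (rule exI[of _ "\<lambda>x. g x + g' x"]) (use g g' in \<open>auto intro: continuous_intros\<close>)
qed

lemma pw_cont_mult [intro]:
  assumes "pw_cont f" "pw_cont f'" shows "pw_cont (\<lambda>x. f x * f' x)"
proof (rule pw_contI)
  fix K assume K: "K \<in> \<T>"
  obtain g where g: "continuous_on UNIV g" "\<And>x. x \<in> interior K \<Longrightarrow> f x = g x"
    using pw_contE[OF assms(1) K] by blast
  obtain g' where g': "continuous_on UNIV g'" "\<And>x. x \<in> interior K \<Longrightarrow> f' x = g' x"
    using pw_contE[OF assms(2) K] by blast
  show "\<exists>g. continuous_on UNIV g \<and> (\<forall>x\<in>interior K. f x * f' x = g x)"
    by (rule exI[of _ "\<lambda>x. g x * g' x"]) (use g g' in \<open>auto intro: continuous_intros\<close>)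
qed

lemma pw_cont_const [simp, intro]: "pw_cont (\<lambda>x. c)"
  by (rule pw_contI) (auto intro: exI[of _ "\<lambda>x. c"])

lemma pw_cont_continuous: "continuous_on UNIV f \<Longrightarrow> pw_cont f"
  by (rule pw_contI) blast

lemma pw_cont_diff [intro]: "pw_cont f \<Longrightarrow> pw_cont g \<Longrightarrow> pw_cont (\<lambda>x. f x - g x)"
  using pw_cont_add[OF _ pw_cont_mult[OF pw_cont_const, of g "-1"], of f] by simp

lemma pw_cont_divide [intro]: "pw_cont f \<Longrightarrow> pw_cont (\<lambda>x. f x / c)"
  using pw_cont_mult[OF _ pw_cont_const, of f "inverse c"] by (simp add: divide_inverse)

lemma pw_cont_sum [intro]: "(\<And>i. i \<in> I \<Longrightarrow> pw_cont (f i)) \<Longrightarrow> pw_cont (\<lambda>x. \<Sum>i\<in>I. f i x)"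
  by (induction I rule: infinite_finite_induct) auto

lemma pw_cont_cong:
  assumes "pw_cont f" "\<And>K x. K \<in> \<T> \<Longrightarrow> x \<in> interior K \<Longrightarrow> f x = g x" shows "pw_cont g"
proof (rule pw_contI)
  fix K assume K: "K \<in> \<T>"
  obtain h where h: "continuous_on UNIV h" "\<And>x. x \<in> interior K \<Longrightarrow> f x = h x"
    using pw_contE[OF assms(1) K] by blast
  show "\<exists>h. continuous_on UNIV h \<and> (\<forall>x\<in>interior K. g x = h x)"
    using h assms(2)[OF K] by (intro exI[of _ h]) simp
qed

lemma pw_C1_imp_cont: "pw_C1 f \<Longrightarrow> pw_cont f"
  unfolding pw_cont_def pw_C1_def using C1_continuous by blast

lemma pw_C1_const [simp, intro]: "pw_C1 (\<lambda>x. c)"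
  by (rule pw_C1I) (auto intro: exI[of _ "\<lambda>x. c"])

lemma pw_C1_C1: "C1 f \<Longrightarrow> pw_C1 f"
  by (rule pw_C1I) blast

lemma pw_C1_add [intro]:
  assumes "pw_C1 f" "pw_C1 f'" shows "pw_C1 (\<lambda>x. f x + f' x)"
proof (rule pw_C1I)
  fix K assume K: "K \<in> \<T>"
  obtain g where g: "C1 g" "\<And>x. x \<in> interior K \<Longrightarrow> f x = g x"
    using pw_C1E[OF assms(1) K] by blast
  obtain g' where g': "C1 g'" "\<And>x. x \<in> interior K \<Longrightarrow> f' x = g' x"
    using pw_C1E[OF assms(2) K] by blast
  show "\<exists>g. C1 g \<and> (\<forall>x\<in>interior K. f x + f' x = g x)"
    by (rule exI[of _ "\<lambda>x. g x + g' x"]) (use g g' in auto)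
qed

lemma pw_C1_mult [intro]:
  assumes "pw_C1 f" "pw_C1 f'" shows "pw_C1 (\<lambda>x. f x * f' x)"
proof (rule pw_C1I)
  fix K assume K: "K \<in> \<T>"
  obtain g where g: "C1 g" "\<And>x. x \<in> interior K \<Longrightarrow> f x = g x"
    using pw_C1E[OF assms(1) K] by blast
  obtain g' where g': "C1 g'" "\<And>x. x \<in> interior K \<Longrightarrow> f' x = g' x"
    using pw_C1E[OF assms(2) K] by blast
  show "\<exists>g. C1 g \<and> (\<forall>x\<in>interior K. f x * f' x = g x)"
    by (rule exI[of _ "\<lambda>x. g x * g' x"]) (use g g' in auto)
qed

lemma pw_C1_sum [intro]: "(\<And>i. i \<in> I \<Longrightarrow> pw_C1 (f i)) \<Longrightarrow> pw_C1 (\<lambda>x. \<Sum>i\<in>I. f i x)"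
  by (induction I rule: infinite_finite_induct) auto

lemma pw_C1_frechet: assumes "pw_C1 f" shows "pw_cont (\<lambda>x. frechet_derivative f (at x) v)"
proof (rule pw_contI)
  fix K assume K: "K \<in> \<T>"
  obtain g where g: "C1 g" "\<And>x. x \<in> interior K \<Longrightarrow> f x = g x"
    using pw_C1E[OF assms K] by blast
  show "\<exists>g. continuous_on UNIV g \<and> (\<forall>x\<in>interior K. frechet_derivative f (at x) v = g x)"
    by (rule exI[of _ "\<lambda>x. frechet_derivative g (at x) v"])
       (use frechet_interior(2)[OF g] C1_cont_deriv[OF g(1)] in auto)
qed

lemma pw_C1_differentiable:
  assumes "pw_C1 f" "K \<in> \<T>" "x \<in> interior K"
  shows "(f has_derivative frechet_derivative f (at x)) (at x)"
proof -
  obtain g where g: "C1 g" "\<And>x. x \<in> interior K \<Longrightarrow> f x = g x"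
    using pw_C1E[OF assms(1,2)] by blast
  show ?thesis using frechet_interior[OF g assms(3)] by simp
qed

lemma pw_C1_grad: "pw_C1 f \<Longrightarrow> pw_cont (\<lambda>x. grad f x $ i)"
  using pw_C1_frechet[of f "axis i 1"] by (simp add: grad_nth)

section \<open>Elementwise integration\<close>

abbreviation II :: "(real^'d \<Rightarrow> real) \<Rightarrow> real" where
  "II f \<equiv> (LINT x|lebesgue_on \<Omega>. f x)"

lemma interior_unique: "K \<in> \<T> \<Longrightarrow> K' \<in> \<T> \<Longrightarrow> x \<in> interior K \<Longrightarrow> x \<in> interior K' \<Longrightarrow> K = K'"
  using interior_disjoint interior_subset by blast

lemma sum_elements:
  fixes g :: "(real^'d) set \<Rightarrow> 'b::real_vector"
  assumes "K \<in> \<T>" "x \<in> interior K"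
  shows "(\<Sum>K'\<in>\<T>. indicator (interior K') x *\<^sub>R g K') = g K"
proof -
  have "(\<Sum>K'\<in>\<T>. indicator (interior K') x *\<^sub>R g K') = (\<Sum>K'\<in>\<T>. if K' = K then g K else 0)"
  proof (intro sum.cong refl)
    fix K' assume "K' \<in> \<T>"
    then have "x \<notin> interior K'" if "K' \<noteq> K" using that interior_unique assms by blast
    then show "indicator (interior K') x *\<^sub>R g K' = (if K' = K then g K else 0)"
      using assms(2) by (cases "K' = K") simp_all
  qed
  then show ?thesis using assms(1) by simp
qed

lemma integrable_element:
  assumes f: "pw_cont f" and K: "K \<in> \<T>"
  shows "integrable lborel (\<lambda>z. indicator (interior K) z * f z)"
proof -
  obtain g where g: "continuous_on UNIV g" "\<And>x. x \<in> interior K \<Longrightarrow> f x = g x"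
    using pw_contE[OF f K] by blast
  obtain C where "simplex_element K C" using element K by blast
  then interpret simplex_element K C .
  have "(\<lambda>z. indicator (interior K) z * f z) = (\<lambda>z. indicator (interior K) z * g z)"
    using g(2) by (auto simp: indicator_def)
  then show ?thesis using integrable_indicator_interior[OF g(1)] by simp
qed

lemma AE_elements: "AE x in lebesgue. x \<in> \<Omega> \<longrightarrow> (\<exists>K\<in>\<T>. x \<in> interior K)"
proof -
  have "negligible (\<Union>K\<in>\<T>. frontier K)"
    using negligible_convex_frontier element_facts by (intro negligible_Union) auto
  then have "AE x in lebesgue. x \<notin> (\<Union>K\<in>\<T>. frontier K)"
    unfolding negligible_iff_null_sets by (rule AE_not_in)
  then show ?thesis
  proof eventually_elim
    case (elim x)
    show ?case
    proof
      assume "x \<in> \<Omega>"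
      then have "x \<in> \<Union>\<T>" using cover closure_subset by blast
      then obtain K where K: "K \<in> \<T>" "x \<in> K" by blast
      then show "\<exists>K\<in>\<T>. x \<in> interior K"
        using elim element_facts(2)[OF K(1)] by (auto simp: frontier_def)
    qed
  qed
qed

text \<open>On the element boundaries, which form a null set, \<open>f\<close> is arbitrary; its
  measurability is inherited from the Borel function \<open>h\<close> through completeness of the
  Lebesgue measure.\<close>

lemma pw_integral:
  assumes f: "pw_cont f"
  shows "integrable (lebesgue_on \<Omega>) f" and "II f = (\<Sum>K\<in>\<T>. int_on K f)"
proof -
  define h where "h x = (\<Sum>K\<in>\<T>. indicator (interior K) x * f x)" for x
  have i: "integrable lborel h"
    unfolding h_def by (intro Bochner_Integration.integrable_sum integrable_element[OF f])
  then have m: "h \<in> borel_measurable lborel" by simp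
  have i': "integrable lebesgue h" using i m by (simp add: integrable_completion)
  have \<Omega>: "\<Omega> \<in> sets lebesgue" using domain_facts by auto
  have ae: "AE x in lebesgue. h x = indicator \<Omega> x *\<^sub>R f x"
    using AE_elements
  proof eventually_elim
    case (elim x)
    show ?case
    proof (cases "x \<in> \<Omega>")
      case True
      then obtain K where "K \<in> \<T>" "x \<in> interior K" using elim by blast
      then show ?thesis using sum_elements[of K x "\<lambda>_. f x"] True by (simp add: h_def)
    next
      case False
      then have "indicator (interior K) x = (0::real)" if "K \<in> \<T>" for K
        using interior_in_domain[OF that] False by (auto simp: indicator_def)
      then show ?thesis using False by (simp add: h_def)
    qed
  qed
  have m': "(\<lambda>x. indicator \<Omega> x *\<^sub>R f x) \<in> borel_measurable lebesgue"
    by (rule completion.measurable_AE_eq[OF _ ae]) (use i' in auto)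
  have "integrable lebesgue (\<lambda>x. indicator \<Omega> x *\<^sub>R f x)"
    using integrable_cong_AE[OF _ m' ae] i' by auto
  then show "integrable (lebesgue_on \<Omega>) f"
    using \<Omega> by (simp add: integrable_restrict_space)
  have "II f = (LINT x|lebesgue. indicator \<Omega> x *\<^sub>R f x)"
    using \<Omega> by (simp add: integral_restrict_space)
  also have "\<dots> = (LINT x|lebesgue. h x)"
    by (rule integral_cong_AE[symmetric, OF _ m' ae]) (use i' in auto)
  also have "\<dots> = (LINT x|lborel. h x)" by (rule integral_completion[OF m])
  also have "\<dots> = (\<Sum>K\<in>\<T>. int_on K f)"
    unfolding h_def int_on_def by (rule Bochner_Integration.integral_sum) (rule integrable_element[OF f])
  finally show "II f = (\<Sum>K\<in>\<T>. int_on K f)" .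
qed

lemma II_lincomb: "pw_cont f \<Longrightarrow> pw_cont g \<Longrightarrow> II (\<lambda>x. a * f x + b * g x) = a * II f + b * II g"
  using pw_integral(1)[of f] pw_integral(1)[of g] by simp

lemma int_on_cong: "(\<And>x. x \<in> interior K \<Longrightarrow> f x = g x) \<Longrightarrow> int_on K f = int_on K g"
  unfolding int_on_def by (intro Bochner_Integration.integral_cong) (auto simp: indicator_def)

lemma II_cong:
  assumes "pw_cont f" "\<And>K x. K \<in> \<T> \<Longrightarrow> x \<in> interior K \<Longrightarrow> f x = g x"
  shows "II f = II g"
proof -
  have g: "pw_cont g" by (rule pw_cont_cong[OF assms])
  show ?thesis unfolding pw_integral(2)[OF assms(1)] pw_integral(2)[OF g]
    by (intro sum.cong int_on_cong refl assms(2))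
qed

lemma II_mono:
  assumes f: "pw_cont f" and g: "pw_cont g" and "\<And>K x. K \<in> \<T> \<Longrightarrow> x \<in> interior K \<Longrightarrow> f x \<le> g x"
  shows "II f \<le> II g"
  unfolding pw_integral(2)[OF f] pw_integral(2)[OF g] int_on_def
  by (intro sum_mono integral_mono integrable_element f g) (use assms(3) in \<open>auto simp: indicator_def\<close>)

lemma II_zero:
  assumes f: "pw_cont f" and nn: "\<And>K x. K \<in> \<T> \<Longrightarrow> x \<in> interior K \<Longrightarrow> 0 \<le> f x"
    and z: "II f = 0" and K: "K \<in> \<T>" "x \<in> interior K"
  shows "f x = 0"
proof -
  have "0 \<le> int_on K f" if "K \<in> \<T>" for K
    unfolding int_on_def using nn[OF that] by (intro integral_nonneg_AE) (auto simp: indicator_def)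
  then have z0: "int_on K f = 0"
    using z K(1) by (simp add: pw_integral(2)[OF f] sum_nonneg_eq_0_iff)
  obtain g where g: "continuous_on UNIV g" "\<And>x. x \<in> interior K \<Longrightarrow> f x = g x"
    using pw_contE[OF f K(1)] by blast
  obtain C where "simplex_element K C" using element K by blast
  then interpret simplex_element K C .
  have "g x = 0"
    by (rule continuous_integral_zero[OF g(1) integrable_indicator_interior[OF g(1)] _ _ K(2)])
       (use nn[OF K(1)] g z0 int_on_cong[of K f g] in auto)
  then show ?thesis using g(2)[OF K(2)] by simp
qed

lemma pw_cont_square_integrable:
  fixes v :: "real^'d \<Rightarrow> real" assumes "pw_cont v" shows "square_integrable \<Omega> v"
  unfolding square_integrable_def
proof
  show "v \<in> borel_measurable (lebesgue_on \<Omega>)" using pw_integral(1)[OF assms] by simp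
  have "pw_cont (\<lambda>x. v x * v x)" using assms by blast
  from pw_integral(1)[OF this] show "integrable (lebesgue_on \<Omega>) (\<lambda>x. (norm (v x))\<^sup>2)"
    by (simp add: power2_eq_square)
qed

lemma pw_cont_square_integrable_vec:
  fixes v :: "real^'d \<Rightarrow> real^'d" assumes v: "\<And>i. pw_cont (\<lambda>x. v x $ i)" shows "square_integrable \<Omega> v"
  unfolding square_integrable_def
proof
  have "(\<lambda>x. v x \<bullet> b) \<in> borel_measurable (lebesgue_on \<Omega>)" if "b \<in> Basis" for b
  proof -
    obtain i where "b = axis i 1" using \<open>b \<in> Basis\<close> by (auto simp: Basis_vec_def)
    then show ?thesis using pw_integral(1)[OF v[of i]] by (simp add: inner_axis)
  qed
  then show "v \<in> borel_measurable (lebesgue_on \<Omega>)"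
    using borel_measurable_euclidean_space by blast
  have "pw_cont (\<lambda>x. \<Sum>i\<in>UNIV. v x $ i * v x $ i)" using v by (intro pw_cont_sum pw_cont_mult)
  from pw_integral(1)[OF this] show "integrable (lebesgue_on \<Omega>) (\<lambda>x. (norm (v x))\<^sup>2)"
    by (simp add: power2_norm_eq_inner inner_vec_def)
qed

end

section \<open>The finite element spaces\<close>

lemma fin_dim_vec:
  fixes W :: "('a \<Rightarrow> real) set"
  assumes "fin_dim W"
  shows "fin_dim {v :: 'a \<Rightarrow> real^'d. \<forall>i. (\<lambda>x. v x $ i) \<in> W}"
proof -
  let ?L = "\<lambda>i f x. f x *\<^sub>R axis i (1::real)"
  have "fin_dim {\<lambda>x. \<Sum>i\<in>UNIV. f i x | f :: 'd \<Rightarrow> 'a \<Rightarrow> real^'d. \<forall>i\<in>UNIV. f i \<in> ?L i ` W}"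
    by (intro fin_dim_sum_family fin_dim_image[OF assms]) (auto intro!: linearI simp: scaleR_add_left)
  moreover have "{v :: 'a \<Rightarrow> real^'d. \<forall>i. (\<lambda>x. v x $ i) \<in> W}
    \<subseteq> {\<lambda>x. \<Sum>i\<in>UNIV. f i x | f :: 'd \<Rightarrow> 'a \<Rightarrow> real^'d. \<forall>i\<in>UNIV. f i \<in> ?L i ` W}"
  proof clarify
    fix v :: "'a \<Rightarrow> real^'d" assume v: "\<forall>i. (\<lambda>x. v x $ i) \<in> W"
    have "v = (\<lambda>x. \<Sum>i\<in>UNIV. v x $ i *\<^sub>R axis i 1)"
      by (simp add: fun_eq_iff basis_expansion flip: scalar_mult_eq_scaleR)
    then show "\<exists>f. v = (\<lambda>x. \<Sum>i\<in>UNIV. f i x) \<and> (\<forall>i\<in>UNIV. f i \<in> ?L i ` W)"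
      using v by (intro exI[of _ "\<lambda>i x. v x $ i *\<^sub>R axis i 1"]) auto
  qed
  ultimately show ?thesis using fin_dim_subset by blast
qed

lemma poly_fun_0: "poly_fun r (\<lambda>x. 0)"
  unfolding poly_fun_def by (intro exI[of _ "\<lambda>\<alpha>. 0"]) simp

lemma poly_fun_lincomb:
  assumes "poly_fun r p" "poly_fun r q" shows "poly_fun r (\<lambda>x. a * p x + b * q x)"
proof -
  obtain c d where "p = (\<lambda>x. \<Sum>\<alpha> | sum \<alpha> UNIV \<le> r. c \<alpha> * (\<Prod>i\<in>UNIV. (x $ i) ^ \<alpha> i))"
    "q = (\<lambda>x. \<Sum>\<alpha> | sum \<alpha> UNIV \<le> r. d \<alpha> * (\<Prod>i\<in>UNIV. (x $ i) ^ \<alpha> i))"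
    using assms unfolding poly_fun_def by blast
  then show ?thesis unfolding poly_fun_def
    by (intro exI[of _ "\<lambda>\<alpha>. a * c \<alpha> + b * d \<alpha>"])
       (simp add: fun_eq_iff sum_distrib_left sum.distrib algebra_simps)
qed

lemma finite_multi_indices: "finite {\<alpha> :: 'd::finite \<Rightarrow> nat. sum \<alpha> UNIV \<le> r}"
proof (rule finite_subset)
  show "finite (PiE (UNIV :: 'd set) (\<lambda>_. {..r}))" by (intro finite_PiE) auto
  have "\<alpha> i \<le> r" if "sum \<alpha> UNIV \<le> r" for \<alpha> :: "'d \<Rightarrow> nat" and i
    using member_le_sum[of i UNIV \<alpha>] that by simp
  then show "{\<alpha> :: 'd \<Rightarrow> nat. sum \<alpha> UNIV \<le> r} \<subseteq> PiE UNIV (\<lambda>_. {..r})" by auto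
qed

lemma fin_dim_poly_fun: "fin_dim {p :: real^'d \<Rightarrow> real. poly_fun r p}"
  by (rule fin_dim_subset[OF _ fin_dim_finite_sums[OF finite_multi_indices[of r],
        where f="\<lambda>\<alpha> x. \<Prod>i\<in>UNIV. (x $ i) ^ \<alpha> i"]])
     (auto simp: poly_fun_def)

lemma lin_closed_Int: "lin_closed V \<Longrightarrow> lin_closed W \<Longrightarrow> lin_closed (V \<inter> W)"
  by (auto simp: lin_closed_def)

lemma lin_closed_PdG: "lin_closed (PdG r \<T>)"
  unfolding lin_closed_def PdG_def
proof safe
  fix f g a b K
  assume "\<forall>K\<in>\<T>. \<exists>p. poly_fun r p \<and> (\<forall>x\<in>interior K. f x = p x)"
    "\<forall>K\<in>\<T>. \<exists>p. poly_fun r p \<and> (\<forall>x\<in>interior K. g x = p x)" "K \<in> \<T>"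
  then obtain p q where "poly_fun r p" "\<forall>x\<in>interior K. f x = p x" "poly_fun r q" "\<forall>x\<in>interior K. g x = q x"
    by blast
  then show "\<exists>p. poly_fun r p \<and> (\<forall>x\<in>interior K. a *\<^sub>R f x + b *\<^sub>R g x = p x)"
    by (intro exI[of _ "\<lambda>x. a * p x + b * q x"]) (auto intro: poly_fun_lincomb)
qed (auto intro: poly_fun_0)

lemma square_integrable_0 [simp]: "square_integrable \<Omega> (\<lambda>x. 0)"
  by (simp add: square_integrable_def)

lemma square_integrable_nth:
  fixes g :: "real^'d \<Rightarrow> real^'n"
  assumes "square_integrable \<Omega> g" shows "square_integrable \<Omega> (\<lambda>x. g x $ i)"
proof -
  have g [measurable]: "g \<in> borel_measurable (lebesgue_on \<Omega>)" and i: "integrable (lebesgue_on \<Omega>) (\<lambda>x. (norm (g x))\<^sup>2)"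
    using assms by (auto simp: square_integrable_def)
  have "(\<lambda>x. g x \<bullet> axis i 1) \<in> borel_measurable (lebesgue_on \<Omega>)" by measurable
  then have m [measurable]: "(\<lambda>x. g x $ i) \<in> borel_measurable (lebesgue_on \<Omega>)" by (simp add: inner_axis)
  have "(g x $ i)\<^sup>2 \<le> (norm (g x))\<^sup>2" for x
    using component_le_norm_cart[of "g x" i] power_mono[of "\<bar>g x $ i\<bar>" "norm (g x)" 2] by simp
  then have "integrable (lebesgue_on \<Omega>) (\<lambda>x. (g x $ i)\<^sup>2)"
    by (intro Bochner_Integration.integrable_bound[OF i]) auto
  then show ?thesis using m by (simp add: square_integrable_def)
qed

lemma L2_inner_zero [simp]: "L2_inner \<Omega> (\<lambda>x. 0) g = 0"
  by (simp add: L2_inner_def)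

context mesh
begin

text \<open>A function that vanishes off the elements is the sum of its restrictions, each an
  indicator times a member of a finite-dimensional local space.\<close>

lemma fin_dim_piecewise:
  fixes V :: "(real^'d \<Rightarrow> 'b::real_vector) set"
  assumes W: "\<And>K. K \<in> \<T> \<Longrightarrow> fin_dim (W K)"
    and loc: "\<And>v K. v \<in> V \<Longrightarrow> K \<in> \<T> \<Longrightarrow> \<exists>w\<in>W K. \<forall>x\<in>interior K. v x = w x"
    and off: "\<And>v x. v \<in> V \<Longrightarrow> x \<in> off_elements \<T> \<Longrightarrow> v x = 0"
  shows "fin_dim V"
proof -
  let ?L = "\<lambda>K f x. indicator (interior K) x *\<^sub>R f x :: 'b"
  have "fin_dim {\<lambda>x. \<Sum>K\<in>\<T>. f K x | f. \<forall>K\<in>\<T>. f K \<in> ?L K ` W K}"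
    by (intro fin_dim_sum_family fin_dim_image W) (auto intro!: linearI simp: scaleR_add_right)
  moreover have "V \<subseteq> {\<lambda>x. \<Sum>K\<in>\<T>. f K x | f. \<forall>K\<in>\<T>. f K \<in> ?L K ` W K}"
  proof
    fix v assume v: "v \<in> V"
    obtain w where w: "\<And>K. K \<in> \<T> \<Longrightarrow> w K \<in> W K \<and> (\<forall>x\<in>interior K. v x = w K x)"
      using loc[OF v] by metis
    have "v = (\<lambda>x. \<Sum>K\<in>\<T>. ?L K (w K) x)"
    proof
      fix x
      show "v x = (\<Sum>K\<in>\<T>. ?L K (w K) x)"
      proof (cases "\<exists>K\<in>\<T>. x \<in> interior K")
        case True
        then obtain K where K: "K \<in> \<T>" "x \<in> interior K" by blast
        then show ?thesis using sum_elements[OF K, of "\<lambda>K. w K x"] w[OF K(1)] by simp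
      next
        case False
        then have "x \<in> off_elements \<T>" by (auto simp: off_elements_def)
        moreover have "(\<Sum>K\<in>\<T>. ?L K (w K) x) = 0" using False by (intro sum.neutral) auto
        ultimately show ?thesis using off[OF v] by simp
      qed
    qed
    then show "v \<in> {\<lambda>x. \<Sum>K\<in>\<T>. f K x | f. \<forall>K\<in>\<T>. f K \<in> ?L K ` W K}"
      using w by (intro CollectI exI[of _ "\<lambda>K. ?L K (w K)"]) auto
  qed
  ultimately show ?thesis using fin_dim_subset by blast
qed

lemma fin_dim_PdG: "fin_dim (PdG r \<T>)"
  by (rule fin_dim_piecewise[where W="\<lambda>_. {p. poly_fun r p}"]) (auto simp: PdG_def fin_dim_poly_fun)

lemma PdG_pw_C1: "v \<in> PdG r \<T> \<Longrightarrow> pw_C1 v"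
  unfolding PdG_def pw_C1_def using C1_poly_fun by blast

lemma PdG_pw_cont: "v \<in> PdG r \<T> \<Longrightarrow> pw_cont v"
  using PdG_pw_C1 pw_C1_imp_cont by blast

lemma zero_everywhere:
  assumes "\<And>K x. K \<in> \<T> \<Longrightarrow> x \<in> interior K \<Longrightarrow> v x = 0" "\<And>x. x \<in> off_elements \<T> \<Longrightarrow> v x = 0"
  shows "v = (\<lambda>x. 0)"
proof
  fix x show "v x = 0" using assms by (cases "x \<in> off_elements \<T>") (auto simp: off_elements_def)
qed

lemma test_square_integrable:
  assumes "test_function \<Omega> \<phi>"
  shows "square_integrable \<Omega> \<phi>" "square_integrable \<Omega> (\<lambda>x. grad \<phi> x $ i)" "square_integrable \<Omega> (grad \<phi>)"
proof -
  have C: "C1 \<phi>" using assms by (rule test_function_C1)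
  show "square_integrable \<Omega> \<phi>"
    using pw_cont_square_integrable pw_C1_imp_cont pw_C1_C1 C by blast
  show "square_integrable \<Omega> (\<lambda>x. grad \<phi> x $ i)"
    using pw_cont_square_integrable pw_C1_grad pw_C1_C1 C by blast
  show "square_integrable \<Omega> (grad \<phi>)"
    using pw_cont_square_integrable_vec pw_C1_grad pw_C1_C1 C by blast
qed

lemma lin_closed_H1: "lin_closed (H1 \<Omega>)"
  unfolding lin_closed_def
proof (intro conjI ballI allI)
  show "(\<lambda>x. 0) \<in> H1 \<Omega>" unfolding H1_def by (auto intro!: exI[of _ "\<lambda>x. 0"])
next
  fix u v :: "real^'d \<Rightarrow> real" and a b :: real assume uv: "u \<in> H1 \<Omega>" "v \<in> H1 \<Omega>"
  then obtain g h where u: "square_integrable \<Omega> u" and v: "square_integrable \<Omega> v"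
    and g: "square_integrable \<Omega> g" and h: "square_integrable \<Omega> h"
    and gu: "\<And>\<phi> i. test_function \<Omega> \<phi> \<Longrightarrow> L2_inner \<Omega> u (\<lambda>x. grad \<phi> x $ i) = - L2_inner \<Omega> (\<lambda>x. g x $ i) \<phi>"
    and hv: "\<And>\<phi> i. test_function \<Omega> \<phi> \<Longrightarrow> L2_inner \<Omega> v (\<lambda>x. grad \<phi> x $ i) = - L2_inner \<Omega> (\<lambda>x. h x $ i) \<phi>"
    unfolding H1_def by blast
  have "L2_inner \<Omega> (\<lambda>x. a *\<^sub>R u x + b *\<^sub>R v x) (\<lambda>x. grad \<phi> x $ i)
      = - L2_inner \<Omega> (\<lambda>x. (a *\<^sub>R g x + b *\<^sub>R h x) $ i) \<phi>" if t: "test_function \<Omega> \<phi>" for \<phi> i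
  proof -
    have "L2_inner \<Omega> (\<lambda>x. a *\<^sub>R u x + b *\<^sub>R v x) (\<lambda>x. grad \<phi> x $ i)
       = a * L2_inner \<Omega> u (\<lambda>x. grad \<phi> x $ i) + b * L2_inner \<Omega> v (\<lambda>x. grad \<phi> x $ i)"
      by (rule L2_inner_lincomb_left[OF u v test_square_integrable(2)[OF t]])
    also have "\<dots> = - (a * L2_inner \<Omega> (\<lambda>x. g x $ i) \<phi> + b * L2_inner \<Omega> (\<lambda>x. h x $ i) \<phi>)"
      by (simp add: gu[OF t] hv[OF t])
    also have "\<dots> = - L2_inner \<Omega> (\<lambda>x. a *\<^sub>R (g x $ i) + b *\<^sub>R (h x $ i)) \<phi>"
      by (subst L2_inner_lincomb_left[OF square_integrable_nth[OF g] square_integrable_nth[OF h] test_square_integrable(1)[OF t]]) simp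
    finally show ?thesis by simp
  qed
  then show "(\<lambda>x. a *\<^sub>R u x + b *\<^sub>R v x) \<in> H1 \<Omega>"
    unfolding H1_def using square_integrable_lincomb[OF u v, of a b] square_integrable_lincomb[OF g h, of a b] by blast
qed

lemma lin_closed_P1: "lin_closed (P1 \<Omega> \<T>)"
  unfolding P1_def by (intro lin_closed_Int lin_closed_PdG lin_closed_H1)

lemma P1_PdG: "v \<in> P1 \<Omega> \<T> \<Longrightarrow> v \<in> PdG 1 \<T>"
  by (simp add: P1_def)

lemma lin_closed_P1_mean0: "lin_closed (P1_mean0 \<Omega> \<T>)"
proof -
  have "II (\<lambda>x. a *\<^sub>R f x + b *\<^sub>R g x) = a * II f + b * II g" if "f \<in> P1 \<Omega> \<T>" "g \<in> P1 \<Omega> \<T>" for f g a b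
    using II_lincomb[OF PdG_pw_cont[OF P1_PdG[OF that(1)]] PdG_pw_cont[OF P1_PdG[OF that(2)]], of a b] by simp
  then show ?thesis using lin_closed_P1 by (auto simp: lin_closed_def P1_mean0_def)
qed

lemma fin_dim_P1_mean0: "fin_dim (P1_mean0 \<Omega> \<T>)"
  by (rule fin_dim_subset[OF _ fin_dim_PdG[of 1]]) (auto simp: P1_mean0_def P1_def)

lemma bubble_pw_C1: assumes K: "K \<in> \<T>" shows "pw_C1 (bubble K)"
proof (rule pw_C1I)
  fix K' assume K': "K' \<in> \<T>"
  obtain C where "simplex_element K C" using element K by blast
  then interpret simplex_element K C .
  show "\<exists>g. C1 g \<and> (\<forall>x\<in>interior K'. bubble K x = g x)"
  proof (cases "K' = K")
    case True
    show ?thesis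
      by (rule exI[of _ "\<lambda>x. \<Prod>a\<in>C. (bgrad a \<bullet> x - boff a)"])
         (auto simp: True bubble_def vertices_K bary_affine intro!: C1_prod C1_diff prod.cong)
  next
    case False
    then have "bubble K x = 0" if "x \<in> interior K'" for x
      using that interior_unique[OF K K'] by (auto simp: bubble_def)
    then show ?thesis by (intro exI[of _ "\<lambda>x. 0"]) simp
  qed
qed

lemma bubble_off: "K \<in> \<T> \<Longrightarrow> x \<in> off_elements \<T> \<Longrightarrow> bubble K x = 0"
  by (auto simp: off_elements_def bubble_def)

lemma P1bE:
  assumes "v \<in> P1b \<Omega> \<T>"
  obtains f \<beta> where "f \<in> P1 \<Omega> \<T>" "v = (\<lambda>x. f x + (\<Sum>K\<in>\<T>. \<beta> K * bubble K x))"
  using assms unfolding P1b_def by blast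

lemma P1b_pw_C1: "v \<in> P1b \<Omega> \<T> \<Longrightarrow> pw_C1 v"
  by (erule P1bE) (auto intro!: pw_C1_add pw_C1_sum pw_C1_mult bubble_pw_C1 dest!: P1_PdG PdG_pw_C1)

lemma P1b_off: "v \<in> P1b \<Omega> \<T> \<Longrightarrow> x \<in> off_elements \<T> \<Longrightarrow> v x = 0"
  by (erule P1bE) (auto simp: bubble_off PdG_def dest!: P1_PdG)

lemma lin_closed_P1b: "lin_closed (P1b \<Omega> \<T>)"
  unfolding lin_closed_def
proof (intro conjI ballI allI)
  show "(\<lambda>x. 0) \<in> P1b \<Omega> \<T>"
    unfolding P1b_def using lin_closedD(1)[OF lin_closed_P1]
    by (intro CollectI exI[of _ "\<lambda>x. 0"]) auto
next
  fix u v a b assume "u \<in> P1b \<Omega> \<T>" "v \<in> P1b \<Omega> \<T>"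
  then obtain f g \<beta> \<gamma> where f: "f \<in> P1 \<Omega> \<T>" "u = (\<lambda>x. f x + (\<Sum>K\<in>\<T>. \<beta> K * bubble K x))"
    and g: "g \<in> P1 \<Omega> \<T>" "v = (\<lambda>x. g x + (\<Sum>K\<in>\<T>. \<gamma> K * bubble K x))"
    by (elim P1bE)
  have "(\<lambda>x. a *\<^sub>R u x + b *\<^sub>R v x)
    = (\<lambda>x. (a *\<^sub>R f x + b *\<^sub>R g x) + (\<Sum>K\<in>\<T>. (a * \<beta> K + b * \<gamma> K) * bubble K x))"
    unfolding f g by (simp add: fun_eq_iff algebra_simps sum.distrib sum_distrib_left)
  then show "(\<lambda>x. a *\<^sub>R u x + b *\<^sub>R v x) \<in> P1b \<Omega> \<T>"
    unfolding P1b_def using lin_closedD(2)[OF lin_closed_P1 f(1) g(1)]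
    by (intro CollectI exI[of _ "\<lambda>x. a *\<^sub>R f x + b *\<^sub>R g x"] exI[of _ "\<lambda>K. a * \<beta> K + b * \<gamma> K"]) auto
qed

lemma fin_dim_P1b: "fin_dim (P1b \<Omega> \<T>)"
proof (rule fin_dim_subset)
  let ?B = "{\<lambda>x. \<Sum>K\<in>\<T>. c K *\<^sub>R bubble K x | c. True}"
  show "fin_dim {\<lambda>x. f x + g x | f g. f \<in> PdG 1 \<T> \<and> g \<in> ?B}"
    by (intro fin_dim_plus fin_dim_PdG fin_dim_finite_sums finite_T)
  show "P1b \<Omega> \<T> \<subseteq> {\<lambda>x. f x + g x | f g. f \<in> PdG 1 \<T> \<and> g \<in> ?B}"
    unfolding P1b_def P1_def by fastforce
qed

lemma lin_closed_P1b0: "lin_closed (P1b0 \<Omega> \<T>)"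
proof -
  have "zero_on_boundary \<Omega> (\<lambda>x. a *\<^sub>R u x + b *\<^sub>R v x)"
    if u: "zero_on_boundary \<Omega> u" and v: "zero_on_boundary \<Omega> v" for u v a b
    using u v unfolding zero_on_boundary_def
  proof eventually_elim
    case (elim x)
    from tendsto_add[OF tendsto_scaleR[OF tendsto_const elim(1)] tendsto_scaleR[OF tendsto_const elim(2)]]
    show ?case by simp
  qed
  moreover have "zero_on_boundary \<Omega> (\<lambda>x. 0)" by (simp add: zero_on_boundary_def)
  ultimately show ?thesis using lin_closed_P1b by (auto simp: lin_closed_def P1b0_def)
qed

lemma P1b0_vec_P1b: "v \<in> P1b0_vec \<Omega> \<T> \<Longrightarrow> (\<lambda>x. v x $ i) \<in> P1b \<Omega> \<T>"
  by (auto simp: P1b0_vec_def P1b0_def)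

lemma P1b0_vec_pw_C1: "v \<in> P1b0_vec \<Omega> \<T> \<Longrightarrow> pw_C1 (\<lambda>x. v x $ i)"
  using P1b0_vec_P1b P1b_pw_C1 by blast

lemma P1b0_vec_pw_cont: "v \<in> P1b0_vec \<Omega> \<T> \<Longrightarrow> pw_cont (\<lambda>x. v x $ i)"
  using P1b0_vec_pw_C1 pw_C1_imp_cont by blast

lemma P1b0_vec_off: "v \<in> P1b0_vec \<Omega> \<T> \<Longrightarrow> x \<in> off_elements \<T> \<Longrightarrow> v x = 0"
  using P1b_off[OF P1b0_vec_P1b] by (simp add: vec_eq_iff)

lemma lin_closed_P1b0_vec: "lin_closed (P1b0_vec \<Omega> \<T>)"
  using lin_closed_P1b0 by (simp add: lin_closed_def P1b0_vec_def)

lemma fin_dim_P1b0_vec: "fin_dim (P1b0_vec \<Omega> \<T>)"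
  by (rule fin_dim_subset[OF _ fin_dim_vec[OF fin_dim_P1b]]) (auto simp: P1b0_vec_def P1b0_def)

lemma RT1_form:
  assumes "w \<in> RT1 \<Omega> \<T>" "K \<in> \<T>"
  obtains q s where "\<And>i. poly_fun 1 (\<lambda>x. q x $ i)" "poly_fun 1 s"
    "\<And>x. x \<in> interior K \<Longrightarrow> w x = q x + s x *\<^sub>R x"
  using assms unfolding RT1_def by blast

lemma RT1_local:
  assumes "w \<in> RT1 \<Omega> \<T>" "K \<in> \<T>"
  obtains p where "\<And>i. C1 (\<lambda>x. p x $ i)" "\<And>x. x \<in> interior K \<Longrightarrow> w x = p x"
proof -
  obtain q s where qs: "\<And>i. poly_fun 1 (\<lambda>x. q x $ i)" "poly_fun 1 s" "\<And>x. x \<in> interior K \<Longrightarrow> w x = q x + s x *\<^sub>R x"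
    using assms unfolding RT1_def by blast
  have "C1 (\<lambda>x. (q x + s x *\<^sub>R x) $ i)" for i
    using C1_add[OF C1_poly_fun[OF qs(1)] C1_mult[OF C1_poly_fun[OF qs(2)] C1_nth]] by simp
  then show thesis by (rule that[OF _ qs(3)])
qed

lemma RT1_pw_C1: assumes "w \<in> RT1 \<Omega> \<T>" shows "pw_C1 (\<lambda>x. w x $ i)"
proof (rule pw_C1I)
  fix K assume "K \<in> \<T>"
  then obtain p where "\<And>i. C1 (\<lambda>x. p x $ i)" "\<And>x. x \<in> interior K \<Longrightarrow> w x = p x"
    using RT1_local[OF assms] by metis
  then show "\<exists>g. C1 g \<and> (\<forall>x\<in>interior K. w x $ i = g x)" by (intro exI[of _ "\<lambda>x. p x $ i"]) simp
qed

lemma RT1_0_RT1: "w \<in> RT1_0 \<Omega> \<T> \<Longrightarrow> w \<in> RT1 \<Omega> \<T>"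
  by (simp add: RT1_0_def)

lemma RT1_0_square_integrable: "w \<in> RT1_0 \<Omega> \<T> \<Longrightarrow> square_integrable \<Omega> w"
  by (simp add: RT1_0_def RT1_def Hdiv_def)

lemma RT1_0_off: "w \<in> RT1_0 \<Omega> \<T> \<Longrightarrow> x \<in> off_elements \<T> \<Longrightarrow> w x = 0"
  by (simp add: RT1_0_def RT1_def)

lemma weak_div_lincomb:
  assumes sq: "square_integrable \<Omega> w" "square_integrable \<Omega> z" "square_integrable \<Omega> g" "square_integrable \<Omega> h"
    and "weak_div \<Omega> w g" "weak_div \<Omega> z h"
  shows "weak_div \<Omega> (\<lambda>x. a *\<^sub>R w x + b *\<^sub>R z x) (\<lambda>x. a *\<^sub>R g x + b *\<^sub>R h x)"
  unfolding weak_div_def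
proof (intro allI impI)
  fix \<phi> assume t: "test_function \<Omega> \<phi>"
  show "L2_inner \<Omega> (\<lambda>x. a *\<^sub>R w x + b *\<^sub>R z x) (grad \<phi>) = - L2_inner \<Omega> (\<lambda>x. a *\<^sub>R g x + b *\<^sub>R h x) \<phi>"
    unfolding L2_inner_lincomb_left[OF sq(1,2) test_square_integrable(3)[OF t]]
      L2_inner_lincomb_left[OF sq(3,4) test_square_integrable(1)[OF t]]
    using assms(5,6) t by (simp add: weak_div_def)
qed

lemma lin_closed_RT1_0: "lin_closed (RT1_0 \<Omega> \<T>)"
  unfolding lin_closed_def
proof (intro conjI ballI allI)
  have "weak_div \<Omega> (\<lambda>x. 0) (\<lambda>x. 0)" by (simp add: weak_div_def)
  moreover have "zero_normal_on_boundary \<Omega> (\<lambda>x. 0)" by (simp add: zero_normal_on_boundary_def)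
  moreover have "(\<lambda>x. 0) \<in> Hdiv \<Omega>" using calculation(1) unfolding Hdiv_def
    by (auto intro!: exI[of _ "\<lambda>x. 0"])
  moreover have "\<exists>q s. (\<forall>i. poly_fun 1 (\<lambda>x. q x $ i)) \<and> poly_fun 1 s \<and> (\<forall>x\<in>interior K. 0 = q x + s x *\<^sub>R x)" for K :: "(real^'d) set"
    by (intro exI[of _ "\<lambda>x. 0"]) (auto simp: poly_fun_0)
  ultimately show "(\<lambda>x. 0) \<in> RT1_0 \<Omega> \<T>" by (simp add: RT1_0_def RT1_def)
next
  fix w z a b assume wz: "w \<in> RT1_0 \<Omega> \<T>" "z \<in> RT1_0 \<Omega> \<T>"
  let ?y = "\<lambda>x. a *\<^sub>R w x + b *\<^sub>R z x"
  note sq = RT1_0_square_integrable[OF wz(1)] RT1_0_square_integrable[OF wz(2)]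
  have div: "weak_div \<Omega> ?y (\<lambda>x. 0)"
    using weak_div_lincomb[OF sq square_integrable_0 square_integrable_0, of a b] wz by (simp add: RT1_0_def)
  moreover have "?y \<in> Hdiv \<Omega>"
    unfolding Hdiv_def using div square_integrable_lincomb[OF sq] square_integrable_0 by blast
  moreover have "zero_normal_on_boundary \<Omega> ?y"
  proof -
    have "zero_normal_on_boundary \<Omega> w" "zero_normal_on_boundary \<Omega> z" using wz by (auto simp: RT1_0_def)
    then show ?thesis unfolding zero_normal_on_boundary_def
    proof eventually_elim
      case (elim x)
      from tendsto_add[OF tendsto_mult[OF tendsto_const elim(1)] tendsto_mult[OF tendsto_const elim(2)], of a b]
      show ?case by (simp add: inner_add_left)
    qed
  qed
  moreover have "\<exists>q s. (\<forall>i. poly_fun 1 (\<lambda>x. q x $ i)) \<and> poly_fun 1 s \<and> (\<forall>x\<in>interior K. ?y x = q x + s x *\<^sub>R x)"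
    if K: "K \<in> \<T>" for K
  proof -
    obtain q s where qs: "\<And>i. poly_fun 1 (\<lambda>x. q x $ i)" "poly_fun 1 s" "\<And>x. x \<in> interior K \<Longrightarrow> w x = q x + s x *\<^sub>R x"
      using RT1_form[OF RT1_0_RT1[OF wz(1)] K] by metis
    obtain q' s' where qs': "\<And>i. poly_fun 1 (\<lambda>x. q' x $ i)" "poly_fun 1 s'" "\<And>x. x \<in> interior K \<Longrightarrow> z x = q' x + s' x *\<^sub>R x"
      using RT1_form[OF RT1_0_RT1[OF wz(2)] K] by metis
    have 1: "poly_fun 1 (\<lambda>x. (a *\<^sub>R q x + b *\<^sub>R q' x) $ i)" for i
      using poly_fun_lincomb[OF qs(1) qs'(1), of a i b i] by simp
    have 2: "poly_fun 1 (\<lambda>x. a * s x + b * s' x)" by (rule poly_fun_lincomb[OF qs(2) qs'(2)])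
    have 3: "?y x = (a *\<^sub>R q x + b *\<^sub>R q' x) + (a * s x + b * s' x) *\<^sub>R x" if "x \<in> interior K" for x
      using qs(3)[OF that] qs'(3)[OF that] by (simp add: algebra_simps)
    show ?thesis
      by (intro exI[of _ "\<lambda>x. a *\<^sub>R q x + b *\<^sub>R q' x"] exI[of _ "\<lambda>x. a * s x + b * s' x"]
          conjI allI ballI 1 2 3)
  qed
  ultimately show "?y \<in> RT1_0 \<Omega> \<T>"
    using RT1_0_off[OF wz(1)] RT1_0_off[OF wz(2)] by (simp add: RT1_0_def RT1_def)
qed

lemma fin_dim_RT1_0: "fin_dim (RT1_0 \<Omega> \<T>)"
proof (rule fin_dim_piecewise)
  let ?Q = "{q :: real^'d \<Rightarrow> real^'d. \<forall>i. (\<lambda>x. q x $ i) \<in> {p. poly_fun 1 p}}"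
  let ?S = "(\<lambda>s x. s x *\<^sub>R x) ` {s :: real^'d \<Rightarrow> real. poly_fun 1 s}"
  show "fin_dim {\<lambda>x. f x + g x | f g. f \<in> ?Q \<and> g \<in> ?S}"
    by (intro fin_dim_plus fin_dim_vec fin_dim_image fin_dim_poly_fun)
       (auto intro!: linearI simp: scaleR_add_left)
  fix v K assume "v \<in> RT1_0 \<Omega> \<T>" "K \<in> \<T>"
  then obtain q s where qs: "\<And>i. poly_fun 1 (\<lambda>x. q x $ i)" "poly_fun 1 s" "\<And>x. x \<in> interior K \<Longrightarrow> v x = q x + s x *\<^sub>R x"
    unfolding RT1_0_def RT1_def by blast
  then show "\<exists>w\<in>{\<lambda>x. f x + g x | f g. f \<in> ?Q \<and> g \<in> ?S}. \<forall>x\<in>interior K. v x = w x"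
    by (intro bexI[of _ "\<lambda>x. q x + s x *\<^sub>R x"] CollectI exI[of _ q] exI[of _ "\<lambda>x. s x *\<^sub>R x"]) auto
qed (use RT1_0_off in auto)

text \<open>The weight \<open>c\<close> is 1 for the projection and the density weight for the
  momentum equation.\<close>

lemma vec_zero:
  fixes w :: "real^'d \<Rightarrow> real^'d"
  assumes "\<And>i. pw_cont (\<lambda>x. w x $ i)" "\<And>x. x \<in> off_elements \<T> \<Longrightarrow> w x = 0"
    and "II (\<lambda>x. c x * (w x \<bullet> w x)) = 0" "pw_cont c" "\<And>K x. K \<in> \<T> \<Longrightarrow> x \<in> interior K \<Longrightarrow> 0 < c x"
  shows "w = (\<lambda>x. 0)"
proof (rule zero_everywhere[OF _ assms(2)])
  fix K x assume K: "K \<in> \<T>" "x \<in> interior K"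
  have "pw_cont (\<lambda>x. w x \<bullet> w x)"
    unfolding inner_vec_def inner_real_def by (intro pw_cont_sum pw_cont_mult assms(1))
  then have cc: "pw_cont (\<lambda>x. c x * (w x \<bullet> w x))" by (rule pw_cont_mult[OF assms(4)])
  have "0 \<le> c x * (w x \<bullet> w x)" if "K \<in> \<T>" "x \<in> interior K" for K x
    using assms(5)[OF that] by (intro mult_nonneg_nonneg) auto
  then have "c x * (w x \<bullet> w x) = 0" by (rule II_zero[OF cc _ assms(3) K])
  then show "w x = 0" using assms(5)[OF K] by simp
qed

text \<open>\<open>P_RT\<close> is a definite description, so membership requires existence and
  uniqueness of the orthogonal projection; both follow from definiteness of the L2 product on the
  finite-dimensional target space.\<close>

lemma P_RT_in_RT1_0:
  assumes u: "square_integrable \<Omega> u" shows "P_RT \<Omega> \<T> u \<in> RT1_0 \<Omega> \<T>"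
proof -
  let ?V = "RT1_0 \<Omega> \<T>"
  note sq = RT1_0_square_integrable
  have ex1: "\<exists>!w. w \<in> ?V \<and> (\<forall>z\<in>?V. L2_inner \<Omega> w z = L2_inner \<Omega> u z)"
  proof (rule bilinear_form_solvable[OF lin_closed_RT1_0 fin_dim_RT1_0])
    fix w assume w: "w \<in> ?V" "\<And>z. z \<in> ?V \<Longrightarrow> L2_inner \<Omega> w z = 0"
    show "w = (\<lambda>x. 0)"
      by (rule vec_zero[where c="\<lambda>x. 1"])
         (use w(2)[OF w(1)] RT1_pw_C1[OF RT1_0_RT1[OF w(1)]] RT1_0_off[OF w(1)] in
          \<open>auto simp: L2_inner_def intro: pw_C1_imp_cont\<close>)
  qed (auto intro!: L2_inner_lincomb_left L2_inner_lincomb_right sq u)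
  have "L2_inner \<Omega> (\<lambda>x. u x - w x) z = 0 \<longleftrightarrow> L2_inner \<Omega> w z = L2_inner \<Omega> u z"
    if "w \<in> ?V" "z \<in> ?V" for w z
    using L2_inner_lincomb_left[OF u sq[OF that(1)] sq[OF that(2)], of 1 "-1"] by auto
  then have "w \<in> ?V \<and> (\<forall>z\<in>?V. L2_inner \<Omega> (\<lambda>x. u x - w x) z = 0)
      \<longleftrightarrow> w \<in> ?V \<and> (\<forall>z\<in>?V. L2_inner \<Omega> w z = L2_inner \<Omega> u z)" for w
    by (cases "w \<in> ?V") simp_all
  then have "\<exists>!w. w \<in> ?V \<and> (\<forall>z\<in>?V. L2_inner \<Omega> (\<lambda>x. u x - w x) z = 0)"
    using ex1 by (simp only:)
  from theI'[OF this] show ?thesis unfolding P_RT_def by blast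
qed

end

section \<open>The transport form\<close>

text \<open>Computed from the components, because differentiability is available for each component
  separately.\<close>

definition cdiv :: "(real^'d \<Rightarrow> real^'d) \<Rightarrow> real^'d \<Rightarrow> real" where
  "cdiv p x = (\<Sum>i\<in>UNIV. frechet_derivative (\<lambda>y. p y $ i) (at x) (axis i 1))"

lemma continuous_on_inner_const:
  fixes p :: "real^'d \<Rightarrow> real^'d"
  assumes "\<And>i. C1 (\<lambda>x. p x $ i)" shows "continuous_on A (\<lambda>x. p x \<bullet> n)"
  unfolding inner_vec_def inner_real_def
  by (intro continuous_on_sum continuous_on_mult continuous_on_const C1_continuous assms)

lemma continuous_on_cdiv: "(\<And>i. C1 (\<lambda>x. p x $ i)) \<Longrightarrow> continuous_on A (cdiv p)"
  unfolding cdiv_def by (intro continuous_on_sum C1_cont_deriv)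

lemma grad_C1: "C1 \<phi> \<Longrightarrow> continuous_on A (\<lambda>x. grad \<phi> x $ i)"
  unfolding grad_nth by (rule C1_cont_deriv)

context simplex_element
begin

lemma int_on_lin:
  assumes "continuous_on UNIV f" "continuous_on UNIV g"
  shows "int_on K (\<lambda>x. f x + g x) = int_on K f + int_on K g" "int_on K (\<lambda>x. c * f x) = c * int_on K f"
  using integrable_indicator_interior[OF assms(1)] integrable_indicator_interior[OF assms(2)]
  by (simp_all add: int_on_def distrib_left mult.left_commute)

lemma int_on_sum:
  assumes "\<And>i. i \<in> I \<Longrightarrow> continuous_on UNIV (f i)"
  shows "int_on K (\<lambda>x. \<Sum>i\<in>I. f i x) = (\<Sum>i\<in>I. int_on K (f i))"
  using integrable_indicator_interior[OF assms]
  by (simp add: int_on_def sum_distrib_left)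

text \<open>For each \<open>i\<close> the directional theorem is applied to the product of the
  component \<open>i\<close> of \<open>p\<close> with \<open>\<phi>\<close>, in the coordinate
  direction \<open>i\<close>.\<close>

theorem integration_by_parts:
  assumes p: "\<And>i. C1 (\<lambda>x. p x $ i)" and \<phi>: "C1 \<phi>"
  shows "int_on K (\<lambda>x. p x \<bullet> grad \<phi> x)
    = (\<Sum>F | F facet_of K. LINT x|facet_measure K F. (p x \<bullet> facet_normal K F) * \<phi> x)
      - int_on K (\<lambda>x. cdiv p x * \<phi> x)"
proof -
  have c\<phi>: "continuous_on UNIV \<phi>" by (rule C1_continuous[OF \<phi>])
  have cp: "continuous_on UNIV (\<lambda>x. p x $ i)" for i by (rule C1_continuous[OF p])
  have c1: "continuous_on UNIV (\<lambda>x. p x $ i * grad \<phi> x $ i)" for i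
    by (intro continuous_on_mult cp grad_C1[OF \<phi>])
  have c2: "continuous_on UNIV (\<lambda>x. frechet_derivative (\<lambda>y. p y $ i) (at x) (axis i 1) * \<phi> x)" for i
    by (intro continuous_on_mult c\<phi> C1_cont_deriv p)
  have one: "int_on K (\<lambda>x. p x $ i * grad \<phi> x $ i)
      + int_on K (\<lambda>x. frechet_derivative (\<lambda>y. p y $ i) (at x) (axis i 1) * \<phi> x)
    = (\<Sum>F | F facet_of K. LINT x|facet_measure K F. p x $ i * facet_normal K F $ i * \<phi> x)" for i
  proof -
    have "int_on K (\<lambda>x. p x $ i * grad \<phi> x $ i)
      + int_on K (\<lambda>x. frechet_derivative (\<lambda>y. p y $ i) (at x) (axis i 1) * \<phi> x)
      = int_on K (\<lambda>x. frechet_derivative (\<lambda>y. p y $ i * \<phi> y) (at x) (axis i 1))"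
      by (simp add: frechet_mult[OF p \<phi>] grad_nth int_on_lin(1)[OF c1[unfolded grad_nth] c2])
    also have "\<dots> = (\<Sum>F | F facet_of K. (facet_normal K F \<bullet> axis i 1) * (LINT x|facet_measure K F. p x $ i * \<phi> x))"
      by (rule divergence_theorem_dir[OF C1_mult[OF p \<phi>]])
    also have "\<dots> = (\<Sum>F | F facet_of K. LINT x|facet_measure K F. p x $ i * facet_normal K F $ i * \<phi> x)"
    proof (intro sum.cong refl)
      fix F
      show "(facet_normal K F \<bullet> axis i 1) * (LINT x|facet_measure K F. p x $ i * \<phi> x)
         = (LINT x|facet_measure K F. p x $ i * facet_normal K F $ i * \<phi> x)"
        by (subst integral_mult_right_zero[symmetric], rule Bochner_Integration.integral_cong)
           (simp_all add: inner_axis)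
    qed
    finally show ?thesis .
  qed
  have "int_on K (\<lambda>x. p x \<bullet> grad \<phi> x) + int_on K (\<lambda>x. cdiv p x * \<phi> x)
    = (\<Sum>i\<in>UNIV. int_on K (\<lambda>x. p x $ i * grad \<phi> x $ i)
      + int_on K (\<lambda>x. frechet_derivative (\<lambda>y. p y $ i) (at x) (axis i 1) * \<phi> x))"
    by (simp add: inner_vec_def cdiv_def sum_distrib_right int_on_sum c1 c2 sum.distrib)
  also have "\<dots> = (\<Sum>F | F facet_of K. \<Sum>i\<in>UNIV. LINT x|facet_measure K F. p x $ i * facet_normal K F $ i * \<phi> x)"
    unfolding one by (rule sum.swap)
  also have "\<dots> = (\<Sum>F | F facet_of K. LINT x|facet_measure K F. (p x \<bullet> facet_normal K F) * \<phi> x)"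
  proof (intro sum.cong refl)
    fix F assume "F \<in> {F. F facet_of K}"
    then have F: "F facet_of K" by simp
    have "(LINT x|facet_measure K F. (\<Sum>i\<in>UNIV. p x $ i * facet_normal K F $ i * \<phi> x))
      = (\<Sum>i\<in>UNIV. LINT x|facet_measure K F. p x $ i * facet_normal K F $ i * \<phi> x)"
      by (intro Bochner_Integration.integral_sum facet_integrable_continuous[OF F] continuous_on_mult
          continuous_on_const cp c\<phi>)
    then show "(\<Sum>i\<in>UNIV. LINT x|facet_measure K F. p x $ i * facet_normal K F $ i * \<phi> x)
      = (LINT x|facet_measure K F. (p x \<bullet> facet_normal K F) * \<phi> x)"
      by (simp add: inner_vec_def sum_distrib_right)
  qed
  finally show ?thesis by simp
qed

end

lemma (in full_polytope) facet_interior_disjoint: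
  assumes "F facet_of C" "x \<in> F" shows "x \<notin> interior C"
proof -
  have "F \<noteq> C" using assms(1) by (auto simp: facet_of_def)
  then show ?thesis
    using face_of_disjoint_interior[OF facet_of_imp_face_of[OF assms(1)]] assms(2) by blast
qed

text \<open>The facet measure is volume in the slab pushed down, so an almost everywhere statement
  on the facet becomes one in the slab, where nonempty open sets are not negligible.\<close>

lemma (in mesh) facet_continuous_integral_zero:
  fixes h :: "real^'d \<Rightarrow> real"
  assumes K: "K \<in> \<T>" and F: "F facet_of K" and h: "continuous_on UNIV h"
    and nn: "\<And>x. x \<in> rel_interior F \<Longrightarrow> 0 \<le> h x" and z: "(LINT x|facet_measure K F. h x) = 0"
    and x: "x \<in> rel_interior F"
  shows "h x = 0"
proof (rule ccontr)
  assume hx: "h x \<noteq> 0"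
  interpret A: full_polytope K using element_facts K by blast
  let ?n = "facet_normal K F" and ?b = "facet_offset K F"
  have nF: "?n \<bullet> ?n = 1" using A.facet_props(1)[OF F] by (simp add: dot_square_norm)
  have xb: "?n \<bullet> x = ?b" using A.facet_props(3)[OF F] x rel_interior_subset by blast
  obtain e where e: "e > 0" "\<And>y. y \<in> ball x e \<Longrightarrow> y \<in> rel_interior F \<longleftrightarrow> ?n \<bullet> y = ?b"
    using facet_local[OF K F x] by metis
  have "AE x in facet_measure K F. h x = 0"
    using z A.facet_integrable_continuous[OF F h] A.AE_facet_measure[OF F] nn
    by (subst (asm) integral_nonneg_eq_0_iff_AE) (auto elim: eventually_mono)
  then have "AE x in hyp ?n ?b ?n. x \<in> rel_interior F \<longrightarrow> h x = 0"
    unfolding facet_measure_def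
    by (subst (asm) AE_density, use A.rel_interior_facet_borel[OF F] in simp)
       (auto elim!: eventually_mono simp: indicator_def split: if_splits)
  then have "AE y in density lborel (indicator (slab ?n ?b)). hproj ?n ?b ?n y \<in> rel_interior F \<longrightarrow> h (hproj ?n ?b ?n y) = 0"
    unfolding hyp_def by (rule AE_distrD[rotated]) simp
  then have ae: "AE y in lborel. y \<in> slab ?n ?b \<longrightarrow> hproj ?n ?b ?n y \<in> rel_interior F \<longrightarrow> h (hproj ?n ?b ?n y) = 0"
    by (subst (asm) AE_density, simp) (auto elim!: eventually_mono simp: indicator_def split: if_splits)
  have cp: "continuous_on UNIV (hproj ?n ?b ?n)" unfolding hproj_def by (intro continuous_intros)
  have ch: "continuous_on UNIV (\<lambda>y. h (hproj ?n ?b ?n y))" by (rule continuous_on_compose2[OF h cp]) simp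
  let ?U = "{y. 0 < ?n \<bullet> y - ?b} \<inter> {y. ?n \<bullet> y - ?b < 1} \<inter> {y. dist x (hproj ?n ?b ?n y) < e} \<inter> {y. h (hproj ?n ?b ?n y) \<noteq> 0}"
  have "open ?U"
    by (intro open_Int open_Collect_less open_Collect_neq ch continuous_intros continuous_on_dist cp)
  \<comment> \<open>The height 1/2 places the point over \<open>x\<close> in the interior of the
    slab.\<close>
  moreover have "x + (1/2) *\<^sub>R ?n \<in> ?U"
    using xb nF e(1) hx by (simp add: hproj_def inner_add_right)
  then have "?U \<noteq> {}" by blast
  ultimately obtain y where y: "y \<in> ?U"
    "y \<in> slab ?n ?b \<longrightarrow> hproj ?n ?b ?n y \<in> rel_interior F \<longrightarrow> h (hproj ?n ?b ?n y) = 0"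
    using AE_open_ex[OF ae, of ?U] by blast
  have "hproj ?n ?b ?n y \<in> rel_interior F"
    using e(2)[of "hproj ?n ?b ?n y"] y(1) hproj_line(2)[OF nF] by simp
  moreover have "y \<in> slab ?n ?b" using y(1) by (simp add: slab_def)
  ultimately show False using y by simp
qed

section \<open>Divergence and normal components of the discrete flow\<close>

locale transport = mesh \<Omega> \<T> for \<Omega> :: "(real^'d) set" and \<T> :: "(real^'d) set set" +
  fixes w :: "real^'d \<Rightarrow> real^'d"
  assumes w: "w \<in> RT1_0 \<Omega> \<T>"
begin

text \<open>A C1 extension of the flow from the element, so that its values on facets can be used
  without taking limits.\<close>

definition wp :: "(real^'d) set \<Rightarrow> real^'d \<Rightarrow> real^'d" where
  "wp K = (SOME p. (\<forall>i. C1 (\<lambda>x. p x $ i)) \<and> (\<forall>x\<in>interior K. w x = p x))"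

lemma wp: assumes "K \<in> \<T>"
  shows "C1 (\<lambda>x. wp K x $ i)" "x \<in> interior K \<Longrightarrow> w x = wp K x"
proof -
  have "\<exists>p. (\<forall>i. C1 (\<lambda>x. p x $ i)) \<and> (\<forall>x\<in>interior K. w x = p x)"
    using RT1_local[OF RT1_0_RT1[OF w] assms] by metis
  from someI_ex[OF this] show "C1 (\<lambda>x. wp K x $ i)" "x \<in> interior K \<Longrightarrow> w x = wp K x"
    unfolding wp_def by blast+
qed

lemma wp_cont: "K \<in> \<T> \<Longrightarrow> continuous_on A (\<lambda>x. wp K x \<bullet> n)"
  using continuous_on_inner_const wp(1) by blast

lemma w_pw_C1: "pw_C1 (\<lambda>x. w x $ i)"
  using RT1_pw_C1[OF RT1_0_RT1[OF w]] .

lemma wp_parts: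
  assumes "K \<in> \<T>" "C1 \<phi>"
  shows "int_on K (\<lambda>x. wp K x \<bullet> grad \<phi> x)
    = (\<Sum>F | F facet_of K. LINT x|facet_measure K F. (wp K x \<bullet> facet_normal K F) * \<phi> x)
      - int_on K (\<lambda>x. cdiv (wp K) x * \<phi> x)"
proof -
  obtain C where "simplex_element K C" using element assms by blast
  then interpret simplex_element K C .
  show ?thesis by (rule integration_by_parts[OF wp(1)[OF assms(1)] assms(2)])
qed

text \<open>Integration by parts on every element turns the vanishing weak divergence into one
  relation between facet fluxes and elementwise divergences; it is localised afterwards by the
  choice of \<open>\<phi>\<close>.\<close>

lemma weak_identity:
  assumes t: "test_function \<Omega> \<phi>"
  shows "(\<Sum>K\<in>\<T>. (\<Sum>F | F facet_of K. LINT x|facet_measure K F. (wp K x \<bullet> facet_normal K F) * \<phi> x)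
      - int_on K (\<lambda>x. cdiv (wp K) x * \<phi> x)) = 0"
proof -
  have C: "C1 \<phi>" by (rule test_function_C1[OF t])
  have "pw_cont (\<lambda>x. \<Sum>i\<in>UNIV. w x $ i * grad \<phi> x $ i)"
    by (intro pw_cont_sum pw_cont_mult pw_C1_imp_cont[OF w_pw_C1] pw_C1_grad pw_C1_C1 C)
  then have pc: "pw_cont (\<lambda>x. w x \<bullet> grad \<phi> x)" by (simp add: inner_vec_def)
  have "0 = L2_inner \<Omega> w (grad \<phi>)"
    using w t by (simp add: RT1_0_def weak_div_def)
  also have "\<dots> = (\<Sum>K\<in>\<T>. int_on K (\<lambda>x. w x \<bullet> grad \<phi> x))"
    unfolding L2_inner_def by (rule pw_integral(2)[OF pc])
  also have "\<dots> = (\<Sum>K\<in>\<T>. int_on K (\<lambda>x. wp K x \<bullet> grad \<phi> x))"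
    by (intro sum.cong refl int_on_cong) (simp add: wp(2))
  finally show ?thesis using wp_parts[OF _ C] by simp
qed

lemma facet_integral_zero:
  assumes K: "K \<in> \<T>" "F facet_of K" and z: "\<And>x. x \<in> rel_interior F \<Longrightarrow> h x = (0::real)"
  shows "(LINT x|facet_measure K F. h x) = 0"
proof -
  interpret A: full_polytope K using element_facts K by blast
  show ?thesis
    by (rule integral_eq_zero_AE) (use A.AE_facet_measure[OF K(2)] z in \<open>auto elim: eventually_mono\<close>)
qed

lemma int_on_zero: "(\<And>x. x \<in> interior K \<Longrightarrow> h x = 0) \<Longrightarrow> int_on K h = 0"
  using int_on_cong[of K h "\<lambda>x. 0"] by (simp add: int_on_def)

text \<open>A bump supported inside a single element vanishes on all facets and in all other
  elements, so \<open>weak_identity\<close> retains only the divergence in that element.\<close>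

lemma div_zero:
  assumes K: "K \<in> \<T>" and x: "x \<in> interior K" shows "cdiv (wp K) x = 0"
proof (rule ccontr)
  assume nz: "cdiv (wp K) x \<noteq> 0"
  \<comment> \<open>The sign makes the integrand nonnegative on the support of the bump, so that its
    zero integral forces it to vanish pointwise.\<close>
  define s where "s = sgn (cdiv (wp K) x)"
  have cont: "continuous_on UNIV (cdiv (wp K))" by (rule continuous_on_cdiv[OF wp(1)[OF K]])
  have "open (interior K \<inter> {y. 0 < s * cdiv (wp K) y})"
    by (intro open_Int open_Collect_less continuous_intros cont) auto
  moreover have "x \<in> interior K \<inter> {y. 0 < s * cdiv (wp K) y}"
    using x nz by (simp add: s_def sgn_if)
  ultimately obtain r where r: "r > 0" "cball x r \<subseteq> interior K \<inter> {y. 0 < s * cdiv (wp K) y}"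
    using open_contains_cball by blast
  have t: "test_function \<Omega> (bump x r)"
    by (rule test_function_bump[OF r(1)]) (use r(2) interior_in_domain[OF K] in blast)
  have b0: "bump x r y = 0" if "y \<notin> interior K" for y
  proof (rule ccontr)
    assume "bump x r y \<noteq> 0"
    then have "y \<in> cball x r" using bump_pos_iff[OF r(1), of x y] by (simp add: dist_commute)
    then show False using r(2) that by blast
  qed
  have "(\<Sum>F | F facet_of K'. LINT y|facet_measure K' F. (wp K' y \<bullet> facet_normal K' F) * bump x r y) = 0"
    if K': "K' \<in> \<T>" for K'
  proof (intro sum.neutral ballI)
    fix F assume "F \<in> {F. F facet_of K'}"
    then have F: "F facet_of K'" by simp
    interpret A: full_polytope K' using element_facts K' by blast
    show "(LINT y|facet_measure K' F. (wp K' y \<bullet> facet_normal K' F) * bump x r y) = 0"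
    proof (rule facet_integral_zero[OF K' F])
      fix y assume "y \<in> rel_interior F"
      then have y: "y \<in> F" "y \<in> K'" using rel_interior_subset facet_of_imp_subset[OF F] by blast+
      have "y \<notin> interior K"
        using A.facet_interior_disjoint[OF F y(1)] interior_disjoint[OF K K' _ y(2)] by blast
      then show "(wp K' y \<bullet> facet_normal K' F) * bump x r y = 0" by (simp add: b0)
    qed
  qed
  then have s0: "(\<Sum>K'\<in>\<T>. int_on K' (\<lambda>y. cdiv (wp K') y * bump x r y)) = 0"
    using weak_identity[OF t] by (simp add: sum_subtractf sum_negf)
  have "int_on K' (\<lambda>y. cdiv (wp K') y * bump x r y) = 0" if "K' \<in> \<T>" "K' \<noteq> K" for K'
  proof (rule int_on_zero)
    fix y assume "y \<in> interior K'"
    then have "y \<notin> interior K" using interior_unique[OF that(1) K] that(2) by blast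
    then show "cdiv (wp K') y * bump x r y = 0" by (simp add: b0)
  qed
  then have "int_on K (\<lambda>y. cdiv (wp K) y * bump x r y) = 0"
    using s0 K by (simp add: sum.remove[OF finite_T K])
  then have z: "int_on K (\<lambda>y. (s * cdiv (wp K) y) * bump x r y) = 0"
    unfolding int_on_def by (simp add: mult.assoc mult.left_commute[of _ s])
  obtain C where "simplex_element K C" using element K by blast
  then interpret simplex_element K C .
  have cb: "continuous_on UNIV (bump x r)" by (rule C1_continuous[OF smooth_C1[OF bump_smooth]])
  have c: "continuous_on UNIV (\<lambda>y. (s * cdiv (wp K) y) * bump x r y)"
    by (intro continuous_on_mult continuous_on_const cont cb)
  have "(s * cdiv (wp K) x) * bump x r x = 0"
  proof (rule continuous_integral_zero[OF c integrable_indicator_interior[OF c] _ z x])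
    fix y assume "y \<in> interior K"
    show "0 \<le> (s * cdiv (wp K) y) * bump x r y"
    proof (cases "y \<in> cball x r")
      case True
      then have "0 < s * cdiv (wp K) y" using r(2) by blast
      then show ?thesis using bump_nonneg[of x r y] by simp
    next
      case False
      then have "bump x r y = 0" using bump_pos_iff[OF r(1), of x y] by (auto simp: dist_commute)
      then show ?thesis by simp
    qed
  qed
  then show False using bump_pos_iff[OF r(1), of x x] r nz by (auto simp: s_def sgn_if)
qed

lemma weak_identity':
  assumes "test_function \<Omega> \<phi>"
  shows "(\<Sum>K\<in>\<T>. \<Sum>F | F facet_of K. LINT x|facet_measure K F. (wp K x \<bullet> facet_normal K F) * \<phi> x) = 0"
proof -
  have "int_on K (\<lambda>x. cdiv (wp K) x * \<phi> x) = 0" if "K \<in> \<T>" for K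
    using that by (intro int_on_zero) (simp add: div_zero)
  then show ?thesis using weak_identity[OF assms] by (simp add: sum_subtractf)
qed

text \<open>The bump is centred on the facet and meets only the two adjacent elements and no other
  facet. Both contribute an integral over the same facet measure with opposite normals, so the jump
  of the normal component times the bump integrates to 0.\<close>

lemma normal_continuity:
  assumes K: "K \<in> \<T>" "F facet_of K" and K': "K' \<in> \<T>" "K' \<noteq> K" "F facet_of K'" and x: "x \<in> rel_interior F"
  shows "wp K x \<bullet> facet_normal K F = wp K' x \<bullet> facet_normal K F"
proof (rule ccontr)
  assume ne: "wp K x \<bullet> facet_normal K F \<noteq> wp K' x \<bullet> facet_normal K F"
  let ?n = "facet_normal K F"
  interpret A: full_polytope K using element_facts K by blast
  interpret B: full_polytope K' using element_facts K' by blast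
  define \<delta> where "\<delta> y = wp K y \<bullet> ?n - wp K' y \<bullet> ?n" for y
  define s where "s = sgn (\<delta> x)"
  have cont: "continuous_on UNIV \<delta>"
    unfolding \<delta>_def by (intro continuous_on_diff wp_cont K K')
  have xK: "x \<in> K" "x \<in> K'"
    using x rel_interior_subset facet_of_imp_subset[OF K(2)] facet_of_imp_subset[OF K'(3)] by blast+
  note nb = neighbour_facet_measure[OF K(1) K'(1,2) K(2) K'(3)]
  have off: "facet_offset K' F = - facet_offset K F"
    by (rule neighbour_facet(3)[OF K(1) K'(1,2) K(2) x xK(2)])
  obtain e1 where e1: "e1 > 0" "\<And>y. y \<in> ball x e1 \<Longrightarrow> y \<in> K \<longleftrightarrow> ?n \<bullet> y \<le> facet_offset K F"
    using facet_halfball[OF K x] by metis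
  obtain e2 where e2: "e2 > 0" "\<And>y. y \<in> ball x e2 \<Longrightarrow> y \<in> K' \<longleftrightarrow> ?n \<bullet> y \<ge> facet_offset K F"
    using facet_halfball[OF K'(1,3) x] unfolding nb(2) off inner_minus_left neg_le_iff_le by metis
  obtain e3 where e3: "e3 > 0" "\<And>y G. y \<in> ball x e3 \<Longrightarrow> G facet_of K \<Longrightarrow> y \<in> rel_interior G \<Longrightarrow> G = F"
    using facet_local[OF K x] by metis
  obtain e4 where e4: "e4 > 0" "\<And>y G. y \<in> ball x e4 \<Longrightarrow> G facet_of K' \<Longrightarrow> y \<in> rel_interior G \<Longrightarrow> G = F"
    using facet_local[OF K'(1,3) x] by metis
  have others: "x \<notin> K''" if K'': "K'' \<in> \<T>" "K'' \<noteq> K" "K'' \<noteq> K'" for K''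
  proof
    assume "x \<in> K''"
    then have "F facet_of K''" using neighbour_facet(1)[OF K(1) K''(1,2) K(2) x] by blast
    then show False using neighbour_unique[OF K K' K''(1,2)] K''(3) by blast
  qed
  have "open (- \<Union>(\<T> - {K, K'}))"
    using element_facts by (intro open_Compl closed_Union) auto
  moreover have "x \<in> - \<Union>(\<T> - {K, K'})" using others by blast
  ultimately obtain e5 where e5: "e5 > 0" "ball x e5 \<subseteq> - \<Union>(\<T> - {K, K'})"
    using open_contains_ball[of "- \<Union>(\<T> - {K, K'})"] by blast
  have "open {y. 0 < s * \<delta> y}" by (intro open_Collect_less continuous_intros cont)
  moreover have "x \<in> {y. 0 < s * \<delta> y}" using ne by (simp add: s_def sgn_if \<delta>_def)
  ultimately obtain e6 where e6: "e6 > 0" "ball x e6 \<subseteq> {y. 0 < s * \<delta> y}"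
    using open_contains_ball[of "{y. 0 < s * \<delta> y}"] by blast
  \<comment> \<open>\<open>e1\<close> and \<open>e2\<close> describe the two elements as half-balls,
    \<open>e3\<close> and \<open>e4\<close> keep away from their other facets, \<open>e5\<close>
    from the other elements, and on the ball of radius \<open>e6\<close> the jump keeps its sign.
    Half the minimum puts the closed ball inside the open ones.\<close>
  define r where "r = Min {e1, e2, e3, e4, e5, e6} / 2"
  have r: "r > 0" using e1 e2 e3 e4 e5 e6 by (simp add: r_def)
  have rr: "r < e1" "r < e2" "r < e3" "r < e4" "r < e5" "r < e6"
    using e1(1) e2(1) e3(1) e4(1) e5(1) e6(1) by (auto simp: r_def min_def)
  then have rb: "cball x r \<subseteq> ball x e1" "cball x r \<subseteq> ball x e2" "cball x r \<subseteq> ball x e3"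
    "cball x r \<subseteq> ball x e4" "cball x r \<subseteq> ball x e5" "cball x r \<subseteq> ball x e6" by auto
  \<comment> \<open>The two half-balls fill the ball, so it lies in the domain and the bump is an
    admissible test function.\<close>
  have "ball x (min e1 e2) \<subseteq> closure \<Omega>"
  proof
    fix y assume "y \<in> ball x (min e1 e2)"
    then have "y \<in> K \<or> y \<in> K'" using e1(2)[of y] e2(2)[of y] by auto
    then show "y \<in> closure \<Omega>" using K K' cover by blast
  qed
  then have "ball x (min e1 e2) \<subseteq> interior (closure \<Omega>)" by (rule interior_maximal) simp
  then have "cball x r \<subseteq> \<Omega>" using rr domain_facts(2) by auto
  then have t: "test_function \<Omega> (bump x r)" by (rule test_function_bump[OF r])
  have b0: "bump x r y = 0" if "y \<notin> cball x r" for y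
    using bump_pos_iff[OF r, of x y] that by (auto simp: dist_commute)
  define T where "T K F = (LINT y|facet_measure K F. (wp K y \<bullet> facet_normal K F) * bump x r y)" for K F
  have T0: "T K'' G = 0" if "K'' \<in> \<T>" "G facet_of K''" "\<And>y. y \<in> rel_interior G \<Longrightarrow> y \<notin> cball x r" for K'' G
    unfolding T_def by (rule facet_integral_zero[OF that(1,2)]) (use b0[OF that(3)] in simp)
  have sK: "(\<Sum>G | G facet_of K. T K G) = T K F"
  proof -
    have "T K G = 0" if "G facet_of K" "G \<noteq> F" for G
      by (rule T0[OF K(1) that(1)]) (use e3(2)[OF _ that(1)] rb(3) that in blast)
    then show ?thesis using A.finite_facets K(2) by (simp add: sum.remove[of _ F])
  qed
  have sK': "(\<Sum>G | G facet_of K'. T K' G) = T K' F"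
  proof -
    have "T K' G = 0" if "G facet_of K'" "G \<noteq> F" for G
      by (rule T0[OF K'(1) that(1)]) (use e4(2)[OF _ that(1)] rb(4) that in blast)
    then show ?thesis using B.finite_facets K'(3) by (simp add: sum.remove[of _ F])
  qed
  have sO: "(\<Sum>G | G facet_of K''. T K'' G) = 0" if K'': "K'' \<in> \<T> - {K, K'}" for K''
  proof (intro sum.neutral ballI)
    fix G assume "G \<in> {G. G facet_of K''}"
    then have G: "G facet_of K''" by simp
    show "T K'' G = 0"
    proof (rule T0[OF _ G])
      show "K'' \<in> \<T>" using K'' by simp
      fix y assume "y \<in> rel_interior G"
      then have "y \<in> K''" using rel_interior_subset facet_of_imp_subset[OF G] by blast
      then show "y \<notin> cball x r" using e5(2) rb(5) K'' by blast
    qed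
  qed
  have "0 = (\<Sum>K''\<in>\<T>. \<Sum>G | G facet_of K''. T K'' G)"
    using weak_identity'[OF t] by (simp add: T_def)
  also have "\<dots> = (\<Sum>K''\<in>{K, K'}. \<Sum>G | G facet_of K''. T K'' G)"
    by (rule sum.mono_neutral_right) (use K K' sO in auto)
  also have "\<dots> = T K F + T K' F" using K'(2) sK sK' by simp
  finally have TT: "T K F + T K' F = 0" by simp
  have cb: "continuous_on UNIV (bump x r)" by (rule C1_continuous[OF smooth_C1[OF bump_smooth]])
  have "T K F + T K' F = (LINT y|facet_measure K F. (wp K y \<bullet> ?n) * bump x r y)
      - (LINT y|facet_measure K F. (wp K' y \<bullet> ?n) * bump x r y)"
    by (simp add: T_def nb)
  also have "\<dots> = (LINT y|facet_measure K F. (wp K y \<bullet> ?n) * bump x r y - (wp K' y \<bullet> ?n) * bump x r y)"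
    by (rule Bochner_Integration.integral_diff[symmetric])
       (intro A.facet_integrable_continuous[OF K(2)] continuous_on_mult wp_cont K K' cb)+
  also have "\<dots> = (LINT y|facet_measure K F. \<delta> y * bump x r y)"
    by (simp add: \<delta>_def left_diff_distrib)
  finally have "(LINT y|facet_measure K F. \<delta> y * bump x r y) = 0" using TT by simp
  then have z: "(LINT y|facet_measure K F. (s * \<delta> y) * bump x r y) = 0"
    by (simp add: mult.assoc)
  have "(s * \<delta> x) * bump x r x = 0"
  proof (rule facet_continuous_integral_zero[OF K _ _ z x])
    show "continuous_on UNIV (\<lambda>y. (s * \<delta> y) * bump x r y)"
      by (intro continuous_on_mult continuous_on_const cont cb)
    fix y
    show "0 \<le> (s * \<delta> y) * bump x r y"
    proof (cases "y \<in> cball x r")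
      case True
      then have "0 < s * \<delta> y" using e6(2) rb(6) by blast
      then show ?thesis using bump_nonneg[of x r y] by simp
    qed (simp add: b0)
  qed
  then show False using bump_pos_iff[OF r, of x x] r ne by (auto simp: s_def sgn_if \<delta>_def split: if_splits)
qed

text \<open>The boundary condition is a limit from inside the domain; restricted to the interior of
  \<open>K\<close> it must agree with the value of the extension \<open>wp K\<close>.\<close>

lemma boundary_normal:
  assumes K: "K \<in> \<T>" "F facet_of K" and nb: "\<not> has_neighbour K F"
  shows "AE x in facet_measure K F. wp K x \<bullet> facet_normal K F = 0"
proof -
  interpret A: full_polytope K using element_facts K by blast
  let ?P = "\<lambda>x. ((\<lambda>y. w y \<bullet> outward_normal (closure \<Omega>) x) \<longlongrightarrow> 0) (at x within \<Omega>)"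
  have P: "AE x in surface_measure (closure \<Omega>). ?P x"
    using w by (simp add: RT1_0_def zero_normal_on_boundary_def)
  show ?thesis
    using AE_boundary_facet(1)[OF K nb P] A.AE_facet_measure[OF K(2)]
  proof eventually_elim
    case (elim x)
    have xK: "x \<in> K" using elim(2) rel_interior_subset facet_of_imp_subset[OF K(2)] by blast
    have "((\<lambda>y. w y \<bullet> facet_normal K F) \<longlongrightarrow> 0) (at x within \<Omega>)"
      using elim(1) AE_boundary_facet(2)[OF K nb P elim(2)] by simp
    then have 1: "((\<lambda>y. w y \<bullet> facet_normal K F) \<longlongrightarrow> 0) (at x within interior K)"
      using interior_in_domain[OF K(1)] tendsto_within_subset by blast
    have "((\<lambda>y. wp K y \<bullet> facet_normal K F) \<longlongrightarrow> wp K x \<bullet> facet_normal K F) (at x within interior K)"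
      using wp_cont[OF K(1), of UNIV] by (meson UNIV_I continuous_on_def subset_UNIV tendsto_within_subset)
    then have "((\<lambda>y. w y \<bullet> facet_normal K F) \<longlongrightarrow> wp K x \<bullet> facet_normal K F) (at x within interior K)"
      by (rule Lim_transform_eventually) (use wp(2)[OF K(1)] in \<open>auto simp: eventually_at_filter\<close>)
    then show ?case using tendsto_unique[OF at_interior_nontrivial[OF K(1) xK] _ 1] by blast
  qed
qed

end

section \<open>Traces expressed by extensions from the neighbouring elements\<close>

context mesh
begin

definition ext :: "(real^'d) set \<Rightarrow> (real^'d \<Rightarrow> real) \<Rightarrow> real^'d \<Rightarrow> real" where
  "ext K v = (SOME g. C1 g \<and> (\<forall>x\<in>interior K. v x = g x))"

lemma ext:
  assumes "pw_C1 v" "K \<in> \<T>"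
  shows "C1 (ext K v)" "x \<in> interior K \<Longrightarrow> v x = ext K v x"
proof -
  have "\<exists>g. C1 g \<and> (\<forall>x\<in>interior K. v x = g x)" using assms by (simp add: pw_C1_def)
  from someI_ex[OF this] show "C1 (ext K v)" "x \<in> interior K \<Longrightarrow> v x = ext K v x"
    unfolding ext_def by blast+
qed

lemma ext_continuous: "pw_C1 v \<Longrightarrow> K \<in> \<T> \<Longrightarrow> continuous_on A (ext K v)"
  using ext(1) C1_continuous by blast

lemma inner_trace_ext: "pw_C1 v \<Longrightarrow> K \<in> \<T> \<Longrightarrow> x \<in> K \<Longrightarrow> inner_trace K v x = ext K v x"
  by (rule inner_trace_eq) (auto simp: ext ext_continuous)

lemma ext_lincomb:
  assumes u: "pw_C1 u" and v: "pw_C1 v" and K: "K \<in> \<T>" "x \<in> K"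
  shows "ext K (\<lambda>x. a * u x + b * v x) x = a * ext K u x + b * ext K v x"
proof -
  have uv: "pw_C1 (\<lambda>x. a * u x + b * v x)" by (intro pw_C1_add pw_C1_mult pw_C1_const u v)
  have "inner_trace K (\<lambda>x. a * u x + b * v x) x = a * ext K u x + b * ext K v x"
    by (rule inner_trace_eq[OF K])
       (auto intro!: continuous_intros ext_continuous u v K simp: ext(2)[OF u K(1)] ext(2)[OF v K(1)])
  then show ?thesis using inner_trace_ext[OF uv K] by simp
qed

definition nbr :: "(real^'d) set \<Rightarrow> (real^'d) set \<Rightarrow> (real^'d) set" where
  "nbr K F = (SOME K'. K' \<in> \<T> \<and> K' \<noteq> K \<and> F facet_of K')"

lemma nbr:
  assumes "has_neighbour K F"
  shows "nbr K F \<in> \<T>" "nbr K F \<noteq> K" "F facet_of nbr K F"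
proof -
  have "\<exists>K'. K' \<in> \<T> \<and> K' \<noteq> K \<and> F facet_of K'" using assms by (auto simp: has_neighbour_def)
  from someI_ex[OF this] show "nbr K F \<in> \<T>" "nbr K F \<noteq> K" "F facet_of nbr K F"
    unfolding nbr_def by blast+
qed

text \<open>Crossing a facet twice returns to the start; \<open>transport_form_nonneg\<close> pairs
  the facet contributions by this involution.\<close>

lemma nbr_nbr:
  assumes K: "K \<in> \<T>" "F facet_of K" and nb: "has_neighbour K F"
  shows "has_neighbour (nbr K F) F" "nbr (nbr K F) F = K"
proof -
  note n = nbr[OF nb]
  show h: "has_neighbour (nbr K F) F" unfolding has_neighbour_def using K n by metis
  note m = nbr[OF h]
  show "nbr (nbr K F) F = K"
    by (rule neighbour_unique[OF n(1,3) m]) (use K n in auto)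
qed

text \<open>The outer trace in terms of the extension on the neighbour; the value 0 on boundary
  facets is the trace of a function that vanishes outside the domain.\<close>

definition outer :: "(real^'d) set \<Rightarrow> (real^'d) set \<Rightarrow> (real^'d \<Rightarrow> real) \<Rightarrow> real^'d \<Rightarrow> real" where
  "outer K F v x = (if has_neighbour K F then ext (nbr K F) v x else 0)"

lemma outer_continuous: "pw_C1 v \<Longrightarrow> continuous_on A (outer K F v)"
  unfolding outer_def using ext_continuous nbr(1) by (cases "has_neighbour K F") auto

lemma outer_trace_outer:
  assumes v: "pw_C1 v" "\<And>y. y \<in> off_elements \<T> \<Longrightarrow> v y = 0"
    and K: "K \<in> \<T>" "F facet_of K" "x \<in> rel_interior F"
  shows "outer_trace K v x = outer K F v x"
proof (cases "has_neighbour K F")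
  case True
  note n = nbr[OF True]
  have "x \<in> nbr K F" using K(3) rel_interior_subset facet_of_imp_subset[OF n(3)] by blast
  then show ?thesis
    using outer_trace_neighbour[OF K n, of v] inner_trace_ext[OF v(1) n(1)] True by (simp add: outer_def)
next
  case False
  then show ?thesis using outer_trace_boundary[OF K False v(2)] by (simp add: outer_def)
qed

lemma outer_lincomb:
  assumes u: "pw_C1 u" and v: "pw_C1 v" and x: "x \<in> rel_interior F"
  shows "outer K F (\<lambda>x. a * u x + b * v x) x = a * outer K F u x + b * outer K F v x"
proof (cases "has_neighbour K F")
  case True
  note n = nbr[OF True]
  have "x \<in> nbr K F" using x rel_interior_subset facet_of_imp_subset[OF n(3)] by blast
  then show ?thesis using ext_lincomb[OF u v n(1)] True by (simp add: outer_def)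
qed (simp add: outer_def)

end

section \<open>Upwind fluxes and the energy of the transport form\<close>

context transport
begin

definition flow :: "(real^'d) set \<Rightarrow> (real^'d) set \<Rightarrow> real^'d \<Rightarrow> real" where
  "flow K F x = wp K x \<bullet> facet_normal K F"

text \<open>The inflow condition is part of the integrand because it depends on the point: the
  normal flow may change sign within a facet.\<close>

definition flux :: "(real^'d) set \<Rightarrow> (real^'d) set \<Rightarrow> (real^'d \<Rightarrow> real) \<Rightarrow> (real^'d \<Rightarrow> real) \<Rightarrow> real^'d \<Rightarrow> real" where
  "flux K F \<rho> \<phi> x = (if flow K F x < 0 then flow K F x * (ext K \<rho> x - outer K F \<rho> x) * ext K \<phi> x else 0)"

lemma flow_continuous: "K \<in> \<T> \<Longrightarrow> continuous_on A (flow K F)"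
  unfolding flow_def by (rule wp_cont)

lemma flux_props:
  assumes \<rho>: "pw_C1 \<rho>" and \<phi>: "pw_C1 \<phi>" and K: "K \<in> \<T>" "F facet_of K"
  shows "flux K F \<rho> \<phi> \<in> borel_measurable borel" "integrable (facet_measure K F) (flux K F \<rho> \<phi>)"
proof -
  interpret A: full_polytope K using element_facts K by blast
  let ?h = "\<lambda>x. flow K F x * (ext K \<rho> x - outer K F \<rho> x) * ext K \<phi> x"
  have h: "continuous_on UNIV ?h"
    by (intro continuous_on_mult continuous_on_diff flow_continuous ext_continuous outer_continuous \<rho> \<phi> K)
  have "open {x. flow K F x < 0}" by (intro open_Collect_less flow_continuous K continuous_on_const)
  then have S: "{x. flow K F x < 0} \<in> sets borel" by simp
  have eq: "flux K F \<rho> \<phi> = (\<lambda>x. indicator {x. flow K F x < 0} x *\<^sub>R ?h x)"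
    by (auto simp: flux_def fun_eq_iff indicator_def)
  have hm: "?h \<in> borel_measurable borel" by (rule borel_measurable_continuous_onI[OF h])
  show "flux K F \<rho> \<phi> \<in> borel_measurable borel"
    unfolding eq by (intro borel_measurable_scaleR borel_measurable_indicator S hm)
  show "integrable (facet_measure K F) (flux K F \<rho> \<phi>)"
    unfolding eq by (rule integrable_mult_indicator[OF _ A.facet_integrable_continuous[OF K(2) h]]) (simp add: S)
qed

lemma flux_lincomb:
  assumes u: "pw_C1 u" and v: "pw_C1 v" and \<phi>: "pw_C1 \<phi>" and K: "K \<in> \<T>" "F facet_of K"
  shows "(LINT x|facet_measure K F. flux K F (\<lambda>x. a * u x + b * v x) \<phi> x)
    = a * (LINT x|facet_measure K F. flux K F u \<phi> x) + b * (LINT x|facet_measure K F. flux K F v \<phi> x)"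
    "(LINT x|facet_measure K F. flux K F \<phi> (\<lambda>x. a * u x + b * v x) x)
    = a * (LINT x|facet_measure K F. flux K F \<phi> u x) + b * (LINT x|facet_measure K F. flux K F \<phi> v x)"
proof -
  interpret A: full_polytope K using element_facts K by blast
  have uv: "pw_C1 (\<lambda>x. a * u x + b * v x)" by (intro pw_C1_add pw_C1_mult pw_C1_const u v)
  have FK: "x \<in> K" if "x \<in> rel_interior F" for x
    using that rel_interior_subset facet_of_imp_subset[OF K(2)] by blast
  have "(LINT x|facet_measure K F. flux K F (\<lambda>x. a * u x + b * v x) \<phi> x)
      = (LINT x|facet_measure K F. a * flux K F u \<phi> x + b * flux K F v \<phi> x)"
  proof (rule integral_cong_AE)
    show "AE x in facet_measure K F. flux K F (\<lambda>x. a * u x + b * v x) \<phi> x = a * flux K F u \<phi> x + b * flux K F v \<phi> x"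
      using A.AE_facet_measure[OF K(2)]
    proof eventually_elim
      case (elim x)
      show ?case
        unfolding flux_def ext_lincomb[OF u v K(1) FK[OF elim]] outer_lincomb[OF u v elim]
        by (simp add: algebra_simps)
    qed
  qed (use flux_props(1)[OF uv \<phi> K] flux_props(1)[OF u \<phi> K] flux_props(1)[OF v \<phi> K] in measurable)
  then show "(LINT x|facet_measure K F. flux K F (\<lambda>x. a * u x + b * v x) \<phi> x)
    = a * (LINT x|facet_measure K F. flux K F u \<phi> x) + b * (LINT x|facet_measure K F. flux K F v \<phi> x)"
    using flux_props(2)[OF u \<phi> K] flux_props(2)[OF v \<phi> K] by simp
  have "(LINT x|facet_measure K F. flux K F \<phi> (\<lambda>x. a * u x + b * v x) x)
      = (LINT x|facet_measure K F. a * flux K F \<phi> u x + b * flux K F \<phi> v x)"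
  proof (rule integral_cong_AE)
    show "AE x in facet_measure K F. flux K F \<phi> (\<lambda>x. a * u x + b * v x) x = a * flux K F \<phi> u x + b * flux K F \<phi> v x"
      using A.AE_facet_measure[OF K(2)]
    proof eventually_elim
      case (elim x)
      show ?case
        unfolding flux_def ext_lincomb[OF u v K(1) FK[OF elim]] by (simp add: algebra_simps)
    qed
  qed (use flux_props(1)[OF \<phi> uv K] flux_props(1)[OF \<phi> u K] flux_props(1)[OF \<phi> v K] in measurable)
  then show "(LINT x|facet_measure K F. flux K F \<phi> (\<lambda>x. a * u x + b * v x) x)
    = a * (LINT x|facet_measure K F. flux K F \<phi> u x) + b * (LINT x|facet_measure K F. flux K F \<phi> v x)"
    using flux_props(2)[OF \<phi> u K] flux_props(2)[OF \<phi> v K] by simp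
qed

text \<open>On relative interiors of facets all traces are values of continuous extensions, so the
  inflow term of the scheme, defined by limits, becomes a sum of integrals of Borel
  functions.\<close>

lemma inflow_integral:
  assumes \<rho>: "pw_C1 \<rho>" "\<And>y. y \<in> off_elements \<T> \<Longrightarrow> \<rho> y = 0" and \<phi>: "pw_C1 \<phi>" and K: "K \<in> \<T>"
  shows "(LINT x:inflow_boundary K w|surface_measure K. (inner_trace K w x \<bullet> jump K \<rho> x) * inner_trace K \<phi> x)
    = (\<Sum>F | F facet_of K. LINT x|facet_measure K F. flux K F \<rho> \<phi> x)"
  unfolding set_lebesgue_integral_def
proof -
  interpret A: full_polytope K using element_facts K by blast
  show "(LINT x|surface_measure K. indicator (inflow_boundary K w) x *\<^sub>R
      ((inner_trace K w x \<bullet> jump K \<rho> x) * inner_trace K \<phi> x))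
    = (\<Sum>F | F facet_of K. LINT x|facet_measure K F. flux K F \<rho> \<phi> x)"
  proof (rule A.integral_surface_measure)
    fix F x assume F: "F facet_of K" and x: "x \<in> rel_interior F"
    have xF: "x \<in> F" "x \<in> K" using x rel_interior_subset facet_of_imp_subset[OF F] by blast+
    have "x \<in> frontier K"
      using A.facet_interior_disjoint[OF F xF(1)] xF(2) closure_subset by (auto simp: frontier_def)
    moreover have wt: "inner_trace K w x = wp K x"
    proof (rule inner_trace_eq[OF K xF(2)])
      show "continuous_on UNIV (wp K)"
        using C1_continuous[OF wp(1)[OF K]] by (simp add: continuous_on_componentwise[where 'b="real^'d"] Basis_vec_def inner_axis)
    qed (simp add: wp(2)[OF K])
    ultimately have "x \<in> inflow_boundary K w \<longleftrightarrow> flow K F x < 0"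
      by (simp add: inflow_boundary_def flow_def A.facet_props(5)[OF F x])
    moreover have "outer_trace K \<rho> x = outer K F \<rho> x" by (rule outer_trace_outer[OF \<rho> K F x])
    ultimately show "indicator (inflow_boundary K w) x *\<^sub>R ((inner_trace K w x \<bullet> jump K \<rho> x) * inner_trace K \<phi> x)
        = flux K F \<rho> \<phi> x"
      unfolding jump_def wt A.facet_props(5)[OF F x]
        inner_trace_ext[OF \<rho>(1) K xF(2)] inner_trace_ext[OF \<phi> K xF(2)]
      by (simp add: flux_def flow_def indicator_def)
  qed (use flux_props[OF \<rho>(1) \<phi> K] in auto)
qed

definition transport_form :: "(real^'d \<Rightarrow> real) \<Rightarrow> (real^'d \<Rightarrow> real) \<Rightarrow> real" where
  "transport_form \<rho> \<phi> = II (\<lambda>x. (w x \<bullet> grad \<rho> x) * \<phi> x)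
     - (\<Sum>K\<in>\<T>. \<Sum>F | F facet_of K. LINT x|facet_measure K F. flux K F \<rho> \<phi> x)"

lemma pw_cont_w_grad: "pw_C1 \<rho> \<Longrightarrow> pw_cont (\<lambda>x. w x \<bullet> grad \<rho> x)"
  unfolding inner_vec_def inner_real_def
  by (intro pw_cont_sum pw_cont_mult pw_C1_imp_cont[OF w_pw_C1] pw_C1_grad)

lemma grad_lincomb:
  assumes u: "pw_C1 u" and v: "pw_C1 v" and K: "K \<in> \<T>" "x \<in> interior K"
  shows "grad (\<lambda>x. a * u x + b * v x) x = a *\<^sub>R grad u x + b *\<^sub>R grad v x"
proof -
  have "((\<lambda>x. a * u x + b * v x) has_derivative
    (\<lambda>h. a * frechet_derivative u (at x) h + b * frechet_derivative v (at x) h)) (at x)"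
    by (intro derivative_intros pw_C1_differentiable[OF u K] pw_C1_differentiable[OF v K])
  then show ?thesis by (simp add: vec_eq_iff grad_nth frechet_eqI)
qed

lemma transport_form_lincomb:
  assumes u: "pw_C1 u" and v: "pw_C1 v" and \<phi>: "pw_C1 \<phi>"
  shows "transport_form (\<lambda>x. a * u x + b * v x) \<phi> = a * transport_form u \<phi> + b * transport_form v \<phi>"
    "transport_form \<phi> (\<lambda>x. a * u x + b * v x) = a * transport_form \<phi> u + b * transport_form \<phi> v"
proof -
  have uv: "pw_C1 (\<lambda>x. a * u x + b * v x)" by (intro pw_C1_add pw_C1_mult pw_C1_const u v)
  note pc = pw_cont_mult[OF pw_cont_w_grad pw_C1_imp_cont]
  have "II (\<lambda>x. (w x \<bullet> grad (\<lambda>x. a * u x + b * v x) x) * \<phi> x)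
    = II (\<lambda>x. a * ((w x \<bullet> grad u x) * \<phi> x) + b * ((w x \<bullet> grad v x) * \<phi> x))"
    by (rule II_cong[OF pc[OF uv \<phi>]]) (simp add: grad_lincomb[OF u v] inner_add_right algebra_simps)
  also have "\<dots> = a * II (\<lambda>x. (w x \<bullet> grad u x) * \<phi> x) + b * II (\<lambda>x. (w x \<bullet> grad v x) * \<phi> x)"
    by (rule II_lincomb[OF pc[OF u \<phi>] pc[OF v \<phi>]])
  finally show "transport_form (\<lambda>x. a * u x + b * v x) \<phi> = a * transport_form u \<phi> + b * transport_form v \<phi>"
    unfolding transport_form_def
    by (simp add: flux_lincomb(1)[OF u v \<phi>] sum.distrib sum_distrib_left right_diff_distrib)
  have "II (\<lambda>x. (w x \<bullet> grad \<phi> x) * (a * u x + b * v x))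
    = II (\<lambda>x. a * ((w x \<bullet> grad \<phi> x) * u x) + b * ((w x \<bullet> grad \<phi> x) * v x))"
    by (simp add: algebra_simps)
  also have "\<dots> = a * II (\<lambda>x. (w x \<bullet> grad \<phi> x) * u x) + b * II (\<lambda>x. (w x \<bullet> grad \<phi> x) * v x)"
    by (rule II_lincomb[OF pc[OF \<phi> u] pc[OF \<phi> v]])
  finally show "transport_form \<phi> (\<lambda>x. a * u x + b * v x) = a * transport_form \<phi> u + b * transport_form \<phi> v"
    unfolding transport_form_def
    by (simp add: flux_lincomb(2)[OF u v \<phi>] sum.distrib sum_distrib_left right_diff_distrib)
qed

text \<open>The integrand is the flow applied to the gradient of half the square of \<rho>, and the
  flow is divergence free on the element.\<close>

lemma element_energy:
  assumes \<rho>: "pw_C1 \<rho>" and K: "K \<in> \<T>"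
  shows "int_on K (\<lambda>x. (w x \<bullet> grad \<rho> x) * \<rho> x)
    = (\<Sum>F | F facet_of K. LINT x|facet_measure K F. flow K F x * (1/2 * (ext K \<rho> x * ext K \<rho> x)))"
proof -
  let ?e = "ext K \<rho>" and ?h = "\<lambda>x. 1/2 * (ext K \<rho> x * ext K \<rho> x)"
  note e = ext[OF \<rho> K]
  have h: "C1 ?h" by (rule C1_cmult[OF C1_mult[OF e(1) e(1)]])
  have "frechet_derivative ?h (at x) v = ?e x * frechet_derivative ?e (at x) v" for x v
    unfolding frechet_mult[OF C1_const C1_mult[OF e(1) e(1)]] frechet_mult[OF e(1) e(1)]
    by (simp add: frechet_const_fun)
  then have "grad ?h x = ?e x *\<^sub>R grad ?e x" for x
    by (simp only: vec_eq_iff grad_nth vector_scaleR_component real_scaleR_def simp_thms)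
  moreover have "grad \<rho> x = grad ?e x" if "x \<in> interior K" for x
    using frechet_interior(2)[OF e that] by (simp add: vec_eq_iff grad_nth)
  ultimately have "int_on K (\<lambda>x. (w x \<bullet> grad \<rho> x) * \<rho> x) = int_on K (\<lambda>x. wp K x \<bullet> grad ?h x)"
    by (intro int_on_cong) (simp add: wp(2)[OF K] e(2))
  also have "\<dots> = (\<Sum>F | F facet_of K. LINT x|facet_measure K F. (wp K x \<bullet> facet_normal K F) * ?h x)
      - int_on K (\<lambda>x. cdiv (wp K) x * ?h x)"
    by (rule wp_parts[OF K h])
  also have "int_on K (\<lambda>x. cdiv (wp K) x * ?h x) = 0"
    by (rule int_on_zero) (simp add: div_zero[OF K])
  finally show ?thesis by (simp add: flow_def)
qed

text \<open>What the facet \<open>F\<close> of \<open>K\<close> contributes to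
  \<open>transport_form \<rho> \<rho>\<close> after integration by parts.\<close>

definition dissipation :: "(real^'d \<Rightarrow> real) \<Rightarrow> (real^'d) set \<Rightarrow> (real^'d) set \<Rightarrow> real^'d \<Rightarrow> real" where
  "dissipation \<rho> K F x = flow K F x * (1/2 * (ext K \<rho> x * ext K \<rho> x)) - flux K F \<rho> \<rho> x"

lemma dissipation_integrable:
  assumes \<rho>: "pw_C1 \<rho>" and K: "K \<in> \<T>" "F facet_of K"
  shows "integrable (facet_measure K F) (dissipation \<rho> K F)"
    and "(LINT x|facet_measure K F. dissipation \<rho> K F x)
      = (LINT x|facet_measure K F. flow K F x * (1/2 * (ext K \<rho> x * ext K \<rho> x)))
        - (LINT x|facet_measure K F. flux K F \<rho> \<rho> x)"
proof -
  interpret A: full_polytope K using element_facts K by blast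
  have i: "integrable (facet_measure K F) (\<lambda>x. flow K F x * (1/2 * (ext K \<rho> x * ext K \<rho> x)))"
    by (intro A.facet_integrable_continuous[OF K(2)] continuous_on_mult continuous_on_const
        flow_continuous ext_continuous \<rho> K)
  show "integrable (facet_measure K F) (dissipation \<rho> K F)"
    unfolding dissipation_def[abs_def] by (rule Bochner_Integration.integrable_diff[OF i flux_props(2)[OF \<rho> \<rho> K]])
  show "(LINT x|facet_measure K F. dissipation \<rho> K F x)
      = (LINT x|facet_measure K F. flow K F x * (1/2 * (ext K \<rho> x * ext K \<rho> x)))
        - (LINT x|facet_measure K F. flux K F \<rho> \<rho> x)"
    unfolding dissipation_def by (rule Bochner_Integration.integral_diff[OF i flux_props(2)[OF \<rho> \<rho> K]])
qed

text \<open>The two contributions of an interior facet add up to half the flow times the squared jump.\<close>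

lemma dissipation_pair:
  assumes \<rho>: "pw_C1 \<rho>" and K: "K \<in> \<T>" "F facet_of K" and nb: "has_neighbour K F"
  shows "0 \<le> (LINT x|facet_measure K F. dissipation \<rho> K F x)
    + (LINT x|facet_measure (nbr K F) F. dissipation \<rho> (nbr K F) F x)"
proof -
  interpret A: full_polytope K using element_facts K by blast
  define K' where "K' = nbr K F"
  note n = nbr[OF nb, folded K'_def]
  note nn = nbr_nbr[OF K nb, folded K'_def]
  note m = neighbour_facet_measure[OF K(1) n(1,2) K(2) n(3)]
  have "0 \<le> dissipation \<rho> K F x + dissipation \<rho> K' F x" if x: "x \<in> rel_interior F" for x
  proof -
    define b where "b = flow K F x"
    define r where "r = ext K \<rho> x"
    define r' where "r' = ext K' \<rho> x"
    have b': "flow K' F x = - b"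
      using normal_continuity[OF K n x] by (simp add: flow_def m(2) b_def)
    have o: "outer K F \<rho> x = r'" "outer K' F \<rho> x = r"
      using nb nn by (simp_all add: outer_def r_def r'_def K'_def[symmetric])
    \<comment> \<open>Only the element for which the facet is inflow carries a flux term; it
      supplies the mixed product that completes the square.\<close>
    have "dissipation \<rho> K F x + dissipation \<rho> K' F x = 1/2 * \<bar>b\<bar> * (r - r')\<^sup>2"
      unfolding dissipation_def flux_def b' o b_def[symmetric] r_def[symmetric] r'_def[symmetric]
      by (auto simp: power2_eq_square algebra_simps abs_if)
    moreover have "0 \<le> 1/2 * \<bar>b\<bar> * (r - r')\<^sup>2" by (intro mult_nonneg_nonneg) auto
    ultimately show ?thesis by linarith
  qed
  then have "AE x in facet_measure K F. 0 \<le> dissipation \<rho> K F x + dissipation \<rho> K' F x"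
    using A.AE_facet_measure[OF K(2)] by (auto elim: eventually_mono)
  then have "0 \<le> (LINT x|facet_measure K F. dissipation \<rho> K F x + dissipation \<rho> K' F x)"
    by (rule integral_nonneg_AE)
  also have "\<dots> = (LINT x|facet_measure K F. dissipation \<rho> K F x) + (LINT x|facet_measure K' F. dissipation \<rho> K' F x)"
    unfolding m(1)
    by (rule Bochner_Integration.integral_add)
       (use dissipation_integrable(1)[OF \<rho> K] dissipation_integrable(1)[OF \<rho> n(1,3)] m(1) in auto)
  finally show ?thesis by (simp add: K'_def)
qed

lemma dissipation_boundary:
  assumes K: "K \<in> \<T>" "F facet_of K" and nb: "\<not> has_neighbour K F"
  shows "(LINT x|facet_measure K F. dissipation \<rho> K F x) = 0"
  by (rule integral_eq_zero_AE)
     (use boundary_normal[OF K nb] in \<open>auto elim!: eventually_mono simp: dissipation_def flux_def flow_def\<close>)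

text \<open>A single facet contribution has no sign. Adding the sum to its image under the
  involution that swaps the two sides of each interior facet gives twice the sum as a sum of
  nonnegative pairs.\<close>

theorem transport_form_nonneg:
  assumes \<rho>: "pw_C1 \<rho>" shows "0 \<le> transport_form \<rho> \<rho>"
proof -
  define D where "D = (\<lambda>(K, F). LINT x|facet_measure K F. dissipation \<rho> K F x)"
  let ?P = "Sigma \<T> (\<lambda>K. {F. F facet_of K})"
  let ?I = "{z \<in> ?P. has_neighbour (fst z) (snd z)}"
  let ?i = "\<lambda>(K, F). (nbr K F, F)"
  have finF: "finite {F. F facet_of K}" if "K \<in> \<T>" for K
    using full_polytope.finite_facets element_facts(1)[OF that] by blast
  then have finP: "finite ?P" by auto
  have pc: "pw_cont (\<lambda>x. (w x \<bullet> grad \<rho> x) * \<rho> x)"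
    by (intro pw_cont_mult pw_cont_w_grad pw_C1_imp_cont \<rho>)
  have "transport_form \<rho> \<rho> = (\<Sum>K\<in>\<T>. \<Sum>F | F facet_of K. D (K, F))"
    unfolding transport_form_def pw_integral(2)[OF pc] D_def
    by (simp add: element_energy[OF \<rho>] dissipation_integrable(2)[OF \<rho>] sum_subtractf)
  also have "\<dots> = sum D ?P" using finF by (subst sum.Sigma) (auto simp: split_def)
  also have "\<dots> = sum D ?I"
  proof (rule sum.mono_neutral_right[OF finP])
    show "\<forall>z\<in>?P - ?I. D z = 0"
    proof
      fix z assume "z \<in> ?P - ?I"
      then show "D z = 0" using dissipation_boundary[of "fst z" "snd z" \<rho>] by (auto simp: D_def)
    qed
  qed auto
  finally have tf: "transport_form \<rho> \<rho> = sum D ?I" .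
  have "sum D ?I = (\<Sum>z\<in>?I. D (?i z))"
    by (rule sum.reindex_bij_witness[of _ ?i ?i]) (auto simp: nbr nbr_nbr)
  then have "2 * sum D ?I = (\<Sum>z\<in>?I. D z + D (?i z))" by (simp add: sum.distrib)
  also have "\<dots> \<ge> 0"
    by (intro sum_nonneg) (auto simp: D_def dissipation_pair[OF \<rho>])
  finally show ?thesis using tf by simp
qed

end

section \<open>Uniqueness of the pressure\<close>

text \<open>A multi-index of total degree at most 1 is zero or a unit vector.\<close>

lemma poly_fun_1_affine:
  fixes p :: "real^'d \<Rightarrow> real"
  assumes "poly_fun 1 p" obtains m c where "p = (\<lambda>x. m \<bullet> x + c)"
proof -
  obtain k where p: "p = (\<lambda>x. \<Sum>\<alpha> | sum \<alpha> UNIV \<le> 1. k \<alpha> * (\<Prod>i\<in>UNIV. (x $ i) ^ \<alpha> i))"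
    using assms unfolding poly_fun_def by blast
  let ?A = "{\<alpha> :: 'd \<Rightarrow> nat. sum \<alpha> UNIV \<le> 1}"
  have "\<exists>mc. \<forall>x :: real^'d. (\<Prod>i\<in>UNIV. (x $ i) ^ \<alpha> i) = fst mc \<bullet> x + snd mc"
    if s: "sum \<alpha> UNIV \<le> 1" for \<alpha> :: "'d \<Rightarrow> nat"
  proof (cases "\<forall>i. \<alpha> i = 0")
    case True
    then show ?thesis by (intro exI[of _ "(0, 1)"]) simp
  next
    case False
    then obtain j where j: "\<alpha> j \<noteq> 0" by blast
    have "\<alpha> j + sum \<alpha> (UNIV - {j}) \<le> 1" using s by (simp add: sum.remove[of UNIV j])
    then have j1: "\<alpha> j = 1" and "sum \<alpha> (UNIV - {j}) = 0" using j by linarith+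
    then have o: "\<alpha> i = 0" if "i \<noteq> j" for i using that by simp
    have "(\<Prod>i\<in>UNIV. (x $ i) ^ \<alpha> i) = x $ j" for x :: "real^'d"
      by (subst prod.remove[of UNIV j]) (auto simp: j1 o)
    then show ?thesis by (intro exI[of _ "(axis j 1, 0)"]) (simp add: inner_axis')
  qed
  then have "\<forall>\<alpha>\<in>?A. \<exists>mc. \<forall>x :: real^'d. (\<Prod>i\<in>UNIV. (x $ i) ^ \<alpha> i) = fst mc \<bullet> x + snd mc" by blast
  then obtain f where "\<forall>\<alpha>\<in>?A. \<forall>x :: real^'d. (\<Prod>i\<in>UNIV. (x $ i) ^ \<alpha> i) = fst (f \<alpha>) \<bullet> x + snd (f \<alpha>)"
    by (rule bchoice[THEN exE])
  then have f: "(\<Prod>i\<in>UNIV. (x $ i) ^ \<alpha> i) = fst (f \<alpha>) \<bullet> x + snd (f \<alpha>)" if "sum \<alpha> UNIV \<le> 1" for \<alpha> and x :: "real^'d"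
    using that by simp
  have "p = (\<lambda>x. (\<Sum>\<alpha>\<in>?A. k \<alpha> *\<^sub>R fst (f \<alpha>)) \<bullet> x + (\<Sum>\<alpha>\<in>?A. k \<alpha> * snd (f \<alpha>)))"
    unfolding p by (simp add: fun_eq_iff f inner_sum_left distrib_left sum.distrib)
  then show thesis by (rule that)
qed

section \<open>Bubbles and cut-offs on one element\<close>

context simplex_element
begin

text \<open>The polynomial behind the bubble, without truncation to the interior, so that it is
  differentiable everywhere.\<close>

definition bub :: "real^'d \<Rightarrow> real" where
  "bub x = (\<Prod>a\<in>C. barycentric K x a)"

lemma bub_C1: "C1 bub"
proof -
  have "bub = (\<lambda>x. \<Prod>a\<in>C. (bgrad a \<bullet> x - boff a))"
    by (auto simp: bub_def bary_affine fun_eq_iff intro!: prod.cong)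
  then show ?thesis by (auto intro!: C1_prod C1_diff)
qed

lemma bubble_bub: "x \<in> interior K \<Longrightarrow> bubble K x = bub x"
  by (simp add: bubble_def bub_def vertices_K)

lemma bub_facet: assumes "F facet_of K" "x \<in> rel_interior F" shows "bub x = 0"
proof -
  obtain a where a: "a \<in> C" "F = facet a" using assms(1) facets by auto
  then have "barycentric K x a = 0" using assms(2) mem_rel_interior_facet[OF a(1)] by simp
  then show ?thesis unfolding bub_def using a(1) by (intro prod_zero) auto
qed

lemma bub_pos: "x \<in> interior K \<Longrightarrow> 0 < bub x"
  by (auto simp: bub_def mem_interior intro!: prod_pos)

text \<open>Outside the interior some coordinate is nonpositive, so the product of the positive
  parts of the coordinates equals the truncated bubble everywhere. Continuity yields the boundary
  condition in \<open>bubble_P1b0\<close>.\<close>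

lemma bubble_continuous: "continuous_on UNIV (bubble K)"
proof -
  have "bubble K x = (\<Prod>a\<in>C. max 0 (bgrad a \<bullet> x - boff a))" for x
  proof (cases "x \<in> interior K")
    case True
    then show ?thesis
      by (auto simp: bubble_bub bub_def mem_interior bary_affine intro!: prod.cong)
  next
    case False
    then obtain a where a: "a \<in> C" "barycentric K x a \<le> 0" by (auto simp: mem_interior not_less)
    then have "max 0 (bgrad a \<bullet> x - boff a) = 0" by (simp add: bary_affine)
    then have "(\<Prod>a\<in>C. max 0 (bgrad a \<bullet> x - boff a)) = 0" using a(1) by (intro prod_zero) auto
    then show ?thesis using False by (simp add: bubble_def)
  qed
  then have "bubble K = (\<lambda>x. \<Prod>a\<in>C. max 0 (bgrad a \<bullet> x - boff a))" by blast
  then show ?thesis by (simp only:) (intro continuous_on_prod continuous_intros)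
qed

lemma int_on_deriv_zero:
  assumes "C1 f" "\<And>F x. F facet_of K \<Longrightarrow> x \<in> rel_interior F \<Longrightarrow> f x = 0"
  shows "int_on K (\<lambda>x. frechet_derivative f (at x) e) = 0"
proof -
  have "(LINT x|facet_measure K F. f x) = 0" if F: "F facet_of K" for F
    by (rule integral_eq_zero_AE) (use AE_facet_measure[OF F] assms(2)[OF F] in \<open>auto elim: eventually_mono\<close>)
  then show ?thesis by (simp add: divergence_theorem_dir[OF assms(1)])
qed

text \<open>The bubble vanishes on all facets, so integration by parts turns the hypothesis into the
  vanishing of \<open>m \<bullet> e\<close> times the integral of the bubble, which is
  nonzero.\<close>

lemma affine_bubble_orthogonal:
  assumes "int_on K (\<lambda>x. (m \<bullet> x + c) * frechet_derivative bub (at x) e) = 0"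
  shows "m \<bullet> e = 0"
proof -
  let ?p = "\<lambda>x. m \<bullet> x + c"
  have p: "C1 ?p" by auto
  have dp: "frechet_derivative ?p (at x) e = m \<bullet> e" for x
    by (subst frechet_add) (auto simp: frechet_inner frechet_const_fun)
  have c1: "continuous_on UNIV (\<lambda>x. ?p x * frechet_derivative bub (at x) e)"
    by (intro continuous_on_mult C1_continuous[OF p] C1_cont_deriv[OF bub_C1])
  have cb: "continuous_on UNIV bub" by (rule C1_continuous[OF bub_C1])
  have "0 = int_on K (\<lambda>x. frechet_derivative (\<lambda>x. ?p x * bub x) (at x) e)"
    by (rule int_on_deriv_zero[symmetric]) (use bub_facet p bub_C1 in auto)
  also have "\<dots> = int_on K (\<lambda>x. ?p x * frechet_derivative bub (at x) e + (m \<bullet> e) * bub x)"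
    unfolding frechet_mult[OF p bub_C1] dp ..
  also have "\<dots> = (m \<bullet> e) * int_on K bub"
    using int_on_lin(1)[OF c1 continuous_on_mult[OF continuous_on_const cb]] int_on_lin(2)[OF cb cb] assms
    by simp
  finally have "m \<bullet> e = 0 \<or> int_on K bub = 0" by simp
  moreover have "int_on K bub \<noteq> 0"
  proof
    assume z: "int_on K bub = 0"
    obtain x where x: "x \<in> interior K" using interior_K_nonempty by blast
    have "bub x = 0"
      by (rule continuous_integral_zero[OF cb integrable_indicator_interior[OF cb] _ z x])
         (use bub_pos less_imp_le in blast)
    then show False using bub_pos[OF x] by simp
  qed
  ultimately show ?thesis by blast
qed

text \<open>Cut-off functions converging to the indicator of the interior: the shift by \<open>1 / Suc n\<close> keeps the
  support compact, the power drives the positive values to 1.\<close>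

definition cut :: "nat \<Rightarrow> real^'d \<Rightarrow> real" where
  "cut n x = 1 - (1 - (\<Prod>a\<in>C. flat 0 (barycentric K x a - 1 / real (Suc n)))) ^ n"

lemma cut_prod_bounds: "0 \<le> (\<Prod>a\<in>C. flat 0 (t a))" "(\<Prod>a\<in>C. flat 0 (t a)) \<le> 1"
  by (auto intro!: prod_nonneg prod_le_1 flat_0(1) less_imp_le[OF flat_0(2)])

lemma cut_smooth: "smooth (cut n)"
proof -
  have "cut n = (\<lambda>x. 1 - (1 - (\<Prod>a\<in>C. flat 0 ((bgrad a \<bullet> x - boff a) - 1 / real (Suc n)))) ^ n)"
    by (auto simp: cut_def bary_affine fun_eq_iff cong: prod.cong)
  then show ?thesis
    by (simp only:) (intro smooth_diff smooth_power smooth_prod smooth_flat smooth_const smooth_inner)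
qed

lemma cut_bounds: "0 \<le> cut n x" "cut n x \<le> 1"
  using cut_prod_bounds[of "\<lambda>a. barycentric K x a - 1 / real (Suc n)"]
  by (auto simp: cut_def intro!: power_le_one)

definition core :: "nat \<Rightarrow> (real^'d) set" where
  "core n = {x. \<forall>a\<in>C. 1 / real (Suc n) \<le> barycentric K x a}"

lemma cut_support: assumes "x \<notin> core n" shows "cut n x = 0"
proof -
  obtain a where a: "a \<in> C" "barycentric K x a < 1 / real (Suc n)" using assms by (auto simp: core_def not_le)
  then have "flat 0 (barycentric K x a - 1 / real (Suc n)) = 0" by (simp only: flat_0(3))
  then have "(\<Prod>a\<in>C. flat 0 (barycentric K x a - 1 / real (Suc n))) = 0" using a(1) by (intro prod_zero) auto
  then show ?thesis unfolding cut_def by (simp only: diff_zero power_one diff_self)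
qed

lemma core_subset: "core n \<subseteq> interior K"
proof
  fix x assume x: "x \<in> core n"
  have "0 < barycentric K x a" if "a \<in> C" for a
  proof -
    have "0 < 1 / real (Suc n)" by simp
    also have "\<dots> \<le> barycentric K x a" using x that by (simp add: core_def)
    finally show ?thesis .
  qed
  then show "x \<in> interior K" by (simp add: mem_interior)
qed

lemma core_compact: "compact (core n)"
proof -
  have "core n = (\<Inter>a\<in>C. {x. 1 / real (Suc n) \<le> bgrad a \<bullet> x - boff a})"
    by (auto simp: core_def bary_affine)
  moreover have "closed \<dots>" by (intro closed_INT ballI closed_Collect_le continuous_intros)
  ultimately have "closed (core n)" by simp
  moreover have "bounded (core n)"
    using core_subset interior_subset compact_imp_bounded[OF compact] bounded_subset by (metis subset_trans)
  ultimately show ?thesis by (simp add: compact_eq_bounded_closed)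
qed

text \<open>The base of the power varies with \<open>n\<close>, so it is bounded uniformly:
  eventually it is at most \<open>1 - ?c / 2\<close>, where \<open>?c\<close> is the positive limit
  of the products.\<close>

lemma cut_tendsto: assumes x: "x \<in> interior K" shows "(\<lambda>n. cut n x) \<longlonglongrightarrow> 1"
proof -
  let ?c = "\<Prod>a\<in>C. flat 0 (barycentric K x a)"
  let ?cn = "\<lambda>n. \<Prod>a\<in>C. flat 0 (barycentric K x a - 1 / real (Suc n))"
  have cpos: "0 < ?c"
    using x flat_0(1,3) by (intro prod_pos) (metis mem_interior less_le not_le)
  have c1: "?c \<le> 1" by (rule cut_prod_bounds)
  have "isCont (flat 0) t" for t using flat_deriv DERIV_isCont by blast
  moreover have "(\<lambda>n. t - 1 / real (Suc n)) \<longlonglongrightarrow> t" for t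
    using tendsto_diff[OF tendsto_const lim_1_over_n[THEN LIMSEQ_Suc], of t] by simp
  ultimately have "(\<lambda>n. flat 0 (t - 1 / real (Suc n))) \<longlonglongrightarrow> flat 0 t" for t
    using isCont_tendsto_compose by blast
  then have "?cn \<longlonglongrightarrow> ?c" by (intro tendsto_prod)
  then have ev: "\<forall>\<^sub>F n in sequentially. ?c / 2 < ?cn n"
    by (rule order_tendstoD(1)) (use cpos in simp)
  have "(\<lambda>n. (1 - ?cn n) ^ n) \<longlonglongrightarrow> 0"
  proof (rule tendsto_sandwich)
    show "(\<lambda>n. 0) \<longlonglongrightarrow> (0::real)" by simp
    show "(\<lambda>n. (1 - ?c / 2) ^ n) \<longlonglongrightarrow> 0"
      using cpos c1 by (intro LIMSEQ_power_zero) auto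
    show "\<forall>\<^sub>F n in sequentially. 0 \<le> (1 - ?cn n) ^ n"
      using cut_prod_bounds by (intro always_eventually allI zero_le_power) simp
    show "\<forall>\<^sub>F n in sequentially. (1 - ?cn n) ^ n \<le> (1 - ?c / 2) ^ n"
      using ev
    proof eventually_elim
      case (elim n)
      then show ?case
        using cut_prod_bounds(2)[of "\<lambda>a. barycentric K x a - 1 / real (Suc n)"] by (intro power_mono) linarith+
    qed
  qed
  then show ?thesis unfolding cut_def using tendsto_diff[OF tendsto_const, of _ 0 sequentially 1] by fastforce
qed

end

section \<open>Piecewise constant functions in H1, and the pressure\<close>

context mesh
begin

lemma bubble_P1b0:
  assumes K: "K \<in> \<T>" shows "bubble K \<in> P1b0 \<Omega> \<T>"
proof -
  obtain C where "simplex_element K C" using element K by blast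
  then interpret simplex_element K C .
  interpret D: full_polytope "closure \<Omega>" by (rule domain_facts)
  have "(\<Sum>K'\<in>\<T>. (if K' = K then 1 else 0) * bubble K' x) = bubble K x" for x
  proof -
    have "(\<Sum>K'\<in>\<T>. (if K' = K then 1 else 0) * bubble K' x) = (\<Sum>K'\<in>\<T>. if K' = K then bubble K x else 0)"
      by (intro sum.cong) auto
    then show ?thesis using K by simp
  qed
  then have "bubble K = (\<lambda>x. 0 + (\<Sum>K'\<in>\<T>. (if K' = K then 1 else 0) * bubble K' x))" by simp
  then have "bubble K \<in> P1b \<Omega> \<T>"
    unfolding P1b_def using lin_closedD(1)[OF lin_closed_P1]
    by (intro CollectI exI[of _ "\<lambda>x. 0"] exI[of _ "\<lambda>K'. if K' = K then 1 else 0"] conjI)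
  moreover have "zero_on_boundary \<Omega> (bubble K)"
    unfolding zero_on_boundary_def
  proof (rule D.AE_surface_measureI)
    fix G x assume G: "G facet_of closure \<Omega>" "x \<in> rel_interior G"
    then have "x \<notin> \<Omega>"
      using D.facet_interior_disjoint[OF G(1)] rel_interior_subset domain_facts(2) by blast
    then have "bubble K x = 0" using interior_in_domain[OF K] by (auto simp: bubble_def)
    moreover have "(bubble K \<longlongrightarrow> bubble K x) (at x within \<Omega>)"
      using bubble_continuous by (meson UNIV_I continuous_on_def subset_UNIV tendsto_within_subset)
    ultimately show "(bubble K \<longlongrightarrow> 0) (at x within \<Omega>)" by simp
  qed
  ultimately show ?thesis by (simp add: P1b0_def)
qed

text \<open>The product has compact support in the open element, so it is a test function for the
  whole domain, and its derivative integrates to 0 over the element.\<close>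

lemma test_cut:
  assumes K: "K \<in> \<T>" and S: "simplex_element K C" and t: "test_function \<Omega> \<phi>"
  shows "test_function \<Omega> (\<lambda>x. \<phi> x * simplex_element.cut K C n x)"
    and "int_on K (\<lambda>x. frechet_derivative (\<lambda>x. \<phi> x * simplex_element.cut K C n x) (at x) e) = 0"
proof -
  interpret simplex_element K C by (rule S)
  have s: "smooth (\<lambda>x. \<phi> x * cut n x)"
    using t cut_smooth by (auto simp: test_function_def smooth_def intro!: Ck_mult)
  show "test_function \<Omega> (\<lambda>x. \<phi> x * cut n x)"
    by (rule test_functionI[OF s core_compact[of n]])
       (use core_subset interior_in_domain[OF K] cut_support in auto)
  show "int_on K (\<lambda>x. frechet_derivative (\<lambda>x. \<phi> x * cut n x) (at x) e) = 0"
  proof (rule int_on_deriv_zero[OF smooth_C1[OF s]])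
    fix F x assume "F facet_of K" "x \<in> rel_interior F"
    then have "x \<notin> core n"
      using facet_interior_disjoint core_subset rel_interior_subset by blast
    then show "\<phi> x * cut n x = 0" by (simp add: cut_support)
  qed
qed

lemma II_piecewise_const:
  assumes c: "\<And>K x. K \<in> \<T> \<Longrightarrow> x \<in> interior K \<Longrightarrow> p x = c K" and f: "continuous_on UNIV f"
  shows "pw_cont p" "II (\<lambda>x. p x * f x) = (\<Sum>K\<in>\<T>. c K * int_on K f)"
proof -
  show p: "pw_cont p" by (rule pw_contI) (use c in \<open>auto intro!: exI[of _ "\<lambda>x. c _"]\<close>)
  have "II (\<lambda>x. p x * f x) = (\<Sum>K\<in>\<T>. int_on K (\<lambda>x. p x * f x))"
    by (rule pw_integral(2)) (intro pw_cont_mult p pw_cont_continuous f)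
  also have "\<dots> = (\<Sum>K\<in>\<T>. c K * int_on K f)"
  proof (intro sum.cong refl)
    fix K assume K: "K \<in> \<T>"
    have "int_on K (\<lambda>x. p x * f x) = int_on K (\<lambda>x. c K * f x)"
      by (rule int_on_cong) (simp add: c[OF K])
    also have "\<dots> = c K * int_on K f" by (simp add: int_on_def mult.left_commute)
    finally show "int_on K (\<lambda>x. p x * f x) = c K * int_on K f" .
  qed
  finally show "II (\<lambda>x. p x * f x) = (\<Sum>K\<in>\<T>. c K * int_on K f)" .
qed

text \<open>The weak gradient of a piecewise constant function vanishes on every element, hence when
  tested with the cut-offs of a test function to the elements; the cut-offs are removed by
  dominated convergence.\<close>

lemma piecewise_const_H1_weak:
  assumes p: "p \<in> H1 \<Omega>" and c: "\<And>K x. K \<in> \<T> \<Longrightarrow> x \<in> interior K \<Longrightarrow> p x = c K"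
    and t: "test_function \<Omega> \<phi>"
  shows "II (\<lambda>x. p x * grad \<phi> x $ i) = 0"
proof -
  obtain g where g: "square_integrable \<Omega> g"
    and pg: "\<And>\<phi> i. test_function \<Omega> \<phi> \<Longrightarrow> L2_inner \<Omega> p (\<lambda>x. grad \<phi> x $ i) = - L2_inner \<Omega> (\<lambda>x. g x $ i) \<phi>"
    using p unfolding H1_def by blast
  have "\<forall>K\<in>\<T>. \<exists>C. simplex_element K C" using element by blast
  then obtain CC where "\<forall>K\<in>\<T>. simplex_element K (CC K)" by (rule bchoice[THEN exE])
  then have CC: "\<And>K. K \<in> \<T> \<Longrightarrow> simplex_element K (CC K)" by blast
  define \<theta> where "\<theta> K n = simplex_element.cut K (CC K) n" for K n
  \<comment> \<open>Multiplied by a cut-off, the test function lives in one element, where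
    \<open>p\<close> is constant; its derivative integrates to 0 there, so the weak gradient tests
    to 0 as well.\<close>
  have zero: "L2_inner \<Omega> (\<lambda>x. g x $ i) (\<lambda>x. \<phi> x * \<theta> K n x) = 0" if K: "K \<in> \<T>" for K n
  proof -
    interpret simplex_element K "CC K" by (rule CC[OF K])
    note tc = test_cut[OF K CC[OF K] t, of n, folded \<theta>_def]
    have C: "C1 (\<lambda>x. \<phi> x * \<theta> K n x)" by (rule test_function_C1[OF tc(1)])
    have o: "int_on K' (\<lambda>x. frechet_derivative (\<lambda>x. \<phi> x * \<theta> K n x) (at x) (axis i 1)) = 0"
      if K': "K' \<in> \<T>" "K' \<noteq> K" for K'
    proof -
      have "frechet_derivative (\<lambda>x. \<phi> x * \<theta> K n x) (at x) = frechet_derivative (\<lambda>x. 0) (at x)"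
        if "x \<in> interior K'" for x
      proof (rule frechet_interior(2)[OF C1_const _ that])
        fix y assume "y \<in> interior K'"
        then have "y \<notin> core n" using interior_unique[OF K K'(1)] K'(2) core_subset[of n] by blast
        then show "\<phi> y * \<theta> K n y = 0" by (simp add: \<theta>_def cut_support)
      qed
      then show ?thesis
        using int_on_cong[of K' "\<lambda>x. frechet_derivative (\<lambda>x. \<phi> x * \<theta> K n x) (at x) (axis i 1)" "\<lambda>x. 0"]
        by (simp add: frechet_const_fun int_on_def)
    qed
    have "L2_inner \<Omega> p (\<lambda>x. grad (\<lambda>x. \<phi> x * \<theta> K n x) x $ i)
      = (\<Sum>K'\<in>\<T>. c K' * int_on K' (\<lambda>x. grad (\<lambda>x. \<phi> x * \<theta> K n x) x $ i))"
      unfolding L2_inner_def inner_real_def by (rule II_piecewise_const(2)[OF c grad_C1[OF C]])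
    also have "\<dots> = 0"
      unfolding grad_nth
    proof (intro sum.neutral ballI)
      fix K' assume "K' \<in> \<T>"
      then show "c K' * int_on K' (\<lambda>x. frechet_derivative (\<lambda>x. \<phi> x * \<theta> K n x) (at x) (axis i 1)) = 0"
        using o tc(2) by (cases "K' = K") auto
    qed
    finally show ?thesis using pg[OF tc(1), of i] by simp
  qed
  let ?f = "\<lambda>x. g x $ i * \<phi> x" and ?s = "\<lambda>n x. \<Sum>K\<in>\<T>. g x $ i * (\<phi> x * \<theta> K n x)"
  have gi: "square_integrable \<Omega> (\<lambda>x. g x $ i)" by (rule square_integrable_nth[OF g])
  have intf: "integrable (lebesgue_on \<Omega>) ?f"
    using square_integrable_inner[OF gi test_square_integrable(1)[OF t]] by simp
  have ints: "integrable (lebesgue_on \<Omega>) (\<lambda>x. g x $ i * (\<phi> x * \<theta> K n x))" if K: "K \<in> \<T>" for K n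
    using square_integrable_inner[OF gi test_square_integrable(1)[OF test_cut(1)[OF K CC[OF K] t, of n, folded \<theta>_def]]]
    by simp
  have int0: "II (?s n) = 0" for n
    using zero by (simp add: Bochner_Integration.integral_sum ints L2_inner_def)
  have aeK: "AE x in lebesgue_on \<Omega>. \<exists>K\<in>\<T>. x \<in> interior K"
    using AE_elements domain_facts(3) by (subst AE_restrict_space_iff) auto
  \<comment> \<open>At an interior point of an element only the cut-off of that element can be
    nonzero; as it lies between 0 and 1, the limit function dominates.\<close>
  have conv: "?s n x = ?f x * \<theta> K n x" if K: "K \<in> \<T>" "x \<in> interior K" for K n x
  proof -
    have "\<theta> K' n x = 0" if "K' \<in> \<T>" "K' \<noteq> K" for K'
    proof -
      interpret simplex_element K' "CC K'" by (rule CC[OF that(1)])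
      have "x \<notin> core n" using interior_unique[OF K(1) that(1) K(2)] that(2) core_subset[of n] by blast
      then show ?thesis by (simp add: \<theta>_def cut_support)
    qed
    then show ?thesis by (simp add: sum.remove[OF finite_T K(1)] mult.assoc)
  qed
  have "(\<lambda>n. II (?s n)) \<longlonglongrightarrow> II ?f"
  proof (rule integral_dominated_convergence)
    show "?f \<in> borel_measurable (lebesgue_on \<Omega>)" using intf by simp
    show "?s n \<in> borel_measurable (lebesgue_on \<Omega>)" for n
      using ints by (intro borel_measurable_sum) auto
    show "integrable (lebesgue_on \<Omega>) (\<lambda>x. norm (?f x))" using intf by (rule integrable_norm)
    show "AE x in lebesgue_on \<Omega>. (\<lambda>n. ?s n x) \<longlonglongrightarrow> ?f x"
      using aeK
    proof eventually_elim
      case (elim x)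
      then obtain K where K: "K \<in> \<T>" "x \<in> interior K" by blast
      interpret simplex_element K "CC K" by (rule CC[OF K(1)])
      have "(\<lambda>n. ?f x * \<theta> K n x) \<longlonglongrightarrow> ?f x"
        unfolding \<theta>_def using tendsto_mult[OF tendsto_const cut_tendsto[OF K(2)], of "?f x"] by simp
      then show ?case by (simp only: conv[OF K])
    qed
    show "AE x in lebesgue_on \<Omega>. norm (?s n x) \<le> norm (?f x)" for n
      using aeK
    proof eventually_elim
      case (elim x)
      then obtain K where K: "K \<in> \<T>" "x \<in> interior K" by blast
      interpret simplex_element K "CC K" by (rule CC[OF K(1)])
      have "\<bar>?f x\<bar> * \<theta> K n x \<le> \<bar>?f x\<bar> * 1"
        unfolding \<theta>_def using cut_bounds by (intro mult_left_mono) auto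
      then show ?case unfolding conv[OF K] using cut_bounds(1)[of n x] by (simp add: abs_mult \<theta>_def)
    qed
  qed
  then have "II ?f = 0" using int0 LIMSEQ_unique[OF _ tendsto_const] by simp
  then show ?thesis using pg[OF t, of i] by (simp add: L2_inner_def)
qed

text \<open>The weak gradient is integrated against the translates of a bump function along the segment
  between interior points of the two elements.\<close>

lemma piecewise_const_H1_const:
  assumes p: "p \<in> H1 \<Omega>" and c: "\<And>K x. K \<in> \<T> \<Longrightarrow> x \<in> interior K \<Longrightarrow> p x = c K"
    and K1: "K1 \<in> \<T>" and K2: "K2 \<in> \<T>"
  shows "c K1 = c K2"
proof -
  interpret E1: full_polytope K1 using element_facts K1 by blast
  interpret E2: full_polytope K2 using element_facts K2 by blast
  obtain a b where a: "a \<in> interior K1" and b: "b \<in> interior K2" using E1.int E2.int by blast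
  obtain r1 where r1: "r1 > 0" "cball a r1 \<subseteq> interior K1" using a open_contains_cball[of "interior K1"] by auto
  obtain r2 where r2: "r2 > 0" "cball b r2 \<subseteq> interior K2" using b open_contains_cball[of "interior K2"] by auto
  define r where "r = min r1 r2"
  have r: "r > 0" "cball a r \<subseteq> interior K1" "cball b r \<subseteq> interior K2"
    using r1 r2 by (auto simp: r_def)
  define v where "v = b - a"
  let ?B = "bump a r"
  define D where "D y = frechet_derivative ?B (at y) v" for y
  have C1B: "C1 (bump a r)" for a :: "real^'d" by (rule smooth_C1[OF bump_smooth])
  have cB: "continuous_on UNIV (bump a r)" for a :: "real^'d" by (rule C1_continuous[OF C1B])
  have cD: "continuous_on UNIV D" unfolding D_def by (rule C1_cont_deriv[OF C1B])
  \<comment> \<open>A Borel function on the whole space that agrees with \<open>p\<close> on the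
    element interiors, which puts Fubini on \<open>lborel\<close>.\<close>
  define h where "h x = (\<Sum>K\<in>\<T>. c K * indicator (interior K) x)" for x
  have h_meas [measurable]: "h \<in> borel_measurable borel" unfolding h_def by measurable
  have hf: "integrable lborel (\<lambda>x. h x * f x)" "(LINT x|lborel. h x * f x) = (\<Sum>K\<in>\<T>. c K * int_on K f)"
    "II (\<lambda>x. p x * f x) = (LINT x|lborel. h x * f x)" if f: "continuous_on UNIV f" for f
  proof -
    have eq: "(\<lambda>x. h x * f x) = (\<lambda>x. \<Sum>K\<in>\<T>. c K * (indicator (interior K) x * f x))"
      by (simp only: h_def sum_distrib_right mult.assoc)
    have i: "integrable lborel (\<lambda>x. indicator (interior K) x * f x)" if "K \<in> \<T>" for K
      by (rule integrable_element[OF pw_cont_continuous[OF f] that])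
    show "integrable lborel (\<lambda>x. h x * f x)"
      unfolding eq by (intro Bochner_Integration.integrable_sum integrable_mult_right i)
    show 1: "(LINT x|lborel. h x * f x) = (\<Sum>K\<in>\<T>. c K * int_on K f)"
      unfolding eq int_on_def by (subst Bochner_Integration.integral_sum) (auto intro: i)
    show "II (\<lambda>x. p x * f x) = (LINT x|lborel. h x * f x)"
      unfolding 1 by (rule II_piecewise_const(2)[OF c f])
  qed
  \<comment> \<open>By convexity the bump translated by \<open>t *\<^sub>R v\<close> is an
    admissible test function, and \<open>D (x - t *\<^sub>R v)\<close> is its derivative in
    direction \<open>v\<close>, so the weak gradient gives 0.\<close>
  have step: "(LINT x|lborel. h x * D (x - t *\<^sub>R v)) = 0" if t: "t \<in> {0..1}" for t
  proof -
    let ?\<phi> = "bump (a + t *\<^sub>R v) r"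
    have "cball (a + t *\<^sub>R v) r \<subseteq> \<Omega>"
    proof
      fix y assume y: "y \<in> cball (a + t *\<^sub>R v) r"
      define z where "z = y - (a + t *\<^sub>R v)"
      have z: "norm z \<le> r" using y by (simp add: z_def dist_norm norm_minus_commute)
      have "a + z \<in> \<Omega>" "b + z \<in> \<Omega>"
        using r(2,3) interior_in_domain[OF K1] interior_in_domain[OF K2] z by (auto simp: dist_norm subset_iff)
      then have "(1 - t) *\<^sub>R (a + z) + t *\<^sub>R (b + z) \<in> \<Omega>"
        using domain_facts(5) t by (intro convexD) auto
      also have "(1 - t) *\<^sub>R (a + z) + t *\<^sub>R (b + z) = y" by (simp add: z_def v_def algebra_simps)
      finally show "y \<in> \<Omega>" .
    qed
    then have tf: "test_function \<Omega> ?\<phi>" by (rule test_function_bump[OF r(1)])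
    have D: "D (x - t *\<^sub>R v) = (\<Sum>i\<in>UNIV. v $ i * grad ?\<phi> x $ i)" for x
    proof -
      have "(?\<phi> has_derivative frechet_derivative ?B (at (x - t *\<^sub>R v))) (at x)"
        unfolding bump_shift
        by (rule has_derivative_compose[OF _ C1_has_derivative[OF C1B], of "\<lambda>x. x - t *\<^sub>R v" "\<lambda>h. h"])
           (auto intro!: derivative_eq_intros)
      then have "D (x - t *\<^sub>R v) = frechet_derivative ?\<phi> (at x) v" by (simp add: D_def frechet_eqI)
      then show ?thesis using linear_sum_axis[OF C1_linear[OF C1B], of "a + t *\<^sub>R v" x v] by (simp add: grad_nth)
    qed
    have cDt: "continuous_on UNIV (\<lambda>x. D (x - t *\<^sub>R v))"
      by (rule continuous_on_compose2[OF cD]) (auto intro!: continuous_intros)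
    have pp: "pw_cont p" by (rule II_piecewise_const(1)[OF c continuous_on_const])
    have "(LINT x|lborel. h x * D (x - t *\<^sub>R v)) = II (\<lambda>x. p x * D (x - t *\<^sub>R v))" by (rule hf(3)[OF cDt, symmetric])
    also have "\<dots> = II (\<lambda>x. \<Sum>i\<in>UNIV. v $ i * (p x * grad ?\<phi> x $ i))"
      by (simp add: D sum_distrib_left mult.left_commute)
    also have "\<dots> = (\<Sum>i\<in>UNIV. II (\<lambda>x. v $ i * (p x * grad ?\<phi> x $ i)))"
      by (rule Bochner_Integration.integral_sum)
         (intro integrable_mult_right pw_integral(1) pw_cont_mult pp pw_C1_grad pw_C1_C1 C1B)
    also have "\<dots> = 0" using piecewise_const_H1_weak[OF p c tf] by simp
    finally show ?thesis .
  qed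
  let ?F = "\<lambda>t x. indicator {0..1} t * (h x * D (x - t *\<^sub>R v))"
  have "compact ((\<lambda>z. D (snd z - fst z *\<^sub>R v)) ` ({0..1::real} \<times> closure \<Omega>))"
    using domain_facts(4)
    by (intro compact_continuous_image compact_Times continuous_on_compose2[OF cD] continuous_intros) auto
  then have "bounded ((\<lambda>z. D (snd z - fst z *\<^sub>R v)) ` ({0..1::real} \<times> closure \<Omega>))" by (rule compact_imp_bounded)
  then obtain M where "\<forall>y\<in>(\<lambda>z. D (snd z - fst z *\<^sub>R v)) ` ({0..1::real} \<times> closure \<Omega>). norm y \<le> M"
    unfolding bounded_iff by blast
  then have M: "\<bar>D (x - t *\<^sub>R v)\<bar> \<le> M" if "t \<in> {0..1}" "x \<in> \<Omega>" for t x
    using that closure_subset by force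
  let ?S = "\<Sum>K\<in>\<T>. \<bar>c K\<bar>"
  have hb: "\<bar>h x\<bar> \<le> ?S" for x
    unfolding h_def by (rule order_trans[OF sum_abs]) (auto intro!: sum_mono simp: indicator_def)
  have h0: "h x = 0" if "x \<notin> \<Omega>" for x
    unfolding h_def using that interior_in_domain by (intro sum.neutral) (auto simp: indicator_def)
  have [measurable]: "D \<in> borel_measurable borel" by (rule borel_measurable_continuous_onI[OF cD])
  have Om: "\<Omega> \<in> sets borel" "emeasure lborel \<Omega> < \<infinity>"
    using domain_facts emeasure_bounded_finite by auto
  have intF: "integrable (lborel \<Otimes>\<^sub>M lborel) (\<lambda>(t, x). ?F t x)"
  proof (rule Bochner_Integration.integrable_bound)
    have "emeasure (lborel \<Otimes>\<^sub>M lborel) ({0..1::real} \<times> \<Omega>) = emeasure lborel {0..1::real} * emeasure lborel \<Omega>"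
      by (rule lborel.emeasure_pair_measure_Times) (use Om in auto)
    also have "\<dots> < \<infinity>" using Om by (simp add: ennreal_mult_less_top)
    finally show "integrable (lborel \<Otimes>\<^sub>M lborel) (\<lambda>z. (?S * M) * indicator ({0..1::real} \<times> \<Omega>) z)"
      using Om by (intro integrable_mult_right integrable_real_indicator pair_measureI) auto
    show "(\<lambda>(t, x). ?F t x) \<in> borel_measurable (lborel \<Otimes>\<^sub>M lborel)" by measurable
    show "AE z in lborel \<Otimes>\<^sub>M lborel. norm (case z of (t, x) \<Rightarrow> ?F t x) \<le> norm ((?S * M) * indicator ({0..1::real} \<times> \<Omega>) z)"
    proof (rule AE_I2, clarify)
      fix t :: real and x
      show "norm (?F t x) \<le> norm ((?S * M) * indicator ({0..1} \<times> \<Omega>) (t, x))"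
      proof (cases "t \<in> {0..1} \<and> x \<in> \<Omega>")
        case True
        have "\<bar>D (x - t *\<^sub>R v)\<bar> \<le> \<bar>M\<bar>"
          using M[OF conjunct1[OF True] conjunct2[OF True]] by linarith
        then have "\<bar>h x\<bar> * \<bar>D (x - t *\<^sub>R v)\<bar> \<le> ?S * \<bar>M\<bar>" using hb[of x] by (intro mult_mono) auto
        then show ?thesis using True by (simp add: abs_mult)
      next
        case False
        then show ?thesis using h0[of x] by (auto simp: indicator_def)
      qed
    qed
  qed
  \<comment> \<open>For fixed \<open>x\<close>, \<open>D (x - t *\<^sub>R v)\<close> is minus the
    derivative in \<open>t\<close> of the translated bump, so integrating over \<open>t\<close>
    leaves the bump at \<open>a\<close> minus the bump at \<open>b\<close>.\<close>
  have ftc: "(LINT t|lborel. ?F t x) = h x * (bump a r x - bump b r x)" for x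
  proof -
    have "(LINT t|lborel. D (x - t *\<^sub>R v) * indicator {0..1} t) = (- ?B (x - 1 *\<^sub>R v)) - (- ?B (x - 0 *\<^sub>R v))"
    proof (rule integral_FTC_Icc_real)
      fix t :: real
      have "((\<lambda>t. ?B (x - t *\<^sub>R v)) has_derivative (\<lambda>h. frechet_derivative ?B (at (x - t *\<^sub>R v)) (- h *\<^sub>R v))) (at t)"
        by (rule has_derivative_compose[OF _ C1_has_derivative[OF C1B]]) (auto intro!: derivative_eq_intros)
      then have "((\<lambda>t. - ?B (x - t *\<^sub>R v)) has_derivative (\<lambda>h. - frechet_derivative ?B (at (x - t *\<^sub>R v)) (- h *\<^sub>R v))) (at t)"
        by (rule has_derivative_minus)
      moreover have "- frechet_derivative ?B (at (x - t *\<^sub>R v)) (- h *\<^sub>R v) = D (x - t *\<^sub>R v) * h" for h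
        using linear_cmul[OF C1_linear[OF C1B], of a "x - t *\<^sub>R v" "- h" v] by (simp add: D_def)
      ultimately show "DERIV (\<lambda>t. - ?B (x - t *\<^sub>R v)) t :> D (x - t *\<^sub>R v)"
        by (simp add: has_field_derivative_def)
      have "continuous_on UNIV (\<lambda>t. D (x - t *\<^sub>R v))"
        by (rule continuous_on_compose2[OF cD]) (auto intro!: continuous_intros)
      then show "isCont (\<lambda>t. D (x - t *\<^sub>R v)) t" by (simp add: continuous_on_eq_continuous_at)
    qed simp
    also have "\<dots> = bump a r x - bump b r x"
      using bump_shift[of a v r x] by (simp add: v_def)
    finally have "(LINT t|lborel. h x * (D (x - t *\<^sub>R v) * indicator {0..1} t)) = h x * (bump a r x - bump b r x)" by simp
    then show ?thesis by (simp add: mult.commute mult.left_commute)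
  qed
  have "(LINT x|lborel. (LINT t|lborel. ?F t x)) = (LINT t|lborel. (LINT x|lborel. ?F t x))"
    by (rule lborel_pair.Fubini_integral[OF intF])
  also have "\<dots> = (LINT t|(lborel :: real measure). 0)"
  proof (intro Bochner_Integration.integral_cong refl)
    fix t :: real
    show "(LINT x|lborel. ?F t x) = 0"
      using step[of t] by (cases "t \<in> {0..1}") simp_all
  qed
  finally have "(LINT x|lborel. h x * bump a r x - h x * bump b r x) = 0" by (simp add: ftc right_diff_distrib)
  then have "(\<Sum>K\<in>\<T>. c K * int_on K (bump a r)) = (\<Sum>K\<in>\<T>. c K * int_on K (bump b r))"
    using hf(1,2)[OF cB, of a] hf(1,2)[OF cB, of b] by simp
  moreover have one: "(\<Sum>K\<in>\<T>. c K * int_on K (bump x r)) = c K0 * (LINT y|lborel. bump x r y)"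
    if K0: "K0 \<in> \<T>" "cball x r \<subseteq> interior K0" for x K0
  proof -
    have b0: "bump x r y = 0" if "y \<notin> interior K0" for y
    proof (rule ccontr)
      assume "bump x r y \<noteq> 0"
      then have "y \<in> cball x r" using bump_pos_iff[OF r(1), of x y] by (simp add: dist_commute)
      then show False using K0 that by blast
    qed
    have "int_on K (bump x r) = 0" if "K \<in> \<T>" "K \<noteq> K0" for K
    proof -
      have "int_on K (bump x r) = int_on K (\<lambda>x. 0)"
        by (rule int_on_cong) (use b0 interior_unique[OF that(1) K0(1)] that(2) in blast)
      then show ?thesis by (simp add: int_on_def)
    qed
    moreover have "int_on K0 (bump x r) = (LINT y|lborel. bump x r y)"
      unfolding int_on_def by (intro Bochner_Integration.integral_cong) (auto simp: indicator_def b0)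
    ultimately show ?thesis by (simp add: sum.remove[OF finite_T K0(1)])
  qed
  ultimately have "c K1 * (LINT y|lborel. bump a r y) = c K2 * (LINT y|lborel. bump b r y)"
    using one[OF K1 r(2)] one[OF K2 r(3)] by simp
  moreover have "(LINT y|lborel. bump b r y) = (LINT y|lborel. bump a r y)"
  proof -
    have [measurable]: "bump b r \<in> borel_measurable borel" by (rule borel_measurable_continuous_onI[OF cB])
    have "(LINT y|lborel. bump b r y) = (LINT y|lborel. bump b r (v + y))"
      by (subst lborel_distr_plus[of v, symmetric]) (simp add: integral_distr)
    also have "\<dots> = (LINT y|lborel. bump a r y)"
      using bump_shift[of a v r] by (simp add: v_def)
    finally show ?thesis .
  qed
  moreover have "(LINT y|lborel. bump a r y) \<noteq> 0"
  proof
    assume "(LINT y|lborel. bump a r y) = 0"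
    moreover have "int_on K1 (bump a r) = (LINT y|lborel. bump a r y)"
      unfolding int_on_def
    proof (intro Bochner_Integration.integral_cong refl)
      fix y
      show "indicator (interior K1) y * bump a r y = bump a r y"
        using bump_pos_iff[OF r(1), of a y] r(2) by (cases "bump a r y = 0") (auto simp: dist_commute indicator_def subset_iff)
    qed
    ultimately have z: "int_on K1 (bump a r) = 0" by simp
    have "bump a r a = 0"
      by (rule continuous_integral_zero[OF cB integrable_element[OF pw_cont_continuous[OF cB] K1] bump_nonneg z a])
    then show False using bump_pos_iff[OF r(1), of a a] r(1) by simp
  qed
  ultimately show ?thesis by simp
qed

text \<open>The bubbles remove the slope of \<open>p\<close> on each element, the H1 condition
  removes the jumps between elements, and the mean value condition removes the remaining
  constant.\<close>

theorem pressure_zero: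
  assumes p: "p \<in> P1_mean0 \<Omega> \<T>"
    and orth: "\<And>K i. K \<in> \<T> \<Longrightarrow> II (\<lambda>x. p x * frechet_derivative (bubble K) (at x) (axis i 1)) = 0"
  shows "p = (\<lambda>x. 0)"
proof -
  have P: "p \<in> PdG 1 \<T>" "p \<in> H1 \<Omega>" "II p = 0" using p by (auto simp: P1_mean0_def P1_def)
  have "\<exists>c. \<forall>x\<in>interior K. p x = c" if K: "K \<in> \<T>" for K
  proof -
    obtain C where "simplex_element K C" using element K by blast
    then interpret simplex_element K C .
    obtain q where q: "poly_fun 1 q" "\<And>x. x \<in> interior K \<Longrightarrow> p x = q x" using P(1) K by (auto simp: PdG_def)
    obtain m c where mc: "q = (\<lambda>x. m \<bullet> x + c)" using poly_fun_1_affine[OF q(1)] by blast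
    have "m \<bullet> axis i 1 = 0" for i
    proof (rule affine_bubble_orthogonal)
      let ?f = "\<lambda>x. p x * frechet_derivative (bubble K) (at x) (axis i 1)"
      have pc: "pw_cont ?f" by (intro pw_cont_mult PdG_pw_cont[OF P(1)] pw_C1_frechet bubble_pw_C1 K)
      have "int_on K' ?f = 0" if "K' \<in> \<T>" "K' \<noteq> K" for K'
      proof -
        have "frechet_derivative (bubble K) (at x) = frechet_derivative (\<lambda>x. 0) (at x)" if x: "x \<in> interior K'" for x
          by (rule frechet_interior(2)[OF C1_const _ x])
             (use interior_unique[OF K \<open>K' \<in> \<T>\<close>] \<open>K' \<noteq> K\<close> in \<open>auto simp: bubble_def\<close>)
        then have "int_on K' ?f = int_on K' (\<lambda>x. 0)" by (intro int_on_cong) (simp add: frechet_const_fun)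
        then show ?thesis by (simp add: int_on_def)
      qed
      then have "int_on K ?f = 0"
        using orth[OF K, of i] by (simp add: pw_integral(2)[OF pc] sum.remove[OF finite_T K])
      moreover have "int_on K ?f = int_on K (\<lambda>x. (m \<bullet> x + c) * frechet_derivative bub (at x) (axis i 1))"
        by (rule int_on_cong) (simp add: q(2) mc frechet_interior(2)[OF bub_C1 bubble_bub])
      ultimately show "int_on K (\<lambda>x. (m \<bullet> x + c) * frechet_derivative bub (at x) (axis i 1)) = 0" by simp
    qed
    then have "m = 0" by (simp add: vec_eq_iff inner_axis)
    then show ?thesis using q(2) mc by auto
  qed
  then have "\<forall>K\<in>\<T>. \<exists>c. \<forall>x\<in>interior K. p x = c" by blast
  then obtain c where "\<forall>K\<in>\<T>. \<forall>x\<in>interior K. p x = c K" by (rule bchoice[THEN exE])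
  then have c: "\<And>K x. K \<in> \<T> \<Longrightarrow> x \<in> interior K \<Longrightarrow> p x = c K" by blast
  show ?thesis
  proof (rule zero_everywhere)
    fix K x assume K: "K \<in> \<T>" "x \<in> interior K"
    have cc: "p y = c K" if "K' \<in> \<T>" "y \<in> interior K'" for K' y
      using c[OF that] piecewise_const_H1_const[OF P(2) c that(1) K(1)] by simp
    have pc: "pw_cont (\<lambda>x. c K * p x)" by (intro pw_cont_mult pw_cont_const PdG_pw_cont[OF P(1)])
    \<comment> \<open>\<open>p\<close> has the value \<open>c K\<close> on all elements, so
      \<open>c K * p\<close> is a square and hence nonnegative, while its integral is a multiple of
      the vanishing integral of \<open>p\<close>.\<close>
    have "c K * p x = 0"
      by (rule II_zero[OF pc _ _ K]) (use cc P(3) in auto)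
    then show "p x = 0" using c[OF K] by simp
  qed (use P(1) in \<open>auto simp: PdG_def\<close>)
qed

end

section \<open>The scheme\<close>

lemma cutoff_bounds:
  assumes "0 < \<rho>min" "\<rho>min \<le> \<rho>max"
  shows "0 < cutoff \<rho>min \<rho>max s"
  using assms by (auto simp: cutoff_def)

lemma continuous_cutoff:
  assumes "0 < \<rho>min" "\<rho>min \<le> \<rho>max"
  shows "continuous_on UNIV (cutoff \<rho>min \<rho>max)"
proof -
  have "cutoff \<rho>min \<rho>max = (\<lambda>s. max (\<rho>min / 2) (min s (3/2 * \<rho>max)))"
    using assms by (auto simp: cutoff_def fun_eq_iff)
  then show ?thesis by (simp only:) (intro continuous_intros)
qed

lemma L2_nrm_square: "(L2_nrm \<Omega> f)\<^sup>2 = L2_inner \<Omega> f f"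
proof -
  have "0 \<le> L2_inner \<Omega> f f" unfolding L2_inner_def by (rule integral_nonneg_AE) simp
  then show ?thesis by (simp add: L2_nrm_def)
qed

lemma inner_matrix: "A \<bullet> B = (\<Sum>i\<in>UNIV. \<Sum>j\<in>UNIV. A $ i $ j * B $ i $ j)" for A B :: "real^'n^'m"
  by (simp add: inner_vec_def)

section \<open>Elementwise calculus of vector fields\<close>

context mesh
begin

lemma jac_nth:
  assumes v: "\<And>i. pw_C1 (\<lambda>x. v x $ i)" and K: "K \<in> \<T>" "x \<in> interior K"
  shows "jac v x $ i $ j = frechet_derivative (\<lambda>y. v y $ i) (at x) (axis j 1)"
proof -
  let ?D = "\<lambda>h. \<chi> i. frechet_derivative (\<lambda>y. v y $ i) (at x) h"
  have "(v has_derivative ?D) (at x)"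
    unfolding has_derivative_componentwise_within[of v ?D x UNIV]
  proof
    fix b :: "real^'d" assume "b \<in> Basis"
    then obtain i where "b = axis i 1" by (auto simp: Basis_vec_def)
    then show "((\<lambda>x. v x \<bullet> b) has_derivative (\<lambda>h. ?D h \<bullet> b)) (at x)"
      using pw_C1_differentiable[OF v K, of i] by (simp add: inner_axis)
  qed
  then show ?thesis by (simp add: jac_def jacobian_def matrix_def frechet_eqI)
qed

lemma pw_cont_jac: assumes v: "\<And>i. pw_C1 (\<lambda>x. v x $ i)" shows "pw_cont (\<lambda>x. jac v x $ i $ j)"
  by (rule pw_cont_cong[OF pw_C1_frechet[OF v, of i "axis j 1"]]) (simp add: jac_nth[OF v])

lemma pw_cont_divg: assumes v: "\<And>i. pw_C1 (\<lambda>x. v x $ i)" shows "pw_cont (divg v)"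
proof -
  have "divg v = (\<lambda>x. \<Sum>i\<in>UNIV. jac v x $ i $ i)" by (auto simp: divg_def trace_def)
  then show ?thesis by (simp only:) (intro pw_cont_sum pw_cont_jac v)
qed

lemma jac_lincomb:
  assumes u: "\<And>i. pw_C1 (\<lambda>x. u x $ i)" and v: "\<And>i. pw_C1 (\<lambda>x. v x $ i)" and K: "K \<in> \<T>" "x \<in> interior K"
  shows "jac (\<lambda>x. a *\<^sub>R u x + b *\<^sub>R v x) x = a *\<^sub>R jac u x + b *\<^sub>R jac v x"
proof -
  have uv: "pw_C1 (\<lambda>x. (a *\<^sub>R u x + b *\<^sub>R v x) $ i)" for i
    using u v by (auto intro!: pw_C1_add pw_C1_mult)
  have "frechet_derivative (\<lambda>y. a * u y $ i + b * v y $ i) (at x) h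
    = a * frechet_derivative (\<lambda>y. u y $ i) (at x) h + b * frechet_derivative (\<lambda>y. v y $ i) (at x) h" for i h
  proof -
    have "((\<lambda>y. a * u y $ i + b * v y $ i) has_derivative
      (\<lambda>h. a * frechet_derivative (\<lambda>y. u y $ i) (at x) h + b * frechet_derivative (\<lambda>y. v y $ i) (at x) h)) (at x)"
      by (intro derivative_intros pw_C1_differentiable[OF u K] pw_C1_differentiable[OF v K])
    then show ?thesis by (simp add: frechet_eqI)
  qed
  then show ?thesis by (simp add: vec_eq_iff jac_nth[OF uv K] jac_nth[OF u K] jac_nth[OF v K])
qed

lemma divg_lincomb:
  assumes u: "\<And>i. pw_C1 (\<lambda>x. u x $ i)" and v: "\<And>i. pw_C1 (\<lambda>x. v x $ i)" and K: "K \<in> \<T>" "x \<in> interior K"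
  shows "divg (\<lambda>x. a *\<^sub>R u x + b *\<^sub>R v x) x = a * divg u x + b * divg v x"
  by (simp add: divg_def jac_lincomb[OF u v K] trace_def sum.distrib sum_distrib_left)

text \<open>The product rule by which the gradient term of the scheme splits into two convective
  terms with the roles of \<open>u\<close> and \<open>v\<close> exchanged.\<close>

lemma grad_inner:
  assumes u: "\<And>i. pw_C1 (\<lambda>x. u x $ i)" and v: "\<And>i. pw_C1 (\<lambda>x. v x $ i)" and K: "K \<in> \<T>" "x \<in> interior K"
  shows "z \<bullet> grad (\<lambda>x. u x \<bullet> v x) x = (jac u x *v z) \<bullet> v x + (jac v x *v z) \<bullet> u x"
proof -
  have "((\<lambda>x. \<Sum>i\<in>UNIV. u x $ i * v x $ i) has_derivative
    (\<lambda>h. \<Sum>i\<in>UNIV. u x $ i * frechet_derivative (\<lambda>y. v y $ i) (at x) h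
      + frechet_derivative (\<lambda>y. u y $ i) (at x) h * v x $ i)) (at x)"
    by (intro has_derivative_sum has_derivative_mult pw_C1_differentiable[OF u K] pw_C1_differentiable[OF v K])
  then have g: "grad (\<lambda>x. u x \<bullet> v x) x $ j = (\<Sum>i\<in>UNIV. u x $ i * jac v x $ i $ j + jac u x $ i $ j * v x $ i)" for j
    by (simp add: grad_nth inner_vec_def frechet_eqI jac_nth[OF u K] jac_nth[OF v K])
  have "z \<bullet> grad (\<lambda>x. u x \<bullet> v x) x = (\<Sum>j\<in>UNIV. \<Sum>i\<in>UNIV. z $ j * (u x $ i * jac v x $ i $ j) + z $ j * (jac u x $ i $ j * v x $ i))"
    by (simp add: inner_vec_def[of z] g sum_distrib_left distrib_left)
  also have "\<dots> = (\<Sum>i\<in>UNIV. \<Sum>j\<in>UNIV. z $ j * (u x $ i * jac v x $ i $ j) + z $ j * (jac u x $ i $ j * v x $ i))"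
    by (rule sum.swap)
  also have "\<dots> = (jac u x *v z) \<bullet> v x + (jac v x *v z) \<bullet> u x"
    by (simp add: inner_vec_def matrix_vector_mult_def sum_distrib_right sum_distrib_left sum.distrib
        mult.commute mult.left_commute)
  finally show ?thesis .
qed

end

text \<open>The cut-off is represented by a function \<open>X\<close>: its continuity serves
  integrability, its positivity definiteness and the energy estimate.\<close>

locale scheme = mesh \<Omega> \<T> for \<Omega> :: "(real^'d) set" and \<T> :: "(real^'d) set set" +
  fixes \<mu> \<tau> :: real and X :: "real \<Rightarrow> real" and \<rho>0 :: "real^'d \<Rightarrow> real" and u0 :: "real^'d \<Rightarrow> real^'d"
  assumes \<mu>: "\<mu> > 0" and \<tau>: "\<tau> > 0" and X_cont: "continuous_on UNIV X" and X_pos: "\<And>s. 0 < X s"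
    and \<rho>0: "\<rho>0 \<in> PdG 2 \<T>" and u0: "u0 \<in> P1b0_vec \<Omega> \<T>"
begin

abbreviation "V \<equiv> P1b0_vec \<Omega> \<T>"
abbreviation "Q \<equiv> P1_mean0 \<Omega> \<T>"

lemma V_C1: "v \<in> V \<Longrightarrow> pw_C1 (\<lambda>x. v x $ i)" by (rule P1b0_vec_pw_C1)

lemma Q_cont: "q \<in> Q \<Longrightarrow> pw_cont q"
  using PdG_pw_cont P1_PdG by (auto simp: P1_mean0_def)

lemma pw_cont_inner:
  "(\<And>i. pw_cont (\<lambda>x. f x $ i)) \<Longrightarrow> (\<And>i. pw_cont (\<lambda>x. g x $ i)) \<Longrightarrow> pw_cont (\<lambda>x. f x \<bullet> g x)" for f g :: "real^'d \<Rightarrow> real^'d"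
  unfolding inner_vec_def inner_real_def by (intro pw_cont_sum pw_cont_mult)

lemma V_inner: "u \<in> V \<Longrightarrow> v \<in> V \<Longrightarrow> pw_cont (\<lambda>x. u x \<bullet> v x)"
  by (intro pw_cont_inner P1b0_vec_pw_cont)

lemma X_cont': "pw_cont \<rho> \<Longrightarrow> pw_cont (\<lambda>x. X (\<rho> x))"
  by (rule pw_cont_compose[OF _ X_cont])

lemma V_transport: "u \<in> V \<Longrightarrow> v \<in> V \<Longrightarrow> pw_cont (\<lambda>x. (jac u x *v u0 x) \<bullet> v x)"
  unfolding inner_vec_def inner_real_def matrix_vector_mult_def vec_lambda_beta
  by (intro pw_cont_sum pw_cont_mult pw_cont_jac V_C1 P1b0_vec_pw_cont u0)

lemma V_jac: "u \<in> V \<Longrightarrow> v \<in> V \<Longrightarrow> pw_cont (\<lambda>x. jac u x \<bullet> jac v x)"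
  unfolding inner_matrix by (intro pw_cont_sum pw_cont_mult pw_cont_jac V_C1)

lemma V_div: "v \<in> V \<Longrightarrow> pw_cont (divg v)"
  by (intro pw_cont_divg V_C1)

subsection \<open>Density\<close>

sublocale transport \<Omega> \<T> "P_RT \<Omega> \<T> u0"
  by unfold_locales (intro P_RT_in_RT1_0 pw_cont_square_integrable_vec P1b0_vec_pw_cont u0)

text \<open>After multiplication by \<open>\<tau>\<close> the equation consists of the L2 product
  plus a multiple of the transport form, which is definite for every positive step size.\<close>

lemma density_eq_iff:
  assumes \<rho>: "\<rho> \<in> PdG 2 \<T>" and \<phi>: "\<phi> \<in> PdG 2 \<T>"
  shows "density_eq \<Omega> \<T> \<tau> \<rho>0 u0 \<rho> \<phi> \<longleftrightarrow> II (\<lambda>x. \<rho> x * \<phi> x) + \<tau> * transport_form \<rho> \<phi> = II (\<lambda>x. \<rho>0 x * \<phi> x)"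
proof -
  have C: "pw_C1 \<rho>" "pw_C1 \<phi>" using \<rho> \<phi> PdG_pw_C1 by blast+
  have off: "\<rho> y = 0" if "y \<in> off_elements \<T>" for y using \<rho> that by (simp add: PdG_def)
  have "II (\<lambda>x. (\<rho> x - \<rho>0 x) / \<tau> * \<phi> x) = II (\<lambda>x. (1/\<tau>) * (\<rho> x * \<phi> x) + (- 1/\<tau>) * (\<rho>0 x * \<phi> x))"
    by (simp add: algebra_simps diff_divide_distrib)
  also have "\<dots> = (1/\<tau>) * II (\<lambda>x. \<rho> x * \<phi> x) + (- 1/\<tau>) * II (\<lambda>x. \<rho>0 x * \<phi> x)"
    by (rule II_lincomb) (intro pw_cont_mult PdG_pw_cont[OF \<rho>] PdG_pw_cont[OF \<phi>] PdG_pw_cont[OF \<rho>0])+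
  finally have *: "II (\<lambda>x. (\<rho> x - \<rho>0 x) / \<tau> * \<phi> x) = (II (\<lambda>x. \<rho> x * \<phi> x) - II (\<lambda>x. \<rho>0 x * \<phi> x)) / \<tau>"
    by (simp add: diff_divide_distrib)
  have "density_eq \<Omega> \<T> \<tau> \<rho>0 u0 \<rho> \<phi> \<longleftrightarrow>
      (II (\<lambda>x. \<rho> x * \<phi> x) - II (\<lambda>x. \<rho>0 x * \<phi> x)) / \<tau> + transport_form \<rho> \<phi> = 0"
    unfolding density_eq_def Let_def L2_inner_def inner_real_def *
    by (auto simp: transport_form_def inflow_integral[OF C(1) off C(2)])
  also have "\<dots> \<longleftrightarrow> II (\<lambda>x. \<rho> x * \<phi> x) + \<tau> * transport_form \<rho> \<phi> = II (\<lambda>x. \<rho>0 x * \<phi> x)"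
    using \<tau> by (simp add: field_simps)
  finally show ?thesis .
qed

lemma density_solvable: "\<exists>!\<rho>. \<rho> \<in> PdG 2 \<T> \<and> (\<forall>\<phi>\<in>PdG 2 \<T>. density_eq \<Omega> \<T> \<tau> \<rho>0 u0 \<rho> \<phi>)"
proof -
  let ?V = "PdG 2 \<T>"
  have "\<exists>!\<rho>. \<rho> \<in> ?V \<and> (\<forall>\<phi>\<in>?V. II (\<lambda>x. \<rho> x * \<phi> x) + \<tau> * transport_form \<rho> \<phi> = II (\<lambda>x. \<rho>0 x * \<phi> x))"
  proof (rule bilinear_form_solvable[OF lin_closed_PdG fin_dim_PdG])
    fix f g h a b assume V: "f \<in> ?V" "g \<in> ?V" "h \<in> ?V"
    note C = PdG_pw_C1[OF V(1)] PdG_pw_C1[OF V(2)] PdG_pw_C1[OF V(3)]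
    note c = pw_cont_mult[OF pw_C1_imp_cont pw_C1_imp_cont]
    have "II (\<lambda>x. (a *\<^sub>R f x + b *\<^sub>R g x) * h x) = a * II (\<lambda>x. f x * h x) + b * II (\<lambda>x. g x * h x)"
      using II_lincomb[OF c[OF C(1,3)] c[OF C(2,3)], of a b] by (simp add: algebra_simps)
    then show "II (\<lambda>x. (a *\<^sub>R f x + b *\<^sub>R g x) * h x) + \<tau> * transport_form (\<lambda>x. a *\<^sub>R f x + b *\<^sub>R g x) h
      = a * (II (\<lambda>x. f x * h x) + \<tau> * transport_form f h) + b * (II (\<lambda>x. g x * h x) + \<tau> * transport_form g h)"
      using transport_form_lincomb(1)[OF C, of a b] by (simp add: algebra_simps)
    have "II (\<lambda>x. h x * (a *\<^sub>R f x + b *\<^sub>R g x)) = a * II (\<lambda>x. h x * f x) + b * II (\<lambda>x. h x * g x)"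
      using II_lincomb[OF c[OF C(3,1)] c[OF C(3,2)], of a b] by (simp add: algebra_simps)
    then show "II (\<lambda>x. h x * (a *\<^sub>R f x + b *\<^sub>R g x)) + \<tau> * transport_form h (\<lambda>x. a *\<^sub>R f x + b *\<^sub>R g x)
      = a * (II (\<lambda>x. h x * f x) + \<tau> * transport_form h f) + b * (II (\<lambda>x. h x * g x) + \<tau> * transport_form h g)"
      using transport_form_lincomb(2)[OF C, of a b] by (simp add: algebra_simps)
  next
    fix f g a b assume V: "f \<in> ?V" "g \<in> ?V"
    note c = pw_cont_mult[OF PdG_pw_cont[OF \<rho>0] PdG_pw_cont]
    show "II (\<lambda>x. \<rho>0 x * (a *\<^sub>R f x + b *\<^sub>R g x)) = a * II (\<lambda>x. \<rho>0 x * f x) + b * II (\<lambda>x. \<rho>0 x * g x)"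
      using II_lincomb[OF c[OF V(1)] c[OF V(2)], of a b] by (simp add: algebra_simps)
  next
    fix f assume f: "f \<in> ?V" "\<And>g. g \<in> ?V \<Longrightarrow> II (\<lambda>x. f x * g x) + \<tau> * transport_form f g = 0"
    have "0 \<le> \<tau> * transport_form f f" using \<tau> transport_form_nonneg[OF PdG_pw_C1[OF f(1)]] by simp
    moreover have "0 \<le> II (\<lambda>x. f x * f x)" by (rule integral_nonneg_AE) simp
    ultimately have z: "II (\<lambda>x. f x * f x) = 0" using f(2)[OF f(1)] by linarith
    show "f = (\<lambda>x. 0)"
    proof (rule zero_everywhere)
      fix K x assume "K \<in> \<T>" "x \<in> interior K"
      then have "f x * f x = 0"
        by (intro II_zero[OF _ _ z]) (auto intro: pw_cont_mult PdG_pw_cont[OF f(1)])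
      then show "f x = 0" by simp
    qed (use f(1) in \<open>auto simp: PdG_def\<close>)
  qed
  then show ?thesis using density_eq_iff by (simp cong: conj_cong)
qed

text \<open>The transport form drops out by its sign; Young's inequality splits the mixed product of
  old and new density, and half the new square is absorbed.\<close>

lemma density_energy:
  assumes \<rho>: "\<rho> \<in> PdG 2 \<T>" and eq: "density_eq \<Omega> \<T> \<tau> \<rho>0 u0 \<rho> \<rho>"
  shows "1/2 * (L2_nrm \<Omega> \<rho>)\<^sup>2 \<le> 1/2 * (L2_nrm \<Omega> \<rho>0)\<^sup>2"
proof -
  note c = pw_cont_mult[OF PdG_pw_cont PdG_pw_cont]
  have "0 \<le> \<tau> * transport_form \<rho> \<rho>" using \<tau> transport_form_nonneg[OF PdG_pw_C1[OF \<rho>]] by simp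
  then have "II (\<lambda>x. \<rho> x * \<rho> x) \<le> II (\<lambda>x. \<rho>0 x * \<rho> x)" using eq density_eq_iff[OF \<rho> \<rho>] by linarith
  also have "\<dots> \<le> II (\<lambda>x. 1/2 * (\<rho>0 x * \<rho>0 x) + 1/2 * (\<rho> x * \<rho> x))"
  proof (rule II_mono)
    fix x
    have "0 \<le> (\<rho>0 x - \<rho> x)\<^sup>2" by simp
    then show "\<rho>0 x * \<rho> x \<le> 1/2 * (\<rho>0 x * \<rho>0 x) + 1/2 * (\<rho> x * \<rho> x)"
      by (simp add: power2_eq_square algebra_simps)
  qed (intro pw_cont_add pw_cont_mult pw_cont_const PdG_pw_cont[OF \<rho>] PdG_pw_cont[OF \<rho>0])+
  also have "\<dots> = 1/2 * II (\<lambda>x. \<rho>0 x * \<rho>0 x) + 1/2 * II (\<lambda>x. \<rho> x * \<rho> x)"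
    by (rule II_lincomb[OF c[OF \<rho>0 \<rho>0] c[OF \<rho> \<rho>]])
  finally show ?thesis by (simp add: L2_nrm_square L2_inner_def)
qed

subsection \<open>Velocity and pressure\<close>

text \<open>Pairs of velocity and pressure are functions with values in the product space.\<close>

definition Z :: "(real^'d \<Rightarrow> (real^'d) \<times> real) set" where
  "Z = {\<lambda>x. (v x, q x) | v q. v \<in> V \<and> q \<in> Q}"

lemma Z_iff: "z \<in> Z \<longleftrightarrow> (\<lambda>x. fst (z x)) \<in> V \<and> (\<lambda>x. snd (z x)) \<in> Q"
proof
  assume "(\<lambda>x. fst (z x)) \<in> V \<and> (\<lambda>x. snd (z x)) \<in> Q"
  then show "z \<in> Z" unfolding Z_def
    by (intro CollectI exI[of _ "\<lambda>x. fst (z x)"] exI[of _ "\<lambda>x. snd (z x)"]) simp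
qed (auto simp: Z_def)

lemma lin_closed_Z: "lin_closed Z"
  using lin_closed_P1b0_vec lin_closed_P1_mean0 by (simp add: lin_closed_def Z_iff zero_prod_def)

lemma fin_dim_Z: "fin_dim Z"
proof (rule fin_dim_subset)
  let ?V = "(\<lambda>v x. (v x, 0::real)) ` V" and ?Q = "(\<lambda>q x. (0::real^'d, q x)) ` Q"
  show "fin_dim {\<lambda>x. f x + g x | f g. f \<in> ?V \<and> g \<in> ?Q}"
    by (intro fin_dim_plus fin_dim_image fin_dim_P1b0_vec fin_dim_P1_mean0) (auto intro!: linearI)
  show "Z \<subseteq> {\<lambda>x. f x + g x | f g. f \<in> ?V \<and> g \<in> ?Q}"
  proof
    fix z assume "z \<in> Z"
    then obtain v q where z: "z = (\<lambda>x. (v x, q x))" "v \<in> V" "q \<in> Q" unfolding Z_def by blast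
    then show "z \<in> {\<lambda>x. f x + g x | f g. f \<in> ?V \<and> g \<in> ?Q}"
      by (intro CollectI exI[of _ "\<lambda>x. (v x, 0)"] exI[of _ "\<lambda>x. (0, q x)"]) auto
  qed
qed

text \<open>These test velocities see the pressure on one element and in one coordinate direction at
  a time.\<close>

lemma bubble_velocity:
  assumes K: "K \<in> \<T>" shows "(\<lambda>x. bubble K x *\<^sub>R axis i 1) \<in> V"
  unfolding P1b0_vec_def
proof (intro CollectI allI)
  fix j
  show "(\<lambda>x. (bubble K x *\<^sub>R axis i 1) $ j) \<in> P1b0 \<Omega> \<T>"
    using bubble_P1b0[OF K] lin_closedD(1)[OF lin_closed_P1b0] by (cases "j = i") (simp_all add: axis_def)
qed

context
  fixes \<rho> :: "real^'d \<Rightarrow> real"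
  assumes \<rho>: "\<rho> \<in> PdG 2 \<T>"
begin

text \<open>The coefficient of \<open>u x \<bullet> v x\<close>: the time difference contributes
  \<open>X (\<rho>0 x) / \<tau>\<close>, and the term with half the difference of the cut-off
  densities turns this into an average.\<close>

definition weight :: "real^'d \<Rightarrow> real" where
  "weight x = (X (\<rho>0 x) + X (\<rho> x)) / (2 * \<tau>)"

text \<open>The convective terms of the momentum equation in skew-symmetric form.\<close>

definition vform :: "(real^'d \<Rightarrow> real^'d) \<Rightarrow> (real^'d \<Rightarrow> real^'d) \<Rightarrow> real^'d \<Rightarrow> real" where
  "vform u v x = weight x * (u x \<bullet> v x)
     + 1/2 * X (\<rho> x) * ((jac u x *v u0 x) \<bullet> v x - (jac v x *v u0 x) \<bullet> u x)
     + \<mu> * (jac u x \<bullet> jac v x)"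

definition rhs :: "(real^'d \<Rightarrow> real^'d) \<Rightarrow> real^'d \<Rightarrow> real" where
  "rhs v x = X (\<rho>0 x) / \<tau> * (u0 x \<bullet> v x)"

lemma X\<rho>: "pw_cont (\<lambda>x. X (\<rho> x))" "pw_cont (\<lambda>x. X (\<rho>0 x))"
  using X_cont' PdG_pw_cont \<rho> \<rho>0 by blast+

lemma weight: "pw_cont weight" "0 < weight x"
  unfolding weight_def[abs_def] using X_pos[of "\<rho> x"] X_pos[of "\<rho>0 x"] \<tau>
  by (auto intro!: pw_cont_divide pw_cont_add X\<rho> simp: weight_def intro: divide_pos_pos add_pos_pos)

lemma vform_cont: "u \<in> V \<Longrightarrow> v \<in> V \<Longrightarrow> pw_cont (vform u v)"
  unfolding vform_def[abs_def]
  by (intro pw_cont_add pw_cont_mult pw_cont_diff pw_cont_const X\<rho> weight V_inner V_transport V_jac)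

lemma rhs_cont: "v \<in> V \<Longrightarrow> pw_cont (rhs v)"
  unfolding rhs_def[abs_def] by (intro pw_cont_mult pw_cont_divide X\<rho> V_inner u0)

text \<open>By the product rule the gradient term is minus one half of both convective terms;
  together with the full convective term their skew half-difference remains. The part with the old
  velocity moves to the right-hand side.\<close>

lemma momentum_eq_iff:
  assumes u: "u \<in> V" and p: "p \<in> Q" and v: "v \<in> V"
  shows "momentum_eq \<Omega> \<mu> \<tau> X \<rho>0 u0 \<rho> u p v \<longleftrightarrow>
    II (vform u v) - II (\<lambda>x. p x * divg v x) = II (rhs v)"
proof -
  let ?a = "\<lambda>x. X (\<rho>0 x) / \<tau> * (u x \<bullet> v x) - rhs v x"
  let ?b = "\<lambda>x. (X (\<rho> x) - X (\<rho>0 x)) / \<tau> * (u x \<bullet> v x)"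
  let ?c = "\<lambda>x. X (\<rho> x) * ((jac u x *v u0 x) \<bullet> v x + (jac v x *v u0 x) \<bullet> u x)"
  let ?d = "\<lambda>x. X (\<rho> x) * ((jac u x *v u0 x) \<bullet> v x)"
  let ?e = "\<lambda>x. \<mu> * (jac u x \<bullet> jac v x)"
  have ca: "pw_cont ?a" by (intro pw_cont_diff pw_cont_mult pw_cont_divide X\<rho> V_inner u v rhs_cont)
  have cb: "pw_cont ?b" by (intro pw_cont_diff pw_cont_mult pw_cont_divide X\<rho> V_inner u v)
  have cc: "pw_cont ?c" by (intro pw_cont_add pw_cont_mult X\<rho> V_transport u v)
  have cd: "pw_cont ?d" by (intro pw_cont_mult X\<rho> V_transport u v)
  have ce: "pw_cont ?e" by (intro pw_cont_mult pw_cont_const V_jac u v)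
  have A: "L2_inner \<Omega> (\<lambda>x. X (\<rho>0 x) *\<^sub>R ((u x - u0 x) /\<^sub>R \<tau>)) v = II ?a"
    unfolding L2_inner_def by (simp add: rhs_def inner_diff_left divide_inverse algebra_simps)
  have B: "L2_inner \<Omega> (\<lambda>x. ((X (\<rho> x) - X (\<rho>0 x)) / \<tau>) *\<^sub>R u x) v = II ?b"
    unfolding L2_inner_def by simp
  have "II ?c = II (\<lambda>x. X (\<rho> x) * (u0 x \<bullet> grad (\<lambda>x. u x \<bullet> v x) x))"
    by (rule II_cong[OF cc]) (simp add: grad_inner[OF V_C1[OF u] V_C1[OF v]])
  then have C: "L2_inner \<Omega> (\<lambda>x. X (\<rho> x) *\<^sub>R u0 x) (grad (\<lambda>x. u x \<bullet> v x)) = II ?c"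
    unfolding L2_inner_def by simp
  have D: "L2_inner \<Omega> (\<lambda>x. X (\<rho> x) *\<^sub>R (jac u x *v u0 x)) v = II ?d"
    unfolding L2_inner_def by simp
  have E: "L2_inner \<Omega> (\<lambda>x. \<mu> *\<^sub>R jac u x) (jac v) = II ?e"
    unfolding L2_inner_def by simp
  have i: "integrable (lebesgue_on \<Omega>) ?a" "integrable (lebesgue_on \<Omega>) ?b" "integrable (lebesgue_on \<Omega>) ?c"
    "integrable (lebesgue_on \<Omega>) ?d" "integrable (lebesgue_on \<Omega>) ?e" "integrable (lebesgue_on \<Omega>) (rhs v)"
    by (rule pw_integral(1)[OF ca] pw_integral(1)[OF cb] pw_integral(1)[OF cc] pw_integral(1)[OF cd]
        pw_integral(1)[OF ce] pw_integral(1)[OF rhs_cont[OF v]])+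
  have "vform u v = (\<lambda>x. ?a x + 1/2 * ?b x - 1/2 * ?c x + ?d x + ?e x + rhs v x)"
    using \<tau> by (auto simp: vform_def weight_def fun_eq_iff field_simps)
  then have "II (vform u v) = II (\<lambda>x. ?a x + 1/2 * ?b x - 1/2 * ?c x + ?d x + ?e x + rhs v x)" by (simp only:)
  also have "\<dots> = II ?a + 1/2 * II ?b - 1/2 * II ?c + II ?d + II ?e + II (rhs v)"
    by (simp only: Bochner_Integration.integral_add Bochner_Integration.integral_diff integral_mult_right_zero
        Bochner_Integration.integrable_add Bochner_Integration.integrable_diff integrable_mult_right i)
  finally have F: "II (vform u v) = II ?a + 1/2 * II ?b - 1/2 * II ?c + II ?d + II ?e + II (rhs v)" .
  show ?thesis
    unfolding momentum_eq_def A B C D E F by (auto simp: L2_inner_def)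
qed

lemma vform_lincomb:
  assumes u: "u \<in> V" and v: "v \<in> V" and z: "z \<in> V"
  shows "II (vform (\<lambda>x. a *\<^sub>R u x + b *\<^sub>R v x) z) = a * II (vform u z) + b * II (vform v z)"
    "II (vform z (\<lambda>x. a *\<^sub>R u x + b *\<^sub>R v x)) = a * II (vform z u) + b * II (vform z v)"
proof -
  have uv: "(\<lambda>x. a *\<^sub>R u x + b *\<^sub>R v x) \<in> V" by (rule lin_closedD(2)[OF lin_closed_P1b0_vec u v])
  note j = jac_lincomb[OF V_C1[OF u] V_C1[OF v]]
  have "II (vform (\<lambda>x. a *\<^sub>R u x + b *\<^sub>R v x) z) = II (\<lambda>x. a * vform u z x + b * vform v z x)"
    by (rule II_cong[OF vform_cont[OF uv z]])
       (simp add: vform_def j inner_add_left inner_add_right matrix_vector_mult_add_rdistrib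
         scaleR_matrix_vector_assoc[symmetric] algebra_simps)
  then show "II (vform (\<lambda>x. a *\<^sub>R u x + b *\<^sub>R v x) z) = a * II (vform u z) + b * II (vform v z)"
    using II_lincomb[OF vform_cont[OF u z] vform_cont[OF v z]] by simp
  have "II (vform z (\<lambda>x. a *\<^sub>R u x + b *\<^sub>R v x)) = II (\<lambda>x. a * vform z u x + b * vform z v x)"
    by (rule II_cong[OF vform_cont[OF z uv]])
       (simp add: vform_def j inner_add_left inner_add_right matrix_vector_mult_add_rdistrib
         scaleR_matrix_vector_assoc[symmetric] algebra_simps)
  then show "II (vform z (\<lambda>x. a *\<^sub>R u x + b *\<^sub>R v x)) = a * II (vform z u) + b * II (vform z v)"
    using II_lincomb[OF vform_cont[OF z u] vform_cont[OF z v]] by simp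
qed

lemma div_lincomb:
  assumes u: "u \<in> V" and v: "v \<in> V" and p: "p \<in> Q" and q: "q \<in> Q"
  shows "II (\<lambda>x. p x * divg (\<lambda>x. a *\<^sub>R u x + b *\<^sub>R v x) x) = a * II (\<lambda>x. p x * divg u x) + b * II (\<lambda>x. p x * divg v x)"
    "II (\<lambda>x. (a *\<^sub>R p x + b *\<^sub>R q x) * divg u x) = a * II (\<lambda>x. p x * divg u x) + b * II (\<lambda>x. q x * divg u x)"
proof -
  have uv: "(\<lambda>x. a *\<^sub>R u x + b *\<^sub>R v x) \<in> V" by (rule lin_closedD(2)[OF lin_closed_P1b0_vec u v])
  note c = pw_cont_mult[OF Q_cont V_div]
  have "II (\<lambda>x. p x * divg (\<lambda>x. a *\<^sub>R u x + b *\<^sub>R v x) x) = II (\<lambda>x. a * (p x * divg u x) + b * (p x * divg v x))"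
    by (rule II_cong[OF c[OF p uv]]) (simp add: divg_lincomb[OF V_C1[OF u] V_C1[OF v]] algebra_simps)
  then show "II (\<lambda>x. p x * divg (\<lambda>x. a *\<^sub>R u x + b *\<^sub>R v x) x) = a * II (\<lambda>x. p x * divg u x) + b * II (\<lambda>x. p x * divg v x)"
    using II_lincomb[OF c[OF p u] c[OF p v]] by simp
  show "II (\<lambda>x. (a *\<^sub>R p x + b *\<^sub>R q x) * divg u x) = a * II (\<lambda>x. p x * divg u x) + b * II (\<lambda>x. q x * divg u x)"
    using II_lincomb[OF c[OF p u] c[OF q u], of a b] by (simp add: algebra_simps)
qed

text \<open>The two convective terms cancel when both arguments agree.\<close>

lemma vform_diag: "vform u u x = weight x * (u x \<bullet> u x) + \<mu> * (jac u x \<bullet> jac u x)"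
  by (simp add: vform_def)

text \<open>The divergence constraint enters with the sign opposite to that of the pressure term, so
  both cancel when the form is tested with its own argument.\<close>

definition BZ :: "(real^'d \<Rightarrow> (real^'d) \<times> real) \<Rightarrow> (real^'d \<Rightarrow> (real^'d) \<times> real) \<Rightarrow> real" where
  "BZ z y = II (vform (\<lambda>x. fst (z x)) (\<lambda>x. fst (y x))) - II (\<lambda>x. snd (z x) * divg (\<lambda>x. fst (y x)) x)
     + II (\<lambda>x. snd (y x) * divg (\<lambda>x. fst (z x)) x)"

text \<open>Testing with \<open>z\<close> itself leaves the weighted square of the velocity plus a
  nonnegative viscous term, so the velocity vanishes; bubbles times unit vectors then isolate the
  pressure.\<close>

lemma BZ_nondegenerate:
  assumes z: "z \<in> Z" and B: "\<And>y. y \<in> Z \<Longrightarrow> BZ z y = 0" shows "z = (\<lambda>x. 0)"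
proof -
  define u p where "u = (\<lambda>x. fst (z x))" and "p = (\<lambda>x. snd (z x))"
  have u: "u \<in> V" and p: "p \<in> Q" using z by (auto simp: Z_iff u_def p_def)
  have c1: "pw_cont (\<lambda>x. weight x * (u x \<bullet> u x))" by (intro pw_cont_mult weight V_inner u)
  have "II (vform u u) = 0" using B[OF z] by (simp add: BZ_def u_def p_def)
  moreover have "II (\<lambda>x. weight x * (u x \<bullet> u x)) \<le> II (vform u u)"
    by (rule II_mono[OF c1 vform_cont[OF u u]]) (use \<mu> in \<open>simp add: vform_diag\<close>)
  moreover have "0 \<le> II (\<lambda>x. weight x * (u x \<bullet> u x))"
    by (rule integral_nonneg_AE) (use weight(2) in \<open>auto intro!: AE_I2 mult_nonneg_nonneg simp: less_imp_le\<close>)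
  ultimately have "II (\<lambda>x. weight x * (u x \<bullet> u x)) = 0" by linarith
  then have u0': "u = (\<lambda>x. 0)"
    by (intro vec_zero[OF P1b0_vec_pw_cont[OF u] P1b0_vec_off[OF u] _ weight(1) weight(2)])
  have "p = (\<lambda>x. 0)"
  proof (rule pressure_zero[OF p])
    fix K and i :: 'd assume K: "K \<in> \<T>"
    let ?v = "\<lambda>x. bubble K x *\<^sub>R axis i (1::real)"
    have v: "?v \<in> V" by (rule bubble_velocity[OF K])
    have Q0: "(\<lambda>x. 0) \<in> Q" by (rule lin_closedD(1)[OF lin_closed_P1_mean0])
    have y: "(\<lambda>x. (?v x, 0)) \<in> Z" using v Q0 by (simp add: Z_iff)
    have "BZ z (\<lambda>x. (?v x, 0)) = II (vform u ?v) - II (\<lambda>x. p x * divg ?v x)"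
      by (simp add: BZ_def u_def p_def)
    \<comment> \<open>The zero velocity is written as a linear combination with zero coefficients,
      so that linearity of the form gives 0.\<close>
    moreover have "II (vform u ?v) = 0"
      using vform_lincomb(1)[OF u u v, of 0 0] by (simp add: u0')
    ultimately have "II (\<lambda>x. p x * divg ?v x) = 0" using B[OF y] by simp
    moreover have "II (\<lambda>x. p x * divg ?v x) = II (\<lambda>x. p x * frechet_derivative (bubble K) (at x) (axis i 1))"
    proof (rule II_cong[OF pw_cont_mult[OF Q_cont[OF p] V_div[OF v]]])
      fix K' x assume K': "K' \<in> \<T>" "x \<in> interior K'"
      have "jac ?v x $ j $ j = (if j = i then frechet_derivative (bubble K) (at x) (axis i 1) else 0)" for j
        unfolding jac_nth[OF V_C1[OF v] K'] by (simp add: axis_def frechet_const_fun)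
      then show "p x * divg ?v x = p x * frechet_derivative (bubble K) (at x) (axis i 1)"
        by (simp add: divg_def trace_def)
    qed
    ultimately show "II (\<lambda>x. p x * frechet_derivative (bubble K) (at x) (axis i 1)) = 0" by simp
  qed
  with u0' show ?thesis by (auto simp: u_def p_def fun_eq_iff prod_eq_iff)
qed

lemma Z_solvable: "\<exists>!z. z \<in> Z \<and> (\<forall>y\<in>Z. BZ z y = II (rhs (\<lambda>x. fst (y x))))"
proof (rule bilinear_form_solvable[OF lin_closed_Z fin_dim_Z])
  fix f g h a b assume fgh: "f \<in> Z" "g \<in> Z" "h \<in> Z"
  then have f: "(\<lambda>x. fst (f x)) \<in> V" "(\<lambda>x. snd (f x)) \<in> Q" and g: "(\<lambda>x. fst (g x)) \<in> V" "(\<lambda>x. snd (g x)) \<in> Q"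
    and h: "(\<lambda>x. fst (h x)) \<in> V" "(\<lambda>x. snd (h x)) \<in> Q" by (auto simp: Z_iff)
  show "BZ (\<lambda>x. a *\<^sub>R f x + b *\<^sub>R g x) h = a * BZ f h + b * BZ g h"
    unfolding BZ_def fst_add snd_add fst_scaleR snd_scaleR
      vform_lincomb(1)[OF f(1) g(1) h(1)] div_lincomb(1)[OF f(1) g(1) h(2) h(2)] div_lincomb(2)[OF h(1) h(1) f(2) g(2)]
    by (simp add: algebra_simps)
  show "BZ h (\<lambda>x. a *\<^sub>R f x + b *\<^sub>R g x) = a * BZ h f + b * BZ h g"
    unfolding BZ_def fst_add snd_add fst_scaleR snd_scaleR
      vform_lincomb(2)[OF f(1) g(1) h(1)] div_lincomb(1)[OF f(1) g(1) h(2) h(2)] div_lincomb(2)[OF h(1) h(1) f(2) g(2)]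
    by (simp add: algebra_simps)
next
  fix f g a b assume fg: "f \<in> Z" "g \<in> Z"
  then have f: "(\<lambda>x. fst (f x)) \<in> V" and g: "(\<lambda>x. fst (g x)) \<in> V" by (auto simp: Z_iff)
  have "rhs (\<lambda>x. fst (a *\<^sub>R f x + b *\<^sub>R g x)) = (\<lambda>x. a * rhs (\<lambda>x. fst (f x)) x + b * rhs (\<lambda>x. fst (g x)) x)"
    by (simp add: rhs_def fun_eq_iff inner_add_right algebra_simps add_divide_distrib)
  then show "II (rhs (\<lambda>x. fst (a *\<^sub>R f x + b *\<^sub>R g x)))
      = a * II (rhs (\<lambda>x. fst (f x))) + b * II (rhs (\<lambda>x. fst (g x)))"
    using II_lincomb[OF rhs_cont[OF f] rhs_cont[OF g]] by simp
qed (rule BZ_nondegenerate)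

text \<open>Test pairs with one zero component separate the two equations; conversely the equation
  on pairs is their sum.\<close>

lemma Z_system_iff:
  assumes u: "u \<in> V" and p: "p \<in> Q"
  shows "(\<forall>y\<in>Z. BZ (\<lambda>x. (u x, p x)) y = II (rhs (\<lambda>x. fst (y x)))) \<longleftrightarrow>
    (\<forall>v\<in>V. momentum_eq \<Omega> \<mu> \<tau> X \<rho>0 u0 \<rho> u p v) \<and> (\<forall>q\<in>Q. L2_inner \<Omega> (divg u) q = 0)" (is "?L \<longleftrightarrow> ?R")
proof -
  have V0: "(\<lambda>x. 0) \<in> V" by (rule lin_closedD(1)[OF lin_closed_P1b0_vec])
  have Q0: "(\<lambda>x. 0) \<in> Q" by (rule lin_closedD(1)[OF lin_closed_P1_mean0])
  have d: "L2_inner \<Omega> (divg u) q = II (\<lambda>x. q x * divg u x)" for q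
    by (simp add: L2_inner_def mult.commute)
  have BZ: "BZ (\<lambda>x. (u x, p x)) (\<lambda>x. (v x, q x))
    = II (vform u v) - II (\<lambda>x. p x * divg v x) + II (\<lambda>x. q x * divg u x)" for v q
    by (simp add: BZ_def)
  show ?thesis
  proof
    assume L: ?L
    have *: "II (vform u v) - II (\<lambda>x. p x * divg v x) + II (\<lambda>x. q x * divg u x) = II (rhs v)"
      if "v \<in> V" "q \<in> Q" for v q
      using L[rule_format, of "\<lambda>x. (v x, q x)"] that by (simp add: Z_iff BZ)
    have "momentum_eq \<Omega> \<mu> \<tau> X \<rho>0 u0 \<rho> u p v" if "v \<in> V" for v
      using *[OF that Q0] by (simp add: momentum_eq_iff[OF u p that])
    \<comment> \<open>Comparing the test pairs \<open>(0, q)\<close> and \<open>(0, 0)\<close>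
      removes the terms that contain only the zero test velocity.\<close>
    moreover have "L2_inner \<Omega> (divg u) q = 0" if "q \<in> Q" for q
      using *[OF V0 that] *[OF V0 Q0] by (simp add: d)
    ultimately show ?R by blast
  next
    assume R: ?R
    show ?L
    proof
      fix y assume "y \<in> Z"
      then obtain v q where y: "y = (\<lambda>x. (v x, q x))" "v \<in> V" "q \<in> Q" unfolding Z_def by blast
      have "II (vform u v) - II (\<lambda>x. p x * divg v x) = II (rhs v)"
        using R y(2) momentum_eq_iff[OF u p y(2)] by blast
      moreover have "II (\<lambda>x. q x * divg u x) = 0" using R y(3) d by metis
      ultimately show "BZ (\<lambda>x. (u x, p x)) y = II (rhs (\<lambda>x. fst (y x)))" by (simp add: y(1) BZ)
    qed
  qed
qed

text \<open>Tested with \<open>u\<close>, the pressure disappears by the divergence constraint.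
  Multiplied by \<open>\<tau>\<close>, the weight splits into halves of \<open>X (\<rho> x)\<close>
  and \<open>X (\<rho>0 x)\<close>: the first gives the new kinetic energy, the second absorbs the
  mixed product of old and new velocity by Young's inequality, which leaves the old kinetic
  energy.\<close>

lemma momentum_energy:
  assumes u: "u \<in> V" and p: "p \<in> Q" and eq: "momentum_eq \<Omega> \<mu> \<tau> X \<rho>0 u0 \<rho> u p u"
    and div: "L2_inner \<Omega> (divg u) p = 0"
  shows "II (\<lambda>x. 1/2 * X (\<rho> x) * (norm (u x))\<^sup>2) + \<tau> * \<mu> * (L2_nrm \<Omega> (jac u))\<^sup>2
    \<le> II (\<lambda>x. 1/2 * X (\<rho>0 x) * (norm (u0 x))\<^sup>2)"
proof -
  let ?E = "\<lambda>x. 1/2 * X (\<rho> x) * (u x \<bullet> u x)" and ?G = "\<lambda>x. 1/2 * X (\<rho>0 x) * (u0 x \<bullet> u0 x)"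
  let ?J = "\<lambda>x. jac u x \<bullet> jac u x"
  have cE: "pw_cont ?E" "pw_cont ?G" by (intro pw_cont_mult pw_cont_const X\<rho> V_inner u u0)+
  have cJ: "pw_cont ?J" by (rule V_jac[OF u u])
  have "II (\<lambda>x. p x * divg u x) = 0" using div by (simp add: L2_inner_def mult.commute)
  then have e: "II (vform u u) = II (rhs u)" using eq momentum_eq_iff[OF u p u] by simp
  have "II ?E + \<tau> * \<mu> * II ?J = II (\<lambda>x. 1 * ?E x + \<tau> * \<mu> * ?J x)"
    using II_lincomb[OF cE(1) cJ, of 1 "\<tau> * \<mu>"] by simp
  also have "\<dots> \<le> II (\<lambda>x. 1 * (\<tau> * vform u u x + (- \<tau>) * rhs u x) + 1 * ?G x)"
  proof (rule II_mono)
    fix x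
    have n: "(u x - u0 x) \<bullet> (u x - u0 x) = u x \<bullet> u x - 2 * (u0 x \<bullet> u x) + u0 x \<bullet> u0 x"
      by (simp add: inner_diff_left inner_diff_right inner_commute)
    have "0 \<le> 1/2 * X (\<rho>0 x) * ((u x - u0 x) \<bullet> (u x - u0 x))"
      using X_pos[of "\<rho>0 x"] by (intro mult_nonneg_nonneg) auto
    then have "0 \<le> 1/2 * X (\<rho>0 x) * (u x \<bullet> u x) - X (\<rho>0 x) * (u0 x \<bullet> u x) + ?G x"
      unfolding n by (simp add: algebra_simps)
    moreover have "\<tau> * vform u u x = 1/2 * X (\<rho>0 x) * (u x \<bullet> u x) + ?E x + \<tau> * \<mu> * ?J x"
      using \<tau> by (simp add: vform_diag weight_def field_simps)
    moreover have "\<tau> * rhs u x = X (\<rho>0 x) * (u0 x \<bullet> u x)" using \<tau> by (simp add: rhs_def)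
    ultimately show "1 * ?E x + \<tau> * \<mu> * ?J x \<le> 1 * (\<tau> * vform u u x + (- \<tau>) * rhs u x) + 1 * ?G x"
      by simp
  qed (intro pw_cont_add pw_cont_mult[of "\<lambda>x. 1"] pw_cont_mult[of "\<lambda>x. \<tau>"] pw_cont_mult[of "\<lambda>x. - \<tau>"]
      pw_cont_mult[of "\<lambda>x. \<tau> * \<mu>"] pw_cont_const cE cJ vform_cont[OF u u] rhs_cont[OF u])+
  also have "\<dots> = (\<tau> * II (vform u u) + (- \<tau>) * II (rhs u)) + II ?G"
  proof -
    have c: "pw_cont (\<lambda>x. \<tau> * vform u u x + (- \<tau>) * rhs u x)"
      by (intro pw_cont_add pw_cont_mult pw_cont_const vform_cont[OF u u] rhs_cont[OF u])
    show ?thesis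
      unfolding II_lincomb[OF c cE(2)] II_lincomb[OF vform_cont[OF u u] rhs_cont[OF u]] by simp
  qed
  also have "\<dots> = II ?G" by (simp add: e)
  finally show ?thesis by (simp add: L2_nrm_square L2_inner_def power2_norm_eq_inner)
qed

end

end

theorem mainTheorem2:
  fixes \<Omega> :: "(real^'d) set" and \<T> :: "(real^'d) set set"
    and \<gamma> h \<mu> \<tau> \<rho>min \<rho>max :: real
    and \<rho>0 :: "real^'d \<Rightarrow> real" and u0 :: "real^'d \<Rightarrow> real^'d"
  assumes "CARD('d) \<in> {2, 3}"
    and "convex_polytopal_domain \<Omega>"
    and "quasi_uniform_mesh \<Omega> \<gamma> h \<T>"
    and "\<mu> > 0" and "\<tau> > 0" and "0 < \<rho>min" and "\<rho>min \<le> \<rho>max"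
    and "\<rho>0 \<in> PdG 2 \<T>" and "u0 \<in> P1b0_vec \<Omega> \<T>"
  shows "(\<exists>!s. solves_scheme \<Omega> \<T> \<mu> \<tau> \<rho>min \<rho>max \<rho>0 u0 s) \<and>
    (\<forall>\<rho> u p. solves_scheme \<Omega> \<T> \<mu> \<tau> \<rho>min \<rho>max \<rho>0 u0 (\<rho>, u, p) \<longrightarrow>
      1/2 * (L2_nrm \<Omega> \<rho>)\<^sup>2
        + (LINT x|lebesgue_on \<Omega>. 1/2 * cutoff \<rho>min \<rho>max (\<rho> x) * (norm (u x))\<^sup>2)
        + \<tau> * \<mu> * (L2_nrm \<Omega> (jac u))\<^sup>2
      \<le> 1/2 * (L2_nrm \<Omega> \<rho>0)\<^sup>2
        + (LINT x|lebesgue_on \<Omega>. 1/2 * cutoff \<rho>min \<rho>max (\<rho>0 x) * (norm (u0 x))\<^sup>2))"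
proof -
  let ?X = "cutoff \<rho>min \<rho>max"
  interpret scheme \<Omega> \<T> \<mu> \<tau> ?X \<rho>0 u0
    by unfold_locales
       (use assms cutoff_bounds continuous_cutoff in \<open>auto simp: quasi_uniform_mesh_def\<close>)
  let ?sol = "\<lambda>\<rho> u p. \<rho> \<in> PdG 2 \<T> \<and> u \<in> V \<and> p \<in> Q \<and> (\<forall>\<phi>\<in>PdG 2 \<T>. density_eq \<Omega> \<T> \<tau> \<rho>0 u0 \<rho> \<phi>) \<and>
     (\<forall>v\<in>V. momentum_eq \<Omega> \<mu> \<tau> ?X \<rho>0 u0 \<rho> u p v) \<and> (\<forall>q\<in>Q. L2_inner \<Omega> (divg u) q = 0)"
  have sol: "solves_scheme \<Omega> \<T> \<mu> \<tau> \<rho>min \<rho>max \<rho>0 u0 (\<rho>, u, p) \<longleftrightarrow> ?sol \<rho> u p" for \<rho> u p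
    by (simp add: solves_scheme_def)
  obtain \<rho> where \<rho>: "\<rho> \<in> PdG 2 \<T>" "\<forall>\<phi>\<in>PdG 2 \<T>. density_eq \<Omega> \<T> \<tau> \<rho>0 u0 \<rho> \<phi>"
    and \<rho>_unique: "\<And>\<rho>'. \<rho>' \<in> PdG 2 \<T> \<Longrightarrow> \<forall>\<phi>\<in>PdG 2 \<T>. density_eq \<Omega> \<T> \<tau> \<rho>0 u0 \<rho>' \<phi> \<Longrightarrow> \<rho>' = \<rho>"
    using density_solvable by blast
  obtain z where z: "z \<in> Z" "\<forall>y\<in>Z. BZ \<rho> z y = II (rhs (\<lambda>x. fst (y x)))"
    and z_unique: "\<And>z'. z' \<in> Z \<Longrightarrow> \<forall>y\<in>Z. BZ \<rho> z' y = II (rhs (\<lambda>x. fst (y x))) \<Longrightarrow> z' = z"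
    using Z_solvable[OF \<rho>(1)] by blast
  obtain u p where up: "z = (\<lambda>x. (u x, p x))" "u \<in> V" "p \<in> Q" using z(1) unfolding Z_def by blast
  have "?sol \<rho> u p"
    using \<rho> up Z_system_iff[OF \<rho>(1) up(2,3)] z(2) by simp
  moreover have "(\<rho>', u', p') = (\<rho>, u, p)" if s: "?sol \<rho>' u' p'" for \<rho>' u' p'
  proof -
    \<comment> \<open>The density equation contains neither the new velocity nor the pressure, so
      the densities agree first, and then both pairs solve the same linear system.\<close>
    have r: "\<rho>' = \<rho>" using s by (intro \<rho>_unique) blast+
    have "u' \<in> V" "p' \<in> Q" using s by blast+
    then have "(\<lambda>x. (u' x, p' x)) = z"
      using s Z_system_iff[OF \<rho>(1), of u' p'] unfolding r by (intro z_unique) (simp_all add: Z_iff)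
    then have "\<And>x. (u' x, p' x) = (u x, p x)" using up(1) by meson
    then show ?thesis using r by auto
  qed
  ultimately have ex1: "\<exists>!s. solves_scheme \<Omega> \<T> \<mu> \<tau> \<rho>min \<rho>max \<rho>0 u0 s"
    by (intro ex1I[of _ "(\<rho>, u, p)"]) (auto simp only: sol split_paired_all)
  have energy: "1/2 * (L2_nrm \<Omega> \<rho>)\<^sup>2 + II (\<lambda>x. 1/2 * ?X (\<rho> x) * (norm (u x))\<^sup>2) + \<tau> * \<mu> * (L2_nrm \<Omega> (jac u))\<^sup>2
      \<le> 1/2 * (L2_nrm \<Omega> \<rho>0)\<^sup>2 + II (\<lambda>x. 1/2 * ?X (\<rho>0 x) * (norm (u0 x))\<^sup>2)" if s: "?sol \<rho> u p" for \<rho> u p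
  proof -
    have m: "\<rho> \<in> PdG 2 \<T>" "u \<in> V" "p \<in> Q" using s by blast+
    have "density_eq \<Omega> \<T> \<tau> \<rho>0 u0 \<rho> \<rho>" "momentum_eq \<Omega> \<mu> \<tau> ?X \<rho>0 u0 \<rho> u p u" "L2_inner \<Omega> (divg u) p = 0"
      using s by blast+
    then show ?thesis
      using density_energy[OF m(1)] momentum_energy[OF m] by linarith
  qed
  show ?thesis using ex1 energy by (simp only: sol) blast
qed

end
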